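(* Let $G$ be a non-trivial finite solvable rational group. Then the Gruenberg-Kegel graph of $G$ is one of the following graphs (vertex set; edge set): (a) $\{2\}$; no edges. (c) $\{2,3\}$; no edges. (d) $\{2,3\}$; edge $2-3$. (e) $\{2,5\}$; no edges. (f) $\{2,5\}$; edge $2-5$. (i) $\{2,3,5\}$; edges $2-3$, $2-5$. (k) $\{2,3,5\}$; edges $2-3$, $2-5$, $3-5$. Moreover, each of these graphs, except possibly (i), is the Gruenberg-Kegel graph of some finite solvable rational group.
   Context: All graphs are undirected, without loops or multiple edges, and their vertices are labeled by distinct prime numbers; $p-q$ denotes an edge joining $p$ and $q$. The Gruenberg-Kegel graph (GK-graph) of a group $G$ is the graph whose vertices are the primes occurring as orders of elements of $G$, with distinct vertices $p,q$ joined by an edge if and only if $G$ has an element of order $pq$. A finite group $G$ is called rational if for every $g\in G$, every generator of $\langle g\rangle$ is conjugate to $g$ in $G$. *)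

theory Defs
  imports "HOL-Algebra.Multiplicative_Group" "HOL-Algebra.Elementary_Groups"
    "HOL-Algebra.Solvable_Groups" "HOL-Computational_Algebra.Primes"
begin

text \<open>A simple undirected graph labelled by natural numbers is a pair (vertex set, edge set),
  an edge being the two-element set of its endpoints.  Equality of such pairs is equality of
  labelled graphs, not isomorphism.\<close>

type_synonym labelled_graph = "nat set \<times> nat set set"

definition gk_vertices :: "('a, 'b) monoid_scheme \<Rightarrow> nat set" where
  "gk_vertices G = {p. prime p \<and> (\<exists>x\<in>carrier G. group.ord G x = p)}"

definition gk_edges :: "('a, 'b) monoid_scheme \<Rightarrow> nat set set" where
  "gk_edges G = {{p, q} | p q. p \<in> gk_vertices G \<and> q \<in> gk_vertices G \<and> p \<noteq> q \<and>
                               (\<exists>x\<in>carrier G. group.ord G x = p * q)}"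

definition gk_graph :: "('a, 'b) monoid_scheme \<Rightarrow> labelled_graph" where
  "gk_graph G = (gk_vertices G, gk_edges G)"

definition conjugate_in :: "('a, 'b) monoid_scheme \<Rightarrow> 'a \<Rightarrow> 'a \<Rightarrow> bool" where
  "conjugate_in G g h \<longleftrightarrow> (\<exists>x\<in>carrier G. h = x \<otimes>\<^bsub>G\<^esub> g \<otimes>\<^bsub>G\<^esub> inv\<^bsub>G\<^esub> x)"

definition finite_rational_group :: "('a, 'b) monoid_scheme \<Rightarrow> bool" where
  "finite_rational_group G \<longleftrightarrow> group G \<and> finite (carrier G) \<and>
     (\<forall>g\<in>carrier G. \<forall>h\<in>carrier G.
        generate G {h} = generate G {g} \<longrightarrow> conjugate_in G g h)"

definition graph_a :: labelled_graph where "graph_a = ({2}, {})"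
definition graph_c :: labelled_graph where "graph_c = ({2, 3}, {})"
definition graph_d :: labelled_graph where "graph_d = ({2, 3}, {{2, 3}})"
definition graph_e :: labelled_graph where "graph_e = ({2, 5}, {})"
definition graph_f :: labelled_graph where "graph_f = ({2, 5}, {{2, 5}})"
definition graph_i :: labelled_graph where "graph_i = ({2, 3, 5}, {{2, 3}, {2, 5}})"
definition graph_k :: labelled_graph where "graph_k = ({2, 3, 5}, {{2, 3}, {2, 5}, {3, 5}})"

end

theory Submission
 imports Defs "HOL-Algebra.Sylow" "HOL-Combinatorics.Perm" "HOL-Number_Theory.Cong"
  "HOL-Library.Function_Algebras" "HOL-Library.Numeral_Type" "HOL-Library.Product_Plus"
begin

text \<open>Let a prime \<open>p \<ge> 7\<close> divide the order of a finite solvable rational group. A minimal quotient whose order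
  is still divisible by \<open>p\<close> has a minimal normal \<open>p\<close>-subgroup \<open>V\<close> of index prime to \<open>p\<close>. Rationality makes the
  module \<open>V\<close> self-dual, so it carries an invariant form \<open>B\<close>, and every nonzero scalar is realised on every
  vector by a group element; applied to \<open>2\<close> this gives \<open>B v v = 4 B v v\<close>, so \<open>B\<close> is alternating. Passing to fixed
  spaces of centralisers yields a primitive pair \<open>(K, Y)\<close>, where solvability provides a normal subgroup \<open>E\<close>
  that is abelian modulo the scalars \<open>\<plusminus>1\<close> but not scalar. As \<open>2\<close> is realised on \<open>v\<close>, the sum of \<open>(B (e v) v)\<^sup>2\<close> over
  \<open>e \<in> E\<close> vanishes modulo \<open>p\<close>. This forces \<open>p = 7\<close> and an action of \<open>E\<close> as a quaternion group of order 8: the only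
  alternative gives a solvable group that acts on five points and moves each of them by an element of 3-power
  order. The three subgroups of order 4 are permuted cyclically by \<open>K\<close>, and rationality makes \<open>K\<close> induce a
  transposition of two of them as well; then some \<open>a \<in> K\<close> satisfies \<open>a\<^sup>4 = -1\<close> and violates rationality.

  If 3 and 5 divide the order but there is no element of order \<open>2 q\<close>, where \<open>{q, r} = {3, 5}\<close>, take a minimal quotient
  whose order is divisible by both and a minimal normal \<open>l\<close>-subgroup \<open>N\<close> of it. There is no element of order 15,
  because rationality would give a nontrivial two-element centralising its \<open>q\<close>-part. If \<open>l = q\<close>, the quotient by \<open>N\<close>
  acts on \<open>N\<close> without fixed points, hence has a unique involution; a rational group with a unique involution has
  no element of order 5, and none of order 3 if its order involves only 2 and 3 and it is solvable. If \<open>l = r\<close>,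
  elements of order \<open>q\<close> act on \<open>N\<close> without fixed points, which leaves no nontrivial abelian normal subgroup of
  the quotient by \<open>N\<close>.

  The examples are built from the group of order 2, the symmetric group of degree 3 and the Frobenius group
  \<open>5\<^sup>2 : Q\<^sub>8\<close> by direct products.\<close>

section \<open>Groups as sets over a type class\<close>

text \<open>Two obstacles shape the proof. Rationality does not pass to the normaliser of a
  centraliser acting on a fixed space. What does pass is that vectors can be doubled and tripled,
  and a statement on class functions, which is transported by inducing a class function and
  projecting it with a sign character. Moreover the field with \<open>p\<close> elements may lack
  the eigenvalues needed to decompose modules; counting arguments modulo \<open>p\<close> replace
  eigenspaces and characters throughout. All information on \<open>E\<close> is read off from the
  values \<open>B (e v) v\<close>. Doubling \<open>v\<close> multiplies them by 4, so the units of a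
  quaternion group can be permuted cyclically only if \<open>4 ^ 3 = 1\<close> modulo
  \<open>p\<close>; this singles out 7. The five points are the singular points of the elliptic
  quadric belonging to the central product of a dihedral and a quaternion group of order 8, whose
  isometry group is the symmetric group of degree 5. Groups are sets in a type class because
  quotients and linear images, taken repeatedly, are then again groups of the same kind, realised by
  permutations.\<close>

class group_mult = monoid_mult + inverse +
 assumes group_left_inverse [simp]: "inverse a * a = 1"
begin

lemma group_left_cancel1: "inverse a * (a * b) = b"
 by (simp flip: mult_assoc)

lemma group_right_inverse [simp]: "a * inverse a = 1"
proof -
 have "a * inverse a = inverse (inverse a) * (inverse a * (a * inverse a))"
  by (metis mult_assoc group_left_inverse mult_1_left)
 also have "\<dots> = 1"
  by (simp add: group_left_cancel1)
 finally show ?thesis .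
qed

lemma group_left_cancel2: "a * (inverse a * b) = b"
 by (simp flip: mult_assoc)

lemma group_inverse_unique:
 assumes "a * b = 1" shows "inverse a = b"
 by (metis assms group_left_cancel1 mult_1_right)

lemma group_inverse_inverse [simp]: "inverse (inverse a) = a"
 by (rule group_inverse_unique) simp

lemma group_inverse_one [simp]: "inverse 1 = 1"
 by (rule group_inverse_unique) simp

lemma group_inverse_mult: "inverse (a * b) = inverse b * inverse a"
 by (rule group_inverse_unique) (simp add: mult_assoc group_left_cancel2)

lemma group_left_cancel [simp]: "a * b = a * c \<longleftrightarrow> b = c"
 by (metis group_left_cancel1)

lemma group_right_cancel [simp]: "b * a = c * a \<longleftrightarrow> b = c"
 by (metis mult_assoc group_right_inverse mult_1_right)

lemmas group_norm = mult_assoc group_left_cancel1 group_left_cancel2 group_inverse_mult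

definition cj :: "'a \<Rightarrow> 'a \<Rightarrow> 'a" where "cj g x = g * x * inverse g"

lemma cj_one [simp]: "cj g 1 = 1" "cj 1 x = x" by (simp_all add: cj_def)
lemma cj_mult: "cj g (x * y) = cj g x * cj g y" by (simp add: cj_def group_norm)
lemma cj_cj: "cj g (cj h x) = cj (g * h) x" by (simp add: cj_def group_norm)
lemma cj_inverse: "cj g (inverse x) = inverse (cj g x)" by (simp add: cj_def group_norm)
lemma cj_left_inv [simp]: "cj (inverse g) (cj g x) = x" "cj g (cj (inverse g) x) = x"
 by (simp_all add: cj_cj)
lemma cj_pow: "cj g (x ^ n) = cj g x ^ n" by (induction n) (simp_all add: cj_mult)
lemma cj_eq_iff [simp]: "cj g x = cj g y \<longleftrightarrow> x = y" by (simp add: cj_def)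
lemma cj_eq_one [simp]: "cj g x = 1 \<longleftrightarrow> x = 1" by (metis cj_one(1) cj_eq_iff)
lemma cj_fix_iff: "cj g x = x \<longleftrightarrow> g * x = x * g"
 by (metis cj_def mult_assoc group_left_inverse group_right_inverse mult_1_right)
definition cmt :: "'a \<Rightarrow> 'a \<Rightarrow> 'a" where "cmt x y = x * y * inverse x * inverse y"

lemma cmt_swap: "x * y = cmt x y * (y * x)" by (simp add: cmt_def group_norm)
lemma cj_cmt: "cj g (cmt x y) = cmt (cj g x) (cj g y)"
 by (simp add: cmt_def cj_mult cj_inverse)
lemma cmt_cj: "cmt x y = cj x y * inverse y" by (simp add: cmt_def cj_def)

lemma pow_inverse: "inverse (x ^ n) = inverse x ^ n"
proof (rule group_inverse_unique, induction n)
 case (Suc n)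
 have "x ^ Suc n * inverse x ^ Suc n = x ^ n * (x * (inverse x * inverse x ^ n))"
  by (simp only: power_Suc2[of x] power_Suc[of "inverse x"] mult_assoc)
 thus ?case using Suc by (simp add: group_left_cancel2)
qed simp

end

definition subgrp :: "'a::group_mult set \<Rightarrow> bool" where
 "subgrp K \<longleftrightarrow> 1 \<in> K \<and> (\<forall>x\<in>K. \<forall>y\<in>K. x * y \<in> K) \<and> (\<forall>x\<in>K. inverse x \<in> K)"

lemma subgrpD: assumes "subgrp K"
 shows "1 \<in> K" "x \<in> K ==> y \<in> K ==> x * y \<in> K" "x \<in> K ==> inverse x \<in> K"
  "x \<in> K ==> y \<in> K ==> cj x y \<in> K" "x \<in> K ==> y \<in> K ==> cmt x y \<in> K"
  "x \<in> K ==> x ^ n \<in> K"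
proof -
 show "1 \<in> K" using assms by (auto simp: subgrp_def)
 thus "x \<in> K ==> x ^ n \<in> K" for n using assms by (induction n) (auto simp: subgrp_def)
qed (use assms in \<open>simp_all add: subgrp_def cj_def cmt_def\<close>)

definition normal_in :: "'a::group_mult set \<Rightarrow> 'a set \<Rightarrow> bool" where
 "normal_in N K \<longleftrightarrow> subgrp N \<and> N \<subseteq> K \<and> (\<forall>g\<in>K. \<forall>n\<in>N. cj g n \<in> N)"

lemma subgrp_mult_iff: assumes "subgrp K" "x \<in> K"
 shows "x * y \<in> K \<longleftrightarrow> y \<in> K" "y * x \<in> K \<longleftrightarrow> y \<in> K"
 using subgrpD[OF assms(1)] assms(2)
 by (metis group_left_cancel1, metis mult.assoc group_right_inverse mult_1_right)

lemma subgrp_inverse_iff: "subgrp K ==> inverse x \<in> K \<longleftrightarrow> x \<in> K"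
 by (metis group_inverse_inverse subgrpD(3))

lemma normal_cj_iff: assumes "normal_in N K" "subgrp K" "g \<in> K"
 shows "cj g n \<in> N \<longleftrightarrow> n \<in> N"
 using assms by (metis cj_left_inv(1) normal_in_def subgrpD(3))

text \<open>The stabilising condition is an equivalence, hence symmetric in \<open>k\<close> and
  \<open>inverse k\<close>; an implication would give closure under inverses only for finite
  sets.\<close>

lemma normalizer_normal:
 assumes "subgrp K"
 shows "subgrp {k \<in> K. \<forall>x. cj k x \<in> S \<longleftrightarrow> x \<in> S}"
proof -
 have "cj (inverse k) x \<in> S \<longleftrightarrow> x \<in> S" if "\<forall>x. cj k x \<in> S \<longleftrightarrow> x \<in> S" for k x
  by (metis that cj_left_inv(2))
 thus ?thesis
  using subgrpD[OF assms] unfolding subgrp_def by (auto simp flip: cj_cj)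
qed

text \<open>The passage to group records, through which Lagrange, Sylow and factor groups become
  available.\<close>

definition GR :: "'a::group_mult set \<Rightarrow> 'a monoid" where "GR K = \<lparr>carrier = K, monoid.mult = (*), one = 1\<rparr>"

lemma GR_simps [simp]: "carrier (GR K) = K" "monoid.mult (GR K) = (*)" "one (GR K) = 1"
 by (simp_all add: GR_def)

lemma GR_group: assumes "subgrp K" shows "group (GR K)"
proof (rule groupI)
 show "\<exists>y\<in>carrier (GR K). y \<otimes>\<^bsub>GR K\<^esub> x = \<one>\<^bsub>GR K\<^esub>" if "x \<in> carrier (GR K)" for x
  using that subgrpD(3)[OF assms] by (intro bexI[of _ "inverse x"]) auto
qed (use subgrpD[OF assms] in \<open>auto simp: mult.assoc\<close>)

lemma GR_pow: "x [^]\<^bsub>GR K\<^esub> (n::nat) = x ^ n"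
 by (induction n) (simp_all add: nat_pow_def power_commutes)

lemma GR_inv: assumes "subgrp K" "x \<in> K" shows "inv\<^bsub>GR K\<^esub> x = inverse x"
 by (rule group.inv_equality[OF GR_group[OF assms(1)]]) (use subgrpD[OF assms(1)] assms(2) in auto)

lemma GR_subgroup: assumes "subgrp K" "subgrp L" "L \<subseteq> K" shows "subgroup L (GR K)"
 by (rule group.subgroupI[OF GR_group[OF assms(1)]])
   (use subgrpD[OF assms(2)] assms in \<open>auto simp: GR_inv subsetD\<close>)

lemma card_subgrp_dvd: assumes "subgrp K" "subgrp L" "L \<subseteq> K" "finite K" shows "card L dvd card K"
 using group.lagrange[OF GR_group[OF assms(1)] GR_subgroup[OF assms(1-3)]]
 by (metis GR_simps(1) dvd_triv_right Coset.order_def)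

lemma card_subgrp_pos: "subgrp K ==> finite K ==> card K > 0"
 using subgrpD(1) card_gt_0_iff by blast

lemma pow_card: assumes "subgrp K" "finite K" "x \<in> K" shows "x ^ card K = 1"
 using group.pow_order_eq_1[OF GR_group[OF assms(1)]] assms by (simp add: GR_pow Coset.order_def)

lemma GR_normal: assumes "subgrp K" "normal_in N K" shows "N \<lhd> GR K"
proof -
 have N: "subgrp N" "N \<subseteq> K" using assms(2) by (auto simp: normal_in_def)
 show ?thesis
  by (subst group.normal_inv_iff[OF GR_group[OF assms(1)]])
    (use assms N in \<open>auto simp: GR_subgroup GR_inv normal_in_def cj_def\<close>)
qed

lemma pow_index_mem:
 assumes "subgrp K" "finite K" "normal_in N K" "x \<in> K"
 shows "x ^ (card K div card N) \<in> N"
proof -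
 have n: "N \<lhd> GR K" and s: "subgrp N" "N \<subseteq> K"
  using assms GR_normal by (auto simp: normal_in_def)
 interpret N: normal N "GR K" by fact
 interpret Q: group "GR K Mod N" by (rule N.factorgroup_is_group)
 have fN: "finite N" using s assms(2) finite_subset by blast
 have ord: "Coset.order (GR K Mod N) = card K div card N"
 proof -
  have "card (rcosets\<^bsub>GR K\<^esub> N) * card N = card K"
   using group.lagrange[OF GR_group[OF assms(1)] GR_subgroup[OF assms(1) s]] by (simp add: Coset.order_def)
  moreover have "Coset.order (GR K Mod N) = card (rcosets\<^bsub>GR K\<^esub> N)"
   by (simp add: FactGroup_def Coset.order_def)
  ultimately show ?thesis using card_subgrp_pos[OF s(1) fN]
   by (metis div_mult_self_is_m)
 qed
 have xin: "N #>\<^bsub>GR K\<^esub> x \<in> carrier (GR K Mod N)"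
  using assms(4) by (auto simp: FactGroup_def RCOSETS_def)
 have "(N #>\<^bsub>GR K\<^esub> x) [^]\<^bsub>GR K Mod N\<^esub> Coset.order (GR K Mod N) = \<one>\<^bsub>GR K Mod N\<^esub>"
  by (rule Q.pow_order_eq_1[OF xin])
 moreover have "(N #>\<^bsub>GR K\<^esub> x) [^]\<^bsub>GR K Mod N\<^esub> (n::nat) = N #>\<^bsub>GR K\<^esub> (x ^ n)" for n
 proof (induction n)
  case (Suc n)
  have "(N #>\<^bsub>GR K\<^esub> (x ^ n)) <#>\<^bsub>GR K\<^esub> (N #>\<^bsub>GR K\<^esub> x) = N #>\<^bsub>GR K\<^esub> (x ^ n * x)"
   using N.rcos_sum[of "x ^ n" x] subgrpD(6)[OF assms(1,4)] assms(4) by simp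
  thus ?case
   using Suc Q.nat_pow_Suc by (simp add: FactGroup_def power_commutes)
 qed (use N.coset_mult_one s in \<open>auto simp: FactGroup_def\<close>)
 ultimately have "N #>\<^bsub>GR K\<^esub> (x ^ (card K div card N)) = N"
  unfolding ord by (metis (no_types) FactGroup_def monoid.select_convs(2))
 moreover have "x ^ (card K div card N) \<in> N #>\<^bsub>GR K\<^esub> (x ^ (card K div card N))"
  by (rule N.rcos_self) (use assms(1,4) subgrpD(6) GR_subgroup[OF assms(1) s] in simp_all)
 ultimately show ?thesis by simp
qed

lemma subgrp_inter: "subgrp A ==> subgrp B ==> subgrp (A \<inter> B)"
 unfolding subgrp_def by auto

lemma pow_coprime_mem:
 assumes "subgrp N" "x ^ m \<in> N" "x ^ n \<in> N" "coprime m n" shows "x \<in> N"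
proof (cases "m = 0")
 case True thus ?thesis using assms by simp
next
 case False
 from bezout_nat[OF False, of n] obtain a b where "m * a = n * b + 1"
  using assms(4) by (auto simp: coprime_iff_gcd_eq_1)
 hence "(x ^ m) ^ a = (x ^ n) ^ b * x"
  by (simp add: power_commutes flip: power_mult)
 moreover have "(x ^ m) ^ a \<in> N" "(x ^ n) ^ b \<in> N"
  using assms(1-3) by (auto intro: subgrpD)
 ultimately show ?thesis
  using subgrp_mult_iff(1)[OF assms(1)] by metis
qed

lemma subgrp_trivial: "subgrp {1}"
 by (simp add: subgrp_def)

lemma pow_coprime_eq_one:
 assumes "x ^ m = 1" "x ^ n = 1" "coprime m n" shows "x = (1::'a::group_mult)"
 using pow_coprime_mem[OF subgrp_trivial, of x m n] assms by simp

lemma exists_prime_power_step: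
 assumes "(x::'a::group_mult) \<noteq> 1" "x ^ (q ^ n) = 1"
 shows "\<exists>j. x ^ (q ^ j) \<noteq> 1 \<and> (x ^ (q ^ j)) ^ q = 1"
 using assms(2)
proof (induction n)
 case 0 thus ?case using assms(1) by simp
next
 case (Suc n)
 thus ?case by (cases "x ^ (q ^ n) = 1") (auto simp: power_mult mult.commute[of q])
qed

instance perm :: (type) group_mult
 by standard (simp add: perm_eq_iff apply_times)

section \<open>Counting modulo a prime\<close>

text \<open>Orbits of \<open>\<sigma>\<close> have \<open>q\<close>-power length and
  \<open>f\<close> is constant on them, so only the orbits of length one survive modulo
  \<open>q\<close>. The induction removes one nontrivial orbit at a time.\<close>

lemma sum_fixpoints_cong:
 fixes f :: "'a \<Rightarrow> int"
 assumes "finite X" "prime q" "\<And>x. x \<in> X ==> \<sigma> x \<in> X" "\<And>x. x \<in> X ==> (\<sigma> ^^ (q ^ n)) x = x"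
  "\<And>x. x \<in> X ==> f (\<sigma> x) = f x"
 shows "int q dvd sum f X - sum f {x \<in> X. \<sigma> x = x}"
 using assms(1,3-5)
proof (induction X rule: finite_psubset_induct)
 case (psubset X)
 show ?case
 proof (cases "\<exists>x\<in>X. \<sigma> x \<noteq> x")
  case False
  hence "{x \<in> X. \<sigma> x = x} = X" by auto
  thus ?thesis by simp
 next
  case True
  then obtain x where x: "x \<in> X" "\<sigma> x \<noteq> x" by blast
  have per: "(\<sigma> ^^ (q ^ n)) x = x" by (rule psubset.prems(2)[OF x(1)])
  have q0: "q ^ n > 0" using assms(2) prime_gt_0_nat by simp
  define d where "d = (LEAST d. d > 0 \<and> (\<sigma> ^^ d) x = x)"
  have d: "d > 0" "(\<sigma> ^^ d) x = x" and dmin: "\<And>e. e > 0 ==> (\<sigma> ^^ e) x = x ==> d \<le> e"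
   using LeastI[of "\<lambda>d. d > 0 \<and> (\<sigma> ^^ d) x = x" "q ^ n"] per q0
    Least_le[of "\<lambda>d. d > 0 \<and> (\<sigma> ^^ d) x = x"] unfolding d_def by auto
  have dvd: "d dvd e" if "(\<sigma> ^^ e) x = x" for e
  proof -
   have "(\<sigma> ^^ (e mod d)) x = x" using funpow_mod_eq[OF d(2)] that by simp
   hence "e mod d = 0" using dmin[of "e mod d"] mod_less_divisor[OF d(1), of e] by force
   thus ?thesis by auto
  qed
  obtain k where k: "d = q ^ k" using dvd[OF per] assms(2) divides_primepow_nat by blast
  have "k \<noteq> 0" using k x(2) d(2) by (metis funpow_0 funpow.simps(2) One_nat_def comp_apply power_0 id_apply)
  hence qd: "int q dvd int d" using k by (simp add: dvd_power)
  define Ob where "Ob = (\<lambda>i. (\<sigma> ^^ i) x) ` {..<d}"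
  have inj: "inj_on (\<lambda>i. (\<sigma> ^^ i) x) {..<d}"
  proof (rule linorder_inj_onI)
   fix i j assume ij: "i < j" "i \<in> {..<d}" "j \<in> {..<d}"
   show "(\<sigma> ^^ i) x \<noteq> (\<sigma> ^^ j) x"
   proof
    assume eq: "(\<sigma> ^^ i) x = (\<sigma> ^^ j) x"
    have "(\<sigma> ^^ (d - j + i)) x = (\<sigma> ^^ (d - j + j)) x"
     by (simp only: funpow_add comp_apply eq)
    hence "(\<sigma> ^^ (d - j + i)) x = x" using ij d(2) by simp
    thus False using dmin[of "d - j + i"] ij by auto
   qed
  qed auto
  have Xcl: "(\<sigma> ^^ i) y \<in> X" if "y \<in> X" for i y
   using that by (induction i) (auto intro: psubset.prems)
  have fcl: "f ((\<sigma> ^^ i) x) = f x" for i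
   using x(1) by (induction i) (auto simp: psubset.prems(3) Xcl)
  have ObX: "Ob \<subseteq> X" using Xcl x(1) by (auto simp: Ob_def)
  have all: "(\<sigma> ^^ i) x \<in> Ob" for i
   using funpow_mod_eq[OF d(2), of i] d(1) unfolding Ob_def
   by (metis imageI lessThan_iff mod_less_divisor)
  have sumOb: "sum f Ob = int d * f x"
   unfolding Ob_def by (subst sum.reindex[OF inj]) (simp add: fcl)
  \<comment> \<open>The complement of an orbit is stable because \<open>\<sigma>\<close> has finite
    order: iterating forwards from \<open>\<sigma> y\<close> leads back to \<open>y\<close>, so an
    orbit that contains \<open>\<sigma> y\<close> contains \<open>y\<close>.\<close>
  have cl': "\<sigma> y \<in> X - Ob" if "y \<in> X - Ob" for y
  proof -
   have "\<sigma> y \<notin> Ob"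
   proof
    assume "\<sigma> y \<in> Ob"
    then obtain i where i: "\<sigma> y = (\<sigma> ^^ i) x" by (auto simp: Ob_def)
    have "y = (\<sigma> ^^ (q ^ n)) y" using psubset.prems(2) that by simp
    also have "\<dots> = (\<sigma> ^^ (q ^ n - 1)) (\<sigma> y)"
     using q0 by (metis Suc_diff_1 comp_apply funpow_Suc_right)
    also have "\<dots> = (\<sigma> ^^ (q ^ n - 1 + i)) x" by (simp add: i funpow_add)
    finally show False using all that by auto
   qed
   thus ?thesis using that psubset.prems(1) by auto
  qed
  have ne: "X - Ob \<subset> X" using ObX all[of 0] x(1) by auto
  have nofix: "\<sigma> y \<noteq> y" if "y \<in> Ob" for y
  proof
   assume fx: "\<sigma> y = y"
   from that obtain i where i: "i < d" "y = (\<sigma> ^^ i) x" by (auto simp: Ob_def)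
   have "(\<sigma> ^^ m) y = y" for m by (induction m) (auto simp: fx)
   moreover have "(\<sigma> ^^ (d - i)) y = (\<sigma> ^^ (d - i + i)) x"
    by (simp only: i funpow_add comp_apply)
   ultimately have "y = x" using i(1) d(2) by simp
   thus False using fx x(2) by simp
  qed
  have "{y \<in> X. \<sigma> y = y} = {y \<in> X - Ob. \<sigma> y = y}" using nofix by auto
  moreover have "sum f X = sum f (X - Ob) + sum f Ob"
   using sum.subset_diff[OF ObX] psubset.hyps by simp
  moreover have "int q dvd sum f (X - Ob) - sum f {y \<in> X - Ob. \<sigma> y = y}"
   by (rule psubset.IH[OF ne]) (use cl' psubset.prems in auto)
  ultimately show ?thesis
   using sumOb qd by (metis (no_types, lifting) add_diff_eq add.commute dvd_add dvd_mult2)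
 qed
qed

lemma card_fixpoints_cong:
 assumes "finite X" "prime q" "\<And>x. x \<in> X ==> \<sigma> x \<in> X" "\<And>x. x \<in> X ==> (\<sigma> ^^ (q ^ n)) x = x"
 shows "int q dvd int (card X) - int (card {x \<in> X. \<sigma> x = x})"
 using sum_fixpoints_cong[of X q \<sigma> n "\<lambda>_. 1"] assms by simp

lemma cauchy:
 assumes "subgrp K" "finite K" "prime q" "q dvd card K"
 shows "\<exists>x\<in>K. x \<noteq> 1 \<and> x ^ q = 1"
proof -
 have o: "Coset.order (GR K) = card K" by (simp add: Coset.order_def)
 have "card K = q ^ multiplicity q (card K) * (card K div q ^ multiplicity q (card K))"
  by (simp add: multiplicity_dvd)
 then obtain L where L: "subgroup L (GR K)" "card L = q ^ multiplicity q (card K)"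
  using sylow_thm[OF assms(3) GR_group[OF assms(1)], of "multiplicity q (card K)"] assms(2) o by auto
 have "multiplicity q (card K) > 0"
  using assms(3,4) card_subgrp_pos[OF assms(1,2)] by (simp add: prime_multiplicity_gt_zero_iff)
 hence "card L > 1" using L(2) assms(3) by (metis one_less_power prime_gt_1_nat)
 moreover have fL: "finite L" and LK: "L \<subseteq> K"
  using subgroup.subset[OF L(1)] assms(2) finite_subset by auto
 ultimately obtain x where x: "x \<in> L" "x \<noteq> 1"
  by (metis card_le_Suc0_iff_eq One_nat_def leD subgroup.one_closed[OF L(1)] GR_simps(3))
 have sL: "subgrp L"
  using L(1) LK assms(1) unfolding subgrp_def subgroup_def
  by (auto simp: subsetD) (metis GR_inv subsetD assms(1))
 have "x ^ (q ^ multiplicity q (card K)) = 1" using pow_card[OF sL fL x(1)] L(2) by simp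
 then obtain j where "x ^ (q ^ j) \<noteq> 1" "(x ^ (q ^ j)) ^ q = 1"
  using exists_prime_power_step[OF x(2)] by blast
 thus ?thesis using x(1) LK subgrpD(6)[OF assms(1)] by blast
qed

text \<open>The cyclic rotation of lists of length \<open>p\<close> with product \<open>1\<close> shows that the coefficient of
  \<open>\<psi>\<^sup>p\<close> at \<open>1\<close> is \<open>\<psi>(1)\<^sup>p\<close> modulo \<open>p\<close>; this replaces the semisimplicity of the group algebra.\<close>

lemma square_zero_imp_one_zero:
 fixes \<psi> :: "'a::group_mult \<Rightarrow> int"
 assumes D: "subgrp D" "finite D" and p: "prime p" "\<not> p dvd card D"
  and sq: "\<And>g. g \<in> D ==> int p dvd (\<Sum>d\<in>D. \<psi> d * \<psi> (inverse d * g))"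
 shows "int p dvd \<psi> 1"
proof -
 have p2: "p \<ge> 2" using p(1) prime_ge_2_nat by blast
 define X where "X = {xs. set xs \<subseteq> D \<and> length xs = p \<and> prod_list xs = 1}"
 define f where "f = (\<lambda>xs. prod_list (map \<psi> xs))"
 define L where "L = {ys. set ys \<subseteq> D \<and> length ys = p - 2}"
 have finX: "finite X"
  by (rule finite_subset[OF _ finite_lists_length_eq[OF D(2), of p]]) (auto simp: X_def)
 have prodD: "prod_list ys \<in> D" if "set ys \<subseteq> D" for ys
  using that subgrpD[OF D(1)] by (induction ys) auto
 have rot: "prod_list (rotate1 xs) = 1" if "prod_list xs = 1" for xs :: "'a list"
 proof (cases xs)
  case (Cons a ys)
  hence "a * prod_list ys = 1" using that by simp
  hence "prod_list ys = inverse a" by (rule group_inverse_unique[symmetric])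
  thus ?thesis using Cons by simp
 qed simp
 have "int p dvd sum f X - sum f {xs \<in> X. rotate1 xs = xs}"
 proof (rule sum_fixpoints_cong[where n = 1])
  show "rotate1 xs \<in> X" if "xs \<in> X" for xs
   using that rot by (auto simp: X_def)
  show "(rotate1 ^^ (p ^ 1)) xs = xs" if "xs \<in> X" for xs
   using that rotate_id[of p xs] by (auto simp: X_def rotate_def)
  show "f (rotate1 xs) = f xs" for xs
   by (cases xs) (auto simp: f_def mult.commute)
 qed (use finX p in auto)
 \<comment> \<open>A list fixed by rotation repeats a single \<open>x\<close> with
   \<open>x ^ p = 1\<close>, and \<open>p\<close> is prime to the order of \<open>D\<close>.\<close>
 moreover have "{xs \<in> X. rotate1 xs = xs} = {replicate p 1}"
 proof
  show "{xs \<in> X. rotate1 xs = xs} \<subseteq> {replicate p 1}"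
  proof
   fix xs assume xs: "xs \<in> {xs \<in> X. rotate1 xs = xs}"
   hence len: "length xs = p" by (simp add: X_def)
   have nth: "xs ! i = xs ! 0" if "i < p" for i
    using that
   proof (induction i)
    case (Suc i)
    have "rotate1 xs ! i = xs ! (Suc i mod p)"
     using nth_rotate1[of i xs] Suc.prems len by simp
    thus ?case using xs Suc by simp
   qed simp
   obtain x where "\<And>i. i < p ==> xs ! i = x" using nth by blast
   hence x: "xs = replicate p x" by (intro nth_equalityI) (simp_all add: len)
   have "xs \<in> X" using xs by simp
   hence "set (replicate p x) \<subseteq> D" "prod_list (replicate p x) = 1"
    unfolding X_def x by blast+
   hence "x \<in> D" "x ^ p = 1" using p2 by auto
   hence "x = 1"
    using pow_coprime_eq_one[of x p "card D"] pow_card[OF D] prime_imp_coprime[OF p] by blast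
   thus "xs \<in> {replicate p 1}" by (simp add: x)
  qed
  show "{replicate p 1} \<subseteq> {xs \<in> X. rotate1 xs = xs}"
   using subgrpD(1)[OF D(1)] p2 by (auto simp: X_def rotate1_replicate set_replicate_conv_if)
 qed
 moreover have "int p dvd sum f X"
 proof -
  \<comment> \<open>A list with product 1 is determined by its first entry \<open>a\<close> and its
    entries from the third on; the second one is forced. Summing over \<open>a\<close> with the rest
    fixed gives a value of the convolution square.\<close>
  have bij: "bij_betw (\<lambda>(a, ys). a # (inverse a * inverse (prod_list ys)) # ys) (D \<times> L) X"
  proof (rule bij_betw_byWitness[where f' = "\<lambda>xs. (hd xs, tl (tl xs))"])
   show "\<forall>xs\<in>X. (case (hd xs, tl (tl xs)) of (a, ys) \<Rightarrow> a # (inverse a * inverse (prod_list ys)) # ys) = xs"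
   proof
    fix xs assume "xs \<in> X"
    then obtain a b ys where xs: "xs = a # b # ys" and "a * (b * prod_list ys) = 1"
     using p2 unfolding X_def by (cases xs; cases "tl xs") auto
    hence "b * prod_list ys = inverse a" by (metis group_inverse_unique)
    hence "b = inverse a * inverse (prod_list ys)"
     by (metis group_right_inverse mult.assoc mult_1_right)
    thus "(case (hd xs, tl (tl xs)) of (a, ys) \<Rightarrow> a # (inverse a * inverse (prod_list ys)) # ys) = xs"
     using xs by simp
   qed
  next
   show "(\<lambda>(a, ys). a # (inverse a * inverse (prod_list ys)) # ys) ` (D \<times> L) \<subseteq> X"
    using p2 prodD by (auto simp: X_def L_def group_norm intro!: subgrpD[OF D(1)])
   show "(\<lambda>xs. (hd xs, tl (tl xs))) ` X \<subseteq> D \<times> L"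
   proof
    fix y assume "y \<in> (\<lambda>xs. (hd xs, tl (tl xs))) ` X"
    then obtain xs where xs: "xs \<in> X" "y = (hd xs, tl (tl xs))" by blast
    then obtain a b ys where "xs = a # b # ys"
     using p2 unfolding X_def by (cases xs; cases "tl xs") auto
    thus "y \<in> D \<times> L" using xs by (auto simp: X_def L_def)
   qed
  qed auto
  have "sum f X = (\<Sum>(a, ys)\<in>D \<times> L. \<psi> a * (\<psi> (inverse a * inverse (prod_list ys)) * prod_list (map \<psi> ys)))"
   by (subst sum.reindex_bij_betw[OF bij, symmetric]) (auto simp: f_def intro!: sum.cong)
  also have "\<dots> = (\<Sum>ys\<in>L. prod_list (map \<psi> ys) * (\<Sum>a\<in>D. \<psi> a * \<psi> (inverse a * inverse (prod_list ys))))"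
   by (subst sum.cartesian_product[symmetric], subst sum.swap)
     (simp add: sum_distrib_left mult_ac)
  finally show ?thesis
   using prodD subgrpD(3)[OF D(1)] by (auto intro!: dvd_sum dvd_mult sq simp: L_def)
 qed
 ultimately have "int p dvd \<psi> 1 ^ p"
  by (simp add: f_def dvd_diff_right_iff)
 thus ?thesis using p(1) prime_dvd_power[of "int p"] by simp
qed

lemma prime_part:
 assumes "subgrp G" "finite G" "g \<in> G" "prime s"
 shows "\<exists>c m. \<not> s dvd c \<and> (g ^ c) ^ (s ^ m) = (1::'a::group_mult)"
proof -
 obtain c where c: "card G = s ^ multiplicity s (card G) * c" "\<not> s dvd c"
  using multiplicity_decompose'[of "card G" s] card_subgrp_pos[OF assms(1,2)] assms(4)
  by (metis not_prime_unit not_gr_zero)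
 have "(g ^ c) ^ (s ^ multiplicity s (card G)) = g ^ card G"
  by (subst (2) c(1)) (simp add: power_mult[symmetric] mult_ac)
 thus ?thesis using c(2) pow_card[OF assms(1-3)] by metis
qed

text \<open>The exponent is 1 modulo 3, so wherever the cube of \<open>g\<close> acts trivially the
  power still acts like \<open>g\<close>. It arises as the square of a number prime to 3 that
  removes the rest of the order.\<close>

lemma three_part:
 assumes "subgrp G" "finite G" "g \<in> G" shows "\<exists>k m. (g ^ (3 * k + 1)) ^ (3 ^ m) = (1::'a::group_mult)"
proof -
 obtain c m where c: "\<not> 3 dvd c" "(g ^ c) ^ (3 ^ m) = 1" using prime_part[OF assms, of 3] by auto
 have "c mod 3 = 1 \<or> c mod 3 = 2" using c(1) by presburger
 hence "c * c mod 3 = 1" by (auto simp: mod_mult_eq[of c 3 c, symmetric])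
 hence "3 * (c * c div 3) + 1 = c * c" using mult_div_mod_eq[of 3 "c * c"] by presburger
 moreover have "(g ^ (c * c)) ^ (3 ^ m) = ((g ^ c) ^ (3 ^ m)) ^ c" by (simp add: mult_ac flip: power_mult)
 ultimately show ?thesis using c(2) by (metis power_one)
qed

lemma power_minus_one:
 assumes "(x::'a::group_mult) ^ n = 1" "n > 0" shows "x ^ (n - 1) = inverse x" "coprime (n - 1) n"
proof -
 have "x ^ (n - 1) * x = x ^ n" using assms(2) by (simp flip: power_Suc2)
 thus "x ^ (n - 1) = inverse x" using assms(1) by (metis group_inverse_inverse group_inverse_unique)
 show "coprime (n - 1) n" using assms(2) by (metis Suc_diff_1 coprime_Suc_right_nat)
qed

section \<open>Linear actions and invariant forms\<close>

definition adsub :: "'v::ab_group_add set \<Rightarrow> bool" where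
 "adsub Y \<longleftrightarrow> 0 \<in> Y \<and> (\<forall>u\<in>Y. \<forall>v\<in>Y. u + v \<in> Y) \<and> (\<forall>u\<in>Y. - u \<in> Y)"

lemma adsubD: assumes "adsub Y"
 shows "0 \<in> Y" "u \<in> Y ==> v \<in> Y ==> u + v \<in> Y" "u \<in> Y ==> - u \<in> Y" "u \<in> Y ==> v \<in> Y ==> u - v \<in> Y"
 using assms unfolding adsub_def by (auto simp del: add_uminus_conv_diff simp: diff_conv_add_uminus)

lemma adsub_sum: assumes "adsub Y" "\<And>x. x \<in> X ==> f x \<in> Y" shows "sum f X \<in> Y"
 using assms(2) by (induction X rule: infinite_finite_induct) (auto intro: adsubD[OF assms(1)])

text \<open>Functionals have integer values and are additive only modulo \<open>p\<close>, so the
  prime field need not be a type that depends on \<open>p\<close>.\<close>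

definition addmod :: "nat \<Rightarrow> 'v::ab_group_add set \<Rightarrow> ('v \<Rightarrow> int) \<Rightarrow> bool" where
 "addmod p V \<alpha> \<longleftrightarrow> (\<forall>u\<in>V. \<forall>v\<in>V. [\<alpha> (u + v) = \<alpha> u + \<alpha> v] (mod int p))"

lemma addmod_zero: assumes "adsub V" "addmod p V \<alpha>" shows "[\<alpha> 0 = 0] (mod int p)"
proof -
 have "[\<alpha> (0 + 0) = \<alpha> 0 + \<alpha> 0] (mod int p)" using assms adsubD(1) unfolding addmod_def by blast
 thus ?thesis by (simp add: cong_iff_dvd_diff)
qed

lemma addmod_minus: assumes "adsub V" "addmod p V \<alpha>" "u \<in> V" shows "[\<alpha> (- u) = - \<alpha> u] (mod int p)"
proof -
 have "[\<alpha> (u + - u) = \<alpha> u + \<alpha> (- u)] (mod int p)"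
  using assms adsubD(3) unfolding addmod_def by blast
 with addmod_zero[OF assms(1,2)] have "[\<alpha> u + \<alpha> (- u) = 0] (mod int p)"
  by (metis add.right_inverse cong_sym cong_trans)
 thus ?thesis by (simp add: cong_iff_dvd_diff algebra_simps)
qed

locale rep =
 fixes act :: "'g::group_mult \<Rightarrow> 'v::ab_group_add \<Rightarrow> 'v" (infixr "$" 75)
 assumes act_mult: "(g * h) $ v = g $ h $ v"
  and act_one [simp]: "1 $ v = v"
  and act_add: "g $ (u + v) = g $ u + g $ v"
begin

lemma act_zero [simp]: "g $ 0 = 0"
 by (metis act_add add_cancel_right_right add_0)

lemma act_minus: "g $ (- v) = - (g $ v)"
 by (metis act_add act_zero add.right_inverse minus_unique)

lemma act_diff: "g $ (u - v) = g $ u - g $ v"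
 by (metis act_add act_minus diff_conv_add_uminus)

lemma act_inverse [simp]: "inverse g $ g $ v = v" "g $ inverse g $ v = v"
 by (simp_all flip: act_mult)

lemma act_sum: "g $ sum f X = (\<Sum>x\<in>X. g $ f x)"
 by (induction X rule: infinite_finite_induct) (auto simp: act_add)

lemma act_eq_iff [simp]: "g $ u = g $ v \<longleftrightarrow> u = v"
 by (metis act_inverse(1))

lemma act_eq_zero [simp]: "g $ u = 0 \<longleftrightarrow> u = 0"
 by (metis act_eq_iff act_zero)

definition cen :: "'g set \<Rightarrow> 'v \<Rightarrow> 'g set" where "cen N v = {n \<in> N. n $ v = v}"

lemma cen_subgrp: assumes "subgrp N" shows "subgrp (cen N v)"
proof -
 have "inverse x $ v = v" if "x $ v = v" for x by (metis that act_inverse(1))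
 thus ?thesis using assms by (auto simp: subgrp_def cen_def act_mult)
qed

definition fixed :: "'g set \<Rightarrow> 'v set \<Rightarrow> 'v set" where "fixed S Y = {u \<in> Y. \<forall>s\<in>S. s $ u = u}"

lemma fixed_adsub: "adsub Y ==> adsub (fixed S Y)"
 by (auto simp: adsub_def fixed_def act_add act_minus)

text \<open>If every averaged bilinear form vanished, the class function \<open>\<tau>\<close> built from a functional \<open>\<alpha>\<close>
 would have square zero in the group algebra, because it is invariant under inversion.\<close>

theorem invariant_form_exists:
 assumes H: "subgrp H" "finite H" and p: "prime p" "\<not> p dvd card H"
  and V: "adsub V" "\<And>h v. h \<in> H ==> v \<in> V ==> h $ v \<in> V"
  and real: "\<And>x. x \<in> H ==> \<exists>g\<in>H. cj g x = inverse x"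
  and irred: "\<And>W. adsub W ==> W \<subseteq> V ==> (\<And>h w. h \<in> H ==> w \<in> W ==> h $ w \<in> W) ==> W = {0} \<or> W = V"
  and \<alpha>: "addmod p V \<alpha>" "v\<^sub>0 \<in> V" "\<not> int p dvd \<alpha> v\<^sub>0"
 shows "\<exists>B. (\<forall>u\<in>V. addmod p V (B u) \<and> addmod p V (\<lambda>x. B x u)) \<and>
  (\<forall>h\<in>H. \<forall>u\<in>V. \<forall>v\<in>V. B (h $ u) (h $ v) = B u v) \<and>
  (\<forall>u\<in>V. (\<forall>v\<in>V. int p dvd B u v) \<longrightarrow> u = 0)"
proof -
 have "\<exists>\<alpha> \<beta> u w. addmod p V \<alpha> \<and> addmod p V \<beta> \<and> u \<in> V \<and> w \<in> V \<and>
   \<not> int p dvd (\<Sum>h\<in>H. \<alpha> (h $ u) * \<beta> (h $ w))"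
 proof (rule ccontr)
  assume "\<not> ?thesis"
  hence none: "int p dvd (\<Sum>h\<in>H. \<alpha> (h $ u) * \<beta> (h $ w))"
   if "addmod p V \<alpha>" "addmod p V \<beta>" "u \<in> V" "w \<in> V" for \<alpha> \<beta> u w
   using that by blast
  define \<tau> where "\<tau> h = (\<Sum>g\<in>H. \<alpha> (cj (inverse g) h $ v\<^sub>0))" for h
  have cl: "\<tau> (cj k h) = \<tau> h" if "k \<in> H" for k h
   unfolding \<tau>_def
   by (rule sum.reindex_bij_witness[where i = "\<lambda>g. k * g" and j = "\<lambda>g. inverse k * g"])
     (use that subgrpD[OF H(1)] in \<open>auto simp: group_norm cj_cj\<close>)
  have \<tau>inv: "\<tau> (inverse h) = \<tau> h" if "h \<in> H" for h
   using real[OF that] cl by metis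
  have \<tau>mem: "addmod p V (\<lambda>v. \<alpha> (inverse g $ v))" if "g \<in> H" for g
   using \<alpha>(1) V(2) subgrpD(3)[OF H(1) that] by (auto simp: addmod_def act_add)
  have "int p dvd \<tau> 1"
  proof (rule square_zero_imp_one_zero[OF H p])
   fix x assume x: "x \<in> H"
   have "(\<Sum>d\<in>H. \<tau> d * \<tau> (inverse d * x)) = (\<Sum>d\<in>H. \<tau> (inverse d) * \<tau> (inverse d * x))"
    by (rule sum.cong) (auto simp: \<tau>inv)
   also have "\<dots> = (\<Sum>d\<in>H. \<tau> d * \<tau> (d * x))"
    by (rule sum.reindex_bij_witness[where i = inverse and j = inverse]) (use subgrpD[OF H(1)] in auto)
   also have "\<dots> = (\<Sum>d\<in>H. \<Sum>g\<in>H. \<Sum>g'\<in>H. \<alpha> (inverse g $ d $ g $ v\<^sub>0) * \<alpha> (inverse g' $ d $ x $ g' $ v\<^sub>0))"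
    unfolding \<tau>_def sum_product by (simp add: cj_def act_mult)
   also have "\<dots> = (\<Sum>g\<in>H. \<Sum>g'\<in>H. \<Sum>d\<in>H. \<alpha> (inverse g $ d $ g $ v\<^sub>0) * \<alpha> (inverse g' $ d $ x $ g' $ v\<^sub>0))"
    by (subst sum.swap, rule sum.cong[OF refl], subst sum.swap, simp)
   finally have eq: "(\<Sum>d\<in>H. \<tau> d * \<tau> (inverse d * x)) =
    (\<Sum>g\<in>H. \<Sum>g'\<in>H. \<Sum>d\<in>H. \<alpha> (inverse g $ d $ g $ v\<^sub>0) * \<alpha> (inverse g' $ d $ x $ g' $ v\<^sub>0))" .
   show "int p dvd (\<Sum>d\<in>H. \<tau> d * \<tau> (inverse d * x))"
    unfolding eq using V(2) \<alpha>(2) x by (intro dvd_sum none[OF \<tau>mem \<tau>mem]) auto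
  qed
  moreover have "\<tau> 1 = int (card H) * \<alpha> v\<^sub>0" by (simp add: \<tau>_def)
  ultimately show False using p \<alpha>(3) by (simp add: prime_dvd_mult_iff)
 qed
 then obtain \<alpha> \<beta> u\<^sub>0 w\<^sub>0 where ab: "addmod p V \<alpha>" "addmod p V \<beta>" and uw: "u\<^sub>0 \<in> V" "w\<^sub>0 \<in> V"
   and nz: "\<not> int p dvd (\<Sum>h\<in>H. \<alpha> (h $ u\<^sub>0) * \<beta> (h $ w\<^sub>0))" by blast
 define B where "B u v = (\<Sum>h\<in>H. \<alpha> (h $ u) * \<beta> (h $ v))" for u v
 have lin: "addmod p V (B u)" "addmod p V (\<lambda>x. B x u)" if "u \<in> V" for u
 proof -
  show "addmod p V (B u)" unfolding addmod_def
  proof (intro ballI)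
   fix v w assume vw: "v \<in> V" "w \<in> V"
   have "[B u (v + w) = (\<Sum>h\<in>H. \<alpha> (h $ u) * (\<beta> (h $ v) + \<beta> (h $ w)))] (mod int p)"
    unfolding B_def using ab(2) V(2) vw
    by (intro cong_sum cong_mult cong_refl) (auto simp: addmod_def act_add)
   thus "[B u (v + w) = B u v + B u w] (mod int p)"
    by (simp add: B_def distrib_left sum.distrib)
  qed
  show "addmod p V (\<lambda>x. B x u)" unfolding addmod_def
  proof (intro ballI)
   fix v w assume vw: "v \<in> V" "w \<in> V"
   have "[B (v + w) u = (\<Sum>h\<in>H. (\<alpha> (h $ v) + \<alpha> (h $ w)) * \<beta> (h $ u))] (mod int p)"
    unfolding B_def using ab(1) V(2) vw
    by (intro cong_sum cong_mult cong_refl) (auto simp: addmod_def act_add)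
   thus "[B (v + w) u = B v u + B w u] (mod int p)"
    by (simp add: B_def distrib_right sum.distrib)
  qed
 qed
 have inv: "B (h $ u) (h $ v) = B u v" if "h \<in> H" for h u v
  unfolding B_def
  by (rule sum.reindex_bij_witness[where i = "\<lambda>g. g * inverse h" and j = "\<lambda>g. g * h"])
    (use that subgrpD[OF H(1)] in \<open>auto simp: group_norm act_mult\<close>)
 \<comment> \<open>The radical of the form. It is invariant, so irreducibility makes it zero once a
   single value of the form is nonzero.\<close>
 define W where "W = {u \<in> V. \<forall>v\<in>V. int p dvd B u v}"
 have "W = {0} \<or> W = V"
 proof (rule irred)
  show "adsub W" unfolding adsub_def
  proof (intro conjI ballI)
   show "0 \<in> W" using addmod_zero[OF V(1) lin(2)] adsubD(1)[OF V(1)] by (auto simp: W_def cong_0_iff)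
   show "- u \<in> W" if "u \<in> W" for u
   proof -
    have u: "u \<in> V" using that by (simp add: W_def)
    have "int p dvd B (- u) v" if "v \<in> V" for v
     using cong_dvd_iff[OF addmod_minus[OF V(1) lin(2)[OF that] u]] \<open>u \<in> W\<close> that
     by (auto simp: W_def)
    thus ?thesis using adsubD(3)[OF V(1) u] by (auto simp: W_def)
   qed
   show "u + v \<in> W" if "u \<in> W" "v \<in> W" for u v
   proof -
    have "int p dvd B (u + v) w" if w: "w \<in> V" for w
    proof -
     have "[B (u + v) w = B u w + B v w] (mod int p)"
      using lin(2)[OF w] \<open>u \<in> W\<close> \<open>v \<in> W\<close> by (auto simp: addmod_def W_def)
     moreover have "int p dvd B u w + B v w" using \<open>u \<in> W\<close> \<open>v \<in> W\<close> w by (auto simp: W_def)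
     ultimately show ?thesis by (metis cong_dvd_iff)
    qed
    thus ?thesis using that adsubD(2)[OF V(1)] by (auto simp: W_def)
   qed
  qed
  show "h $ w \<in> W" if "h \<in> H" "w \<in> W" for h w
  proof -
   have "int p dvd B (h $ w) v" if "v \<in> V" for v
    using inv[of h w "inverse h $ v"] \<open>h \<in> H\<close> \<open>w \<in> W\<close> V(2) subgrpD(3)[OF H(1)] that
    by (auto simp: W_def)
   thus ?thesis using that V(2) by (auto simp: W_def)
  qed
 qed (auto simp: W_def)
 moreover have "u\<^sub>0 \<notin> W" using nz uw by (auto simp: W_def B_def)
 ultimately have "W = {0}" using uw by blast
 hence "\<forall>u\<in>V. (\<forall>v\<in>V. int p dvd B u v) \<longrightarrow> u = 0" by (auto simp: W_def)
 thus ?thesis using lin inv by (intro exI[of _ B]) simp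
qed

end

section \<open>The alternating form and the quartic identity\<close>

locale form_module = rep act for act :: "'g::group_mult \<Rightarrow> 'v::ab_group_add \<Rightarrow> 'v" (infixr "$" 75) +
 fixes H :: "'g set" and V :: "'v set" and p :: nat and B :: "'v \<Rightarrow> 'v \<Rightarrow> int"
 assumes H: "subgrp H" "finite H" and p: "prime p" "\<not> p dvd card H" "p \<ge> 7"
  and V: "adsub V" "finite V" "\<And>h v. h \<in> H ==> v \<in> V ==> h $ v \<in> V"
  and B_mod: "\<And>u. u \<in> V ==> addmod p V (B u)" "\<And>u. u \<in> V ==> addmod p V (\<lambda>x. B x u)"
  and B_inv: "\<And>h u v. h \<in> H ==> u \<in> V ==> v \<in> V ==> B (h $ u) (h $ v) = B u v"
  and B_alt: "\<And>v. v \<in> V ==> int p dvd B v v"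
begin

definition zeq :: "int \<Rightarrow> int \<Rightarrow> bool" (infix "\<simeq>" 50) where "x \<simeq> y \<longleftrightarrow> [x = y] (mod int p)"

lemma zeq_refl [simp, intro]: "x \<simeq> x" by (simp add: zeq_def)
lemma zeq_sym: "x \<simeq> y ==> y \<simeq> x" by (simp add: zeq_def cong_sym)
lemma zeq_trans [trans]: "x \<simeq> y ==> y \<simeq> z ==> x \<simeq> z" unfolding zeq_def by (rule cong_trans)
lemma zeq_add: "a \<simeq> b ==> c \<simeq> d ==> a + c \<simeq> b + d" unfolding zeq_def by (rule cong_add)
lemma zeq_diff: "a \<simeq> b ==> c \<simeq> d ==> a - c \<simeq> b - d" unfolding zeq_def by (rule cong_diff)
lemma zeq_mult: "a \<simeq> b ==> c \<simeq> d ==> a * c \<simeq> b * d" unfolding zeq_def by (rule cong_mult)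
lemma zeq_pow: "a \<simeq> b ==> a ^ n \<simeq> b ^ n" unfolding zeq_def by (rule cong_pow)
lemma zeq_minus: "a \<simeq> b ==> - a \<simeq> - b" using zeq_diff[of 0 0 a b] by simp
lemma zeq_sum: "(\<And>x. x \<in> X ==> f x \<simeq> g x) ==> sum f X \<simeq> sum g X" unfolding zeq_def by (rule cong_sum)
lemma zeq_0_iff: "x \<simeq> 0 \<longleftrightarrow> int p dvd x" by (simp add: zeq_def cong_0_iff)
lemma zeq_iff_dvd: "x \<simeq> y \<longleftrightarrow> int p dvd x - y" by (simp add: zeq_def cong_iff_dvd_diff)
lemma zeq_cancel: assumes "c * x \<simeq> 0" "\<not> int p dvd c" shows "x \<simeq> 0"
 using assms p(1) by (simp add: zeq_0_iff prime_dvd_mult_iff)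

lemma zeq_scale_eq: assumes "a * x \<simeq> b * x" "\<not> int p dvd a - b" shows "x \<simeq> 0"
 using zeq_cancel[of "a - b" x] assms by (simp add: zeq_iff_dvd left_diff_distrib)

lemma V_closed [simp, intro]: "0 \<in> V" "u \<in> V ==> v \<in> V ==> u + v \<in> V" "u \<in> V ==> - u \<in> V"
 "u \<in> V ==> v \<in> V ==> u - v \<in> V" "h \<in> H ==> v \<in> V ==> h $ v \<in> V"
 using V(3) adsubD[OF V(1)] by blast+

lemma not_dvd_small: "0 < c ==> c < 7 ==> \<not> int p dvd c"
 using p(3) zdvd_imp_le by fastforce

lemma not_dvd_prod: "\<not> int p dvd a ==> \<not> int p dvd b ==> \<not> int p dvd a * b"
 using p(1) by (simp add: prime_dvd_mult_iff)

lemma not_dvd_card: assumes "subgrp S" "S \<subseteq> H" shows "\<not> int p dvd int (card S)"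
 using card_subgrp_dvd[OF H(1) assms H(2)] p(2) dvd_trans by auto

lemma B_add1: "u \<in> V ==> v \<in> V ==> w \<in> V ==> B (u + v) w \<simeq> B u w + B v w"
 using B_mod(2) by (auto simp: addmod_def zeq_def)
lemma B_add2: "u \<in> V ==> v \<in> V ==> w \<in> V ==> B w (u + v) \<simeq> B w u + B w v"
 using B_mod(1) by (auto simp: addmod_def zeq_def)
lemma B_zero1: "w \<in> V ==> B 0 w \<simeq> 0"
 using addmod_zero[OF V(1) B_mod(2)] by (simp add: zeq_def)
lemma B_zero2: "w \<in> V ==> B w 0 \<simeq> 0"
 using addmod_zero[OF V(1) B_mod(1)] by (simp add: zeq_def)
lemma B_minus1: "u \<in> V ==> w \<in> V ==> B (- u) w \<simeq> - B u w"
 using addmod_minus[OF V(1) B_mod(2)] by (simp add: zeq_def)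
lemma B_minus2: "u \<in> V ==> w \<in> V ==> B w (- u) \<simeq> - B w u"
 using addmod_minus[OF V(1) B_mod(1)] by (simp add: zeq_def)

lemma B_alt': "v \<in> V ==> B v v \<simeq> 0" using B_alt by (simp add: zeq_0_iff)

lemma B_skew: assumes "u \<in> V" "v \<in> V" shows "B v u \<simeq> - B u v"
proof -
 have uv: "u + v \<in> V" using assms by simp
 have "B (u + v) (u + v) \<simeq> B u (u + v) + B v (u + v)" using B_add1 assms uv by blast
 also have "\<dots> \<simeq> (B u u + B u v) + (B v u + B v v)" using B_add2 assms by (intro zeq_add) blast+
 also have "\<dots> \<simeq> (0 + B u v) + (B v u + 0)" using assms B_alt' by (intro zeq_add zeq_refl) blast+
 finally have "B (u + v) (u + v) \<simeq> B u v + B v u" by simp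
 hence "B u v + B v u \<simeq> 0" using zeq_trans[OF zeq_sym B_alt'[OF uv]] by blast
 thus ?thesis by (simp add: zeq_iff_dvd algebra_simps)
qed

lemma B_adj: assumes "h \<in> H" "u \<in> V" "v \<in> V" shows "B (h $ u) v = B u (inverse h $ v)"
 using B_inv[of h u "inverse h $ v"] assms V(3) subgrpD(3)[OF H(1)] by simp

lemma B_sum2: assumes "\<And>x. x \<in> X ==> f x \<in> V" "w \<in> V" shows "B w (sum f X) \<simeq> (\<Sum>x\<in>X. B w (f x))"
 using assms(1)
proof (induction X rule: infinite_finite_induct)
 case (insert x X)
 have "B w (f x + sum f X) \<simeq> B w (f x) + B w (sum f X)"
  using insert adsub_sum[OF V(1), of X f] assms(2) by (intro B_add2) auto
 also have "\<dots> \<simeq> B w (f x) + (\<Sum>x\<in>X. B w (f x))" using insert by (intro zeq_add zeq_refl) auto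
 finally show ?case using insert by simp
qed (use B_zero2 assms in auto)

text \<open>The condition on the scalars 2 and 3 is the part of rationality that survives the passage to the fixed
  space of a maximal centraliser.\<close>

definition good :: "'g set \<Rightarrow> 'v set \<Rightarrow> bool" where
 "good K Y \<longleftrightarrow> subgrp K \<and> K \<subseteq> H \<and> adsub Y \<and> Y \<subseteq> V \<and> (\<exists>v\<in>Y. v \<noteq> 0) \<and>
  (\<forall>k\<in>K. \<forall>v\<in>Y. k $ v \<in> Y) \<and>
  (\<forall>v\<in>Y. \<exists>k\<in>K. k $ v = v + v) \<and> (\<forall>v\<in>Y. \<exists>k\<in>K. k $ v = v + v + v) \<and>
  (\<forall>v\<in>Y. (\<forall>w\<in>Y. B v w \<simeq> 0) \<longrightarrow> v = 0)"

lemma goodD: assumes "good K Y"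
 shows "subgrp K" "finite K" "k \<in> K ==> k \<in> H" "adsub Y" "v \<in> Y ==> v \<in> V" "\<exists>v\<in>Y. v \<noteq> 0"
  "k \<in> K ==> v \<in> Y ==> k $ v \<in> Y" "v \<in> Y ==> \<exists>k\<in>K. k $ v = v + v"
  "v \<in> Y ==> \<exists>k\<in>K. k $ v = v + v + v"
  "v \<in> Y ==> (\<And>w. w \<in> Y ==> B v w \<simeq> 0) ==> v = 0"
 using assms H(2) finite_subset unfolding good_def by (blast+)

lemma B_double1: assumes "v \<in> V" "w \<in> V" shows "B (v + v) w \<simeq> 2 * B v w"
 using B_add1[of v v w] assms by simp
lemma B_double2: assumes "v \<in> V" "w \<in> V" shows "B w (v + v) \<simeq> 2 * B w v"
 using B_add2[of v v w] assms by simp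

lemma good_two: assumes "good K Y" "v \<in> Y" "v + v = 0" shows "v = 0"
proof (rule goodD(10)[OF assms(1,2)])
 fix w assume w: "w \<in> Y"
 have "2 * B v w \<simeq> 0"
  using B_double1[of v w] B_zero1[of w] goodD(5)[OF assms(1)] w assms(2,3)
  by (metis zeq_sym zeq_trans)
 thus "B v w \<simeq> 0" by (rule zeq_cancel) (rule not_dvd_small, auto)
qed

lemma good_three: assumes "good K Y" "v \<in> Y" "v + v + v = 0" shows "v = 0"
proof (rule goodD(10)[OF assms(1,2)])
 fix w assume w: "w \<in> Y"
 have v: "v \<in> V" "w \<in> V" "v + v \<in> V" using goodD(5)[OF assms(1)] w assms(2) by auto
 have "B (v + v + v) w \<simeq> B (v + v) w + B v w" using B_add1 v by blast
 also have "\<dots> \<simeq> 2 * B v w + B v w" using B_double1 v by (intro zeq_add zeq_refl) blast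
 finally have "B 0 w \<simeq> 3 * B v w" using assms(3) by simp
 hence "3 * B v w \<simeq> 0" using B_zero1[OF v(2)] zeq_sym zeq_trans by blast
 thus "B v w \<simeq> 0" by (rule zeq_cancel) (rule not_dvd_small, auto)
qed

lemma good_eq_minus: assumes "good K Y" "v \<in> Y" "v = - v" shows "v = 0"
 using good_two[OF assms(1,2)] assms(3) by (metis add.right_inverse)

lemma good_double_cancel: assumes "good K Y" "v \<in> Y" "w \<in> Y" "v + v = w + w" shows "v = w"
 using good_two[OF assms(1), of "v - w"] assms(2-4) adsubD(4)[OF goodD(4)[OF assms(1)]]
 by (simp add: algebra_simps)

text \<open>Conjugation by an element that doubles \<open>v\<close> permutes \<open>C\<close> and
  multiplies each \<open>B (x $ v) v\<close> by 4. The sum of squares therefore equals 16 times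
  itself, and 15 is invertible because \<open>p \<ge> 7\<close>.\<close>

lemma quartic:
 assumes g: "good K Y" and C: "C \<subseteq> K" "\<And>k x. k \<in> K ==> x \<in> C ==> cj k x \<in> C" and v: "v \<in> Y"
 shows "(\<Sum>x\<in>C. (B (x $ v) v)\<^sup>2) \<simeq> 0"
proof -
 note G = goodD[OF g]
 obtain k where k: "k \<in> K" "k $ v = v + v" using G(8)[OF v] by blast
 have vV: "v \<in> V" "\<And>x. x \<in> K ==> x $ v \<in> V" using G(3,5,7) v by blast+
 have CK: "x \<in> K" if "x \<in> C" for x using that C by blast
 have vvV: "v + v \<in> V" using vV by simp
 have ik: "inverse k \<in> K" using k(1) subgrpD[OF G(1)] by blast
 have key: "(B (cj (inverse k) x $ v) v)\<^sup>2 \<simeq> 16 * (B (x $ v) v)\<^sup>2" if x: "x \<in> C" for x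
 proof -
  have "B (cj (inverse k) x $ v) v = B (k $ cj (inverse k) x $ v) (k $ v)"
   using B_inv[of k "cj (inverse k) x $ v" v] k(1) G(3) vV subgrpD[OF G(1)] CK[OF x] by simp
  also have "k $ cj (inverse k) x $ v = x $ k $ v" by (simp add: cj_def act_mult)
  finally have "B (cj (inverse k) x $ v) v = B (x $ v + x $ v) (v + v)" by (simp add: k(2) act_add)
  moreover have "B (x $ v + x $ v) (v + v) \<simeq> 2 * B (x $ v) (v + v)"
   using B_double1 vV CK[OF x] vvV by blast
  moreover have "2 * B (x $ v) (v + v) \<simeq> 2 * (2 * B (x $ v) v)"
   using B_double2 vV CK[OF x] by (intro zeq_mult zeq_refl) blast
  ultimately have "B (cj (inverse k) x $ v) v \<simeq> 2 * (2 * B (x $ v) v)"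
   using zeq_trans by metis
  hence "B (cj (inverse k) x $ v) v \<simeq> 4 * B (x $ v) v" by simp
  hence "(B (cj (inverse k) x $ v) v)\<^sup>2 \<simeq> (4 * B (x $ v) v)\<^sup>2" by (rule zeq_pow)
  thus ?thesis by (simp add: power_mult_distrib)
 qed
 have "(\<Sum>x\<in>C. (B (x $ v) v)\<^sup>2) = (\<Sum>x\<in>C. (B (cj (inverse k) x $ v) v)\<^sup>2)"
  by (rule sum.reindex_bij_witness[where i = "cj (inverse k)" and j = "cj k"]) (use C k ik in auto)
 also have "\<dots> \<simeq> (\<Sum>x\<in>C. 16 * (B (x $ v) v)\<^sup>2)" by (rule zeq_sum) (rule key)
 finally have "15 * (\<Sum>x\<in>C. (B (x $ v) v)\<^sup>2) \<simeq> 0"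
  unfolding zeq_iff_dvd sum_distrib_left[symmetric] by (subst dvd_minus_iff[symmetric]) simp
 moreover have "\<not> int p dvd 3 * 5" by (intro not_dvd_prod not_dvd_small) auto
 ultimately show ?thesis using zeq_cancel by auto
qed

text \<open>The sum is half the coefficient of \<open>t\<close> in the quartic polynomial obtained
  by evaluating the identity at \<open>v + t w\<close>. Doubling and negating \<open>w\<close>
  supplies the values at 1, -1, 2 and -2.\<close>

lemma quartic_derivative:
 assumes g: "good K Y" and C: "C \<subseteq> K" "\<And>v. v \<in> Y ==> (\<Sum>x\<in>C. (B (x $ v) v)\<^sup>2) \<simeq> 0"
  and v: "v \<in> Y" "w \<in> Y"
 shows "(\<Sum>x\<in>C. B (x $ v) v * (B (x $ v) w + B (x $ w) v)) \<simeq> 0"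
proof -
 note G = goodD[OF g]
 define b0 b1 b2 where "b0 x = B (x $ v) v" and "b1 x = B (x $ v) w + B (x $ w) v"
  and "b2 x = B (x $ w) w" for x
 have KV: "x $ u \<in> V" if "x \<in> C" "u \<in> Y" for x u using that G(3,5,7) C(1) by blast
 have ex: "B (x $ (a + b)) (a + b) \<simeq> B (x $ a) a + (B (x $ a) b + B (x $ b) a) + B (x $ b) b"
  if "x \<in> C" "a \<in> Y" "b \<in> Y" for x a b
 proof -
  have ab: "a \<in> V" "b \<in> V" "a + b \<in> V" "x $ a \<in> V" "x $ b \<in> V"
   using that G(5) KV by auto
  have "B (x $ (a + b)) (a + b) \<simeq> B (x $ a) (a + b) + B (x $ b) (a + b)"
   using B_add1 ab by (auto simp: act_add)
  also have "\<dots> \<simeq> (B (x $ a) a + B (x $ a) b) + (B (x $ b) a + B (x $ b) b)"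
   using B_add2 ab by (intro zeq_add) blast+
  finally show ?thesis by (simp add: algebra_simps)
 qed
 have neg: "B (x $ a) (- b) + B (x $ - b) a \<simeq> - (B (x $ a) b + B (x $ b) a)"
    "B (x $ - b) (- b) \<simeq> B (x $ b) b" if "x \<in> C" "a \<in> Y" "b \<in> Y" for x a b
 proof -
  have ab: "a \<in> V" "b \<in> V" "- b \<in> V" "x $ a \<in> V" "x $ b \<in> V" "- (x $ b) \<in> V"
   using that G(5) KV by auto
  have "B (x $ a) (- b) + B (- (x $ b)) a \<simeq> - B (x $ a) b + - B (x $ b) a"
   using B_minus1 B_minus2 ab by (intro zeq_add) blast+
  thus "B (x $ a) (- b) + B (x $ - b) a \<simeq> - (B (x $ a) b + B (x $ b) a)"
   by (simp add: act_minus)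
  have "B (- (x $ b)) (- b) \<simeq> - B (x $ b) (- b)" using B_minus1 ab by blast
  also have "\<dots> \<simeq> - (- B (x $ b) b)"
   using B_minus2[OF ab(2) ab(5)] zeq_minus by blast
  finally show "B (x $ - b) (- b) \<simeq> B (x $ b) b" by (simp add: act_minus)
 qed
 have dbl: "B (x $ a) (b + b) + B (x $ (b + b)) a \<simeq> 2 * (B (x $ a) b + B (x $ b) a)"
    "B (x $ (b + b)) (b + b) \<simeq> 4 * B (x $ b) b" if "x \<in> C" "a \<in> Y" "b \<in> Y" for x a b
 proof -
  have ab: "a \<in> V" "b \<in> V" "b + b \<in> V" "x $ a \<in> V" "x $ b \<in> V" "x $ b + x $ b \<in> V"
   using that G(5) KV by auto
  have "B (x $ a) (b + b) + B (x $ b + x $ b) a \<simeq> 2 * B (x $ a) b + 2 * B (x $ b) a"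
   using B_double1 B_double2 ab by (intro zeq_add) blast+
  thus "B (x $ a) (b + b) + B (x $ (b + b)) a \<simeq> 2 * (B (x $ a) b + B (x $ b) a)"
   by (simp add: act_add algebra_simps)
  have "B (x $ b + x $ b) (b + b) \<simeq> 2 * B (x $ b) (b + b)" using B_double1 ab by blast
  also have "\<dots> \<simeq> 2 * (2 * B (x $ b) b)"
   using B_double2 ab by (intro zeq_mult zeq_refl) blast
  finally show "B (x $ (b + b)) (b + b) \<simeq> 4 * B (x $ b) b" by (simp add: act_add)
 qed
 have w': "- w \<in> Y" "w + w \<in> Y" "- (w + w) \<in> Y" using v adsubD[OF G(4)] by blast+
 have F: "(\<Sum>x\<in>C. (b0 x + t * b1 x + t\<^sup>2 * b2 x)\<^sup>2) \<simeq> 0"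
  if u: "u \<in> Y" and t: "\<And>x. x \<in> C ==> B (x $ v) u + B (x $ u) v \<simeq> t * b1 x"
   "\<And>x. x \<in> C ==> B (x $ u) u \<simeq> t\<^sup>2 * b2 x" for u t
 proof -
  have "(\<Sum>x\<in>C. (b0 x + t * b1 x + t\<^sup>2 * b2 x)\<^sup>2) \<simeq> (\<Sum>x\<in>C. (B (x $ (v + u)) (v + u))\<^sup>2)"
  proof (rule zeq_sum, rule zeq_pow, rule zeq_sym)
   fix x assume x: "x \<in> C"
   have "B (x $ (v + u)) (v + u) \<simeq> B (x $ v) v + (B (x $ v) u + B (x $ u) v) + B (x $ u) u"
    by (rule ex[OF x v(1) u])
   also have "\<dots> \<simeq> b0 x + t * b1 x + t\<^sup>2 * b2 x"
    using t[OF x] by (intro zeq_add) (auto simp: b0_def)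
   finally show "B (x $ (v + u)) (v + u) \<simeq> b0 x + t * b1 x + t\<^sup>2 * b2 x" .
  qed
  also have "\<dots> \<simeq> 0" using C(2) adsubD(2)[OF G(4) v(1) u] by blast
  finally show ?thesis .
 qed
 have F1: "(\<Sum>x\<in>C. (b0 x + 1 * b1 x + 1\<^sup>2 * b2 x)\<^sup>2) \<simeq> 0"
  by (rule F[OF v(2)]) (simp_all add: b1_def b2_def)
 have Fm1: "(\<Sum>x\<in>C. (b0 x + (-1) * b1 x + (-1)\<^sup>2 * b2 x)\<^sup>2) \<simeq> 0"
  by (rule F[OF w'(1)]) (use neg[OF _ v] in \<open>simp_all add: b1_def b2_def\<close>)
 have F2: "(\<Sum>x\<in>C. (b0 x + 2 * b1 x + 2\<^sup>2 * b2 x)\<^sup>2) \<simeq> 0"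
  by (rule F[OF w'(2)]) (use dbl[OF _ v] in \<open>simp_all add: b1_def b2_def\<close>)
 have Fm2: "(\<Sum>x\<in>C. (b0 x + (-2) * b1 x + (-2)\<^sup>2 * b2 x)\<^sup>2) \<simeq> 0"
 proof (rule F[OF w'(3)])
  fix x assume x: "x \<in> C"
  have "B (x $ v) (- (w + w)) + B (x $ - (w + w)) v \<simeq> - (B (x $ v) (w + w) + B (x $ (w + w)) v)"
   by (rule neg(1)[OF x v(1) w'(2)])
  also have "\<dots> \<simeq> - (2 * (B (x $ v) w + B (x $ w) v))"
   using dbl(1)[OF x v] zeq_minus by blast
  finally show "B (x $ v) (- (w + w)) + B (x $ - (w + w)) v \<simeq> - 2 * b1 x" by (simp add: b1_def)
  show "B (x $ - (w + w)) (- (w + w)) \<simeq> (- 2)\<^sup>2 * b2 x"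
   using zeq_trans[OF neg(2)[OF x v(1) w'(2)] dbl(2)[OF x v]] by (simp add: b2_def)
 qed
 \<comment> \<open>The odd part, \<open>F t - F (- t)\<close>, is
   \<open>4 t b0 b1 + 4 t^3 b1 b2\<close> summed over \<open>C\<close>. The weights 8 and 1 at
   \<open>t = 1\<close> and \<open>t = 2\<close> cancel the cubic term.\<close>
 have "24 * (\<Sum>x\<in>C. b0 x * b1 x) =
   8 * ((\<Sum>x\<in>C. (b0 x + 1 * b1 x + 1\<^sup>2 * b2 x)\<^sup>2) - (\<Sum>x\<in>C. (b0 x + (-1) * b1 x + (-1)\<^sup>2 * b2 x)\<^sup>2))
   - ((\<Sum>x\<in>C. (b0 x + 2 * b1 x + 2\<^sup>2 * b2 x)\<^sup>2) - (\<Sum>x\<in>C. (b0 x + (-2) * b1 x + (-2)\<^sup>2 * b2 x)\<^sup>2))"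
  unfolding sum_subtractf[symmetric] sum_distrib_left
  by (rule sum.cong[OF refl]) (simp add: power2_eq_square algebra_simps)
 also have "\<dots> \<simeq> 8 * (0 - 0) - (0 - 0)"
  by (intro zeq_diff zeq_mult zeq_refl F1 Fm1 F2 Fm2)
 finally have "(2 * 2 * 6) * (\<Sum>x\<in>C. b0 x * b1 x) \<simeq> 0" by simp
 hence "(\<Sum>x\<in>C. b0 x * b1 x) \<simeq> 0"
  by (rule zeq_cancel) (intro not_dvd_prod not_dvd_small; simp)
 thus ?thesis by (simp add: b0_def b1_def)
qed

end

section \<open>Fixed spaces and abelian normal subgroups\<close>

context form_module begin

definition nondeg :: "'v set \<Rightarrow> bool" where
 "nondeg Y \<longleftrightarrow> adsub Y \<and> Y \<subseteq> V \<and> (\<forall>v\<in>Y. (\<forall>w\<in>Y. B v w \<simeq> 0) \<longrightarrow> v = 0)"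

lemma good_nondeg: "good K Y ==> nondeg Y"
 unfolding good_def nondeg_def by blast

text \<open>The adjoint of \<open>g\<close> is its inverse; polarising the hypothesis shows that
  \<open>g $ v - inverse g $ v\<close> is orthogonal to all of \<open>Y\<close>.\<close>

lemma alternating_imp_involution:
 assumes Y: "nondeg Y" and g: "g \<in> H" "\<And>v. v \<in> Y ==> g $ v \<in> Y" "\<And>v. v \<in> Y ==> inverse g $ v \<in> Y"
  and alt: "\<And>v. v \<in> Y ==> B (g $ v) v \<simeq> 0" and v: "v \<in> Y"
 shows "g $ g $ v = v"
proof -
 have YV: "u \<in> V" if "u \<in> Y" for u using that Y by (auto simp: nondeg_def)
 have ad: "adsub Y" using Y by (simp add: nondeg_def)
 have "g $ v - inverse g $ v = 0"
 proof -
  have "B (g $ v - inverse g $ v) w \<simeq> 0" if w: "w \<in> Y" for w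
  proof -
   have m: "g $ v \<in> V" "g $ w \<in> V" "inverse g $ v \<in> V" "v \<in> V" "w \<in> V"
    using YV g v w by auto
   have e1: "B (g $ v + g $ w) (v + w) \<simeq> 0"
    using alt[OF adsubD(2)[OF ad v w]] by (simp add: act_add)
   have e2: "B (g $ v + g $ w) (v + w) \<simeq> (B (g $ v) v + B (g $ v) w) + (B (g $ w) v + B (g $ w) w)"
    by (rule zeq_trans[OF B_add1 zeq_add[OF B_add2 B_add2]]) (use m in auto)
   also have "\<dots> \<simeq> (0 + B (g $ v) w) + (B (g $ w) v + 0)"
    using alt v w by (intro zeq_add zeq_refl) auto
   finally have "0 \<simeq> B (g $ v) w + B (g $ w) v"
    using zeq_trans[OF zeq_sym[OF e1]] by simp
   moreover have "B (g $ w) v \<simeq> - B (inverse g $ v) w"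
    using B_adj[OF g(1) m(5,4)] B_skew[OF m(3,5)] by simp
   moreover have "B (g $ v - inverse g $ v) w \<simeq> B (g $ v) w + - B (inverse g $ v) w"
    unfolding diff_conv_add_uminus
    by (rule zeq_trans[OF B_add1 zeq_add[OF zeq_refl B_minus1]]) (use m in auto)
   ultimately show ?thesis by (metis zeq_add zeq_refl zeq_sym zeq_trans)
  qed
  moreover have "g $ v - inverse g $ v \<in> Y" using g v adsubD(4)[OF ad] by blast
  ultimately show ?thesis using Y unfolding nondeg_def by blast
 qed
 hence "g $ v = inverse g $ v" by simp
 thus ?thesis by simp
qed

lemma involution_imp_alternating:
 assumes "g \<in> H" "v \<in> V" "g $ g $ v = v" shows "B (g $ v) v \<simeq> 0"
proof -
 have "inverse g $ v = g $ v" using assms(3) by (metis act_inverse(1))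
 hence "B (g $ v) v \<simeq> - B (g $ v) v"
  using B_adj[OF assms(1,2,2)] B_skew[of "g $ v" v] assms by simp
 hence "2 * B (g $ v) v \<simeq> 0" by (simp add: zeq_iff_dvd)
 thus ?thesis by (rule zeq_cancel) (simp add: not_dvd_small)
qed

text \<open>For fixed \<open>v\<close>, replacing \<open>u\<close> by the sum of its
  \<open>S\<close>-translates multiplies \<open>B v u\<close> by the order of \<open>S\<close>,
  which is prime to \<open>p\<close>. So a fixed vector orthogonal to the fixed space is orthogonal
  to everything.\<close>

lemma fixed_nondeg:
 assumes Y: "nondeg Y" and S: "subgrp S" "S \<subseteq> H" "\<And>s v. s \<in> S ==> v \<in> Y ==> s $ v \<in> Y"
 shows "nondeg (fixed S Y)"
proof -
 have YV: "u \<in> V" if "u \<in> Y" for u using that Y by (auto simp: nondeg_def)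
 have ad: "adsub Y" using Y by (simp add: nondeg_def)
 have fS: "finite S" using S(2) H(2) finite_subset by blast
 have "v = 0" if v: "v \<in> fixed S Y" and z: "\<forall>w\<in>fixed S Y. B v w \<simeq> 0" for v
 proof -
  have vY: "v \<in> Y" "\<And>s. s \<in> S ==> s $ v = v" using v by (auto simp: fixed_def)
  have "B v u \<simeq> 0" if u: "u \<in> Y" for u
  proof -
   define w where "w = (\<Sum>s\<in>S. s $ u)"
   have "w \<in> Y" unfolding w_def by (rule adsub_sum[OF ad]) (use S u in blast)
   moreover have "s $ w = w" if "s \<in> S" for s
    unfolding w_def act_sum
    by (rule sum.reindex_bij_witness[where i = "\<lambda>x. inverse s * x" and j = "\<lambda>x. s * x"])
      (use subgrpD[OF S(1)] that in \<open>auto simp: group_norm act_mult\<close>)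
   ultimately have "B v w \<simeq> 0" using z by (auto simp: fixed_def)
   moreover have "B v w \<simeq> (\<Sum>s\<in>S. B v (s $ u))"
    unfolding w_def by (rule B_sum2) (use S u vY YV in auto)
   moreover have "(\<Sum>s\<in>S. B v (s $ u)) = (\<Sum>s\<in>S. B v u)"
   proof (rule sum.cong[OF refl])
    fix s assume s: "s \<in> S"
    thus "B v (s $ u) = B v u"
     using B_inv[of s v u] vY(2)[OF s] S(2) YV vY(1) u by auto
   qed
   ultimately have "int (card S) * B v u \<simeq> 0" using zeq_sym zeq_trans by (metis sum_constant)
   thus ?thesis by (rule zeq_cancel) (rule not_dvd_card[OF S(1,2)])
  qed
  thus ?thesis using Y vY(1) unfolding nondeg_def by blast
 qed
 thus ?thesis using fixed_adsub[OF ad] Y by (auto simp: nondeg_def fixed_def)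
qed

lemma normal_inH: "normal_in N K ==> good K Y ==> N \<subseteq> H \<and> N \<subseteq> K \<and> subgrp N \<and> finite N"
 using goodD(2,3) finite_subset unfolding normal_in_def by (metis subsetD subsetI)

text \<open>The derivative of the quartic identity in the directions \<open>c $ v\<close> says that
  all autocorrelations of \<open>\<phi> d = B (d $ v) v\<close> vanish. As \<open>\<phi>\<close>
  changes sign under inversion, its translate by \<open>g\<close> has convolution square zero, so
  \<open>\<phi> g = 0\<close> and \<open>g\<close> is an involution on \<open>Y\<close>. This takes
  the place of a decomposition into eigenspaces over a larger field.\<close>

theorem abelian_normal_involution:
 assumes g: "good K Y" and D: "normal_in D K"
  and comm: "\<And>c d v. c \<in> D ==> d \<in> D ==> v \<in> Y ==> c $ d $ v = d $ c $ v"
  and d: "d \<in> D" "v \<in> Y"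
 shows "d $ d $ v = v"
proof -
 note G = goodD[OF g]
 have DH: "D \<subseteq> H" "D \<subseteq> K" "subgrp D" "finite D" using normal_inH[OF D g] by auto
 note SD = subgrpD[OF DH(3)]
 have "B (g $ v) v \<simeq> 0" if gD: "g \<in> D" and v: "v \<in> Y" for g v
 proof -
  define \<phi> where "\<phi> d = B (d $ v) v" for d
  have vV: "v \<in> V" "\<And>d. d \<in> D ==> d $ v \<in> V" using G(5) v DH(1) by auto
  have skew: "\<phi> (inverse x) \<simeq> - \<phi> x" if "x \<in> D" for x
   using B_adj[of "inverse x" v v] B_skew[of "x $ v" v] vV that subsetD[OF DH(1) SD(3)[OF that]]
   by (auto simp: \<phi>_def)
  have com: "\<phi> (c * d) = \<phi> (d * c)" if "c \<in> D" "d \<in> D" for c d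
   using comm[OF that v] by (simp add: \<phi>_def act_mult)
  have auto0: "(\<Sum>d\<in>D. \<phi> d * \<phi> (d * c)) \<simeq> 0" if c: "c \<in> D" for c
  proof -
   have "(\<Sum>d\<in>D. \<phi> d * (B (d $ v) (c $ v) + B (d $ c $ v) v)) \<simeq> 0"
    unfolding \<phi>_def
   proof (rule quartic_derivative[OF g DH(2) _ v])
    show "(\<Sum>x\<in>D. (B (x $ v) v)\<^sup>2) \<simeq> 0" if "v \<in> Y" for v
     by (rule quartic[OF g DH(2) _ that]) (use D in \<open>auto simp: normal_in_def\<close>)
    show "c $ v \<in> Y" using G(7) v c DH(2) by blast
   qed
   also have "(\<Sum>d\<in>D. \<phi> d * (B (d $ v) (c $ v) + B (d $ c $ v) v)) =
    (\<Sum>d\<in>D. \<phi> d * \<phi> (inverse c * d)) + (\<Sum>d\<in>D. \<phi> d * \<phi> (d * c))"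
   proof -
    have "B (d $ v) (c $ v) = \<phi> (inverse c * d)" if "d \<in> D" for d
     using B_inv[of c "inverse c $ d $ v" v] that c vV DH(1) SD(3)
     by (auto simp: \<phi>_def act_mult subsetD)
    thus ?thesis by (simp add: distrib_left sum.distrib \<phi>_def act_mult)
   qed
   also have "(\<Sum>d\<in>D. \<phi> d * \<phi> (inverse c * d)) = (\<Sum>d\<in>D. \<phi> d * \<phi> (d * c))"
   proof (rule sum.reindex_bij_witness[where i = "\<lambda>x. c * x" and j = "\<lambda>x. inverse c * x"])
    fix d assume "d \<in> D"
    thus "\<phi> (inverse c * d) * \<phi> (inverse c * d * c) = \<phi> d * \<phi> (inverse c * d)"
     using com[of "inverse c * d" c] SD c by (simp add: group_norm)
   qed (use SD c in \<open>auto simp: group_norm\<close>)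
   finally have "2 * (\<Sum>d\<in>D. \<phi> d * \<phi> (d * c)) \<simeq> 0" by simp
   thus ?thesis by (rule zeq_cancel) (simp add: not_dvd_small)
  qed
  have "int p dvd \<phi> (1 * g)"
  proof (rule square_zero_imp_one_zero[OF DH(3,4) p(1), where \<psi> = "\<lambda>d. \<phi> (d * g)"])
   show "\<not> p dvd card D" using not_dvd_card[OF DH(3,1)] by simp
   fix x assume x: "x \<in> D"
   have "(\<Sum>d\<in>D. \<phi> (d * g) * \<phi> (inverse d * x * g)) \<simeq>
      (\<Sum>d\<in>D. - \<phi> (inverse g * inverse d) * \<phi> (inverse d * x * g))"
   proof (intro zeq_sum zeq_mult zeq_refl)
    fix d assume "d \<in> D"
    hence "\<phi> (inverse (inverse (d * g))) \<simeq> - \<phi> (inverse (d * g))" by (intro skew) (use SD gD in auto)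
    thus "\<phi> (d * g) \<simeq> - \<phi> (inverse g * inverse d)" by (simp add: group_inverse_mult)
   qed
   also have "\<dots> = - (\<Sum>d\<in>D. \<phi> d * \<phi> (d * (g * x * g)))"
    unfolding sum_negf[symmetric]
   proof (rule sum.reindex_bij_witness[where i = "\<lambda>d. inverse (d * g)" and j = "\<lambda>d. inverse d * inverse g"])
    fix d assume "d \<in> D"
    thus "- (\<phi> (inverse d * inverse g) * \<phi> (inverse d * inverse g * (g * x * g))) =
      - \<phi> (inverse g * inverse d) * \<phi> (inverse d * x * g)"
     using com[of "inverse d" "inverse g"] SD gD by (simp add: group_norm)
   qed (use SD gD in \<open>auto simp: group_norm\<close>)
   also have "\<dots> \<simeq> - 0" by (intro zeq_minus auto0) (use SD gD x in auto)
   finally show "int p dvd (\<Sum>d\<in>D. \<phi> (d * g) * \<phi> (inverse d * x * g))" by (simp add: zeq_0_iff)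
  qed
  thus ?thesis by (simp add: \<phi>_def zeq_0_iff)
 qed
 thus ?thesis
  using alternating_imp_involution[OF good_nondeg[OF g], of d v] d DH G(7) SD(3) by blast
qed

definition nrm :: "'g set \<Rightarrow> 'g set \<Rightarrow> 'g set" where "nrm K S = {k \<in> K. \<forall>x. cj k x \<in> S \<longleftrightarrow> x \<in> S}"

lemma nrm_subgrp: "subgrp K ==> subgrp (nrm K S)" unfolding nrm_def by (rule normalizer_normal)

lemma cen_cj: assumes "normal_in N K" "subgrp K" "k \<in> K"
 shows "cj k x \<in> cen N (k $ v) \<longleftrightarrow> x \<in> cen N v"
 using normal_cj_iff[OF assms] by (auto simp: cen_def cj_def act_mult)

text \<open>\<open>Y\<close> has neither 2-torsion nor 3-torsion, so fixing a multiple of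
  \<open>u\<close> means fixing \<open>u\<close>.\<close>

lemma cen_double: assumes "good K Y" "N \<subseteq> K" "u \<in> Y"
 shows "cen N (u + u) = cen N u" "cen N (u + u + u) = cen N u" "cen N (- u) = cen N u"
proof -
 have "n $ u = u" if "n \<in> N" "n $ (u + u) = u + u" for n
 proof -
  have "n $ u \<in> Y" using goodD(7)[OF assms(1)] that assms by blast
  thus ?thesis using good_double_cancel[OF assms(1) _ assms(3)] that(2) by (simp add: act_add)
 qed
 thus "cen N (u + u) = cen N u" by (auto simp: cen_def act_add)
 have "n $ u = u" if "n \<in> N" "n $ (u + u + u) = u + u + u" for n
 proof -
  have "n $ u \<in> Y" using goodD(7)[OF assms(1)] that assms by blast
  hence "n $ u - u \<in> Y" using adsubD(4)[OF goodD(4)[OF assms(1)]] assms(3) by blast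
  moreover have "(n $ u - u) + (n $ u - u) + (n $ u - u) = 0" using that(2) by (simp add: act_add algebra_simps)
  ultimately show ?thesis using good_three[OF assms(1)] by fastforce
 qed
 thus "cen N (u + u + u) = cen N u" by (auto simp: cen_def act_add)
 show "cen N (- u) = cen N u" by (auto simp: cen_def act_minus)
qed

lemma max_centralizer_exists:
 assumes "good K Y" "N \<subseteq> K"
 obtains v where "v \<in> Y" "v \<noteq> 0" "\<And>u. u \<in> Y ==> u \<noteq> 0 ==> card (cen N u) \<le> card (cen N v)"
proof -
 obtain v0 where v0: "v0 \<in> Y \<and> v0 \<noteq> 0" using goodD(6)[OF assms(1)] by blast
 have "card (cen N u) \<le> card K" for u
  using assms goodD(2)[OF assms(1)] by (intro card_mono) (auto simp: cen_def)
 hence "\<exists>v. (v \<in> Y \<and> v \<noteq> 0) \<and> (\<forall>u. u \<in> Y \<and> u \<noteq> 0 \<longrightarrow> card (cen N u) \<le> card (cen N v))"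
  by (intro ex_has_greatest_nat[of _ v0 _ "Suc (card K)"] v0) (auto simp: less_Suc_eq_le)
 thus ?thesis using that by blast
qed

text \<open>By maximality all nonzero vectors of the fixed space have the same centraliser in
  \<open>N\<close>. An element of \<open>K\<close> that multiplies one of them by 2, 3 or -1 must
  therefore normalise this centraliser, and so the scalars realised on vectors survive the
  reduction.\<close>

theorem fixed_reduction:
 assumes g: "good K Y" and N: "normal_in N K" and v: "v \<in> Y" "v \<noteq> 0"
  and max: "\<And>u. u \<in> Y ==> u \<noteq> 0 ==> card (cen N u) \<le> card (cen N v)"
 shows "good (nrm K (cen N v)) (fixed (cen N v) Y)"
  and "u \<in> fixed (cen N v) Y ==> u \<noteq> 0 ==> cen N u = cen N v"
  and "v \<in> fixed (cen N v) Y"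
  and "k \<in> K ==> u \<in> fixed (cen N v) Y ==> u \<noteq> 0 ==> k $ u \<in> {u, u + u, u + u + u, - u} ==>
     k \<in> nrm K (cen N v)"
proof -
 define S where "S = cen N v"
 note G = goodD[OF g]
 have NH: "N \<subseteq> H" "N \<subseteq> K" "subgrp N" "finite N" using normal_inH[OF N g] by auto
 have S: "subgrp S" "S \<subseteq> N" unfolding S_def using cen_subgrp[OF NH(3)] by (auto simp: cen_def)
 show vf: "v \<in> fixed (cen N v) Y" using v by (auto simp: fixed_def cen_def)
 have eq: "cen N u = S" if "u \<in> fixed S Y" "u \<noteq> 0" for u
 proof -
  have "S \<subseteq> cen N u" using that S(2) by (auto simp: fixed_def cen_def)
  moreover have "card (cen N u) \<le> card S" using max that unfolding S_def by (auto simp: fixed_def)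
  moreover have "finite (cen N u)" using NH(4) by (simp add: cen_def)
  ultimately show ?thesis by (metis card_seteq)
 qed
 thus "u \<in> fixed (cen N v) Y ==> u \<noteq> 0 ==> cen N u = cen N v" for u by (simp add: S_def)
 have nr: "k \<in> nrm K S" if k: "k \<in> K" and u: "u \<in> fixed S Y" "u \<noteq> 0" "k $ u \<in> {u, u + u, u + u + u, - u}" for k u
 proof -
  have uY: "u \<in> Y" using u by (simp add: fixed_def)
  have "cen N (k $ u) = cen N u"
   using u(3) by (elim insertE) (simp_all add: cen_double[OF g NH(2) uY] del: act_eq_iff)
  thus ?thesis
   using cen_cj[OF N G(1) k, of _ u] eq[OF u(1,2)] k by (simp add: nrm_def)
 qed
 thus "k \<in> K ==> u \<in> fixed (cen N v) Y ==> u \<noteq> 0 ==> k $ u \<in> {u, u + u, u + u + u, - u} ==>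
     k \<in> nrm K (cen N v)" for k u by (simp add: S_def)
 have nd: "nondeg (fixed S Y)"
  by (rule fixed_nondeg[OF good_nondeg[OF g] S(1)]) (use S NH G in blast)+
 have inv: "k $ u \<in> fixed S Y" if "k \<in> nrm K S" "u \<in> fixed S Y" for k u
 proof -
  have kK: "k \<in> K" and kS: "\<And>x. cj k x \<in> S \<longleftrightarrow> x \<in> S" using that by (auto simp: nrm_def)
  have "s $ k $ u = k $ u" if s: "s \<in> S" for s
  proof -
   have "cj (inverse k) s \<in> S" using kS[of "cj (inverse k) s"] s by simp
   hence "cj (inverse k) s $ u = u" using \<open>u \<in> fixed S Y\<close> by (auto simp: fixed_def)
   hence "k $ cj (inverse k) s $ u = k $ u" by simp
   thus ?thesis by (simp add: cj_def act_mult)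
  qed
  thus ?thesis using G(7) kK that by (auto simp: fixed_def)
 qed
 have sub: "nrm K S \<subseteq> K" by (auto simp: nrm_def)
 have one: "1 \<in> nrm K S" using subgrpD(1)[OF nrm_subgrp[OF G(1)]] .
 show "good (nrm K (cen N v)) (fixed (cen N v) Y)"
  unfolding S_def[symmetric] good_def
 proof (intro conjI ballI)
  show "\<exists>k\<in>nrm K S. k $ u = u + u" if u: "u \<in> fixed S Y" for u
  proof (cases "u = 0")
   case False
   obtain k where "k \<in> K" "k $ u = u + u" using G(8)[of u] u by (auto simp: fixed_def)
   thus ?thesis using nr[of k u] u False by auto
  qed (use one in auto)
  show "\<exists>k\<in>nrm K S. k $ u = u + u + u" if u: "u \<in> fixed S Y" for u
  proof (cases "u = 0")
   case False
   obtain k where "k \<in> K" "k $ u = u + u + u" using G(9)[of u] u by (auto simp: fixed_def)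
   thus ?thesis using nr[of k u] u False by auto
  qed (use one in auto)
  show "\<exists>v\<in>fixed S Y. v \<noteq> 0" using vf v(2) S_def by blast
 qed (use nd inv sub G(3) nrm_subgrp[OF G(1)] in \<open>auto simp: nondeg_def\<close>)
qed

end

lemma pow_inj_coprime:
 fixes x y :: "'a::group_mult"
 assumes "x ^ n = 1" "y ^ n = 1" "x ^ k = y ^ k" "coprime k n" shows "x = y"
proof (cases "k = 0")
 case True thus ?thesis using assms by simp
next
 case False
 from bezout_nat[OF False, of n] obtain a b where "k * a = n * b + 1"
  using assms(4) by (auto simp: coprime_iff_gcd_eq_1)
 hence "z = (z ^ k) ^ a" if "z ^ n = 1" for z :: 'a
  using that by (simp add: power_add power_mult flip: power_mult[of z k a])
 thus ?thesis using assms by metis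
qed

section \<open>Rationality under the passage to fixed spaces\<close>

context form_module begin

definition zs :: "'g set \<Rightarrow> 'v set \<Rightarrow> 'g set" where
 "zs K Y = {z \<in> K. (\<forall>v\<in>Y. z $ v = v) \<or> (\<forall>v\<in>Y. z $ v = - v)}"

definition sg :: "'v set \<Rightarrow> 'g \<Rightarrow> int" where
 "sg Y z = (if \<forall>v\<in>Y. z $ v = v then 1 else - 1)"

text \<open>Rationality phrased through class functions on which the scalars \<open>\<plusminus>1\<close> act by their sign; in this form it is
  inherited by the smaller pairs of the reduction.\<close>

definition ratl :: "'g set \<Rightarrow> 'v set \<Rightarrow> bool" where
 "ratl K Y \<longleftrightarrow> (\<forall>f :: 'g \<Rightarrow> int. (\<forall>g\<in>K. \<forall>x\<in>K. f (cj g x) = f x) \<and>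
   (\<forall>z\<in>zs K Y. \<forall>x\<in>K. f (z * x) = sg Y z * f x) \<longrightarrow>
   (\<forall>x\<in>K. \<forall>k. coprime k (card H) \<longrightarrow> f (x ^ k) = f x))"

lemma sg_eqs: assumes "good K Y"
 shows "\<forall>v\<in>Y. z $ v = v ==> sg Y z = 1" "\<forall>v\<in>Y. z $ v = - v ==> sg Y z = - 1"
proof -
 show "\<forall>v\<in>Y. z $ v = v ==> sg Y z = 1" by (simp add: sg_def)
 assume z: "\<forall>v\<in>Y. z $ v = - v"
 obtain v where v: "v \<in> Y" "v \<noteq> 0" using goodD(6)[OF assms] by blast
 hence "v \<noteq> - v" using good_eq_minus[OF assms] by metis
 hence "z $ v \<noteq> v" using z v(1) by simp
 thus "sg Y z = - 1" using v(1) by (auto simp: sg_def)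
qed

text \<open>A class function on \<open>K'\<close> is induced to \<open>K\<close>. Summing the result
  over \<open>D\<close> against the sign by which \<open>D\<close> acts on \<open>Y'\<close> kills
  all contributions from outside \<open>K'\<close> and returns a positive multiple of the original
  function, so the hypothesis on \<open>K\<close> can be applied to the products
  \<open>d * t\<close>.\<close>

lemma ratl_reduction:
 assumes g: "good K Y" and rat: "ratl K Y" and D: "normal_in D K" and v: "v \<in> Y" "v \<noteq> 0"
  and S: "S = cen D v" and K': "K' = nrm K S" and Y': "Y' = fixed S Y" and g': "good K' Y'"
  and DK': "D \<subseteq> K'" and neg: "\<And>d u. d \<in> D - S ==> u \<in> Y' ==> d $ u = - u" and vY': "v \<in> Y'"
 shows "ratl K' Y'"
 unfolding ratl_def
proof (intro allI impI ballI, elim conjE)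
 fix f :: "'g \<Rightarrow> int" and t k
 assume cl: "\<forall>g\<in>K'. \<forall>x\<in>K'. f (cj g x) = f x"
  and zf: "\<forall>z\<in>zs K' Y'. \<forall>x\<in>K'. f (z * x) = sg Y' z * f x"
  and t: "t \<in> K'" and k: "coprime k (card H)"
 note G = goodD[OF g]
 note G' = goodD[OF g']
 note SK = subgrpD[OF G(1)]
 note SK' = subgrpD[OF G'(1)]
 have DH: "D \<subseteq> H" "D \<subseteq> K" "subgrp D" "finite D" using normal_inH[OF D g] by auto
 note SD = subgrpD[OF DH(3)]
 have SsD: "S \<subseteq> D" by (auto simp: S cen_def)
 have K'K: "K' \<subseteq> K" by (auto simp: K' nrm_def)
 have YY: "Y' \<subseteq> Y" by (auto simp: Y' fixed_def)
 have tK: "t \<in> K" using t K'K by blast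
 \<comment> \<open>The linear character of \<open>D\<close> with kernel \<open>S\<close> by which
   \<open>D\<close> acts on \<open>Y'\<close>.\<close>
 define e where "e d = (if d \<in> S then 1 else - 1 :: int)" for d
 have pos: "d $ u = u" if "d \<in> S" "u \<in> Y'" for d u using that by (auto simp: Y' fixed_def)
 have Dzs: "d \<in> zs K' Y'" "sg Y' d = e d" if d: "d \<in> D" for d
 proof -
  show "d \<in> zs K' Y'" using d DK' pos neg unfolding zs_def by blast
  show "sg Y' d = e d"
   using sg_eqs[OF g', of d] d pos[of d] neg[of d] unfolding e_def by fastforce
 qed
 have emul: "e (d * d') = e d * e d'" if d: "d \<in> D" "d' \<in> D" for d d'
 proof -
  have nv: "v \<noteq> - v" using good_eq_minus[OF g v(1)] v(2) by auto
  have *: "d $ v = (if e d = 1 then v else - v)" if "d \<in> D" for d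
   using pos neg vY' that unfolding e_def by auto
  have ev: "e d = 1 \<longleftrightarrow> d $ v = v" if "d \<in> D" for d using *[OF that] nv by auto
  have e1: "e d = 1 \<or> e d = - 1" for d by (simp add: e_def)
  show ?thesis
   using ev[OF SD(2)[OF d]] *[OF d(1)] *[OF d(2)] e1[of d] e1[of d'] e1[of "d * d'"] nv
   by (auto simp: act_mult act_minus)
 qed
 have ecj: "e (cj h d) = e d" if "h \<in> K'" for h d
  using that by (simp add: e_def K' nrm_def)
 have zsK': "z \<in> K'" "cj h z \<in> zs K Y" "sg Y (cj h z) = sg Y z" "z \<in> zs K' Y'" "sg Y' z = sg Y z"
  if z: "z \<in> zs K Y" and h: "h \<in> K" for z h
 proof -
  have zK: "z \<in> K" using z by (simp add: zs_def)
  have hi: "inverse h $ w \<in> Y" if "w \<in> Y" for w using G(7) SK(3) h that by blast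
  consider "\<forall>v\<in>Y. z $ v = v" | "\<forall>v\<in>Y. z $ v = - v" using z by (auto simp: zs_def)
  thus "z \<in> K'"
  proof cases
   case 1
   hence "z $ v = v" using v by blast
   thus ?thesis using cen_cj[OF D G(1) zK, of _ v] zK by (simp add: K' nrm_def S)
  next
   case 2
   hence "z $ v = - v" using v by blast
   thus ?thesis using cen_cj[OF D G(1) zK, of _ v] zK cen_double(3)[OF g DH(2) v(1)]
    by (simp add: K' nrm_def S)
  qed
  have c1: "\<forall>v\<in>Y. cj h z $ v = v" if "\<forall>v\<in>Y. z $ v = v"
   using that hi by (simp add: cj_def act_mult)
  have c2: "\<forall>v\<in>Y. cj h z $ v = - v" if "\<forall>v\<in>Y. z $ v = - v"
   using that hi by (simp add: cj_def act_mult act_minus)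
  have "cj h z \<in> K" using SK h zK by blast
  thus "cj h z \<in> zs K Y" using z c1 c2 by (auto simp: zs_def)
  show "sg Y (cj h z) = sg Y z" using sg_eqs[OF g] c1 c2 z by (auto simp: zs_def)
  show "z \<in> zs K' Y'" "sg Y' z = sg Y z" using \<open>z \<in> K'\<close> z YY sg_eqs[OF g] sg_eqs[OF g']
   by (auto simp: zs_def subset_iff)
 qed
 \<comment> \<open>The induced class function, without the usual normalising factor.\<close>
 define F where "F x = (\<Sum>h\<in>K. if cj h x \<in> K' then f (cj h x) else 0)" for x
 have Fcl: "F (cj h x) = F x" if "h \<in> K" for h x
  unfolding F_def
  by (rule sum.reindex_bij_witness[where i = "\<lambda>y. y * inverse h" and j = "\<lambda>y. y * h"])
    (use that SK in \<open>auto simp: group_norm cj_cj\<close>)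
 have Fz: "F (z * x) = sg Y z * F x" if z: "z \<in> zs K Y" and x: "x \<in> K" for z x
  unfolding F_def sum_distrib_left
 proof (rule sum.cong[OF refl])
  fix h assume h: "h \<in> K"
  let ?z = "cj h z"
  have zz: "?z \<in> zs K Y" "sg Y ?z = sg Y z" using zsK'[OF z h] by auto
  have z1: "?z \<in> K'" "?z \<in> zs K' Y'" "sg Y' ?z = sg Y z" using zsK'[OF zz(1) h] zz by auto
  show "(if cj h (z * x) \<in> K' then f (cj h (z * x)) else 0) = sg Y z * (if cj h x \<in> K' then f (cj h x) else 0)"
   using zf z1 subgrp_mult_iff(1)[OF G'(1) z1(1)] by (auto simp: cj_mult)
 qed
 have Frat: "F (x ^ k) = F x" if "x \<in> K" for x
  using rat Fcl Fz that k unfolding ratl_def by blast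
 have key: "(\<Sum>d\<in>D. e d * F (d * t)) = int (card D) * (int (card K') * f t)" if t: "t \<in> K'" for t
 proof -
  have "(\<Sum>d\<in>D. e d * F (d * t)) =
    (\<Sum>d\<in>D. \<Sum>h\<in>K. e d * (if cj h (d * t) \<in> K' then f (cj h (d * t)) else 0))"
   by (simp add: F_def sum_distrib_left)
  also have "\<dots> = (\<Sum>d\<in>D. \<Sum>h\<in>K. (e d * e (cj h d)) * (if cj h t \<in> K' then f (cj h t) else 0))"
  proof (intro sum.cong refl)
   fix d h assume dh: "d \<in> D" "h \<in> K"
   hence c: "cj h d \<in> D" using D by (auto simp: normal_in_def)
   hence "cj h d * cj h t \<in> K' \<longleftrightarrow> cj h t \<in> K'"
    using subgrp_mult_iff(1)[OF G'(1)] DK' by blast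
   thus "e d * (if cj h (d * t) \<in> K' then f (cj h (d * t)) else 0) =
     e d * e (cj h d) * (if cj h t \<in> K' then f (cj h t) else 0)"
    using zf Dzs[OF c] by (auto simp: cj_mult)
  qed
  also have "\<dots> = (\<Sum>h\<in>K. (\<Sum>d\<in>D. e d * e (cj h d)) * (if cj h t \<in> K' then f (cj h t) else 0))"
   by (subst sum.swap) (simp add: sum_distrib_right)
  also have "\<dots> = (\<Sum>h\<in>K. if h \<in> K' then int (card D) * f t else 0)"
  proof (intro sum.cong refl)
   fix h assume h: "h \<in> K"
   show "(\<Sum>d\<in>D. e d * e (cj h d)) * (if cj h t \<in> K' then f (cj h t) else 0) =
     (if h \<in> K' then int (card D) * f t else 0)"
   proof (cases "h \<in> K'")
    case True
    have "e d * e (cj h d) = 1" for d unfolding ecj[OF True] by (simp add: e_def)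
    thus ?thesis using True cl t SK'(4) by simp
   next
    case False
    \<comment> \<open>Outside \<open>K'\<close>, conjugation by \<open>h\<close> moves the kernel
      \<open>S\<close>, so \<open>e\<close> and its conjugate are different characters and hence
      orthogonal: their product is -1 at \<open>x\<close>, and translating the sum by
      \<open>x\<close> changes its sign.\<close>
    then obtain x where x: "(cj h x \<in> S) \<noteq> (x \<in> S)" using h by (auto simp: K' nrm_def)
    hence xD: "x \<in> D" using SsD normal_cj_iff[OF D G(1) h, of x] by blast
    have hD: "cj h d \<in> D" if "d \<in> D" for d using normal_cj_iff[OF D G(1) h] that by blast
    have m1: "e x * e (cj h x) = - 1" using x by (auto simp: e_def)
    have "(\<Sum>d\<in>D. e d * e (cj h d)) = (\<Sum>d\<in>D. e (x * d) * e (cj h (x * d)))"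
     by (rule sum.reindex_bij_witness[where i = "\<lambda>d. x * d" and j = "\<lambda>d. inverse x * d"])
       (use SD xD in \<open>auto simp: group_norm\<close>)
    also have "\<dots> = (\<Sum>d\<in>D. (e x * e (cj h x)) * (e d * e (cj h d)))"
     by (intro sum.cong refl) (simp add: emul xD hD cj_mult)
    also have "\<dots> = - (\<Sum>d\<in>D. e d * e (cj h d))"
     unfolding m1 by (simp add: sum_negf)
    finally show ?thesis using False by simp
   qed
  qed
  also have "\<dots> = (\<Sum>h\<in>K'. int (card D) * f t)"
   using K'K G(2) by (simp add: sum.inter_restrict[symmetric] Int_absorb1)
  finally show ?thesis by simp
 qed
 have "(\<Sum>d\<in>D. e d * F (d * t)) = (\<Sum>d\<in>D. e d * F (d * t ^ k))"
 proof -
  \<comment> \<open>Taking \<open>k\<close>-th powers carries the coset of \<open>t\<close> modulo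
    \<open>D\<close> bijectively onto that of \<open>t ^ k\<close>; \<open>\<pi>\<close> is the
    resulting permutation of \<open>D\<close>. It preserves \<open>e\<close> because
    \<open>k\<close> is odd as soon as \<open>e\<close> takes the value -1.\<close>
  define \<pi> where "\<pi> d = (d * t) ^ k * inverse (t ^ k)" for d
  have dn: "(d * t) ^ n * inverse (t ^ n) \<in> D \<and> e ((d * t) ^ n * inverse (t ^ n)) = e d ^ n"
   if d: "d \<in> D" for d n
  proof (induction n)
   case 0
   have "e 1 = 1" using subgrpD(1)[OF cen_subgrp[OF DH(3)]] by (simp add: e_def S)
   thus ?case using SD by simp
  next
   case (Suc n)
   let ?x = "(d * t) ^ n * inverse (t ^ n)"
   have c: "cj (t ^ n) d \<in> D" using D d tK SK(6) by (auto simp: normal_in_def)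
   have "(d * t) ^ Suc n * inverse (t ^ Suc n) = ?x * cj (t ^ n) d"
    by (simp only: power_Suc2[of "d * t"] power_Suc2[of t] cj_def group_norm)
   moreover have "e (cj (t ^ n) d) = e d" by (rule ecj) (rule SK'(6)[OF t])
   ultimately show ?case using emul[of ?x "cj (t ^ n) d"] Suc c SD by simp
  qed
  have ed: "e d ^ k = e d" if d: "d \<in> D" for d
  proof (cases "e d = 1")
   case False
   hence m1: "e d = - 1" by (auto simp: e_def split: if_splits)
   have e1: "e 1 = 1" using subgrpD(1)[OF cen_subgrp[OF DH(3)]] by (simp add: e_def S)
   have "e (d ^ n) = e d ^ n" for n
   proof (induction n)
    case (Suc n)
    thus ?case using emul[OF d SD(6)[OF d], of n] by simp
   qed (simp add: e1)
   hence "e d ^ card D = 1"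
    using pow_card[OF DH(3,4) d] e1 by metis
   hence "even (card D)" using m1 by (simp add: minus_one_power_iff split: if_splits)
   hence "even (card H)" using card_subgrp_dvd[OF H(1) DH(3,1) H(2)] dvd_trans by blast
   hence "odd k" using k by (metis coprime_common_divisor_nat odd_one dvd_refl even_numeral numeral_One coprime_def nat_dvd_1_iff_1)
   thus ?thesis using m1 by simp
  qed simp
  have inj: "inj_on \<pi> D"
  proof (rule inj_onI)
   fix x y assume xy: "x \<in> D" "y \<in> D" "\<pi> x = \<pi> y"
   have "x * t \<in> H" "y * t \<in> H" using xy DH(1) tK G(3) subgrpD(2)[OF H(1)] by auto
   moreover have "(x * t) ^ k = (y * t) ^ k" using xy(3) by (simp add: \<pi>_def)
   ultimately have "x * t = y * t" using pow_inj_coprime[OF pow_card[OF H] pow_card[OF H] _ k] by blast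
   thus "x = y" by simp
  qed
  have im: "\<pi> ` D = D"
   by (rule endo_inj_surj[OF DH(4) _ inj]) (use dn in \<open>auto simp: \<pi>_def\<close>)
  have "(\<Sum>d\<in>D. e d * F (d * t ^ k)) = (\<Sum>d\<in>D. e (\<pi> d) * F (\<pi> d * t ^ k))"
   using sum.reindex[OF inj, of "\<lambda>d. e d * F (d * t ^ k)"] im by (simp add: comp_def)
  also have "\<dots> = (\<Sum>d\<in>D. e d * F (d * t))"
  proof (rule sum.cong[OF refl])
   fix d assume d: "d \<in> D"
   have "\<pi> d * t ^ k = (d * t) ^ k" by (simp add: \<pi>_def group_norm)
   moreover have "F ((d * t) ^ k) = F (d * t)" by (rule Frat) (use d DH(2) tK SK in blast)
   moreover have "e (\<pi> d) = e d" using dn[OF d, of k] ed[OF d] by (simp add: \<pi>_def)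
   ultimately show "e (\<pi> d) * F (\<pi> d * t ^ k) = e d * F (d * t)" by simp
  qed
  finally show ?thesis by simp
 qed
 hence "int (card D) * (int (card K') * f t) = int (card D) * (int (card K') * f (t ^ k))"
  unfolding key[OF t] key[OF SK'(6)[OF t]] .
 thus "f (t ^ k) = f t"
  using card_subgrp_pos[OF DH(3,4)] card_subgrp_pos[OF G'(1,2)] by simp
qed

definition primitive :: "'g set \<Rightarrow> 'v set \<Rightarrow> bool" where
 "primitive K Y \<longleftrightarrow> (\<forall>D. normal_in D K \<longrightarrow>
   (\<forall>c\<in>D. \<forall>d\<in>D. \<forall>v\<in>Y. c $ d $ v = d $ c $ v) \<longrightarrow> D \<subseteq> zs K Y)"

text \<open>Induction on the size of \<open>Y\<close>. A nonscalar abelian normal \<open>D\<close>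
  acts with exponent 2; on the fixed space of a maximal centraliser in \<open>D\<close> the whole of
  \<open>D\<close> acts by signs, so this space is smaller than \<open>Y\<close>.\<close>

theorem primitive_pair_exists:
 assumes "good K Y" "ratl K Y"
 shows "\<exists>K' Y'. K' \<subseteq> K \<and> good K' Y' \<and> ratl K' Y' \<and> primitive K' Y'"
 using assms
proof (induction "card Y" arbitrary: K Y rule: less_induct)
 case less
 note g = less.prems(1)
 note G = goodD[OF g]
 show ?case
 proof (cases "primitive K Y")
  case True thus ?thesis using less.prems by blast
 next
  case False
  then obtain D where D: "normal_in D K" and com: "\<And>c d v. c \<in> D ==> d \<in> D ==> v \<in> Y ==> c $ d $ v = d $ c $ v"
    and nz: "\<not> D \<subseteq> zs K Y" unfolding primitive_def by blast
  have DH: "D \<subseteq> H" "D \<subseteq> K" "subgrp D" "finite D" using normal_inH[OF D g] by auto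
  have inv: "d $ d $ v = v" if "d \<in> D" "v \<in> Y" for d v
   using abelian_normal_involution[OF g D com] that by blast
  obtain v where v: "v \<in> Y" "v \<noteq> 0" and max: "\<And>u. u \<in> Y ==> u \<noteq> 0 ==> card (cen D u) \<le> card (cen D v)"
   using max_centralizer_exists[OF g DH(2)] by blast
  define S where "S = cen D v"
  define K' Y' where "K' = nrm K S" and "Y' = fixed S Y"
  note R = fixed_reduction[OF g D v max, folded S_def, folded K'_def Y'_def]
  have SD: "S \<subseteq> D" by (auto simp: S_def cen_def)
  have dY: "d $ u \<in> Y'" if "d \<in> D" "u \<in> Y'" for d u
  proof -
   have uY: "u \<in> Y" "\<And>s. s \<in> S ==> s $ u = u" using that by (auto simp: Y'_def fixed_def)
   have "s $ d $ u = d $ u" if s: "s \<in> S" for s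
    using com[of s d u] uY s SD \<open>d \<in> D\<close> by auto
   thus ?thesis using G(7) DH(2) uY that by (auto simp: Y'_def fixed_def)
  qed
  \<comment> \<open>The vector \<open>u + d $ u\<close> is fixed by \<open>d\<close>. If it were
    nonzero, its centraliser would be \<open>S\<close>, and \<open>d\<close> would lie in
    it.\<close>
  have neg: "d $ u = - u" if d: "d \<in> D - S" and u: "u \<in> Y'" for d u
  proof (rule ccontr)
   assume n: "d $ u \<noteq> - u"
   have uY: "u \<in> Y" using u by (simp add: Y'_def fixed_def)
   have w: "u + d $ u \<in> Y'"
    using adsubD(2)[OF goodD(4)[OF R(1)]] u dY d by blast
   moreover have "u + d $ u \<noteq> 0" using n by (metis add_eq_0_iff)
   ultimately have "cen D (u + d $ u) = S" using R(2) by blast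
   moreover have "d $ (u + d $ u) = u + d $ u" using inv[of d u] d uY by (simp add: act_add add.commute)
   ultimately show False using d by (auto simp: cen_def)
  qed
  have DK': "D \<subseteq> K'"
  proof
   fix d assume d: "d \<in> D"
   show "d \<in> K'"
   proof (cases "d \<in> S")
    case True
    hence "d $ v = v" by (simp add: S_def cen_def)
    thus ?thesis using R(4)[of d v] R(3) d DH(2) v by auto
   next
    case False
    hence "d $ v = - v" using neg R(3) d by blast
    thus ?thesis using R(4)[of d v] R(3) d DH(2) v by auto
   qed
  qed
  have rat': "ratl K' Y'"
   by (rule ratl_reduction[OF g less.prems(2) D v S_def K'_def Y'_def R(1) DK' neg R(3)])
  have "Y' \<noteq> Y"
  proof
   assume eq: "Y' = Y"
   have "D \<subseteq> zs K Y"
   proof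
    fix d assume d: "d \<in> D"
    show "d \<in> zs K Y"
     using neg[of d] d DH(2) eq by (cases "d \<in> S") (auto simp: zs_def Y'_def fixed_def)
   qed
   thus False using nz by blast
  qed
  hence "card Y' < card Y"
   using finite_subset[of Y V] V(2) G(5) by (intro psubset_card_mono) (auto simp: Y'_def fixed_def)
  from less.hyps[OF this R(1) rat'] show ?thesis by (auto simp: K'_def nrm_def)
 qed
qed

end

section \<open>Solvable groups\<close>

definition der :: "'a::group_mult set \<Rightarrow> 'a set" where
 "der K = \<Inter> {L. subgrp L \<and> (\<forall>x\<in>K. \<forall>y\<in>K. cmt x y \<in> L)}"

definition solv :: "'a::group_mult set \<Rightarrow> bool" where "solv K \<longleftrightarrow> (\<exists>n. (der ^^ n) K \<subseteq> {1})"

lemma der_subgrp: "subgrp (der K)" unfolding der_def subgrp_def by auto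

lemma cmt_der: "x \<in> K ==> y \<in> K ==> cmt x y \<in> der K" unfolding der_def by auto

lemma der_least: "subgrp L ==> (\<And>x y. x \<in> K ==> y \<in> K ==> cmt x y \<in> L) ==> der K \<subseteq> L"
 unfolding der_def by blast

lemma der_mono: "A \<subseteq> B ==> der A \<subseteq> der B" unfolding der_def by blast

lemma der_pow_mono: "A \<subseteq> B ==> (der ^^ n) A \<subseteq> (der ^^ n) B"
 by (induction n) (auto intro: der_mono[THEN subsetD])

lemma solv_subset: "solv B ==> A \<subseteq> B ==> solv A"
 unfolding solv_def using der_pow_mono by (metis subset_trans)

lemma der_normal: assumes "normal_in N K" "subgrp K" shows "normal_in (der N) K"
proof -
 have N: "subgrp N" "N \<subseteq> K" using assms by (auto simp: normal_in_def)
 have "der N \<subseteq> N" by (rule der_least[OF N(1)]) (rule subgrpD(5)[OF N(1)])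
 moreover have "cj g n \<in> der N" if g: "g \<in> K" and n: "n \<in> der N" for g n
 proof -
  have "subgrp {x. cj g x \<in> der N}"
   using subgrpD[OF der_subgrp[of N]] by (auto simp: subgrp_def cj_mult cj_inverse)
  moreover have "cmt x y \<in> {x. cj g x \<in> der N}" if "x \<in> N" "y \<in> N" for x y
   using that assms(1) g cmt_der[of "cj g x" N "cj g y"] by (auto simp: cj_cmt normal_in_def)
  ultimately have "der N \<subseteq> {x. cj g x \<in> der N}" by (rule der_least)
  thus ?thesis using n by blast
 qed
 ultimately show ?thesis using der_subgrp N by (auto simp: normal_in_def)
qed

text \<open>\<open>E\<close> is the last derived subgroup of \<open>N\<close> that is not contained
  in \<open>Z\<close>. Here \<open>Z\<close> is any set containing 1, so scalars, central pairs and
  normal subgroups can all take its place.\<close>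

lemma solv_normal_section:
 assumes "subgrp K" "normal_in N K" "solv N" "1 \<in> Z" "\<not> N \<subseteq> Z"
 shows "\<exists>E. normal_in E K \<and> E \<subseteq> N \<and> \<not> E \<subseteq> Z \<and> (\<forall>x\<in>E. \<forall>y\<in>E. cmt x y \<in> Z)"
proof -
 define n where "n = (LEAST n. (der ^^ n) N \<subseteq> Z)"
 obtain m where "(der ^^ m) N \<subseteq> {1}" using assms(3) by (auto simp: solv_def)
 hence "(der ^^ m) N \<subseteq> Z" using assms(4) by auto
 hence n: "(der ^^ n) N \<subseteq> Z" unfolding n_def by (rule LeastI)
 hence "n \<noteq> 0" using assms(5) by (metis funpow_0)
 then obtain k where k: "n = Suc k" by (cases n) auto
 have nk: "\<not> (der ^^ k) N \<subseteq> Z"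
  using not_less_Least[of k "\<lambda>n. (der ^^ n) N \<subseteq> Z"] k unfolding n_def by auto
 have norm: "normal_in ((der ^^ j) N) K" for j
  by (induction j) (auto intro: der_normal assms)
 have sub: "(der ^^ j) N \<subseteq> N" for j
 proof (induction j)
  case (Suc j)
  have "der ((der ^^ j) N) \<subseteq> (der ^^ j) N"
   using norm[of j] by (intro der_least subgrpD(5)) (auto simp: normal_in_def)
  thus ?case using Suc by simp
 qed simp
 have "cmt x y \<in> Z" if "x \<in> (der ^^ k) N" "y \<in> (der ^^ k) N" for x y
  using cmt_der[OF that] n k by auto
 thus ?thesis using norm sub nk by blast
qed

section \<open>Primitive pairs\<close>

locale prim_pair = form_module act H V p B
 for act :: "'g::group_mult \<Rightarrow> 'v::ab_group_add \<Rightarrow> 'v" (infixr "$" 75) and H V p B +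
 fixes K :: "'g set" and Y :: "'v set" and E :: "'g set"
 assumes KY: "good K Y" "primitive K Y"
  and E: "normal_in E K" "\<not> E \<subseteq> zs K Y" "\<And>x y. x \<in> E ==> y \<in> E ==> cmt x y \<in> zs K Y"
begin

lemmas KD = goodD[OF KY(1)]
lemmas SK = subgrpD[OF KD(1)]

lemma EH: "E \<subseteq> H" "E \<subseteq> K" "subgrp E" "finite E" using normal_inH[OF E(1) KY(1)] by auto
lemmas SE = subgrpD[OF EH(3)]

lemma Y_closed [simp, intro]: "0 \<in> Y" "u \<in> Y ==> v \<in> Y ==> u + v \<in> Y" "u \<in> Y ==> - u \<in> Y"
 "u \<in> Y ==> v \<in> Y ==> u - v \<in> Y" "h \<in> K ==> v \<in> Y ==> h $ v \<in> Y" "h \<in> E ==> v \<in> Y ==> h $ v \<in> Y"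
 "v \<in> Y ==> v \<in> V"
 by (fact adsubD[OF KD(4)] KD(5,7) KD(7)[OF subsetD[OF EH(2)]])+

lemma E_K [simp, intro]: "e \<in> E ==> e \<in> K" "e \<in> E ==> e \<in> H" "k \<in> K ==> k \<in> H" using EH KD(3) by auto

lemma not_minus: "v \<in> Y ==> v = - v ==> v = 0" by (rule good_eq_minus[OF KY(1)])

text \<open>These relations hold between operators on \<open>Y\<close> and not between group
  elements: \<open>K\<close> may act with a kernel, and the operator -1 is not tied to a chosen
  group element.\<close>

definition com :: "'g \<Rightarrow> 'g \<Rightarrow> bool" where "com x y \<longleftrightarrow> (\<forall>v\<in>Y. x $ y $ v = y $ x $ v)"
definition anti :: "'g \<Rightarrow> 'g \<Rightarrow> bool" where "anti x y \<longleftrightarrow> (\<forall>v\<in>Y. x $ y $ v = - (y $ x $ v))"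
definition sqp :: "'g \<Rightarrow> bool" where "sqp x \<longleftrightarrow> (\<forall>v\<in>Y. x $ x $ v = v)"
definition sqm :: "'g \<Rightarrow> bool" where "sqm x \<longleftrightarrow> (\<forall>v\<in>Y. x $ x $ v = - v)"

lemma com_sym: "com x y ==> com y x" by (simp add: com_def)
lemma anti_sym: "anti x y ==> anti y x" by (simp add: anti_def)

lemma com_or_anti: assumes "x \<in> E" "y \<in> E" shows "com x y \<or> anti x y"
proof -
 have "x * y = cmt x y * (y * x)" by (rule cmt_swap)
 hence e: "x $ y $ v = cmt x y $ y $ x $ v" for v by (metis act_mult)
 have "(\<forall>v\<in>Y. cmt x y $ v = v) \<or> (\<forall>v\<in>Y. cmt x y $ v = - v)" using E(3)[OF assms] by (auto simp: zs_def)
 thus ?thesis using e assms by (auto simp: com_def anti_def)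
qed

lemma Y_ex: "\<exists>v\<in>Y. v \<noteq> 0 \<and> v \<noteq> - v" using KD(6) not_minus by blast

lemma not_com_anti: assumes "x \<in> K" "y \<in> K" shows "\<not> (com x y \<and> anti x y)"
proof
 assume a: "com x y \<and> anti x y"
 obtain v where v: "v \<in> Y" "v \<noteq> 0" using Y_ex by blast
 hence "x $ y $ v = - (x $ y $ v)" using a unfolding com_def anti_def by (metis)
 hence "x $ y $ v = 0" using not_minus v assms by blast
 thus False using v by simp
qed

lemma com_mult: assumes "com x y" "com x z" "x \<in> K" "y \<in> K" "z \<in> K" shows "com x (y * z)"
 using assms by (auto simp: com_def act_mult)
lemma anti_mult1: assumes "anti x y" "com x z" "x \<in> K" "y \<in> K" "z \<in> K" shows "anti x (y * z)" "anti x (z * y)"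
 using assms by (auto simp: com_def anti_def act_mult act_minus)
lemma anti_mult2: assumes "anti x y" "anti x z" "x \<in> K" "y \<in> K" "z \<in> K" shows "com x (y * z)"
 using assms by (auto simp: com_def anti_def act_mult act_minus)

lemma com_mult_left: assumes "com x z" "com y z" "x \<in> K" "y \<in> K" "z \<in> K" shows "com (x * y) z"
 using com_mult[of z x y] assms com_sym by blast

lemma com_inverse: assumes "com e s" "e \<in> K" shows "com (inverse e) s"
proof -
 have "inverse e $ e $ s $ inverse e $ v = inverse e $ s $ e $ inverse e $ v" if "v \<in> Y" for v
  using assms that SK(3) unfolding com_def by (metis Y_closed(5))
 thus ?thesis by (simp add: com_def)
qed

lemma commutant_subgrp: assumes "subgrp P" "P \<subseteq> K" "A \<subseteq> K" shows "subgrp {e \<in> P. \<forall>s\<in>A. com e s}"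
 unfolding subgrp_def
proof (intro conjI ballI)
 let ?C = "{e \<in> P. \<forall>s\<in>A. com e s}"
 show "1 \<in> ?C" using subgrpD[OF assms(1)] by (simp add: com_def)
 fix e f assume e: "e \<in> ?C" and f: "f \<in> ?C"
 have "com (e * f) s" "com (inverse e) s" if "s \<in> A" for s
  using com_mult_left[of e s f] com_inverse[of e s] e f that assms(2,3) by auto
 thus "e * f \<in> ?C" "inverse e \<in> ?C" using e f subgrpD(2,3)[OF assms(1)] by blast+
qed

lemma conj_relations:
 assumes "k \<in> K"
 shows com_cj: "com x y ==> com (cj k x) (cj k y)" and anti_cj: "anti x y ==> anti (cj k x) (cj k y)"
  and sqp_cj: "sqp x ==> sqp (cj k x)" and sqm_cj: "sqm x ==> sqm (cj k x)"
proof -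
 have w: "inverse k $ v \<in> Y" if "v \<in> Y" for v using that assms SK(3) by blast
 show "com x y ==> com (cj k x) (cj k y)"
  unfolding com_def cj_def act_mult act_inverse by (intro ballI arg_cong[of _ _ "($) k"]) (use w in blast)
 show "anti x y ==> anti (cj k x) (cj k y)" "sqp x ==> sqp (cj k x)" "sqm x ==> sqm (cj k x)"
  using w by (simp_all add: anti_def sqp_def sqm_def cj_def act_mult act_minus)
qed

lemma com_cj_left: "com x (cj (inverse k) y) ==> k \<in> K ==> com (cj k x) y"
 using com_cj[of k x "cj (inverse k) y"] by simp

text \<open>The elements of \<open>E\<close> that commute with all of \<open>E\<close> on
  \<open>Y\<close> form a normal subgroup of \<open>K\<close> acting commutatively, which is scalar
  by primitivity. Together with scalar commutators this makes \<open>E\<close> act like an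
  extraspecial 2-group.\<close>

lemma central_zs: assumes "x \<in> E" "\<And>y. y \<in> E ==> com x y" shows "x \<in> zs K Y"
proof -
 define D where "D = {d \<in> E. \<forall>y\<in>E. com d y}"
 have "subgrp D" unfolding D_def by (rule commutant_subgrp[OF EH(3,2,2)])
 moreover have "cj g d \<in> D" if "g \<in> K" "d \<in> D" for g d
  using that E(1) SK(3)[OF that(1)] com_cj_left[OF _ that(1), of d] by (simp add: D_def normal_in_def)
 ultimately have "normal_in D K" using EH(2) by (auto simp: normal_in_def D_def)
 moreover have "\<forall>c\<in>D. \<forall>d\<in>D. \<forall>v\<in>Y. c $ d $ v = d $ c $ v" unfolding D_def com_def by blast
 ultimately have "D \<subseteq> zs K Y" using KY(2) unfolding primitive_def by blast
 thus ?thesis using assms by (auto simp: D_def)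
qed

text \<open>Whether \<open>x\<close> commutes or anticommutes with \<open>y\<close>, its square
  commutes with \<open>y\<close>.\<close>

lemma sq_cases: assumes "x \<in> E" shows "sqp x \<or> sqm x"
proof -
 have "com (x * x) y" if "y \<in> E" for y
  using com_or_anti[OF assms that] com_mult[of y x x] anti_mult2[of y x x] assms that com_sym anti_sym by blast
 hence "x * x \<in> zs K Y" using central_zs SE assms by blast
 thus ?thesis by (auto simp: zs_def sqp_def sqm_def act_mult)
qed

lemma not_sqp_sqm: assumes "x \<in> K" shows "\<not> (sqp x \<and> sqm x)"
proof
 assume a: "sqp x \<and> sqm x"
 obtain v where v: "v \<in> Y" "v \<noteq> - v" using Y_ex by blast
 thus False using a unfolding sqp_def sqm_def by metis
qed

lemma anti_exists: assumes "x \<in> E" "x \<notin> zs K Y" shows "\<exists>y\<in>E. anti x y"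
 using central_zs assms com_or_anti by blast

lemma sqp_mult: assumes "x \<in> E" "y \<in> E"
 shows "com x y ==> sqp x ==> sqp y ==> sqp (x * y)"
  "com x y ==> sqm x ==> sqm y ==> sqp (x * y)"
  "com x y ==> sqp x ==> sqm y ==> sqm (x * y)"
  "anti x y ==> sqp x ==> sqp y ==> sqm (x * y)"
  "anti x y ==> sqm x ==> sqp y ==> sqp (x * y)"
  "anti x y ==> sqm x ==> sqm y ==> sqm (x * y)"
proof -
 have c: "(x * y) $ (x * y) $ v = x $ x $ y $ y $ v" if "com x y" "v \<in> Y" for v
  using that assms unfolding com_def by (simp add: act_mult)
 have a: "(x * y) $ (x * y) $ v = - (x $ x $ y $ y $ v)" if "anti x y" "v \<in> Y" for v
 proof -
  have "y $ x $ y $ v = - (x $ y $ y $ v)" using that assms unfolding anti_def by simp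
  thus ?thesis by (simp add: act_mult act_minus)
 qed
 show "com x y ==> sqp x ==> sqp y ==> sqp (x * y)"
  "com x y ==> sqm x ==> sqm y ==> sqp (x * y)"
  "com x y ==> sqp x ==> sqm y ==> sqm (x * y)"
  using c assms by (simp_all add: sqp_def sqm_def act_minus)
 show "anti x y ==> sqp x ==> sqp y ==> sqm (x * y)"
  "anti x y ==> sqm x ==> sqp y ==> sqp (x * y)"
  "anti x y ==> sqm x ==> sqm y ==> sqm (x * y)"
  using a assms by (simp_all add: sqp_def sqm_def act_minus)
qed

end

section \<open>Vectors with maximal centraliser in \<open>E\<close>\<close>

locale prim_max = prim_pair act H V p B K Y E
 for act :: "'g::group_mult \<Rightarrow> 'v::ab_group_add \<Rightarrow> 'v" (infixr "$" 75) and H V p B K Y E +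
 fixes v\<^sub>0 :: 'v
 assumes v0: "v\<^sub>0 \<in> Y" "v\<^sub>0 \<noteq> 0" and v0_max: "\<And>u. u \<in> Y ==> u \<noteq> 0 ==> card (cen E u) \<le> card (cen E v\<^sub>0)"
begin

definition S :: "'g set" where "S = cen E v\<^sub>0"
definition Yp :: "'v set" where "Yp = fixed S Y"
definition Kp :: "'g set" where "Kp = nrm K S"
definition ES :: "'g set" where "ES = {e \<in> E. \<forall>s\<in>S. com e s}"

lemma R: "good Kp Yp" "u \<in> Yp ==> u \<noteq> 0 ==> cen E u = S" "v\<^sub>0 \<in> Yp"
  "k \<in> K ==> u \<in> Yp ==> u \<noteq> 0 ==> k $ u \<in> {u, u + u, u + u + u, - u} ==> k \<in> Kp"
 unfolding Kp_def Yp_def S_def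
 using fixed_reduction[OF KY(1) E(1) v0] v0_max by blast+

lemmas GP = goodD[OF R(1)]

lemma S_E: "s \<in> S ==> s \<in> E" "subgrp S" using cen_subgrp[OF EH(3)] by (auto simp: S_def cen_def)
lemma Yp_Y: "u \<in> Yp ==> u \<in> Y" "u \<in> Yp ==> s \<in> S ==> s $ u = u" by (auto simp: Yp_def fixed_def)
lemma Kp_K: "k \<in> Kp ==> k \<in> K" by (auto simp: Kp_def nrm_def)
lemma ES_E: "e \<in> ES ==> e \<in> E" by (simp add: ES_def)

lemma ES_Yp: assumes "e \<in> ES" "u \<in> Yp" shows "e $ u \<in> Yp"
proof -
 have "s $ e $ u = e $ u" if "s \<in> S" for s
 proof -
  have "s $ e $ u = e $ s $ u" using assms that Yp_Y(1) by (simp add: ES_def com_def)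
  thus ?thesis using Yp_Y(2) assms(2) that by simp
 qed
 thus ?thesis using Y_closed(6)[OF ES_E[OF assms(1)] Yp_Y(1)[OF assms(2)]]
  by (auto simp: Yp_def fixed_def)
qed

lemma ES_subgrp: "subgrp ES"
 unfolding ES_def by (rule commutant_subgrp[OF EH(3,2)]) (use S_E(1) in auto)

lemma ES_cj: assumes "k \<in> Kp" "e \<in> ES" shows "cj k e \<in> ES"
proof -
 have kK: "k \<in> K" and kS: "\<And>x. cj k x \<in> S \<longleftrightarrow> x \<in> S" using assms(1) by (auto simp: Kp_def nrm_def)
 have "com (cj k e) s" if "s \<in> S" for s
  by (rule com_cj_left[OF _ kK]) (use assms(2) that kS[of "cj (inverse k) s"] in \<open>simp add: ES_def\<close>)
 thus ?thesis using E(1) kK ES_E[OF assms(2)] by (auto simp: ES_def normal_in_def)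
qed

definition onYp :: "'g \<Rightarrow> 'g \<Rightarrow> bool" where
 "onYp e q \<longleftrightarrow> (\<forall>u\<in>Yp. e $ u = q $ u) \<or> (\<forall>u\<in>Yp. e $ u = - (q $ u))"

lemma onYp_sq: assumes "e \<in> ES" "onYp e 1" shows "sqp e"
proof -
 have "e $ e $ v\<^sub>0 = v\<^sub>0" using assms(2) R(3) ES_Yp[OF assms(1) R(3)] by (auto simp: onYp_def act_minus)
 hence "\<not> sqm e" using v0 not_minus unfolding sqm_def by metis
 thus ?thesis using sq_cases ES_E assms(1) by blast
qed

text \<open>If \<open>e\<close> has square 1 and is not -1 at some \<open>u\<close> of
  \<open>Yp\<close>, then \<open>u + e $ u\<close> is a nonzero vector fixed by \<open>e\<close>,
  and maximality puts \<open>e\<close> into \<open>S\<close>. So the only involutions on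
  \<open>Yp\<close> are signs.\<close>

lemma ES_cases: assumes "e \<in> ES" shows "onYp e 1 \<or> sqm e"
proof (rule ccontr)
 assume n: "\<not> (onYp e 1 \<or> sqm e)"
 hence sq: "sqp e" using sq_cases ES_E[OF assms] by blast
 obtain u where u: "u \<in> Yp" "e $ u \<noteq> - u" using n by (auto simp: onYp_def)
 have w: "u + e $ u \<in> Yp" using adsubD(2)[OF GP(4)] u ES_Yp[OF assms] by blast
 moreover have "u + e $ u \<noteq> 0" using u(2) by (metis add_eq_0_iff)
 ultimately have "cen E (u + e $ u) = S" using R(2) by blast
 moreover have "e $ (u + e $ u) = u + e $ u" using sq u Yp_Y by (auto simp: sqp_def act_add add.commute)
 ultimately have "e \<in> S" using ES_E[OF assms] by (auto simp: cen_def)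
 thus False using n Yp_Y by (auto simp: onYp_def)
qed

end

context prim_pair begin

lemma sqp_alternating: assumes "e \<in> E" "sqp e" "v \<in> Y" shows "B (e $ v) v \<simeq> 0"
 using involution_imp_alternating[of e v] assms by (auto simp: sqp_def)

lemma B_minus_sq: assumes "u \<in> V" "w \<in> V" shows "(B (- u) w)\<^sup>2 \<simeq> (B u w)\<^sup>2"
 using zeq_pow[OF B_minus1[OF assms], of 2] by simp

end

context prim_max begin

lemma S_com: assumes "s \<in> S" "s' \<in> S" shows "com s s'"
proof (rule ccontr)
 assume "\<not> com s s'"
 hence "anti s s'" using com_or_anti S_E assms by blast
 hence "s $ s' $ v\<^sub>0 = - (s' $ s $ v\<^sub>0)" using v0 by (auto simp: anti_def)
 thus False using assms v0 not_minus by (auto simp: S_def cen_def)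
qed

lemma S_sqp: assumes "s \<in> S" shows "sqp s"
proof -
 have "s $ s $ v\<^sub>0 = v\<^sub>0" using assms by (simp add: S_def cen_def)
 hence "\<not> sqm s" using v0 not_minus unfolding sqm_def by metis
 thus ?thesis using sq_cases S_E assms by blast
qed

text \<open>An element of \<open>S\<close> fixes \<open>v\<^sub>0\<close>, so when it acts
  nontrivially it is not scalar and anticommutes with some \<open>a\<close>. If \<open>a\<close> has
  square -1, then \<open>a * x\<close> has square 1 and still anticommutes with
  \<open>x\<close>.\<close>

lemma config_exists:
 assumes "\<not> (\<forall>s\<in>S. \<forall>v\<in>Y. s $ v = v)"
 shows "\<exists>x\<in>S. \<exists>a\<in>E. anti x a \<and> sqp a"
proof -
 obtain x v where x: "x \<in> S" "v \<in> Y" "x $ v \<noteq> v" using assms by blast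
 have "x $ v\<^sub>0 \<noteq> - v\<^sub>0" using x(1) v0 not_minus by (auto simp: S_def cen_def)
 hence "x \<notin> zs K Y" using x(2,3) v0(1) unfolding zs_def by blast
 then obtain a where a: "a \<in> E" "anti x a" using anti_exists S_E x(1) by blast
 show ?thesis
 proof (cases "sqp a")
  case False
  hence "sqp (a * x)" using sqp_mult(5)[of a x] sq_cases a anti_sym S_sqp S_E x(1) by blast
  moreover have "anti x (a * x)" by (rule anti_mult1(1)) (use a x S_E in \<open>auto simp: com_def\<close>)
  ultimately show ?thesis using a x SE(2) S_E(1) by blast
 qed (use a x in blast)
qed

end

section \<open>The dihedral case: two anticommuting involutions\<close>

locale prim_conf = prim_max act H V p B K Y E v\<^sub>0
 for act :: "'g::group_mult \<Rightarrow> 'v::ab_group_add \<Rightarrow> 'v" (infixr "$" 75) and H V p B K Y E v\<^sub>0 +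
 fixes x a :: 'g
 assumes xa: "x \<in> S" "a \<in> E" "anti x a" "sqp a"
begin

text \<open>\<open>S1\<close> has index 2 in \<open>S\<close>, and its fixed space \<open>Y1\<close>
  is the sum of \<open>Yp\<close> and the image of \<open>Yp\<close> under \<open>a\<close>, the
  eigenspaces of \<open>x\<close> for 1 and -1.\<close>

definition S1 :: "'g set" where "S1 = {s \<in> S. com s a}"
definition Y1 :: "'v set" where "Y1 = fixed S1 Y"
definition E1 :: "'g set" where "E1 = {e \<in> E. \<forall>s\<in>S1. com e s}"

lemma xE: "x \<in> E" using xa S_E by blast
lemma x_sqp: "sqp x" using S_sqp xa by blast
lemma sq [simp]: "v \<in> Y ==> x $ x $ v = v" "v \<in> Y ==> a $ a $ v = v"
 "v \<in> Y ==> x $ a $ v = - (a $ x $ v)"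
 using x_sqp xa by (auto simp: sqp_def anti_def)

lemma S1_S: "s \<in> S1 ==> s \<in> S" "s \<in> S1 ==> s \<in> E" "s \<in> S1 ==> com s a"
 using S_E by (auto simp: S1_def)

lemma S1_subgrp: "subgrp S1"
proof -
 have "S1 = S \<inter> {e \<in> E. \<forall>s\<in>{a}. com e s}" using S_E by (auto simp: S1_def)
 thus ?thesis using subgrp_inter[OF S_E(2) commutant_subgrp[OF EH(3,2), of "{a}"]] xa by auto
qed

lemma Y1_Y: "u \<in> Y1 ==> u \<in> Y" "u \<in> Y1 ==> s \<in> S1 ==> s $ u = u" by (auto simp: Y1_def fixed_def)

lemma Yp_Y1: "u \<in> Yp ==> u \<in> Y1" using Yp_Y S1_S by (auto simp: Y1_def fixed_def)

lemma Y1_nondeg: "nondeg Y1"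
 unfolding Y1_def by (rule fixed_nondeg[OF good_nondeg[OF KY(1)] S1_subgrp]) (use S1_S in auto)

lemma Y1_add: "adsub Y1" using Y1_nondeg by (simp add: nondeg_def)

lemma E1_E: "e \<in> E1 ==> e \<in> E" by (simp add: E1_def)

lemma E1_subgrp: "subgrp E1"
 unfolding E1_def by (rule commutant_subgrp[OF EH(3,2)]) (use S1_S in auto)

lemma x_E1: "x \<in> E1" and a_E1: "a \<in> E1" and ES_E1: "e \<in> ES ==> e \<in> E1"
 using S1_S xE xa S_com com_sym by (auto simp: E1_def ES_def)

lemma E1_Y1: assumes "e \<in> E1" "u \<in> Y1" shows "e $ u \<in> Y1"
proof -
 have "s $ e $ u = e $ u" if s: "s \<in> S1" for s
 proof -
  have "e $ s $ u = s $ e $ u" using assms s Y1_Y(1) by (auto simp: E1_def com_def)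
  thus ?thesis using Y1_Y(2)[OF assms(2) s] by simp
 qed
 thus ?thesis using Y_closed(6)[OF E1_E[OF assms(1)] Y1_Y(1)[OF assms(2)]] by (auto simp: Y1_def fixed_def)
qed

lemma S_split: assumes "s \<in> S" shows "s \<in> S1 \<or> x * s \<in> S1"
proof -
 have "com (x * s) a" if "\<not> com s a"
 proof -
  have "anti s a" using that com_or_anti S_E assms xa by blast
  thus ?thesis using anti_mult2[of a x s] xa S_E assms com_sym anti_sym by blast
 qed
 thus ?thesis using assms xa subgrpD(2)[OF S_E(2)] by (auto simp: S1_def)
qed

lemma x_fix_Yp: assumes "w \<in> Y1" "x $ w = w" shows "w \<in> Yp"
proof -
 have "s $ w = w" if s: "s \<in> S" for s
 proof (cases "s \<in> S1")
  case False
  hence "(x * s) $ w = w" using S_split[OF s] Y1_Y(2)[OF assms(1)] by blast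
  hence "x $ x $ s $ w = x $ w" by (simp add: act_mult)
  thus ?thesis using assms Y1_Y S_E s by auto
 qed (use Y1_Y assms in auto)
 thus ?thesis using Y1_Y(1)[OF assms(1)] by (auto simp: Yp_def fixed_def)
qed

lemma x_Yp: "u \<in> Yp ==> x $ u = u" using Yp_Y xa by blast

lemma a_flip: assumes "w \<in> Y1" "x $ w = - w" shows "a $ w \<in> Yp"
 by (rule x_fix_Yp) (use assms E1_Y1 a_E1 Y1_Y in \<open>auto simp: act_minus\<close>)

lemma Y1_decomp: assumes "v \<in> Y1" shows "v + x $ v \<in> Yp" "a $ (v - x $ v) \<in> Yp"
proof -
 have xv: "x $ v \<in> Y1" "v \<in> Y" using E1_Y1 x_E1 assms Y1_Y by auto
 show "v + x $ v \<in> Yp"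
  by (rule x_fix_Yp) (use xv assms adsubD[OF Y1_add] in \<open>auto simp: act_add add.commute\<close>)
 show "a $ (v - x $ v) \<in> Yp"
  by (rule a_flip) (use xv assms adsubD[OF Y1_add] in \<open>auto simp: act_diff\<close>)
qed

lemma com_x_ES: assumes "e \<in> E1" "com e x" shows "e \<in> ES"
proof -
 have "com e s" if s: "s \<in> S" for s
 proof (cases "s \<in> S1")
  case False
  hence xs: "x * s \<in> S1" using S_split[OF s] by blast
  have c: "com e (x * s)" using assms(1) xs unfolding E1_def by blast
  have "com e (x * (x * s))"
   by (rule com_mult[OF assms(2) c]) (use E1_E[OF assms(1)] xE S1_S(2)[OF xs] in simp_all)
  thus ?thesis using S_E(1)[OF s] E1_E[OF assms(1)] unfolding com_def by (simp add: act_mult)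
 qed (use assms in \<open>auto simp: E1_def\<close>)
 thus ?thesis using E1_E[OF assms(1)] by (simp add: ES_def)
qed

text \<open>On the fixed space \<open>Y1\<close> the group \<open>E1\<close> would act as a dihedral group of order 8, whose cyclic
  subgroup of order 4 is generated by \<open>x a\<close>; the quartic identity forces \<open>(x a)\<^sup>2 = 1\<close> there.\<close>

lemma ES_quaternion_conf: "\<exists>i\<in>ES. sqm i"
proof (rule ccontr)
 assume "\<not> ?thesis"
 hence all1: "onYp e 1" "sqp e" if "e \<in> ES" for e using ES_cases onYp_sq that by blast+
 \<comment> \<open>Only \<open>T\<close> contributes to the quartic identity on \<open>Y1\<close>:
   an element outside \<open>E1\<close> anticommutes with some \<open>s\<close> fixing
   \<open>v\<close>, and the elements of \<open>E1\<close> outside \<open>T\<close> are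
   involutions.\<close>
 define T where "T = {e \<in> E1. anti e x \<and> anti e a}"
 have zero: "B (e $ v) v \<simeq> 0" if e: "e \<in> E" "e \<notin> T" and v: "v \<in> Y1" for e v
 proof (cases "e \<in> E1")
  case False
  then obtain s where s: "s \<in> S1" "anti e s" using e com_or_anti[of e] S1_S by (auto simp: E1_def)
  have sv: "s $ v = v" using Y1_Y v s by blast
  have m: "v \<in> V" "e $ v \<in> V" "s \<in> H" "v \<in> Y" using Y1_Y(1)[OF v] e S1_S s by auto
  have "e $ s $ v = - (s $ e $ v)" using s(2) m(4) unfolding anti_def by blast
  hence "B (e $ v) v = B (- (s $ e $ v)) v" using sv by simp
  also have "\<dots> \<simeq> - B (s $ e $ v) v" using m by (intro B_minus1) auto
  also have "B (s $ e $ v) v = B (e $ v) v" using B_inv[OF m(3,2,1)] sv by simp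
  finally have "2 * B (e $ v) v \<simeq> 0" by (simp add: zeq_iff_dvd)
  thus ?thesis by (rule zeq_cancel) (simp add: not_dvd_small)
 next
  case True
  have "sqp e"
  proof (cases "com e x")
   case True
   thus ?thesis using com_x_ES \<open>e \<in> E1\<close> all1 by blast
  next
   case False
   hence ax: "anti e x" using com_or_anti e xE by blast
   hence ca: "com e a" using e True com_or_anti[OF e(1) xa(2)] by (auto simp: T_def)
   have "com (e * a) x" using anti_mult2[of x e a] ax xa xE e anti_sym com_sym by blast
   hence "e * a \<in> ES" using com_x_ES subgrpD(2)[OF E1_subgrp True a_E1] by blast
   hence "sqp (e * a)" using all1 by blast
   hence "sqp (e * a * a)"
    using sqp_mult(1)[of "e * a" a] SE e xa com_mult_left[of e a a] ca by (auto simp: com_def)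
   thus ?thesis using e unfolding sqp_def by (simp add: act_mult)
  qed
  thus ?thesis using sqp_alternating e Y1_Y v by blast
 qed
 have T_act: "(B (e $ v) v)\<^sup>2 \<simeq> (B ((x * a) $ v) v)\<^sup>2" if e: "e \<in> T" and v: "v \<in> Y1" for e v
 proof -
  have eE: "e \<in> E1" "e \<in> E" "anti e x" "anti e a" using e E1_E by (auto simp: T_def)
  have "com (e * a) x" using anti_mult2[of x e a] eE xa xE anti_sym com_sym by blast
  hence ea: "e * a \<in> ES" using com_x_ES subgrpD(2)[OF E1_subgrp eE(1) a_E1] by blast
  \<comment> \<open>\<open>e * a\<close> is a sign on \<open>Yp\<close> and, as \<open>e\<close>
    anticommutes with \<open>a\<close>, the opposite sign on the image of \<open>Yp\<close> under
    \<open>a\<close>. Up to sign this is \<open>x\<close>.\<close>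
  have key: "(e * a) $ v = x $ v \<or> (e * a) $ v = - (x $ v)" if v: "v \<in> Y1"
   and eps: "(\<forall>u\<in>Yp. (e * a) $ u = u) \<or> (\<forall>u\<in>Yp. (e * a) $ u = - u)" for v
  proof -
   have vY: "v \<in> Y" using v Y1_Y by blast
   let ?p = "v + x $ v" and ?m = "v - x $ v"
   have d: "?p \<in> Yp" "a $ ?m \<in> Yp" using Y1_decomp v by auto
   have mm: "(e * a) $ ?m = - (a $ (e * a) $ a $ ?m)"
   proof -
    have "a $ e $ ?m = - (e $ a $ ?m)" using eE(4) vY xE unfolding anti_def by auto
    thus ?thesis using vY xE eE by (simp add: act_mult)
   qed
   have two: "(e * a) $ v + (e * a) $ v = (e * a) $ ?p + (e * a) $ ?m"
    by (simp add: act_add act_diff)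
   have "\<exists>w \<in> {x $ v, - (x $ v)}. (e * a) $ v + (e * a) $ v = w + w"
    using eps mm two d vY xE by (elim disjE) (simp_all add: act_minus)
   moreover have "(e * a) $ v \<in> Y" "x $ v \<in> Y" using vY xE SE eE xa by auto
   ultimately show ?thesis using good_double_cancel[OF KY(1)] by (metis Y_closed(3) insert_iff singletonD)
  qed
  have vY: "v \<in> Y" "a $ v \<in> Y1" using v Y1_Y E1_Y1 a_E1 by auto
  have "(e * a) $ a $ v = x $ a $ v \<or> (e * a) $ a $ v = - (x $ a $ v)"
   by (rule key[OF vY(2)]) (use all1(1)[OF ea] in \<open>auto simp: onYp_def\<close>)
  hence "e $ v = (x * a) $ v \<or> e $ v = - ((x * a) $ v)" using vY by (simp add: act_mult)
  thus ?thesis using B_minus_sq[of "(x * a) $ v" v] vY xE xa by (auto simp: act_mult)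
 qed
 have xaE1: "x * a \<in> E1" using subgrpD(2)[OF E1_subgrp x_E1 a_E1] .
 have alt: "B ((x * a) $ v) v \<simeq> 0" if v: "v \<in> Y1" for v
 proof -
  \<comment> \<open>\<open>T\<close> is a coset of \<open>Z\<close>, so its size is prime to
    \<open>p\<close>, and the quartic sum is an invertible multiple of a single square.\<close>
  define Z where "Z = {e \<in> E. \<forall>s\<in>insert x (insert a S1). com e s}"
  have Z: "subgrp Z" "Z \<subseteq> H" unfolding Z_def using commutant_subgrp[OF EH(3,2), of "insert x (insert a S1)"] xE xa S1_S by auto
  have ZT: "x * a * z \<in> T" if z: "z \<in> Z" for z
  proof -
   have zE: "z \<in> E" "z \<in> E1" "com z x" "com z a" using z by (auto simp: Z_def E1_def)
   have "anti x (x * a)" "anti a (x * a)"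
    by (rule anti_mult1, use xE xa anti_sym in \<open>auto simp: com_def\<close>)+
   hence "anti x (x * a * z)" "anti a (x * a * z)"
    using anti_mult1(1)[of x "x * a" z] anti_mult1(1)[of a "x * a" z] zE xE xa SE com_sym by auto
   thus ?thesis using zE xaE1 subgrpD(2)[OF E1_subgrp] anti_sym by (auto simp: T_def)
  qed
  have TZ: "inverse (x * a) * e \<in> Z" if e: "e \<in> T" for e
  proof -
   have eE: "e \<in> E1" "e \<in> E" "anti e x" "anti e a" using e E1_E by (auto simp: T_def)
   have i: "inverse (x * a) \<in> E1" "inverse (x * a) \<in> E"
    using subgrpD(3)[OF E1_subgrp xaE1] E1_E by auto
   have xaE: "x * a \<in> E" using xaE1 E1_E by blast
   have an: "anti x (x * a)" "anti a (x * a)"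
    by (rule anti_mult1, use xE xa anti_sym in \<open>auto simp: com_def\<close>)+
   have an': "anti y (inverse (x * a))" if y: "anti y (x * a)" "y \<in> E" for y
   proof (rule ccontr)
    assume "\<not> anti y (inverse (x * a))"
    hence "com (inverse (x * a)) y" using com_or_anti i y com_sym by blast
    hence "com (x * a) y" using com_inverse[of "inverse (x * a)" y] i y by auto
    thus False using not_com_anti[of y "x * a"] y xaE com_sym by auto
   qed
   have "com x (inverse (x * a) * e)" "com a (inverse (x * a) * e)"
    using anti_mult2[of x "inverse (x * a)" e] anti_mult2[of a "inverse (x * a)" e]
     an' an xE xa eE i anti_sym by auto
   moreover have "inverse (x * a) * e \<in> E1" using subgrpD(2)[OF E1_subgrp i(1) eE(1)] .
   ultimately show ?thesis using com_sym by (auto simp: Z_def E1_def)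
  qed
  have "card T = card Z"
   by (rule bij_betw_same_card[OF bij_betw_byWitness[where f = "\<lambda>e. inverse (x * a) * e" and f' = "\<lambda>e. x * a * e"]])
     (use ZT TZ in \<open>auto simp: group_norm\<close>)
  hence cT: "\<not> int p dvd int (card T)" using not_dvd_card[OF Z] by simp
  have "0 \<simeq> (\<Sum>e\<in>E. (B (e $ v) v)\<^sup>2)"
   using quartic[OF KY(1) EH(2) _ Y1_Y(1)[OF v]] E(1) zeq_sym by (auto simp: normal_in_def)
  also have "\<dots> \<simeq> (\<Sum>e\<in>E. if e \<in> T then (B ((x * a) $ v) v)\<^sup>2 else 0)"
  proof (rule zeq_sum)
   fix e assume e: "e \<in> E"
   show "(B (e $ v) v)\<^sup>2 \<simeq> (if e \<in> T then (B ((x * a) $ v) v)\<^sup>2 else 0)"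
    using T_act[of e v] v zeq_pow[OF zero[OF e _ v], of 2] by auto
  qed
  also have "\<dots> = int (card T) * (B ((x * a) $ v) v)\<^sup>2"
  proof -
   have "T \<subseteq> E" using E1_E by (auto simp: T_def)
   thus ?thesis using EH(4) by (simp add: sum.inter_restrict[symmetric] Int_absorb1)
  qed
  finally have "int (card T) * (B ((x * a) $ v) v)\<^sup>2 \<simeq> 0" by (rule zeq_sym)
  hence "(B ((x * a) $ v) v)\<^sup>2 \<simeq> 0" using cT by (rule zeq_cancel)
  thus ?thesis using p(1) by (simp add: zeq_0_iff prime_dvd_power_iff)
 qed
 have v01: "v\<^sub>0 \<in> Y1" using Yp_Y1 R(3) .
 have "(x * a) $ (x * a) $ v\<^sub>0 = v\<^sub>0"
  by (rule alternating_imp_involution[OF Y1_nondeg _ _ _ alt v01])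
    (use xaE1 E1_E E1_Y1 subgrpD(3)[OF E1_subgrp] in auto)
 moreover have "(x * a) $ (x * a) $ v\<^sub>0 = - v\<^sub>0" using v0 xE xa by (simp add: act_mult act_minus)
 ultimately show False using v0 not_minus by metis
qed

end

section \<open>Quaternion units and the prime 7\<close>

context prim_max begin

lemma ES_quaternion: "\<exists>i\<in>ES. sqm i"
proof (cases "\<forall>s\<in>S. \<forall>v\<in>Y. s $ v = v")
 case False
 then obtain x a where "x \<in> S" "a \<in> E" "anti x a" "sqp a" using config_exists by blast
 then interpret prim_conf act H V p B K Y E v\<^sub>0 x a by unfold_locales
 show ?thesis by (rule ES_quaternion_conf)
next
 case True
 hence Yp: "Yp = Y" by (auto simp: Yp_def fixed_def)
 have ES: "ES = E" using True S_E(1) by (auto simp: ES_def com_def)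
 show ?thesis
 proof (rule ccontr)
  assume "\<not> ?thesis"
  hence "E \<subseteq> zs K Y" using ES_cases EH(2) unfolding ES by (auto simp: onYp_def zs_def Yp)
  thus False using E(2) by blast
 qed
qed

text \<open>If \<open>e\<close> has square -1, the form \<open>B (e $ u) w\<close> is symmetric and
  \<open>q e\<close> is its quadratic form; if \<open>e\<close> has square 1, then
  \<open>q e\<close> vanishes modulo \<open>p\<close>.\<close>

definition q :: "'g \<Rightarrow> 'v \<Rightarrow> int" where "q e u = B (e $ u) u"

lemma ES_mult: "e \<in> ES ==> f \<in> ES ==> e * f \<in> ES" using subgrpD(2)[OF ES_subgrp] .

lemma onYp_not_sqm: "e \<in> ES ==> onYp e 1 ==> \<not> sqm e"
 using onYp_sq not_sqp_sqm ES_E by blast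

lemma onYp_right:
 assumes "onYp (e * j) f" "j \<in> ES" "sqm j" shows "onYp e (f * j)"
proof -
 have jj: "j $ j $ u = - u" "j $ u \<in> Yp" if "u \<in> Yp" for u
  using that assms(2,3) Yp_Y(1) ES_Yp by (auto simp: sqm_def)
 show ?thesis unfolding onYp_def
 proof (rule disjE[OF assms(1)[unfolded onYp_def]])
  assume h: "\<forall>u\<in>Yp. (e * j) $ u = f $ u"
  have "e $ u = - ((f * j) $ u)" if "u \<in> Yp" for u
   using bspec[OF h jj(2)[OF that]] jj[OF that] by (simp add: act_mult act_minus) (metis minus_minus)
  thus "(\<forall>u\<in>Yp. e $ u = (f * j) $ u) \<or> (\<forall>u\<in>Yp. e $ u = - ((f * j) $ u))" by blast
 next
  assume h: "\<forall>u\<in>Yp. (e * j) $ u = - (f $ u)"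
  have "e $ u = (f * j) $ u" if "u \<in> Yp" for u
   using bspec[OF h jj(2)[OF that]] jj[OF that] by (simp add: act_mult act_minus)
  thus "(\<forall>u\<in>Yp. e $ u = (f * j) $ u) \<or> (\<forall>u\<in>Yp. e $ u = - ((f * j) $ u))" by blast
 qed
qed

lemma ES_commuting: assumes "i \<in> ES" "sqm i" "e \<in> ES" "com e i" shows "onYp e 1 \<or> onYp e i"
proof (cases "sqm e")
 case True
 have "sqp (e * i)" using sqp_mult(2)[of e i] ES_E assms True by blast
 hence "onYp (e * i) 1" using ES_cases[OF ES_mult[OF assms(3,1)]] not_sqp_sqm[of "e * i"] ES_E ES_mult assms by blast
 thus ?thesis using onYp_right[of e i 1] assms(1,2) by simp
qed (use ES_cases assms in blast)

lemma ES_anticommuting: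
 assumes "i \<in> ES" "sqm i" "j \<in> ES" "sqm j" "anti i j" "e \<in> ES" "anti e i"
 shows "onYp e j \<or> onYp e (i * j)"
proof -
 have "com (e * j) i"
  using anti_mult2[of i e j] assms anti_sym com_sym ES_E by blast
 hence "onYp (e * j) 1 \<or> onYp (e * j) i" using ES_commuting assms ES_mult by blast
 thus ?thesis using onYp_right[of e j 1] onYp_right[of e j i] assms(3,4) by auto
qed

lemma q_onYp: assumes "onYp e f" "e \<in> E" "f \<in> E" "u \<in> Yp" shows "q e u \<simeq> q f u \<or> q e u \<simeq> - q f u"
proof -
 have "e $ u = f $ u \<or> e $ u = - (f $ u)" using assms by (auto simp: onYp_def)
 moreover have "B (- (f $ u)) u \<simeq> - B (f $ u) u" using B_minus1 assms Yp_Y by auto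
 ultimately show ?thesis by (auto simp: q_def)
qed

lemma q_conj:
 assumes "h \<in> K" "e \<in> E" "u \<in> Y" shows "q (cj (inverse h) e) u = q e (h $ u)"
proof -
 have "cj (inverse h) e $ u \<in> V" using assms SK E_K by (metis SK(3,4) Y_closed(5,7))
 hence "B (h $ cj (inverse h) e $ u) (h $ u) = B (cj (inverse h) e $ u) u"
  using B_inv assms by auto
 thus ?thesis by (simp add: q_def cj_def act_mult)
qed

lemma q_double: assumes "e \<in> E" "u \<in> Y" shows "q e (u + u) \<simeq> 4 * q e u"
proof -
 have m: "u \<in> V" "e $ u \<in> V" "u + u \<in> V" using assms by auto
 have "B (e $ u + e $ u) (u + u) \<simeq> 2 * B (e $ u) (u + u)" using m by (intro B_double1)
 also have "\<dots> \<simeq> 2 * (2 * B (e $ u) u)" using m by (intro zeq_mult zeq_refl B_double2)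
 finally show ?thesis by (simp add: q_def act_add)
qed

lemma q_triple: assumes "e \<in> E" "u \<in> Y" shows "q e (u + u + u) \<simeq> 9 * q e u"
proof -
 have m: "u \<in> V" "e $ u \<in> V" "u + u \<in> V" "e $ u + e $ u \<in> V" "u + u + u \<in> V" using assms by auto
 have d: "B w (u + u + u) \<simeq> 3 * B w u" if "w \<in> V" for w
  using zeq_trans[OF B_add2[of "u + u" u w] zeq_add[OF B_double2[of u w] zeq_refl]] m that by simp
 have "B (e $ u + e $ u + e $ u) (u + u + u) \<simeq> B (e $ u + e $ u) (u + u + u) + B (e $ u) (u + u + u)"
  using m by (intro B_add1)
 also have "\<dots> \<simeq> 2 * B (e $ u) (u + u + u) + B (e $ u) (u + u + u)"
  using m by (intro zeq_add zeq_refl B_double1)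
 also have "\<dots> \<simeq> 2 * (3 * B (e $ u) u) + 3 * B (e $ u) u"
  using m by (intro zeq_add zeq_mult zeq_refl d)
 finally show ?thesis by (simp add: q_def act_add)
qed

lemma q_nonzero_exists: assumes "i \<in> ES" "sqm i" shows "\<exists>u\<in>Yp. \<not> q i u \<simeq> 0"
proof (rule ccontr)
 assume "\<not> ?thesis"
 hence alt: "B (i $ u) u \<simeq> 0" if "u \<in> Yp" for u using that by (auto simp: q_def)
 have "i $ i $ v\<^sub>0 = v\<^sub>0"
  by (rule alternating_imp_involution[OF good_nondeg[OF R(1)] _ _ _ alt R(3)])
    (use assms ES_Yp ES_E subgrpD(3)[OF ES_subgrp] in auto)
 thus False using assms v0 not_minus unfolding sqm_def by metis
qed

text \<open>Conjugation by \<open>inverse h\<close> multiplies the values of \<open>q\<close> at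
  \<open>u\<close> by \<open>L\<close>. The conditions on \<open>L\<close> forbid fixed points and
  2-cycles, so it takes \<open>i\<close> to \<open>j\<close>, then to \<open>i * j\<close> up to
  sign, and back to \<open>i\<close> up to sign; the sign \<open>c\<close> occurs twice and cancels.
  Three steps give \<open>L ^ 3 = 1\<close>.\<close>

lemma scaling_step:
 assumes i: "i \<in> ES" "sqm i" and u: "u \<in> Yp" "\<not> q i u \<simeq> 0" and h: "h \<in> Kp"
  and sc: "\<And>e. e \<in> ES ==> q (cj (inverse h) e) u \<simeq> L * q e u"
  and L0: "\<not> int p dvd L" and L: "\<not> int p dvd L - 1" "\<not> int p dvd L + 1" "\<not> int p dvd L * L - 1" "\<not> int p dvd L * L + 1"
 shows "int p dvd L ^ 3 - 1"
  and "\<exists>j\<in>ES. sqm j \<and> anti i j \<and> q j u \<simeq> L * q i u \<and>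
   (q (i * j) u \<simeq> L * L * q i u \<or> q (i * j) u \<simeq> - (L * L * q i u))"
proof -
 have hK: "h \<in> K" "inverse h \<in> Kp" "inverse h \<in> K"
  using Kp_K h subgrpD(3)[OF GP(1) h] by auto
 define j where "j = cj (inverse h) i"
 define k1 where "k1 = cj (inverse h) j"
 have j: "j \<in> ES" "sqm j" "q j u \<simeq> L * q i u" unfolding j_def using ES_cj hK i sqm_cj sc by auto
 have k1: "k1 \<in> ES" "sqm k1" "q k1 u \<simeq> L * q j u" unfolding k1_def using ES_cj hK j sqm_cj sc by auto
 have k1': "q k1 u \<simeq> L * L * q i u"
  using zeq_trans[OF k1(3) zeq_mult[OF zeq_refl j(3)]] by (simp add: mult.assoc)
 have no: "False" if "e \<in> ES" "f \<in> ES" "onYp e f" "q e u \<simeq> c * q f u" "\<not> q f u \<simeq> 0"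
   "\<not> int p dvd c - 1" "\<not> int p dvd c + 1" for e f c
 proof -
  have "q f u \<simeq> c * q f u \<or> - q f u \<simeq> c * q f u"
   using q_onYp[OF that(3) ES_E[OF that(1)] ES_E[OF that(2)] u(1)] that(4) zeq_sym zeq_trans by metis
  hence "1 * q f u \<simeq> c * q f u \<or> (- 1) * q f u \<simeq> c * q f u" by simp
  moreover have "\<not> int p dvd 1 - c" "\<not> int p dvd - 1 - c"
   using that(6,7) by (metis dvd_minus_iff minus_diff_eq, metis dvd_minus_iff minus_add_distrib add.commute diff_conv_add_uminus)
  ultimately show False using zeq_scale_eq that(5) by blast
 qed
 have aij: "anti i j"
 proof (rule ccontr)
  assume "\<not> anti i j"
  hence "com j i" using com_or_anti ES_E i(1) j(1) com_sym by blast
  hence "onYp j i" using ES_commuting i j onYp_not_sqm by blast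
  thus False using no[OF j(1) i(1) _ j(3) u(2) L(1,2)] by blast
 qed
 have qj: "\<not> q j u \<simeq> 0"
  using j(3) zeq_sym zeq_trans u(2) zeq_cancel L0 by metis
 have "\<not> onYp k1 j" using no[OF k1(1) j(1) _ k1(3) qj L(1,2)] by blast
 moreover have "\<not> onYp k1 i" using no[OF k1(1) i(1) _ k1' u(2) L(3,4)] by blast
 moreover have "\<not> onYp k1 1" using onYp_not_sqm k1 by blast
 ultimately have o: "onYp k1 (i * j)"
  using ES_commuting[OF i k1(1)] ES_anticommuting[OF i j(1,2) aij k1(1)] com_or_anti ES_E k1(1) i(1)
  by blast
 have ij: "i * j \<in> ES" using ES_mult i j by blast
 define k2 where "k2 = cj (inverse h) (i * j)"
 have k2: "q k2 u \<simeq> L * q (i * j) u" unfolding k2_def by (rule sc[OF ij])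
 have k2_eq: "k2 = j * k1" by (simp add: k2_def k1_def j_def cj_mult)
 have uY: "u \<in> Y" using u(1) Yp_Y by blast
 have jij: "j $ i $ j $ u = i $ u"
 proof -
  have "j $ i $ w = - (i $ j $ w)" if "w \<in> Y" for w using anti_sym[OF aij] that by (simp add: anti_def)
  thus ?thesis using j(2) uY ES_E j(1) by (simp add: sqm_def act_minus)
 qed
 have m: "i $ u \<in> V" "(i * j) $ u \<in> V" "u \<in> V" using uY ES_E i j ij by auto
 obtain c :: int where c: "c = 1 \<or> c = - 1" "q k1 u \<simeq> c * q (i * j) u" "q k2 u \<simeq> c * q i u"
 proof (cases "k1 $ u = (i * j) $ u")
  case True
  thus thesis using jij by (intro that[of 1]) (simp_all add: q_def k2_eq act_mult)
 next
  case False
  hence "k1 $ u = - ((i * j) $ u)" using o u(1) by (auto simp: onYp_def)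
  thus thesis using jij B_minus1[OF m(2,3)] B_minus1[OF m(1,3)]
   by (intro that[of "- 1"]) (simp_all add: q_def k2_eq act_mult act_minus)
 qed
 have cc: "c * (c * a) = a" for a using c(1) by auto
 have e1: "q (i * j) u \<simeq> c * (L * L * q i u)"
  using zeq_mult[OF zeq_refl zeq_trans[OF zeq_sym[OF c(2)] k1'], of c] by (simp only: cc)
 have "q i u \<simeq> c * (L * (c * (L * L * q i u)))"
  using zeq_mult[OF zeq_refl zeq_trans[OF zeq_sym[OF c(3)] zeq_trans[OF k2 zeq_mult[OF zeq_refl e1]]], of c]
  by (simp only: cc)
 hence "1 * q i u \<simeq> L ^ 3 * q i u" using cc by (simp add: power3_eq_cube mult_ac)
 hence "int p dvd 1 - L ^ 3" using zeq_scale_eq u(2) by blast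
 hence "int p dvd L ^ 3 - 1" by (metis dvd_minus_iff minus_diff_eq)
 hence main: "int p dvd L ^ 3 - 1 \<and> (q (i * j) u \<simeq> L * L * q i u \<or> q (i * j) u \<simeq> - (L * L * q i u))"
  using e1 c(1) by auto
 thus "int p dvd L ^ 3 - 1" by blast
 show "\<exists>j\<in>ES. sqm j \<and> anti i j \<and> q j u \<simeq> L * q i u \<and>
   (q (i * j) u \<simeq> L * L * q i u \<or> q (i * j) u \<simeq> - (L * L * q i u))"
  using main j aij by blast
qed

text \<open>Doubling gives the factor 4, with \<open>4 ^ 3 - 1 = 3 * 3 * 7\<close>. The side
  conditions for 4 concern the numbers 3, 5, 15 and 17, so only 17 escapes. For
  \<open>p = 17\<close> the factor 9 from tripling satisfies all of them, and \<open>9 ^ 3\<close>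
  is not 1 modulo 17.\<close>

lemma p_eq_seven: "p = 7"
proof -
 obtain i where i: "i \<in> ES" "sqm i" using ES_quaternion by blast
 obtain u where u: "u \<in> Yp" "\<not> q i u \<simeq> 0" using q_nonzero_exists[OF i] by blast
 have uY: "u \<in> Y" "u \<noteq> 0" using u Yp_Y B_zero1[of 0] by (auto simp: q_def)
 have h2: "\<exists>h\<in>Kp. h $ u = u + u" "\<exists>h\<in>Kp. h $ u = u + u + u" using GP(8,9) u(1) by auto
 have sc2: "\<exists>h\<in>Kp. \<forall>e\<in>ES. q (cj (inverse h) e) u \<simeq> 4 * q e u"
  using h2(1) q_conj Kp_K ES_E uY q_double by metis
 have sc3: "\<exists>h\<in>Kp. \<forall>e\<in>ES. q (cj (inverse h) e) u \<simeq> 9 * q e u"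
  using h2(2) q_conj Kp_K ES_E uY q_triple by metis
 have pr: "int p dvd a * b ==> int p dvd a \<or> int p dvd b" for a b
  using p(1) by (simp add: prime_dvd_mult_iff)
 have n: "\<not> int p dvd 2" "\<not> int p dvd 3" "\<not> int p dvd 5" using not_dvd_small by auto
 have p17: "p = 17" if "int p dvd 17"
 proof -
  have "prime (17::nat)" by (simp add: prime_nat_numeral_eq)
  thus ?thesis using that p(1) primes_dvd_imp_eq by (metis of_nat_dvd_iff of_nat_numeral)
 qed
 have "p = 7" if "p \<noteq> 17"
 proof -
  obtain h where h: "h \<in> Kp" "\<forall>e\<in>ES. q (cj (inverse h) e) u \<simeq> 4 * q e u" using sc2 by blast
  have "int p dvd 4 ^ 3 - 1"
  proof (rule scaling_step(1)[OF i u h(1)])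
   show "\<not> int p dvd 4 * 4 - 1" using pr[of 3 5] n by auto
   show "\<not> int p dvd 4 * 4 + 1" using p17 that by auto
   show "\<not> int p dvd 4" using not_dvd_small by simp
  qed (use h n in auto)
  hence "int p dvd 3 * (3 * 7)" by simp
  hence "int p dvd 7" using pr n by blast
  hence "p dvd 7" by (metis of_nat_dvd_iff of_nat_numeral)
  thus ?thesis using p(3) dvd_imp_le[of p 7] by simp
 qed
 moreover have False if p17: "p = 17"
 proof -
  obtain h where h: "h \<in> Kp" "\<forall>e\<in>ES. q (cj (inverse h) e) u \<simeq> 9 * q e u" using sc3 by blast
  have "int p dvd 9 ^ 3 - 1"
   by (rule scaling_step(1)[OF i u h(1)]) (use h(2) in \<open>auto simp: p17\<close>)
  thus False by (simp add: p17)
 qed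
 ultimately show ?thesis by blast
qed

lemma zeq_seven: "a - b = 7 * c ==> a \<simeq> b" by (subst zeq_iff_dvd) (simp add: p_eq_seven)

text \<open>Squares remove the undetermined signs: modulo 7, \<open>4 ^ 2\<close> is 2 and
  \<open>16 ^ 2\<close> is 4, so the squared values at the three units are in the ratio 1 : 2 :
  4.\<close>

lemma good_scaling:
 assumes "i \<in> ES" "sqm i" "u \<in> Yp" "\<not> q i u \<simeq> 0"
 shows "\<exists>j\<in>ES. sqm j \<and> anti i j \<and> (q j u)\<^sup>2 \<simeq> 2 * (q i u)\<^sup>2 \<and> (q (i * j) u)\<^sup>2 \<simeq> 4 * (q i u)\<^sup>2"
proof -
 have uY: "u \<in> Y" using assms Yp_Y by blast
 obtain h where h: "h \<in> Kp" "h $ u = u + u" using GP(8) assms(3) by blast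
 have sc: "q (cj (inverse h) e) u \<simeq> 4 * q e u" if "e \<in> ES" for e
  using h q_conj Kp_K ES_E[OF that] uY q_double by metis
 obtain j where j: "j \<in> ES" "sqm j" "anti i j" "q j u \<simeq> 4 * q i u"
   "q (i * j) u \<simeq> 4 * 4 * q i u \<or> q (i * j) u \<simeq> - (4 * 4 * q i u)"
  using scaling_step(2)[OF assms h(1) sc] p_eq_seven by auto
 have "(q j u)\<^sup>2 \<simeq> (4 * q i u)\<^sup>2" using j(4) by (rule zeq_pow)
 also have "\<dots> \<simeq> 2 * (q i u)\<^sup>2" by (rule zeq_seven[of _ _ "2 * (q i u)\<^sup>2"]) (simp add: power_mult_distrib)
 finally have a: "(q j u)\<^sup>2 \<simeq> 2 * (q i u)\<^sup>2" .
 have "(q (i * j) u)\<^sup>2 \<simeq> (4 * 4 * q i u)\<^sup>2"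
  using j(5) zeq_pow[of "q (i * j) u" "4 * 4 * q i u" 2] zeq_pow[of "q (i * j) u" "- (4 * 4 * q i u)" 2] by auto
 also have "\<dots> \<simeq> 4 * (q i u)\<^sup>2" by (rule zeq_seven[of _ _ "36 * (q i u)\<^sup>2"]) (simp add: power_mult_distrib)
 finally show ?thesis using a j by blast
qed

end

context prim_max begin

lemma B_expand: assumes "a \<in> V" "b \<in> V" "c \<in> V" "d \<in> V"
 shows "B (a + b) (c + d) \<simeq> (B a c + B a d) + (B b c + B b d)"
 by (rule zeq_trans[OF B_add1 zeq_add[OF B_add2 B_add2]]) (use assms in auto)

text \<open>The operator \<open>1 + i\<close> normalises the quaternion group and exchanges
  \<open>j\<close> with \<open>i * j\<close> up to sign. It serves to reverse the cyclic order of
  the three values.\<close>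

lemma q_flip:
 assumes "i \<in> E" "j \<in> E" "sqm i" "anti i j" "u \<in> Y"
 shows "q i (u + i $ u) \<simeq> 2 * q i u" "q j (u + i $ u) \<simeq> - 2 * q (i * j) u"
  "q (i * j) (u + i $ u) \<simeq> 2 * q j u"
proof -
 have m: "u \<in> V" "i $ u \<in> V" "j $ u \<in> V" "i $ j $ u \<in> V" "- (i $ j $ u) \<in> V" "- u \<in> V" "i \<in> H"
  using assms by auto
 have ii: "i $ i $ w = - w" and ji: "j $ i $ w = - (i $ j $ w)" if "w \<in> Y" for w
  using assms(3) anti_sym[OF assms(4)] that by (auto simp: sqm_def anti_def)
 have b1: "B (j $ u) (i $ u) \<simeq> - B (i $ j $ u) u"
 proof -
  have "B (j $ u) (i $ u) = B (i $ j $ u) (- u)" using B_inv[OF m(7,3,2)] ii assms(5) by simp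
  thus ?thesis using B_minus2[OF m(1,4)] by simp
 qed
 have b2: "B (i $ j $ u) (i $ u) = B (j $ u) u" using B_inv[OF m(7,3,1)] .
 have "B (i $ u + - u) (u + i $ u) \<simeq> (B (i $ u) u + B (i $ u) (i $ u)) + (B (- u) u + B (- u) (i $ u))"
  using m by (intro B_expand)
 also have "\<dots> \<simeq> (B (i $ u) u + 0) + (- B u u + - (B u (i $ u)))"
  using m by (intro zeq_add zeq_refl B_alt' B_minus1)
 also have "\<dots> \<simeq> (B (i $ u) u + 0) + (- 0 + - (- B (i $ u) u))"
  using m by (intro zeq_add zeq_refl zeq_minus B_alt' B_skew)
 finally show "q i (u + i $ u) \<simeq> 2 * q i u" using ii assms(5) by (simp add: q_def act_add)
 have "B (j $ u + - (i $ j $ u)) (u + i $ u) \<simeq>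
   (B (j $ u) u + B (j $ u) (i $ u)) + (B (- (i $ j $ u)) u + B (- (i $ j $ u)) (i $ u))"
  using m by (intro B_expand)
 also have "\<dots> \<simeq> (B (j $ u) u + - B (i $ j $ u) u) + (- B (i $ j $ u) u + - B (i $ j $ u) (i $ u))"
  using m by (intro zeq_add zeq_refl b1 B_minus1)
 finally show "q j (u + i $ u) \<simeq> - 2 * q (i * j) u"
  using ji assms(5) b2 by (simp add: q_def act_add act_mult)
 have iji: "i $ j $ i $ u = j $ u" using ii ji assms(2,5) by (simp add: act_minus)
 have "B (i $ j $ u + j $ u) (u + i $ u) \<simeq>
   (B (i $ j $ u) u + B (i $ j $ u) (i $ u)) + (B (j $ u) u + B (j $ u) (i $ u))"
  using m by (intro B_expand)
 also have "\<dots> \<simeq> (B (i $ j $ u) u + B (j $ u) u) + (B (j $ u) u + - B (i $ j $ u) u)"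
  unfolding b2 by (intro zeq_add zeq_refl b1)
 finally show "q (i * j) (u + i $ u) \<simeq> 2 * q j u"
  using iji by (simp add: q_def act_add act_mult)
qed

end

context prim_pair begin

text \<open>As \<open>8 = 1\<close> modulo 7, the cube of an element doubling \<open>w\<close> fixes \<open>w\<close>.\<close>

lemma doubling_three_element:
 assumes p7: "p = 7" and h: "h \<in> K" "h $ w = w + w" "w \<in> Y"
 shows "\<exists>m n. (h ^ m) ^ (3 ^ n) = 1 \<and> h ^ m $ w = w + w"
proof -
 have h3: "h $ h $ h $ w = w"
 proof -
  define z where "z = h $ h $ h $ w - w"
  have zY: "z \<in> Y" using h by (simp add: z_def)
  have "z = 0"
  proof (rule KD(10)[OF zY])
   fix y assume y: "y \<in> Y"
   let ?w2 = "w + w" let ?w4 = "?w2 + ?w2" let ?w8 = "?w4 + ?w4"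
   have m: "w \<in> V" "?w2 \<in> V" "?w4 \<in> V" "?w8 \<in> V" "y \<in> V" "- w \<in> V" using h(3) y by auto
   have "z = ?w8 + - w" using h by (simp add: z_def act_add)
   hence "B z y \<simeq> B ?w8 y + B (- w) y" using B_add1[OF m(4,6,5)] by simp
   also have "\<dots> \<simeq> 2 * B ?w4 y + - B w y" using m by (intro zeq_add B_double1 B_minus1)
   also have "\<dots> \<simeq> 2 * (2 * B ?w2 y) + - B w y"
    using m by (intro zeq_add zeq_refl zeq_mult B_double1)
   also have "\<dots> \<simeq> 2 * (2 * (2 * B w y)) + - B w y"
    using m by (intro zeq_add zeq_refl zeq_mult B_double1)
   also have "\<dots> \<simeq> 0" by (subst zeq_0_iff) (simp add: p7)
   finally show "B z y \<simeq> 0" .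
  qed
  thus ?thesis by (simp add: z_def)
 qed
 have h3n: "h ^ (3 * n) $ w = w" for n
  by (induction n) (simp_all add: act_mult h3 power_add numeral_3_eq_3)
 obtain k m where "(h ^ (3 * k + 1)) ^ (3 ^ m) = 1" using three_part[OF H KD(3)[OF h(1)]] by blast
 moreover have "h ^ (3 * k + 1) $ w = w + w" using h3n h(2) by (simp add: power_Suc2 act_mult act_add del: power_Suc)
 ultimately show ?thesis by blast
qed

end

section \<open>Moving the five points\<close>

context prim_conf begin

definition onY1 :: "'g \<Rightarrow> 'g \<Rightarrow> bool" where
 "onY1 e f \<longleftrightarrow> (\<forall>u\<in>Y1. e $ u = f $ u) \<or> (\<forall>u\<in>Y1. e $ u = - (f $ u))"

text \<open>\<open>x\<close> is trivial on \<open>Yp\<close>, so a factor \<open>x\<close> is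
  invisible there but turns anticommuting with \<open>a\<close> into commuting.\<close>

lemma adjust_ES: assumes "e \<in> ES" "sqm e" shows "\<exists>e'\<in>ES. sqm e' \<and> com e' a \<and> (\<forall>u\<in>Yp. e' $ u = e $ u)"
proof (cases "com e a")
 case False
 hence an: "anti e a" using com_or_anti ES_E assms xa by blast
 have cx: "com e x" using assms xa by (auto simp: ES_def)
 have "x \<in> ES" using xE xa S_com by (auto simp: ES_def)
 hence "e * x \<in> ES" using ES_mult assms by blast
 moreover have "sqm (e * x)" using sqp_mult(3)[of x e] cx com_sym x_sqp assms ES_E xE
   sq_cases[of "e * x"] SE(2) sqp_mult(2)[of "e * x" x] by (simp add: sqm_def com_def act_mult act_minus)
 moreover have "com (e * x) a" using anti_mult2[of a e x] an xa anti_sym com_sym ES_E assms xE by blast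
 moreover have "\<forall>u\<in>Yp. (e * x) $ u = e $ u" using x_Yp by (simp add: act_mult)
 ultimately show ?thesis by blast
qed (use assms in blast)

lemma nrm_Y1: assumes "k \<in> nrm K S1" "u \<in> Y1" shows "k $ u \<in> Y1"
proof -
 have kK: "k \<in> K" and kS: "\<And>x. cj k x \<in> S1 \<longleftrightarrow> x \<in> S1" using assms(1) by (auto simp: nrm_def)
 have "s $ k $ u = k $ u" if s: "s \<in> S1" for s
 proof -
  have "cj (inverse k) s \<in> S1" using kS[of "cj (inverse k) s"] s by simp
  hence "cj (inverse k) s $ u = u" using Y1_Y assms(2) by blast
  hence "k $ cj (inverse k) s $ u = k $ u" by simp
  thus ?thesis by (simp add: cj_def act_mult)
 qed
 thus ?thesis using Y1_Y(1)[OF assms(2)] kK by (auto simp: Y1_def fixed_def)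
qed

text \<open>A vector with components of opposite orientation in the two eigenspaces of \<open>x\<close> is doubled
  only by elements that move \<open>x\<close>.\<close>

lemma point_moved:
 "\<exists>t\<in>nrm K S1. \<exists>n. t ^ (3 ^ n) = 1 \<and> \<not> onY1 (cj t x) x"
proof -
 obtain i0 where i0: "i0 \<in> ES" "sqm i0" using ES_quaternion by blast
 obtain i where i: "i \<in> ES" "sqm i" "com i a" using adjust_ES[OF i0] by blast
 obtain u0 where u0: "u0 \<in> Yp" "\<not> q i u0 \<simeq> 0" using q_nonzero_exists[OF i(1,2)] by blast
 define A where "A = (q i u0)\<^sup>2"
 have A: "\<not> A \<simeq> 0" using u0(2) p(1) by (simp add: A_def zeq_0_iff prime_dvd_power_iff)
 obtain j0 where j0: "j0 \<in> ES" "sqm j0" "anti i j0" "(q j0 u0)\<^sup>2 \<simeq> 2 * A" "(q (i * j0) u0)\<^sup>2 \<simeq> 4 * A"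
  using good_scaling[OF i(1,2) u0] unfolding A_def by blast
 obtain j where j: "j \<in> ES" "sqm j" "com j a" and jj: "\<And>u. u \<in> Yp ==> j $ u = j0 $ u"
  using adjust_ES[OF j0(1,2)] by blast
 have iE: "i \<in> E" "j \<in> E" "i * j \<in> E" "i * j \<in> ES" using ES_E i j ES_mult by auto
 have u0Y: "u0 \<in> Y" "u0 \<noteq> 0" using u0 Yp_Y B_zero1[of 0] by (auto simp: q_def)
 have aj: "anti i j"
 proof (rule ccontr)
  assume "\<not> anti i j"
  hence "com i j" using com_or_anti iE by blast
  hence "i $ j $ u0 = j $ i $ u0" using u0Y by (simp add: com_def)
  hence "i $ j0 $ u0 = j0 $ i $ u0" using jj u0(1) ES_Yp i(1) by simp
  hence "i $ j0 $ u0 = - (i $ j0 $ u0)" using j0(3) u0Y(1) unfolding anti_def by metis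
  hence "i $ j0 $ u0 = 0" using not_minus[of "i $ j0 $ u0"] iE ES_E j0(1) u0Y by auto
  thus False using u0Y by simp
 qed
 have aj0: "(q j u0)\<^sup>2 \<simeq> 2 * A" "(q (i * j) u0)\<^sup>2 \<simeq> 4 * A"
  using j0(4,5) jj u0(1) by (auto simp: q_def act_mult)
 \<comment> \<open>The squared values at \<open>i\<close>, \<open>j\<close>, \<open>i * j\<close>
   are \<open>A\<close>, \<open>2 A\<close>, \<open>4 A\<close> at \<open>u0\<close>, and by
   \<open>q_flip\<close> they are \<open>4 A\<close>, \<open>2 A\<close>, \<open>A\<close> modulo 7
   at \<open>u1\<close>: the opposite orientation.\<close>
 define u1 where "u1 = u0 + i $ u0"
 have u1: "u1 \<in> Yp" "u1 \<in> Y" using u0 ES_Yp i(1) adsubD(2)[OF GP(4)] Yp_Y by (auto simp: u1_def)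
 have i1: "(q i u1)\<^sup>2 \<simeq> 4 * A"
  using zeq_pow[OF q_flip(1)[OF iE(1,2) i(2) aj u0Y(1)], of 2] by (simp add: u1_def A_def power_mult_distrib)
 have j1: "(q j u1)\<^sup>2 \<simeq> 2 * A"
 proof -
  have "(q j u1)\<^sup>2 \<simeq> 4 * (q (i * j) u0)\<^sup>2"
   using zeq_pow[OF q_flip(2)[OF iE(1,2) i(2) aj u0Y(1)], of 2] by (simp add: u1_def power_mult_distrib)
  also have "\<dots> \<simeq> 4 * (4 * A)" by (intro zeq_mult zeq_refl aj0)
  also have "\<dots> \<simeq> 2 * A" by (rule zeq_seven[of _ _ "2 * A"]) simp
  finally show ?thesis .
 qed
 define w where "w = u0 + a $ u1"
 have aY: "a $ u1 \<in> Y1" "a $ u1 \<in> Y" "x $ a $ u1 = - (a $ u1)" "a $ a $ u1 = u1"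
  using E1_Y1[OF a_E1] Yp_Y1 u1 x_Yp xa by auto
 have u0x: "x $ u0 = u0" "u0 \<in> Y1" using x_Yp Yp_Y1 u0 by auto
 have wY: "w \<in> Y" "w \<in> Y1" using u0Y aY u0x adsubD(2)[OF Y1_add] by (auto simp: w_def)
 \<comment> \<open>Decompositions into eigenvectors of \<open>x\<close> are unique because
   \<open>Y\<close> has no 2-torsion.\<close>
 have comps: "y = u0' \<and> z = z'" if "y + z = u0' + z'" "x $ y = y" "x $ u0' = u0'" "x $ z = - z" "x $ z' = - z'"
   "y \<in> Y" "z \<in> Y" "u0' \<in> Y" "z' \<in> Y" for y z u0' z'
 proof -
  have "y - z = x $ (y + z)" by (simp only: act_add that(2,4) diff_conv_add_uminus)
  also have "\<dots> = u0' - z'" by (simp only: that(1) act_add that(3,5) diff_conv_add_uminus)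
  finally have d: "y - z = u0' - z'" .
  have "y + y = (y + z) + (y - z)" "u0' + u0' = (u0' + z') + (u0' - z')" by (simp_all add: algebra_simps)
  hence "y + y = u0' + u0'" using that(1) d by metis
  hence "y = u0'" using good_double_cancel[OF KY(1)] that by blast
  thus ?thesis using that(1) by simp
 qed
 have wn0: "w \<noteq> 0"
 proof
  assume "w = 0"
  hence "u0 = 0" using comps[of u0 "a $ u1" 0 0] u0x u0Y aY by (auto simp: w_def)
  thus False using u0Y by simp
 qed
 have qa: "q e (a $ u1) = q e u1" if "com e a" "e \<in> E" for e
 proof -
  have "e $ a $ u1 = a $ e $ u1" using that u1 by (simp add: com_def)
  thus ?thesis using B_inv[of a "e $ u1" u1] that u1 xa by (simp add: q_def)
 qed
 have q_sign: "(q e z')\<^sup>2 \<simeq> (B z z')\<^sup>2" if "e $ z' = z \<or> e $ z' = - z" "z \<in> V" "z' \<in> V" for e z z'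
  using that B_minus_sq[of z z'] by (auto simp: q_def)
 \<comment> \<open>An element of \<open>E1\<close> that fixes \<open>w\<close> either fixes both
   components or exchanges them. An exchange would equate the squared values of \<open>q i\<close>
   at the two components, which are \<open>A\<close> and \<open>4 A\<close>.\<close>
 have "cen E w = S1"
 proof
  show "S1 \<subseteq> cen E w"
   using Y1_Y(2)[OF wY(2)] S1_S(2) by (auto simp: cen_def)
  show "cen E w \<subseteq> S1"
  proof
   fix e assume "e \<in> cen E w"
   hence e: "e \<in> E" "e $ w = w" by (auto simp: cen_def)
   have "com e s" if s: "s \<in> S1" for s
   proof (rule ccontr)
    assume "\<not> com e s"
    hence "anti e s" using com_or_anti e S1_S s by blast
    hence "e $ s $ w = - (s $ e $ w)" using wY by (simp add: anti_def)
    hence "w = - w" using e Y1_Y(2)[OF wY(2) s] by simp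
    thus False using not_minus wY wn0 by blast
   qed
   hence eE1: "e \<in> E1" using e by (simp add: E1_def)
   have eq: "e $ u0 + e $ a $ u1 = u0 + a $ u1" using e(2) by (simp add: w_def act_add)
   have eY: "e $ u0 \<in> Y" "e $ a $ u1 \<in> Y" using e u0Y aY by auto
   show "e \<in> S1"
   proof (cases "com e x")
    case True
    hence c: "x $ e $ z = e $ x $ z" if "z \<in> Y" for z using that by (simp add: com_def)
    have "e $ u0 = u0 \<and> e $ a $ u1 = a $ u1"
     by (rule comps[OF eq]) (use c u0x aY u0Y eY in \<open>auto simp: act_minus\<close>)
    hence f: "e $ u0 = u0" "e $ a $ u1 = a $ u1" by auto
    hence eS: "e \<in> S" using R(2)[OF u0(1) u0Y(2)] e(1) by (auto simp: cen_def)
    have "com e a"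
    proof (rule ccontr)
     assume "\<not> com e a"
     hence "anti e a" using com_or_anti e xa by blast
     hence "e $ a $ u1 = - (a $ e $ u1)" using u1 by (simp add: anti_def)
     hence "a $ u1 = - (a $ u1)" using f(2) Yp_Y(2)[OF u1(1) eS] by simp
     hence "a $ u1 = 0" using not_minus aY by blast
     hence "q i u1 = B 0 0" by (simp add: q_def)
     hence "(q i u1)\<^sup>2 \<simeq> 0" using zeq_pow[OF B_zero1[of 0], of 2] by simp
     hence "4 * A \<simeq> 0" using i1 zeq_sym zeq_trans by blast
     thus False using A zeq_cancel not_dvd_small[of 4] by auto
    qed
    thus ?thesis using eS by (simp add: S1_def)
   next
    case False
    hence "anti e x" using com_or_anti e xE by blast
    hence c: "x $ e $ z = - (e $ x $ z)" if "z \<in> Y" for z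
     using that anti_sym by (simp add: anti_def)
    have "e $ a $ u1 = u0 \<and> e $ u0 = a $ u1"
     by (rule comps) (use eq c u0x aY u0Y eY in \<open>auto simp: act_minus add.commute\<close>)
    hence f: "e $ u0 = a $ u1" by blast
    have "i $ e $ u0 = e $ i $ u0 \<or> i $ e $ u0 = - (e $ i $ u0)"
     using com_or_anti[OF iE(1) e(1)] u0Y by (auto simp: com_def anti_def)
    hence "(q i (e $ u0))\<^sup>2 \<simeq> (B (e $ i $ u0) (e $ u0))\<^sup>2"
     using e(1) iE u0Y by (intro q_sign) auto
    moreover have "B (e $ i $ u0) (e $ u0) = q i u0"
     using B_inv[of e "i $ u0" u0] e(1) iE u0Y by (simp add: q_def)
    ultimately have "(q i u1)\<^sup>2 \<simeq> A" using qa[OF i(3) iE(1)] f by (simp add: A_def)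
    hence "4 * A \<simeq> 1 * A" using zeq_trans[OF zeq_sym[OF i1]] by simp
    hence "A \<simeq> 0" by (rule zeq_scale_eq) (simp add: not_dvd_small)
    thus ?thesis using A by blast
   qed
  qed
 qed
 moreover obtain h where h: "h \<in> K" "h $ w = w + w" using KD(8)[OF wY(1)] by blast
 ultimately obtain m n where t: "(h ^ m) ^ (3 ^ n) = 1" "h ^ m $ w = w + w"
   and cenw: "cen E w = S1"
  by (metis doubling_three_element[OF p_eq_seven h wY(1)])
 define t where "t = h ^ m"
 have tK: "t \<in> K" using SK(6)[OF h(1)] by (simp add: t_def)
 have tw: "t $ w = w + w" and t3: "t ^ (3 ^ n) = 1" using t by (auto simp: t_def)
 have tn: "t \<in> nrm K S1"
 proof -
  have "cen E (t $ w) = S1" using cen_double(1)[OF KY(1) EH(2) wY(1)] tw cenw by simp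
  thus ?thesis using cen_cj[OF E(1) KD(1) tK, of _ w] tK cenw by (simp add: nrm_def)
 qed
 have "\<not> onY1 (cj t x) x"
 proof
  assume "onY1 (cj t x) x"
  hence txc: "(\<forall>v\<in>Y1. t $ x $ v = x $ t $ v) \<or> (\<forall>v\<in>Y1. t $ x $ v = - (x $ t $ v))"
  proof -
   have "t $ x $ v = cj t x $ t $ v" for v by (simp add: cj_def act_mult)
   thus ?thesis using \<open>onY1 (cj t x) x\<close> nrm_Y1[OF tn] by (auto simp: onY1_def)
  qed
  have "\<forall>v\<in>Y1. t $ x $ v = x $ t $ v"
  proof (rule ccontr)
   assume "\<not> ?thesis"
   hence neg: "\<forall>v\<in>Y1. t $ x $ v = - (x $ t $ v)" using txc by blast
   have tY1: "t ^ k $ v \<in> Y1" if "v \<in> Y1" for k v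
    using that by (induction k) (auto simp: act_mult nrm_Y1[OF tn])
   have "t ^ k $ x $ v = (if even k then x $ t ^ k $ v else - (x $ t ^ k $ v))" if "v \<in> Y1" for k v
    using that by (induction k) (auto simp: act_mult neg tY1 act_minus)
   from this[OF u0x(2), of "3 ^ n"] have "x $ u0 = - (x $ u0)" by (simp add: t3)
   thus False using u0x u0Y not_minus by metis
  qed
  hence tx: "t $ x $ v = x $ t $ v" if "v \<in> Y1" for v using that by blast
  have tY: "t $ u0 \<in> Y" "t $ a $ u1 \<in> Y" using tK u0Y aY by auto
  have "t $ u0 + t $ a $ u1 = (u0 + u0) + (a $ u1 + a $ u1)"
   using tw by (simp add: w_def act_add algebra_simps)
  hence "t $ u0 = u0 + u0 \<and> t $ a $ u1 = a $ u1 + a $ u1"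
   by (rule comps) (use tx[of u0] tx[of "a $ u1"] u0x aY u0Y tY in \<open>auto simp: act_add act_minus\<close>)
  hence tu: "t $ u0 = u0 + u0" "t $ a $ u1 = a $ u1 + a $ u1" by auto
  have tKp: "t \<in> Kp" using R(4)[OF tK u0(1) u0Y(2)] tu by simp
  \<comment> \<open>Since \<open>t\<close> would double both components, its conjugate
    \<open>e\<close> of \<open>i\<close> has squared value \<open>2 A\<close> at \<open>u0\<close>,
    so it is \<open>j\<close> up to sign on \<open>Yp\<close>. At the other component its squared
    value is \<open>16 * 4 A\<close>, that is \<open>A\<close>, while \<open>j\<close> gives
    \<open>2 A\<close>.\<close>
  define e where "e = cj (inverse t) i"
  have e: "e \<in> ES" "sqm e" "e \<in> E"
   using ES_cj[OF subgrpD(3)[OF GP(1) tKp] i(1)] sqm_cj[OF SK(3)[OF tK] i(2)] ES_E by (auto simp: e_def)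
  have eu0: "q e u0 \<simeq> 4 * q i u0"
   using q_conj[OF tK iE(1) u0Y(1)] q_double[OF iE(1) u0Y(1)] tu by (simp add: e_def)
  have eu1: "q e (a $ u1) \<simeq> 4 * q i (a $ u1)"
   using q_conj[OF tK iE(1) aY(2)] q_double[OF iE(1) aY(2)] tu by (simp add: e_def)
  have e0: "(q e u0)\<^sup>2 \<simeq> 2 * A"
  proof -
   have "(q e u0)\<^sup>2 \<simeq> 16 * A" using zeq_pow[OF eu0, of 2] by (simp add: A_def power_mult_distrib)
   also have "\<dots> \<simeq> 2 * A" by (rule zeq_seven[of _ _ "2 * A"]) simp
   finally show ?thesis .
  qed
  have on_sq: "(q e u0)\<^sup>2 \<simeq> (q f u0)\<^sup>2" if "onYp e f" "f \<in> E" for f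
   using q_onYp[OF that(1) e(3) that(2) u0(1)] zeq_pow[of "q e u0" "q f u0" 2] zeq_pow[of "q e u0" "- q f u0" 2]
   by auto
  have "\<not> onYp e i"
  proof
   assume "onYp e i"
   hence "2 * A \<simeq> 1 * A" using zeq_trans[OF zeq_sym[OF e0] on_sq[of i]] iE by (simp add: A_def)
   thus False using zeq_scale_eq[of 2 A 1] A not_dvd_small[of 1] by simp
  qed
  moreover have "\<not> onYp e (i * j)"
  proof
   assume "onYp e (i * j)"
   hence "(q e u0)\<^sup>2 \<simeq> 4 * A" using on_sq[of "i * j"] iE aj0(2) zeq_trans by blast
   hence "4 * A \<simeq> 2 * A" using e0 zeq_sym zeq_trans by blast
   thus False using zeq_scale_eq[of 4 A 2] A not_dvd_small[of 2] by simp
  qed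
  moreover have "\<not> onYp e 1" using onYp_not_sqm e by blast
  ultimately have ej: "onYp e j"
   using ES_commuting[OF i(1,2) e(1)] ES_anticommuting[OF i(1,2) j(1,2) aj e(1)] com_or_anti e iE by blast
  have "(q e (a $ u1))\<^sup>2 \<simeq> (B (a $ j $ u1) (a $ u1))\<^sup>2"
  proof (rule q_sign)
   have "e $ a $ u1 = a $ e $ u1 \<or> e $ a $ u1 = - (a $ e $ u1)"
    using com_or_anti[OF e(3) xa(2)] u1 by (auto simp: com_def anti_def)
   moreover have "e $ u1 = j $ u1 \<or> e $ u1 = - (j $ u1)" using ej u1 by (auto simp: onYp_def)
   ultimately show "e $ a $ u1 = a $ j $ u1 \<or> e $ a $ u1 = - (a $ j $ u1)"
    by (auto simp: act_minus)
  qed (use iE u1 xa in auto)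
  also have "B (a $ j $ u1) (a $ u1) = q j u1"
   using B_inv[of a "j $ u1" u1] xa iE u1 by (simp add: q_def)
  finally have l: "(q e (a $ u1))\<^sup>2 \<simeq> 2 * A" using j1 zeq_trans by blast
  have "(q e (a $ u1))\<^sup>2 \<simeq> 16 * (q i u1)\<^sup>2"
   using zeq_pow[OF eu1, of 2] qa[OF i(3) iE(1)] by (simp add: power_mult_distrib)
  also have "\<dots> \<simeq> 16 * (4 * A)" by (intro zeq_mult zeq_refl i1)
  also have "\<dots> \<simeq> 1 * A" by (rule zeq_seven[of _ _ "9 * A"]) simp
  finally have "2 * A \<simeq> 1 * A" using l zeq_sym zeq_trans by blast
  thus False using zeq_scale_eq[of 2 A 1] A not_dvd_small[of 1] by simp
 qed
 thus ?thesis using tn t3 by blast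
qed

end

text \<open>Galois: a solvable group that is transitive on five points contains no element fixing exactly two
  of them.\<close>

lemma no_solvable_five:
 fixes \<pi> :: "'g::group_mult \<Rightarrow> 'x \<Rightarrow> 'x"
 assumes K: "subgrp K" "finite K" "solv K" and X: "card X = 5"
  and \<pi>: "\<And>g y. g \<in> K ==> y \<in> X ==> \<pi> g y \<in> X" "\<And>g h y. g \<in> K ==> h \<in> K ==> y \<in> X ==> \<pi> (g * h) y = \<pi> g (\<pi> h y)"
   "\<And>y. y \<in> X ==> \<pi> 1 y = y"
  and mv: "\<And>y. y \<in> X ==> \<exists>t\<in>K. \<exists>n. t ^ (3 ^ n) = 1 \<and> \<pi> t y \<noteq> y"
 shows False
proof -
 note SK = subgrpD[OF K(1)]
 have fX: "finite X" using X card.infinite by force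
 have inv: "\<pi> (inverse g) (\<pi> g y) = y" "\<pi> g (\<pi> (inverse g) y) = y" if "g \<in> K" "y \<in> X" for g y
  using \<pi>(2)[of "inverse g" g y] \<pi>(2)[of g "inverse g" y] \<pi>(3) SK that by auto
 have inj: "y = z" if "\<pi> g y = \<pi> g z" "g \<in> K" "y \<in> X" "z \<in> X" for g y z
  using inv(1) that by metis
 have pow: "\<pi> (g ^ n) y = (\<pi> g ^^ n) y" if "g \<in> K" "y \<in> X" for g n y
  using that by (induction n) (auto simp: \<pi>(2,3) SK(6))
 have orb3: "card ((\<lambda>k. \<pi> k y) ` K) \<ge> 3" if y: "y \<in> X" for y
 proof -
  obtain t n where t: "t \<in> K" "t ^ (3 ^ n) = 1" "\<pi> t y \<noteq> y" using mv[OF y] by blast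
  have ne: "\<pi> t (\<pi> t y) \<noteq> y"
  proof
   assume e: "\<pi> t (\<pi> t y) = y"
   have "(\<pi> t ^^ k) y = (if even k then y else \<pi> t y)" for k
    by (induction k) (auto simp: e)
   from this[of "3 ^ n"] show False using pow[OF t(1) y, of "3 ^ n"] t \<pi>(3)[OF y] by auto
  qed
  have "\<pi> t (\<pi> t y) \<noteq> \<pi> t y" using inj[OF _ t(1) \<pi>(1)[OF t(1) y] y] t(3) by blast
  hence "card {y, \<pi> t y, \<pi> t (\<pi> t y)} = 3" using t(3) ne by auto
  moreover have "{y, \<pi> t y, \<pi> t (\<pi> t y)} \<subseteq> (\<lambda>k. \<pi> k y) ` K"
  proof -
   have "y = \<pi> 1 y" "\<pi> t (\<pi> t y) = \<pi> (t * t) y" using \<pi>(2,3) t(1) y by auto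
   thus ?thesis using SK t(1) by (metis (no_types, lifting) empty_subsetI imageI insert_subset)
  qed
  ultimately show ?thesis using card_mono[OF finite_imageI[OF K(2)]] by metis
 qed
 \<comment> \<open>Each orbit has at least three points, since an element of 3-power order moves one
   of them, and five points have no room for two such orbits.\<close>
 have trans: "\<exists>k\<in>K. \<pi> k y = z" if yz: "y \<in> X" "z \<in> X" for y z
 proof (rule ccontr)
  assume n: "\<not> ?thesis"
  have "(\<lambda>k. \<pi> k y) ` K \<inter> (\<lambda>k. \<pi> k z) ` K = {}"
  proof (rule ccontr)
   assume "\<not> ?thesis"
   then obtain k l where kl: "k \<in> K" "l \<in> K" "\<pi> k y = \<pi> l z" by auto
   hence "\<pi> (inverse l * k) y = z" using \<pi>(2)[of "inverse l" k y] SK yz inv(1) by auto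
   thus False using n SK kl by blast
  qed
  hence "card ((\<lambda>k. \<pi> k y) ` K \<union> (\<lambda>k. \<pi> k z) ` K) \<ge> 6"
   using orb3[OF yz(1)] orb3[OF yz(2)] K(2) by (simp add: card_Un_disjoint)
  moreover have "card ((\<lambda>k. \<pi> k y) ` K \<union> (\<lambda>k. \<pi> k z) ` K) \<le> card X"
   using \<pi>(1) yz by (intro card_mono fX) auto
  ultimately show False using X by simp
 qed
 define N where "N = {k \<in> K. \<forall>y\<in>X. \<pi> k y = y}"
 obtain y0 where y0: "y0 \<in> X" using X by fastforce
 obtain t n where t: "t \<in> K" "t ^ (3 ^ n) = 1" "\<pi> t y0 \<noteq> y0" using mv[OF y0] by blast
 have "normal_in K K" using K(1) SK by (auto simp: normal_in_def)
 moreover have "1 \<in> N" using SK \<pi>(3) by (simp add: N_def)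
 moreover have "\<not> K \<subseteq> N" using t y0 by (auto simp: N_def)
 ultimately obtain M where M: "normal_in M K" "\<not> M \<subseteq> N" "\<And>x y. x \<in> M ==> y \<in> M ==> cmt x y \<in> N"
  using solv_normal_section[OF K(1) _ K(3), of N] by metis
 have MK: "m \<in> K" if "m \<in> M" for m using M(1) that by (auto simp: normal_in_def)
 have SM: "subgrp M" using M(1) by (simp add: normal_in_def)
 have Mc: "\<pi> m (\<pi> n y) = \<pi> n (\<pi> m y)" if "m \<in> M" "n \<in> M" "y \<in> X" for m n y
 proof -
  have "m * n = cmt m n * (n * m)" by (rule cmt_swap)
  hence "\<pi> m (\<pi> n y) = \<pi> (cmt m n) (\<pi> (n * m) y)"
   using \<pi>(2)[of m n y] \<pi>(2)[of "cmt m n" "n * m" y] SK(2) MK that M(3)[of m n] by (auto simp: N_def)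
  also have "\<dots> = \<pi> n (\<pi> m y)"
   using M(3)[of m n] \<pi>(1,2) MK that SK(2) by (auto simp: N_def)
  finally show ?thesis .
 qed
 define Ob where "Ob y = (\<lambda>m. \<pi> m y) ` M" for y
 have finM: "finite M" by (rule finite_subset[OF _ K(2)]) (use MK in blast)
 have ObX: "Ob y \<subseteq> X" if "y \<in> X" for y using \<pi>(1) MK that by (auto simp: Ob_def)
 have ob_self: "y \<in> Ob y" if "y \<in> X" for y
  using \<pi>(3)[OF that] subgrpD(1)[OF SM] by (force simp: Ob_def)
 have ob_eq: "Ob y = Ob z" if zy: "z \<in> Ob y" "y \<in> X" for y z
 proof -
  obtain m where m: "m \<in> M" "z = \<pi> m y" using zy by (auto simp: Ob_def)
  have "\<pi> m' z \<in> Ob y" if "m' \<in> M" for m'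
   using \<pi>(2)[of m' m y] m MK that \<open>y \<in> X\<close> subgrpD(2)[OF SM] by (force simp: Ob_def)
  moreover have "\<pi> m' y \<in> Ob z" if "m' \<in> M" for m'
  proof -
   have "\<pi> m' y = \<pi> (m' * inverse m) z"
    using \<pi>(2)[of m' "inverse m" z] m MK that \<open>y \<in> X\<close> SK(3) inv(1) \<pi>(1) by auto
   thus ?thesis using that m subgrpD(2,3)[OF SM] by (auto simp: Ob_def)
  qed
  ultimately show ?thesis by (auto simp: Ob_def)
 qed
 have ob_card: "card (Ob y) = card (Ob z)" if yz: "y \<in> X" "z \<in> X" for y z
 proof -
  obtain k where k: "k \<in> K" "\<pi> k y = z" using trans yz by blast
  have "Ob z = \<pi> k ` Ob y"
  proof -
   have "\<pi> k (\<pi> m y) = \<pi> (cj k m) z" if "m \<in> M" for m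
   proof -
    have "cj k m * k = k * m" by (simp add: cj_def group_norm)
    moreover have "cj k m \<in> K" using SK(4) k MK that by blast
    ultimately show ?thesis using \<pi>(2)[of "cj k m" k y] \<pi>(2)[of k m y] k MK that yz by auto
   qed
   hence "\<pi> k ` Ob y = (\<lambda>m. \<pi> m z) ` cj k ` M" unfolding Ob_def image_image by auto
   moreover have "cj k ` M = M"
    using M(1) k SK(3) cj_left_inv(2)[of k] unfolding normal_in_def by (metis (no_types, lifting) image_eqI image_subset_iff subsetI subset_antisym)
   ultimately show ?thesis by (simp add: Ob_def)
  qed
  moreover have "inj_on (\<pi> k) (Ob y)" using inj k(1) ObX[OF yz(1)] by (meson inj_onI subsetD)
  ultimately show ?thesis by (simp add: card_image)
 qed
 \<comment> \<open>\<open>M\<close> is normal in a transitive group, so its orbits have equal size;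
   this size divides 5 and is not 1.\<close>
 have ob_X: "Ob y = X" if y: "y \<in> X" for y
 proof -
  obtain m z where mz: "m \<in> M" "z \<in> X" "\<pi> m z \<noteq> z" using M(2) MK by (auto simp: N_def)
  have "card (Ob z) \<noteq> 1"
  proof
   assume "card (Ob z) = 1"
   then obtain c where "Ob z = {c}" by (auto simp: card_1_singleton_iff)
   moreover have "\<pi> m z \<in> Ob z" using mz by (auto simp: Ob_def)
   ultimately show False using ob_self[OF mz(2)] mz(3) by auto
  qed
  hence n1: "card (Ob y) \<noteq> 1" using ob_card[OF y mz(2)] by simp
  have "card (Ob y) * card (Ob ` X) = card (\<Union> (Ob ` X))"
  proof (rule card_partition)
   show "finite (\<Union> (Ob ` X))" using fX finM by (auto simp: Ob_def)
   show "c \<inter> d = {}" if cd: "c \<in> Ob ` X" "d \<in> Ob ` X" "c \<noteq> d" for c d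
   proof (rule ccontr)
    assume "c \<inter> d \<noteq> {}"
    then obtain e where "e \<in> c" "e \<in> d" by blast
    hence "c = Ob e" "d = Ob e" using cd(1,2) ob_eq by blast+
    thus False using cd(3) by blast
   qed
   show "card c = card (Ob y)" if "c \<in> Ob ` X" for c using that ob_card[OF _ y] by blast
  qed (use fX in blast)
  moreover have "\<Union> (Ob ` X) = X" using ObX ob_self by blast
  ultimately have "card (Ob y) * card (Ob ` X) = 5" using X by simp
  hence "card (Ob y) dvd 5" by (metis dvd_triv_left)
  moreover have "prime (5::nat)" by simp
  ultimately have "card (Ob y) = 5" using n1 prime_nat_iff by blast
  thus ?thesis using card_subset_eq[OF fX ObX[OF y]] X by simp
 qed
 have fixall: "\<pi> m z = z" if my: "m \<in> M" "y \<in> X" "\<pi> m y = y" "z \<in> X" for m y z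
 proof -
  obtain n where "n \<in> M" "z = \<pi> n y" using ob_X[OF my(2)] my(4) by (auto simp: Ob_def)
  thus ?thesis using Mc my by metis
 qed
 have "int 3 dvd int (card X) - int (card {y \<in> X. \<pi> t y = y})"
  by (rule card_fixpoints_cong[where n = n]) (use fX \<pi> t pow[OF t(1), symmetric] in auto)
 hence "3 dvd 5 - int (card {y \<in> X. \<pi> t y = y})" using X by simp
 moreover have "card {y \<in> X. \<pi> t y = y} \<le> 4"
 proof -
  have "card {y \<in> X. \<pi> t y = y} \<le> card (X - {y0})" using t(3) by (intro card_mono) (auto simp: fX)
  thus ?thesis using X y0 fX by simp
 qed
 ultimately have c2: "card {y \<in> X. \<pi> t y = y} = 2" by presburger
 then obtain P0 P1 where P: "{y \<in> X. \<pi> t y = y} = {P0, P1}" "P0 \<noteq> P1" by (auto simp: card_2_iff)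
 hence PX: "P0 \<in> X" "P1 \<in> X" "\<pi> t P0 = P0" "\<pi> t P1 = P1" by auto
 obtain m where m: "m \<in> M" "\<pi> m P0 = P1" using ob_X[OF PX(1)] PX(2) by (auto simp: Ob_def)
 \<comment> \<open>\<open>m\<close> and its conjugate by \<open>t\<close> both send
   \<open>P0\<close> to \<open>P1\<close>. A transitive commutative action is regular, so they agree
   and \<open>m\<close> commutes with \<open>t\<close>. Hence \<open>m\<close> exchanges the two
   fixed points of \<open>t\<close> and acts as an involution, which must fix one of five
   points.\<close>
 have tm: "\<pi> t (\<pi> m z) = \<pi> m (\<pi> t z)" if z: "z \<in> X" for z
 proof -
  define c where "c = cj t m"
  have c: "c \<in> M" using M(1) t(1) m(1) by (auto simp: c_def normal_in_def)
  have ct: "\<pi> c (\<pi> t z) = \<pi> t (\<pi> m z)" if "z \<in> X" for z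
  proof -
   have "c * t = t * m" by (simp add: c_def cj_def group_norm)
   thus ?thesis using \<pi>(2)[of c t z] \<pi>(2)[of t m z] c MK m(1) t(1) that by auto
  qed
  have "\<pi> c P0 = P1" using ct[OF PX(1)] PX m(2) by simp
  hence "\<pi> (inverse m * c) P0 = P0"
   using \<pi>(2)[of "inverse m" c P0] SK(3) MK m c PX inv(1)[of m P0] by auto
  hence "\<pi> (inverse m * c) (\<pi> t z) = \<pi> t z"
   using fixall[of "inverse m * c" P0 "\<pi> t z"] subgrpD(2,3)[OF SM] m c PX \<pi>(1) t(1) z by blast
  hence "\<pi> (inverse m) (\<pi> c (\<pi> t z)) = \<pi> t z"
   using \<pi>(2)[of "inverse m" c "\<pi> t z"] SK(3) MK m c \<pi>(1) t(1) z by auto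
  hence "\<pi> c (\<pi> t z) = \<pi> m (\<pi> t z)"
   using inv(2)[of m "\<pi> c (\<pi> t z)"] MK m c \<pi>(1) t(1) z by auto
  thus ?thesis using ct[OF z] by simp
 qed
 have mP: "\<pi> m P1 \<in> X" using \<pi>(1) MK m PX by auto
 have "\<pi> t (\<pi> m P1) = \<pi> m P1" using tm[OF PX(2)] PX by simp
 hence "\<pi> m P1 \<in> {P0, P1}" using P(1) mP by blast
 moreover have "\<pi> m P1 \<noteq> P1" using inj[of m P1 P0] m MK PX P(2) by auto
 ultimately have mm: "\<pi> m P1 = P0" by blast
 have m2: "\<pi> m (\<pi> m z) = z" if "z \<in> X" for z
 proof -
  have "\<pi> (m * m) P0 = P0" using \<pi>(2)[of m m P0] m mm MK PX by auto
  hence "\<pi> (m * m) z = z" using fixall[of "m * m" P0 z] subgrpD(2)[OF SM] m PX that by blast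
  thus ?thesis using \<pi>(2)[of m m z] m MK that by auto
 qed
 have "int 2 dvd int (card X) - int (card {y \<in> X. \<pi> m y = y})"
 proof (rule card_fixpoints_cong[where n = 1])
  show "(\<pi> m ^^ 2 ^ 1) z = z" if "z \<in> X" for z using m2[OF that] by (simp add: numeral_2_eq_2)
 qed (use fX \<pi> m MK in auto)
 hence "card {y \<in> X. \<pi> m y = y} \<noteq> 0" using X by presburger
 then obtain z where "z \<in> X" "\<pi> m z = z"
  by (metis (mono_tags, lifting) card.empty empty_Collect_eq)
 hence "\<pi> m P0 = P0" using fixall m PX by blast
 thus False using m P by simp
qed

context prim_conf begin

lemma S1_S_card: "card S = 2 * card S1"
proof -
 have xi: "inverse x \<in> S" using xa subgrpD[OF S_E(2)] by blast
 have "S = S1 \<union> (\<lambda>s. inverse x * s) ` S1"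
 proof
  show "S \<subseteq> S1 \<union> (\<lambda>s. inverse x * s) ` S1"
  proof
   fix s assume "s \<in> S"
   thus "s \<in> S1 \<union> (\<lambda>s. inverse x * s) ` S1"
    using S_split[of s] by (auto simp: image_iff group_left_cancel1 intro!: bexI[of _ "x * s"])
  qed
  show "S1 \<union> (\<lambda>s. inverse x * s) ` S1 \<subseteq> S" using S1_S xi subgrpD(2)[OF S_E(2)] by auto
 qed
 moreover have "S1 \<inter> (\<lambda>s. inverse x * s) ` S1 = {}"
 proof (rule ccontr)
  assume "\<not> ?thesis"
  then obtain s where s: "s \<in> S1" "inverse x * s \<in> S1" by auto
  hence "inverse x \<in> S1" using subgrp_mult_iff(2)[OF S1_subgrp s(1)] by blast
  hence "x \<in> S1" using subgrp_inverse_iff[OF S1_subgrp] by blast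
  hence "com x a" by (rule S1_S)
  thus False using not_com_anti[of x a] xa xE by auto
 qed
 moreover have "card ((\<lambda>s. inverse x * s) ` S1) = card S1" by (rule card_image) (auto simp: inj_on_def)
 moreover have "finite S1" by (rule finite_subset[OF _ EH(4)]) (auto dest: S1_S)
 ultimately show ?thesis by (metis card_Un_disjoint finite_imageI mult_2)
qed

text \<open>The pair \<open>y\<close>, \<open>b\<close> takes over the role of \<open>x\<close>,
  \<open>a\<close>, with a vector \<open>v'\<close> fixed by \<open>y\<close>. Comparing orders
  shows that \<open>v'\<close> is again maximal and that \<open>S1\<close> and \<open>Y1\<close>
  stay the same, so all five points are on an equal footing.\<close>

lemma point_moved_any:
 assumes y: "y \<in> E1" "sqp y" and b: "b \<in> E1" "anti y b" "sqp b"
 shows "\<exists>t\<in>nrm K S1. \<exists>n. t ^ (3 ^ n) = 1 \<and> \<not> onY1 (cj t y) y"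
proof -
 have yb: "y \<in> E" "b \<in> E" using y b E1_E by auto
 have v01: "v\<^sub>0 \<in> Y1" using Yp_Y1 R(3) .
 obtain v' where v': "v' \<in> Y1" "v' \<noteq> 0" "y $ v' = v'"
 proof (cases "y $ v\<^sub>0 = - v\<^sub>0")
  case True
  have "y $ b $ v\<^sub>0 = - (b $ y $ v\<^sub>0)" using b(2) v0 by (simp add: anti_def)
  thus ?thesis using that[of "b $ v\<^sub>0"] True E1_Y1[OF b(1) v01] v0 by (simp add: act_minus)
 next
  case False
  have "v\<^sub>0 + y $ v\<^sub>0 \<noteq> 0" using False by (metis add_eq_0_iff)
  moreover have "y $ (v\<^sub>0 + y $ v\<^sub>0) = v\<^sub>0 + y $ v\<^sub>0"
   using y(2) v0 by (simp add: sqp_def act_add add.commute)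
  ultimately show ?thesis using that[of "v\<^sub>0 + y $ v\<^sub>0"] adsubD(2)[OF Y1_add v01 E1_Y1[OF y(1) v01]] by blast
 qed
 have v'Y: "v' \<in> Y" using v' Y1_Y by blast
 have finS1: "finite S1" by (rule finite_subset[OF _ EH(4)]) (auto dest: S1_S)
 have yi: "inverse y $ v' = v'" by (metis act_inverse(1) v'(3))
 have sub: "S1 \<union> (\<lambda>s. inverse y * s) ` S1 \<subseteq> cen E v'"
  using Y1_Y(2)[OF v'(1)] S1_S(2) yi yb SE by (auto simp: cen_def act_mult)
 have "S1 \<inter> (\<lambda>s. inverse y * s) ` S1 = {}"
 proof (rule ccontr)
  assume "\<not> ?thesis"
  then obtain s where s: "s \<in> S1" "inverse y * s \<in> S1" by auto
  hence "inverse y \<in> S1" using subgrp_mult_iff(2)[OF S1_subgrp s(1)] by blast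
  hence "y \<in> S1" using subgrp_inverse_iff[OF S1_subgrp] by blast
  hence "com y b" using b(1) com_sym by (auto simp: E1_def)
  thus False using not_com_anti[of y b] b yb by auto
 qed
 hence "card (S1 \<union> (\<lambda>s. inverse y * s) ` S1) = 2 * card S1"
  using finS1 by (subst card_Un_disjoint) (auto simp: card_image inj_on_def)
 moreover have "finite (cen E v')" using EH(4) by (simp add: cen_def)
 ultimately have ge: "card S \<le> card (cen E v')" using card_mono[OF _ sub] S1_S_card by simp
 interpret C: prim_conf act H V p B K Y E v' y b
 proof unfold_locales
  show "v' \<in> Y" "v' \<noteq> 0" using v' v'Y by auto
  show m: "card (cen E u) \<le> card (cen E v')" if "u \<in> Y" "u \<noteq> 0" for u
   using v0_max[OF that] ge unfolding S_def by simp
  show "b \<in> E" "anti y b" "sqp b" using yb b by auto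
  interpret M: prim_max act H V p B K Y E v' by unfold_locales (use v' v'Y m in auto)
  show "y \<in> M.S" unfolding M.S_def using v' yb by (simp add: cen_def)
 qed
 have "S1 \<subseteq> C.S1"
 proof
  fix s assume s: "s \<in> S1"
  hence "com s b" using b(1) com_sym by (auto simp: E1_def)
  thus "s \<in> C.S1" using sub s by (auto simp: C.S1_def C.S_def)
 qed
 moreover have "card C.S1 \<le> card S1"
  using C.S1_S_card S1_S_card v0_max[OF v'Y v'(2)] unfolding C.S_def S_def by simp
 moreover have "finite C.S1" by (rule finite_subset[OF _ EH(4)]) (auto dest: C.S1_S)
 ultimately have eq: "C.S1 = S1" by (metis card_seteq)
 hence "C.Y1 = Y1" by (simp add: C.Y1_def Y1_def)
 thus ?thesis using C.point_moved eq by (simp add: C.onY1_def onY1_def)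
qed

end

context prim_conf begin

lemma onY1_refl [simp]: "onY1 e e" by (simp add: onY1_def)
lemma onY1_sym: "onY1 e f ==> onY1 f e" unfolding onY1_def by (metis minus_minus)
lemma onY1_trans: "onY1 e f ==> onY1 f g ==> onY1 e g" unfolding onY1_def by (metis minus_minus)

lemma onY1_mult_right: assumes "onY1 e f" "g \<in> E1" shows "onY1 (e * g) (f * g)"
 using assms E1_Y1 by (auto simp: onY1_def act_mult)

lemma onY1_cj: assumes "onY1 e f" "k \<in> nrm K S1" shows "onY1 (cj k e) (cj k f)"
proof -
 have "inverse k \<in> nrm K S1" using subgrpD(3)[OF nrm_subgrp[OF KD(1)] assms(2)] .
 hence "inverse k $ u \<in> Y1" if "u \<in> Y1" for u using nrm_Y1 that by blast
 thus ?thesis using assms(1) by (auto simp: onY1_def cj_def act_mult act_minus)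
qed

lemma anti_not_onY1: assumes "e \<in> E1" "f \<in> E1" "anti e f" shows "\<not> onY1 e f" "\<not> onY1 e 1"
proof -
 have v: "v\<^sub>0 \<in> Y1" using Yp_Y1 R(3) .
 have a: "e $ f $ v\<^sub>0 = - (f $ e $ v\<^sub>0)" using assms(3) v0 by (simp add: anti_def)
 have "e $ f $ v\<^sub>0 \<noteq> f $ e $ v\<^sub>0"
 proof
  assume "e $ f $ v\<^sub>0 = f $ e $ v\<^sub>0"
  hence "f $ e $ v\<^sub>0 = - (f $ e $ v\<^sub>0)" using a by simp
  moreover have "f $ e $ v\<^sub>0 \<in> Y" using v0(1) E1_E[OF assms(1)] E1_E[OF assms(2)] by blast
  ultimately have "f $ e $ v\<^sub>0 = 0" using not_minus by blast
  thus False using v0 by simp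
 qed
 hence ne: "e $ f $ v\<^sub>0 = f $ e $ v\<^sub>0 ==> False" by blast
 have f: "f $ v\<^sub>0 \<in> Y1" using E1_Y1[OF assms(2) v] .
 show "\<not> onY1 e f"
  by (rule notI, rule ne, unfold onY1_def, erule disjE) (simp_all add: v f act_minus)
 show "\<not> onY1 e 1"
  by (rule notI, rule ne, unfold onY1_def, erule disjE) (simp_all add: v f act_minus)
qed

text \<open>Elements commuting with \<open>a\<close> are determined on \<open>Y1\<close>, the sum of
  \<open>Yp\<close> and its image under \<open>a\<close>, by what they do on
  \<open>Yp\<close>.\<close>

lemma ES_onY1: assumes "e \<in> ES" "f \<in> ES" "com e a" "com f a" "onYp e f" shows "onY1 e f"
proof -
 have act2: "g $ v + g $ v = g $ (v + x $ v) + a $ g $ a $ (v - x $ v)" if "g \<in> ES" "com g a" "v \<in> Y1" for g v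
 proof -
  have vY: "v \<in> Y" "x $ v \<in> Y" using that Y1_Y xE by auto
  hence m: "a $ (v - x $ v) \<in> Y" "a $ a $ (v - x $ v) = v - x $ v" using xa by auto
  hence "a $ g $ a $ (v - x $ v) = g $ (v - x $ v)" using that(2) unfolding com_def by metis
  thus ?thesis by (simp add: act_add act_diff)
 qed
 have "e $ v = c" if v: "v \<in> Y1" and c: "c \<in> Y" "e $ v + e $ v = c + c" for v c
 proof -
  have "e $ v \<in> Y" using Y1_Y[OF v] ES_E[OF assms(1)] by auto
  thus ?thesis using good_double_cancel[OF KY(1)] c by blast
 qed
 note eq = this
 show ?thesis
 proof (rule disjE[OF assms(5)[unfolded onYp_def]])
  assume h: "\<forall>u\<in>Yp. e $ u = f $ u"
  have "e $ v = f $ v" if v: "v \<in> Y1" for v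
   by (rule eq[OF v]) (use act2[OF assms(1,3) v] act2[OF assms(2,4) v] h Y1_decomp[OF v] ES_E[OF assms(2)] Y1_Y[OF v] in auto)
  thus ?thesis by (simp add: onY1_def)
 next
  assume h: "\<forall>u\<in>Yp. e $ u = - (f $ u)"
  have "e $ v = - (f $ v)" if v: "v \<in> Y1" for v
  proof (rule eq[OF v])
   have "e $ v + e $ v = - (f $ v + f $ v)"
    unfolding act2[OF assms(1,3) v] act2[OF assms(2,4) v] using h Y1_decomp[OF v] by (simp add: act_minus)
   thus "e $ v + e $ v = - (f $ v) + - (f $ v)" by simp
  qed (use ES_E[OF assms(2)] Y1_Y[OF v] in auto)
  thus ?thesis by (simp add: onY1_def)
 qed
qed

text \<open>The five involutions are \<open>x, a, xai, xaj, xaij\<close> with \<open>i, j\<close> generating a quaternion group.\<close>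

lemma five_points:
 "\<exists>r. (\<forall>m<(5::nat). r m \<in> E1 \<and> sqp (r m)) \<and> (\<forall>m<5. \<forall>n<5. m \<noteq> n \<longrightarrow> anti (r m) (r n)) \<and>
   (\<forall>y\<in>E1. sqp y \<longrightarrow> \<not> onY1 y 1 \<longrightarrow> (\<exists>m<5. onY1 y (r m)))"
proof -
 obtain i0 where i0: "i0 \<in> ES" "sqm i0" using ES_quaternion by blast
 obtain i where i: "i \<in> ES" "sqm i" "com i a" using adjust_ES[OF i0] by blast
 obtain u0 where u0: "u0 \<in> Yp" "\<not> q i u0 \<simeq> 0" using q_nonzero_exists[OF i(1,2)] by blast
 have u0Y: "u0 \<in> Y" "u0 \<noteq> 0" using u0 Yp_Y B_zero1[of 0] by (auto simp: q_def)
 obtain j0 where j0: "j0 \<in> ES" "sqm j0" "anti i j0"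
  using good_scaling[OF i(1,2) u0] by blast
 obtain j where j: "j \<in> ES" "sqm j" "com j a" and jj: "\<And>u. u \<in> Yp ==> j $ u = j0 $ u"
  using adjust_ES[OF j0(1,2)] by blast
 have iE: "i \<in> E" "j \<in> E" "i * j \<in> E" "i * j \<in> ES" using ES_E i j ES_mult by auto
 have aj: "anti i j"
 proof (rule ccontr)
  assume "\<not> anti i j"
  hence "com i j" using com_or_anti iE by blast
  hence "i $ j $ u0 = j $ i $ u0" using u0Y by (simp add: com_def)
  hence "i $ j0 $ u0 = j0 $ i $ u0" using jj u0(1) ES_Yp i(1) by simp
  hence "i $ j0 $ u0 = - (i $ j0 $ u0)" using j0(3) u0Y(1) unfolding anti_def by metis
  hence "i $ j0 $ u0 = 0" using not_minus[of "i $ j0 $ u0"] iE ES_E j0(1) u0Y by auto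
  thus False using u0Y by simp
 qed
 define k where "k = i * j"
 define w where "w = x * a"
 note EK = E_K
 have E: "i \<in> E" "j \<in> E" "k \<in> E" "x \<in> E" "a \<in> E" "w \<in> E"
  using iE xE xa SE by (auto simp: k_def w_def)
 have k: "k \<in> ES" "sqm k" "com k a" "anti i k" "anti j k"
  using iE(4) sqp_mult(6)[OF iE(1,2) aj i(2) j(2)] com_mult[of a i j] i j E com_sym aj anti_sym
   anti_mult1(2)[of i j i] anti_mult1(1)[of j i j] by (auto simp: k_def com_def[of i i] com_def[of j j])
 have cx: "com x e" "com a e" "com w e" "com e w" if "e \<in> ES" "com e a" for e
 proof -
  show "com x e" "com a e" using that xa com_sym by (auto simp: ES_def)
  thus "com e w" unfolding w_def using com_mult[of e x a] com_sym E EK ES_E that by blast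
  thus "com w e" by (rule com_sym)
 qed
 have w: "sqm w" "anti x w" "anti a w"
  using sqp_mult(4)[of x a] E xa x_sqp anti_mult1[of x a x] anti_mult1[of a x a] anti_sym
  by (auto simp: w_def com_def[of x x] com_def[of a a])
 have wE1: "w \<in> E1" using subgrpD(2)[OF E1_subgrp x_E1 a_E1] by (simp add: w_def)
 define r where "r m = [x, a, w * i, w * j, w * k] ! m" for m
 have pair: "anti (w * f) (w * g)" if "f \<in> ES" "com f a" "g \<in> ES" "com g a" "anti f g" for f g
 proof -
  have fg: "f \<in> E" "g \<in> E" using ES_E that by auto
  have "anti f (w * g)" by (rule anti_mult1(2)) (use that cx fg E EK in auto)
  moreover have "com w (w * g)" by (rule com_mult) (use that cx fg E EK in \<open>auto simp: com_def[of w w]\<close>)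
  ultimately show ?thesis using anti_mult1(2)[of "w * g" f w] anti_sym com_sym fg E SE(2) EK by blast
 qed
 have ends: "anti x (w * f)" "anti a (w * f)" "sqp (w * f)" "w * f \<in> E1" if "f \<in> ES" "com f a" "sqm f" for f
  using anti_mult1(1)[OF w(2) cx(1)] anti_mult1(1)[OF w(3) cx(2)] that E EK ES_E sqp_mult(2)[of w f] w cx
   subgrpD(2)[OF E1_subgrp wE1 ES_E1] by auto
 have lt5: "m = 0 \<or> m = 1 \<or> m = 2 \<or> m = 3 \<or> m = 4" if "m < 5" for m :: nat using that by auto
 have r: "r 0 = x" "r 1 = a" "r 2 = w * i" "r 3 = w * j" "r 4 = w * k" by (simp_all add: r_def)
 have prs: "anti (w * i) (w * j)" "anti (w * i) (w * k)" "anti (w * j) (w * k)"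
  using pair i j k aj by auto
 have c1: "r m \<in> E1 \<and> sqp (r m)" if "m < 5" for m
  using lt5[OF that] r x_E1 a_E1 x_sqp xa ends(3,4) i j k by metis
 have c2: "anti (r m) (r n)" if "m < n" "n < 5" for m n
 proof -
  have "m = 0 \<or> m = 1 \<or> m = 2 \<or> m = 3" "n = 1 \<or> n = 2 \<or> n = 3 \<or> n = 4" using that by auto
  thus ?thesis using that r xa(3) ends(1,2)[OF i(1,3,2)] ends(1,2)[OF j(1,3,2)] ends(1,2)[OF k(1,3,2)] prs
   by auto
 qed
 have c3: "\<exists>m<5. onY1 y (r m)" if y: "y \<in> E1" "sqp y" "\<not> onY1 y 1" for y
 proof -
  have yE: "y \<in> E" using E1_E y by blast
  have one: "1 \<in> ES" "com 1 a" using subgrpD(1)[OF ES_subgrp] by (auto simp: com_def)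
  have ONE: "onY1 e 1" if "e \<in> ES" "com e a" "onYp e 1" for e using ES_onY1 that one by blast
  have pull: "onY1 y (f * g)" if "onY1 (y * g) f" "g \<in> E" "g \<in> E1" "sqp g \<or> sqm g" for f g
  proof -
   have "onY1 (y * g * g) (f * g)" using onY1_mult_right that by blast
   moreover have "onY1 (y * g * g) y"
    using that Y1_Y(1) E1_E by (auto simp: onY1_def act_mult sqp_def sqm_def act_minus)
   ultimately show ?thesis using onY1_sym onY1_trans by blast
  qed
  \<comment> \<open>In the four cases \<open>y\<close> is an element of \<open>ES\<close> times 1,
    \<open>x\<close>, \<open>a\<close> or \<open>x * a\<close>. Having square 1, the factor from
    \<open>ES\<close> is a sign in the first three cases and a quaternion unit in the last.\<close>
  consider "com y x" "com y a" | "com y x" "anti y a" | "anti y x" "com y a" | "anti y x" "anti y a"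
   using com_or_anti E yE by blast
  thus ?thesis
  proof cases
   case 1
   hence yS: "y \<in> ES" using com_x_ES y by blast
   hence "onYp y 1" using ES_cases not_sqp_sqm EK(1)[OF yE] y(2) by blast
   thus ?thesis using ONE yS 1 y(3) by blast
  next
   case 2
   hence yS: "y \<in> ES" using com_x_ES y by blast
   have xS: "x \<in> ES" using com_x_ES x_E1 by (auto simp: com_def)
   have s: "sqp (y * x)" using sqp_mult(1)[OF yE E(4) 2(1) y(2) x_sqp] .
   have c: "com (y * x) a" using anti_mult2[of a y x] 2 xa(3) anti_sym com_sym E EK yE by blast
   have "onYp (y * x) 1" using ES_cases[OF ES_mult[OF yS xS]] not_sqp_sqm s ES_E[OF ES_mult[OF yS xS]] EK by blast
   hence "onY1 (y * x) 1" using ONE ES_mult[OF yS xS] c by blast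
   hence "onY1 y (1 * x)" by (rule pull) (use E x_E1 x_sqp in auto)
   thus ?thesis using r(1) by (intro exI[of _ 0]) simp
  next
   case 3
   have s: "sqp (y * a)" using sqp_mult(1)[OF yE E(5) 3(2) y(2) xa(4)] .
   have c: "com (y * a) x" using anti_mult2[of x y a] 3 xa(3) anti_sym com_sym E EK yE by blast
   have cc: "com (y * a) a" using 3 com_mult[of a y a] com_sym E EK yE by (auto simp: com_def[of a a])
   have yS: "y * a \<in> ES" using com_x_ES[OF subgrpD(2)[OF E1_subgrp y(1) a_E1]] c by blast
   hence "onYp (y * a) 1" using ES_cases not_sqp_sqm s ES_E EK by blast
   hence "onY1 (y * a) 1" using ONE yS cc by blast
   hence "onY1 y (1 * a)" by (rule pull) (use E a_E1 xa in auto)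
   thus ?thesis using r(2) by (intro exI[of _ 1]) simp
  next
   case 4
   have c: "com (y * w) x" "com (y * w) a"
    using anti_mult2[of x y w] anti_mult2[of a y w] 4 w anti_sym com_sym E EK yE by blast+
   have yw: "com y w" using anti_mult2[of y x a] 4 E EK yE by (auto simp: w_def)
   have e: "y * w \<in> ES" "sqm (y * w)"
    using com_x_ES[OF subgrpD(2)[OF E1_subgrp y(1) wE1]] c(1) sqp_mult(3)[OF yE E(6) yw y(2) w(1)] by blast+
   have n1: "\<not> onYp (y * w) 1" using onYp_not_sqm e by blast
   have "onYp (y * w) i \<or> onYp (y * w) j \<or> onYp (y * w) k"
   proof (cases "com (y * w) i")
    case True
    thus ?thesis using ES_commuting[OF i(1,2) e(1)] n1 by blast
   next
    case False
    hence "anti (y * w) i" using com_or_anti E(1) ES_E[OF e(1)] by blast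
    thus ?thesis using ES_anticommuting[OF i(1,2) j(1,2) aj e(1)] unfolding k_def by blast
   qed
   hence fin: "onY1 y (f * w)" if "onYp (y * w) f" "f \<in> ES" "com f a" for f
    using pull[OF ES_onY1[OF e(1) that(2) c(2) that(3,1)] E(6) wE1] w by blast
   have "onY1 y (w * f)" if "onYp (y * w) f" "f \<in> ES" "com f a" for f
   proof -
    have "onY1 (f * w) (w * f)" using cx(4)[OF that(2,3)] Y1_Y(1) by (auto simp: onY1_def com_def act_mult)
    thus ?thesis using fin[OF that] onY1_trans by blast
   qed
   hence "onY1 y (r 2) \<or> onY1 y (r 3) \<or> onY1 y (r 4)"
    using \<open>onYp (y * w) i \<or> onYp (y * w) j \<or> onYp (y * w) k\<close> i j k r by metis
   then obtain m where "m \<in> {2, 3, 4}" "onY1 y (r m)" by blast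
   thus ?thesis by (intro exI[of _ m]) auto
  qed
 qed
 show ?thesis
 proof (intro exI[of _ r] conjI allI impI ballI)
  fix m n :: nat assume "m < 5" "n < 5" "m \<noteq> n"
  thus "anti (r m) (r n)" using c2[of m n] c2[of n m] anti_sym by (metis nat_neq_iff)
 qed (use c1 c3 in auto)
qed

text \<open>\<open>E1\<close> acts on \<open>Y1\<close> as the central product of a dihedral and a
  quaternion group of order 8. Modulo sign its noncentral involutions form five classes; the
  normaliser of \<open>S1\<close> permutes them by conjugation, and each is moved by an element of
  3-power order.\<close>

lemma not_solvable: "\<not> solv H"
proof
 assume sH: "solv H"
 define P where "P e = {f \<in> E1. onY1 f e}" for e
 define T where "T = {y \<in> E1. sqp y \<and> \<not> onY1 y 1}"
 have Peq: "P e = P f \<longleftrightarrow> onY1 e f" if "e \<in> E1" "f \<in> E1" for e f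
 proof
  assume "P e = P f"
  moreover have "e \<in> P e" using that(1) by (simp add: P_def)
  ultimately have "e \<in> P f" by simp
  thus "onY1 e f" by (simp add: P_def)
 next
  assume h: "onY1 e f"
  have "onY1 g e \<longleftrightarrow> onY1 g f" for g using onY1_trans[OF _ h] onY1_trans[OF _ onY1_sym[OF h]] by metis
  thus "P e = P f" by (simp add: P_def)
 qed
 obtain r where r0: "\<forall>m<(5::nat). r m \<in> E1 \<and> sqp (r m)" "\<forall>m<5. \<forall>n<5. m \<noteq> n \<longrightarrow> anti (r m) (r n)"
   "\<forall>y\<in>E1. sqp y \<longrightarrow> \<not> onY1 y 1 \<longrightarrow> (\<exists>m<5. onY1 y (r m))"
  using five_points by (elim exE conjE)
 hence r: "\<And>m. m < 5 ==> r m \<in> E1 \<and> sqp (r m)"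
   "\<And>m n. m < 5 ==> n < 5 ==> m \<noteq> n ==> anti (r m) (r n)"
   "\<And>y. y \<in> E1 ==> sqp y ==> \<not> onY1 y 1 ==> \<exists>m<(5::nat). onY1 y (r m)" by metis+
 have partner: "\<exists>n<5. n \<noteq> m" for m :: nat by (rule exI[of _ "if m = 0 then 1 else 0"]) auto
 have rT: "r m \<in> T" if m: "m < 5" for m
 proof -
  obtain n where n: "n < 5" "n \<noteq> m" using partner by blast
  thus ?thesis using anti_not_onY1(2)[of "r m" "r n"] r(1)[OF m] r(1)[OF n(1)] r(2)[OF m n(1)] by (auto simp: T_def)
 qed
 have PT: "P ` T = (P \<circ> r) ` {..<5}"
 proof
  show "P ` T \<subseteq> (P \<circ> r) ` {..<5}"
  proof
   fix A assume "A \<in> P ` T"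
   then obtain y where y: "A = P y" "y \<in> E1" "sqp y" "\<not> onY1 y 1" by (auto simp: T_def)
   then obtain m where "m < 5" "onY1 y (r m)" using r(3) by blast
   hence "A = P (r m)" using y Peq r(1) by blast
   thus "A \<in> (P \<circ> r) ` {..<5}" using \<open>m < 5\<close> by auto
  qed
 qed (use rT in auto)
 have "inj_on (P \<circ> r) {..<5}"
 proof (rule inj_onI)
  fix m n assume mn: "m \<in> {..<5}" "n \<in> {..<5}" "(P \<circ> r) m = (P \<circ> r) n"
  hence "onY1 (r m) (r n)" using Peq r(1) by auto
  thus "m = n" using anti_not_onY1(1) r(1,2) mn by (metis lessThan_iff)
 qed
 hence card: "card (P ` T) = 5" unfolding PT by (simp only: card_image card_lessThan)
 define G where "G = nrm K S1"
 have SG: "subgrp G" unfolding G_def by (rule nrm_subgrp[OF KD(1)])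
 have GK: "g \<in> K" if "g \<in> G" for g using that by (simp add: G_def nrm_def)
 have finG: "finite G" by (rule finite_subset[OF _ H(2)]) (use GK KD(2) in blast)
 have sG: "solv G" by (rule solv_subset[OF sH]) (use GK KD(2) in blast)
 have cjE1: "cj g e \<in> E1" if g: "g \<in> G" and e: "e \<in> E1" for g e
 proof -
  have gS: "cj g s \<in> S1 \<longleftrightarrow> s \<in> S1" for s using g by (simp add: G_def nrm_def)
  have "com (cj g e) s" if "s \<in> S1" for s
   by (rule com_cj_left[OF _ GK[OF g]]) (use e that gS[of "cj (inverse g) s"] in \<open>simp add: E1_def\<close>)
  moreover have "cj g e \<in> E" using E(1) GK[OF g] E1_E[OF e] by (auto simp: normal_in_def)
  ultimately show ?thesis by (simp add: E1_def)
 qed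
 have cjY: "onY1 (cj g e) (cj g f) \<longleftrightarrow> onY1 e f" if "g \<in> G" for g e f
  using onY1_cj[of e f g] onY1_cj[of "cj g e" "cj g f" "inverse g"] that subgrpD(3)[OF SG that] by (auto simp: G_def)
 have cjT: "cj g y \<in> T" if g: "g \<in> G" and y: "y \<in> T" for g y
 proof -
  have "sqp (cj g y)" using y sqp_cj[OF GK[OF g]] by (simp add: T_def)
  thus ?thesis using y cjE1[OF g] cjY[OF g, of y 1] by (simp add: T_def)
 qed
 have cjP: "cj g ` P e = P (cj g e)" if g: "g \<in> G" and e: "e \<in> E1" for g e
 proof
  show "cj g ` P e \<subseteq> P (cj g e)" using cjE1[OF g] cjY[OF g] by (auto simp: P_def)
  show "P (cj g e) \<subseteq> cj g ` P e"
  proof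
   fix f assume "f \<in> P (cj g e)"
   hence f: "f \<in> E1" "onY1 f (cj g e)" by (auto simp: P_def)
   have "cj (inverse g) f \<in> P e"
    using cjE1[OF subgrpD(3)[OF SG g] f(1)] cjY[OF subgrpD(3)[OF SG g], of f "cj g e"] f by (simp add: P_def)
   thus "f \<in> cj g ` P e" by (metis cj_left_inv(2) imageI)
  qed
 qed
 show False
 proof (rule no_solvable_five[OF SG finG sG card, of "\<lambda>k A. cj k ` A"])
  show "cj g ` A \<in> P ` T" if "g \<in> G" "A \<in> P ` T" for g A
   using that cjP cjT by (auto simp: T_def)
  show "\<exists>t\<in>G. \<exists>n. t ^ 3 ^ n = 1 \<and> cj t ` A \<noteq> A" if A: "A \<in> P ` T" for A
  proof -
   obtain m where m: "m < 5" "A = P (r m)" using A unfolding PT by auto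
   obtain n where n: "n < 5" "n \<noteq> m" using partner by blast
   obtain t l where t: "t \<in> G" "t ^ 3 ^ l = 1" "\<not> onY1 (cj t (r m)) (r m)"
    using point_moved_any[of "r m" "r n"] r(1)[OF m(1)] r(1)[OF n(1)] r(2)[OF m(1) n(1)] n(2) unfolding G_def by blast
   hence "cj t ` A \<noteq> A" using cjP[OF t(1)] Peq cjE1[OF t(1)] r(1)[OF m(1)] m(2) by simp
   thus ?thesis using t by blast
  qed
 qed (auto simp: image_image cj_cj)
qed

end

section \<open>The quaternion group of a solvable primitive pair\<close>

locale prim_solv = prim_pair act H V p B K Y E
 for act :: "'g::group_mult \<Rightarrow> 'v::ab_group_add \<Rightarrow> 'v" (infixr "$" 75) and H V p B K Y E +
 assumes sH: "solv H"
begin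

definition onY :: "'g \<Rightarrow> 'g \<Rightarrow> bool" where
 "onY e f \<longleftrightarrow> (\<forall>u\<in>Y. e $ u = f $ u) \<or> (\<forall>u\<in>Y. e $ u = - (f $ u))"

lemma onY_refl [simp]: "onY e e" by (simp add: onY_def)
lemma onY_sym: "onY e f ==> onY f e" unfolding onY_def by (metis minus_minus)
lemma onY_trans: "onY e f ==> onY f g ==> onY e g" unfolding onY_def by (metis minus_minus)
lemma onY_mult: assumes "onY e f" "onY e' f'" "e' \<in> K" "f' \<in> K" shows "onY (e * e') (f * f')"
proof -
 have "onY (e * e') (f * e')" using assms by (auto simp: onY_def act_mult)
 moreover have "onY (f * e') (f * f')" using assms(2) by (auto simp: onY_def act_mult act_minus)
 ultimately show ?thesis by (rule onY_trans)
qed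
lemma onY_cj: assumes "onY e f" "k \<in> K" shows "onY (cj k e) (cj k f)"
proof -
 have "inverse k $ u \<in> Y" if "u \<in> Y" for u using SK(3)[OF assms(2)] that by blast
 thus ?thesis using assms(1) by (auto simp: onY_def cj_def act_mult act_minus)
qed
lemma onY_cj_iff: assumes "b \<in> K"
 shows "onY (cj b k) e \<longleftrightarrow> (\<forall>u\<in>Y. b $ k $ u = e $ b $ u) \<or> (\<forall>u\<in>Y. b $ k $ u = - (e $ b $ u))"
proof -
 have s: "(\<forall>u\<in>Y. P u) \<longleftrightarrow> (\<forall>u\<in>Y. P (b $ u))" for P
  using Y_closed(5)[OF assms] Y_closed(5)[OF SK(3)[OF assms]] by (metis act_inverse(2))
 show ?thesis unfolding onY_def s[of "\<lambda>u. cj b k $ u = e $ u"] s[of "\<lambda>u. cj b k $ u = - (e $ u)"]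
  by (simp add: cj_def act_mult)
qed
lemma onY_anti: "anti e f ==> onY (e * f) (f * e)" by (auto simp: onY_def anti_def act_mult)
lemma onY_sqm: "sqm e ==> onY (e * e) 1" by (auto simp: onY_def sqm_def act_mult)
lemma onY_one: "e \<in> K ==> onY e 1 \<longleftrightarrow> e \<in> zs K Y" by (auto simp: onY_def zs_def)
lemma onY_com: assumes "onY e f" "com f g" "g \<in> K" shows "com e g"
 using assms by (auto simp: onY_def com_def act_minus)

lemma E_cj: "k \<in> K ==> e \<in> E ==> cj k e \<in> E" using E(1) by (auto simp: normal_in_def)

text \<open>Solvability excludes the dihedral case, so \<open>S\<close> acts trivially and
  everything known on \<open>Yp\<close> holds on \<open>Y\<close>.\<close>

lemma faithful_max_exists:
 "\<exists>v\<^sub>0. prim_max act H V p B K Y E v\<^sub>0 \<and> (\<forall>s\<in>cen E v\<^sub>0. \<forall>v\<in>Y. s $ v = v)"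
proof -
 have fin: "finite ((\<lambda>v. card (cen E v)) ` (Y - {0}))"
  using V(2) KD(5) finite_subset by (meson finite_imageI finite_Diff subsetI)
 have ne: "(\<lambda>v. card (cen E v)) ` (Y - {0}) \<noteq> {}" using KD(6) by blast
 obtain v0 where v0: "v0 \<in> Y" "v0 \<noteq> 0" "Max ((\<lambda>v. card (cen E v)) ` (Y - {0})) = card (cen E v0)"
  using Max_in[OF fin ne] by blast
 have mx: "card (cen E u) \<le> card (cen E v0)" if "u \<in> Y" "u \<noteq> 0" for u
  using Max_ge[OF fin, of "card (cen E u)"] that v0(3) by auto
 interpret M: prim_max act H V p B K Y E v0 by unfold_locales (use v0 mx in auto)
 have "\<forall>s\<in>M.S. \<forall>v\<in>Y. s $ v = v"
 proof (rule ccontr)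
  assume "\<not> ?thesis"
  then obtain x a where c: "x \<in> M.S" "a \<in> E" "anti x a" "sqp a" using M.config_exists by blast
  interpret C: prim_conf act H V p B K Y E v0 x a by unfold_locales (fact c)+
  show False using C.not_solvable sH by blast
 qed
 thus ?thesis using M.prim_max_axioms unfolding M.S_def by blast
qed

lemma quaternion_action:
 shows "\<exists>i\<in>E. sqm i"
  and "i \<in> E ==> sqm i ==> e \<in> E ==> com e i ==> onY e 1 \<or> onY e i"
  and "i \<in> E ==> sqm i ==> j \<in> E ==> sqm j ==> anti i j ==> e \<in> E ==> anti e i ==> onY e j \<or> onY e (i * j)"
  and "i \<in> E ==> sqm i ==> \<exists>h\<in>K. anti i (cj h i) \<and> anti (cj h i) (cj h (cj h i)) \<and> \<not> onY (cj h (cj h i)) i"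
proof -
 obtain v0 where v0: "prim_max act H V p B K Y E v0" "\<forall>s\<in>cen E v0. \<forall>v\<in>Y. s $ v = v"
  using faithful_max_exists by blast
 interpret M: prim_max act H V p B K Y E v0 by (rule v0(1))
 have S: "M.S = cen E v0" by (simp add: M.S_def)
 have Yp: "M.Yp = Y" using v0(2) by (auto simp: M.Yp_def S fixed_def)
 have ES: "M.ES = E" using v0(2) by (auto simp: M.ES_def S com_def)
 have on: "M.onYp e f = onY e f" for e f by (simp add: M.onYp_def onY_def Yp)
 show "\<exists>i\<in>E. sqm i" using M.ES_quaternion ES by simp
 show c1: "onY e 1 \<or> onY e i" if "i \<in> E" "sqm i" "e \<in> E" "com e i" for e i
  using M.ES_commuting[of i e] that by (simp add: ES on)
 show "onY e j \<or> onY e (i * j)" if "i \<in> E" "sqm i" "j \<in> E" "sqm j" "anti i j" "e \<in> E" "anti e i"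
  using M.ES_anticommuting[of i j e] that by (simp add: ES on)
 show "\<exists>h\<in>K. anti i (cj h i) \<and> anti (cj h i) (cj h (cj h i)) \<and> \<not> onY (cj h (cj h i)) i" if i: "i \<in> E" "sqm i"
 proof -
  obtain u where u: "u \<in> Y" "\<not> M.q i u \<simeq> 0" using M.q_nonzero_exists[of i] i by (auto simp: ES Yp)
  \<comment> \<open>Conjugation by \<open>inverse h\<close> multiplies the values at
    \<open>u\<close> by 4. Neither 4 nor 16 is 1 or -1 modulo 7, so the first two successive
    conjugates of \<open>i\<close> differ from \<open>i\<close> even up to sign.\<close>
  obtain h where h: "h \<in> K" "h $ u = u + u" using KD(8)[OF u(1)] by blast
  have ih: "inverse h \<in> K" using SK(3)[OF h(1)] .
  define j k where "j = cj (inverse h) i" and "k = cj (inverse h) j"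
  have jE: "j \<in> E" "k \<in> E" using E_cj[OF ih] i by (auto simp: j_def k_def)
  have qs: "M.q (cj (inverse h) e) u \<simeq> 4 * M.q e u" if "e \<in> E" for e
   using M.q_conj[OF h(1) that u(1)] M.q_double[OF that u(1)] h(2) by simp
  have qj: "M.q j u \<simeq> 4 * M.q i u" using qs i by (simp add: j_def)
  have "M.q k u \<simeq> 4 * M.q j u" using qs jE(1) by (simp add: k_def)
  also have "\<dots> \<simeq> 4 * (4 * M.q i u)" by (intro zeq_mult zeq_refl qj)
  finally have qk: "M.q k u \<simeq> 16 * M.q i u" by simp
  have no: "\<not> onY e i" if "M.q e u \<simeq> c * M.q i u" "\<not> int p dvd c - 1" "\<not> int p dvd c + 1" "e \<in> E" for e c
  proof
   assume "onY e i"
   hence "M.q e u \<simeq> 1 * M.q i u \<or> M.q e u \<simeq> (- 1) * M.q i u"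
    using M.q_onYp[of e i u] on that(4) i u by (simp add: Yp)
   hence "c * M.q i u \<simeq> 1 * M.q i u \<or> c * M.q i u \<simeq> (- 1) * M.q i u"
    using zeq_trans[OF zeq_sym[OF that(1)]] by blast
   thus False using zeq_scale_eq[of c "M.q i u" 1] zeq_scale_eq[of c "M.q i u" "- 1"] that u(2) by auto
  qed
  have nj: "\<not> onY j i" using no[OF qj _ _ jE(1)] by (simp add: M.p_eq_seven)
  have nk: "\<not> onY k i" using no[OF qk _ _ jE(2)] by (simp add: M.p_eq_seven)
  have "\<not> onY j 1" using M.onYp_not_sqm[of j] sqm_cj[OF ih i(2)] jE(1) unfolding ES on j_def by blast
  hence "\<not> com j i" using c1 i jE nj by blast
  hence a: "anti i j" using com_or_anti i jE anti_sym by blast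
  hence "anti j k" using anti_cj[OF ih] by (simp add: k_def j_def)
  thus ?thesis using a nk ih unfolding k_def j_def by blast
 qed
qed

lemma quaternion_action_cases:
 assumes "i \<in> E" "sqm i" "j \<in> E" "sqm j" "anti i j" "e \<in> E"
 shows "onY e 1 \<or> onY e i \<or> onY e j \<or> onY e (i * j)"
 using quaternion_action(2)[of i e] quaternion_action(3)[of i j e] com_or_anti[of e i] assms by blast

text \<open>Otherwise a nonscalar section \<open>X1\<close> of the centraliser of \<open>E\<close>,
  abelian modulo scalars, can be multiplied to \<open>E\<close>, and the description as a quaternion
  group applies to the product \<open>E2\<close>. An element of \<open>X1\<close> commutes with
  \<open>i\<close>, so up to sign it is 1 or \<open>i\<close>; but \<open>i\<close> does not commute
  with all of \<open>E\<close>.\<close>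

lemma centralizer_central:
 assumes x: "x \<in> K" "\<And>e. e \<in> E ==> com x e" shows "x \<in> zs K Y"
proof (rule ccontr)
 assume nx: "x \<notin> zs K Y"
 define X where "X = {x \<in> K. \<forall>e\<in>E. com x e}"
 have SX: "subgrp X" unfolding X_def by (rule commutant_subgrp[OF KD(1)]) (use EH in auto)
 have NX: "normal_in X K"
  using SX SK(3,4) E_cj by (auto simp: normal_in_def X_def intro!: com_cj_left)
 have sX: "solv X" by (rule solv_subset[OF sH]) (use KD(3) in \<open>auto simp: X_def\<close>)
 have one: "1 \<in> zs K Y" using SK(1) by (simp add: zs_def)
 have "\<not> X \<subseteq> zs K Y" using nx x by (auto simp: X_def)
 then obtain X1 where X1: "normal_in X1 K" "X1 \<subseteq> X" "\<not> X1 \<subseteq> zs K Y" "\<And>x y. x \<in> X1 ==> y \<in> X1 ==> cmt x y \<in> zs K Y"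
  using solv_normal_section[OF KD(1) NX sX one] by metis
 have X1K: "x \<in> K" "e \<in> E ==> com x e" if "x \<in> X1" for x e using that X1(2) by (auto simp: X_def)
 have SX1: "subgrp X1" using X1(1) by (simp add: normal_in_def)
 note S1 = subgrpD[OF SX1]
 define E2 where "E2 = {e * y | e y. e \<in> E \<and> y \<in> X1}"
 have EE2: "e \<in> E2" if "e \<in> E" for e using that S1(1) unfolding E2_def by (metis (mono_tags, lifting) mem_Collect_eq mult_1_right)
 have XE2: "y \<in> E2" if "y \<in> X1" for y using that SE(1) unfolding E2_def by (metis (mono_tags, lifting) mem_Collect_eq mult_1_left)
 have cjX1: "cj g y \<in> X1" if "g \<in> K" "y \<in> X1" for g y using X1(1) that by (auto simp: normal_in_def)
 have N2: "normal_in E2 K" unfolding normal_in_def subgrp_def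
 proof (intro conjI ballI)
  show "1 \<in> E2" using EE2 SE by blast
  show "E2 \<subseteq> K" using X1K SK(2) by (auto simp: E2_def)
  show "s * t \<in> E2" if s2: "s \<in> E2" "t \<in> E2" for s t
  proof -
   obtain e y e' y' where st: "s = e * y" "t = e' * y'" "e \<in> E" "e' \<in> E" "y \<in> X1" "y' \<in> X1"
    using s2 by (auto simp: E2_def)
   have "s * t = (e * cj y e') * (y * y')" by (simp add: st cj_def group_norm)
   thus ?thesis using st S1(2) SE(2) E_cj X1K(1) unfolding E2_def by blast
  qed
  show "inverse s \<in> E2" if s2: "s \<in> E2" for s
  proof -
   obtain e y where st: "s = e * y" "e \<in> E" "y \<in> X1" using s2 by (auto simp: E2_def)
   have "inverse s = cj (inverse y) (inverse e) * inverse y" by (simp add: st cj_def group_norm)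
   thus ?thesis using st S1(3) SE(3) E_cj X1K(1) unfolding E2_def by blast
  qed
  show "cj g s \<in> E2" if s2: "g \<in> K" "s \<in> E2" for g s
  proof -
   obtain e y where st: "s = e * y" "e \<in> E" "y \<in> X1" using s2 by (auto simp: E2_def)
   thus ?thesis using cj_mult[of g e y] E_cj[OF s2(1) st(2)] cjX1[OF s2(1) st(3)] unfolding E2_def by blast
  qed
 qed
 have ca_mult: "com x (y * z) \<or> anti x (y * z)"
  if "com x y \<or> anti x y" "com x z \<or> anti x z" "x \<in> K" "y \<in> K" "z \<in> K" for x y z
  using com_mult[of x y z] anti_mult1[of x y z] anti_mult1[of x z y] anti_mult2[of x y z] that by blast
 have zs_ca: "cmt x y \<in> zs K Y" if "com x y \<or> anti x y" "x \<in> K" "y \<in> K" for x y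
 proof -
  have "inverse x \<in> K" "inverse y \<in> K" using SK that by auto
  hence "cmt x y $ v = v \<or> False" if "com x y" "v \<in> Y" for v
   using that \<open>x \<in> K\<close> \<open>y \<in> K\<close> unfolding com_def cmt_def by (simp add: act_mult)
  moreover have "cmt x y $ v = - v" if "anti x y" "v \<in> Y" for v
   using that \<open>x \<in> K\<close> \<open>y \<in> K\<close> \<open>inverse x \<in> K\<close> \<open>inverse y \<in> K\<close> unfolding anti_def cmt_def by (simp add: act_mult)
  ultimately show ?thesis using SK(5) that by (auto simp: zs_def)
 qed
 have ca_zs: "com x y \<or> anti x y" if "cmt x y \<in> zs K Y" "x \<in> K" "y \<in> K" for x y
 proof -
  have "x * y = cmt x y * (y * x)" by (rule cmt_swap)
  hence e: "x $ y $ v = cmt x y $ y $ x $ v" for v by (metis act_mult)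
  thus ?thesis using that by (auto simp: zs_def com_def anti_def)
 qed
 have E2c: "cmt s t \<in> zs K Y" if s: "s \<in> E2" and t: "t \<in> E2" for s t
 proof -
  obtain e y e' y' where st: "s = e * y" "t = e' * y'" "e \<in> E" "e' \<in> E" "y \<in> X1" "y' \<in> X1"
   using s t by (auto simp: E2_def)
  have k: "e \<in> K" "e' \<in> K" "y \<in> K" "y' \<in> K" using st X1K by auto
  have base: "com e e' \<or> anti e e'" "com e' y" "com e y'" "com y y' \<or> anti y y'"
   using com_or_anti st X1K com_sym ca_zs[OF X1(4)] by blast+
  have "com e t \<or> anti e t" unfolding st by (rule ca_mult) (use base k com_sym in auto)
  moreover have "com y t \<or> anti y t" unfolding st by (rule ca_mult) (use base k com_sym in auto)
  ultimately have "com t e \<or> anti t e" "com t y \<or> anti t y" using com_sym anti_sym by blast+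
  moreover have "t \<in> K" using k SK(2) st(2) by blast
  ultimately have "com t s \<or> anti t s" unfolding st(1) using ca_mult k(1,3) by blast
  moreover have "s \<in> K" "t \<in> K" using N2 s t unfolding normal_in_def by blast+
  ultimately show ?thesis using zs_ca[of s t] com_sym anti_sym by blast
 qed
 interpret E2: prim_solv act H V p B K Y E2
  by unfold_locales (use KY N2 E2c sH E(2) EE2 in auto)
 obtain i where i: "i \<in> E" "sqm i" using quaternion_action(1) by blast
 obtain h where h: "h \<in> K" "anti i (cj h i)" using quaternion_action(4)[OF i] by blast
 have "X1 \<subseteq> zs K Y"
 proof
  fix y assume y: "y \<in> X1"
  have "onY y 1 \<or> onY y i"
   using E2.quaternion_action(2)[OF EE2[OF i(1)] i(2) XE2[OF y] X1K(2)[OF y i(1)]] unfolding E2.onY_def onY_def .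
  moreover have "\<not> onY y i"
  proof
   assume "onY y i"
   hence "com i (cj h i)" using onY_com[OF onY_sym] X1K(2)[OF y E_cj[OF h(1) i(1)]] E_cj[OF h(1) i(1)] by blast
   thus False using h(2) not_com_anti[of i "cj h i"] i E_cj[OF h(1) i(1)] by blast
  qed
  ultimately show "y \<in> zs K Y" using onY_one X1K(1)[OF y] by blast
 qed
 thus False using X1(3) by blast
qed

end

context form_module begin

text \<open>Averaging the sign over the pairs \<open>(g, u)\<close> with \<open>g y g\<^sup>-\<^sup>1 = u y\<close> gives a class function to which
  \<open>ratl\<close> applies; it is nonzero at \<open>y\<close> unless \<open>y\<close> is conjugate to an element acting as \<open>- y\<close>.\<close>

lemma ratl_conjugate:
 assumes g: "good K Y" and r: "ratl K Y" and y: "y \<in> K" and k: "coprime k (card H)"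
  and ns: "\<And>g. g \<in> K ==> \<not> (\<forall>v\<in>Y. (cj g y * inverse y) $ v = - v)"
 shows "\<exists>g\<in>K. \<forall>v\<in>Y. (cj g (y ^ k) * inverse y) $ v = v"
proof -
 note KD = goodD[OF g] and SK = subgrpD[OF goodD(1)[OF g]]
 define \<phi> :: "'g \<Rightarrow> int" where
  "\<phi> u = (if \<forall>v\<in>Y. u $ v = v then 1 else if \<forall>v\<in>Y. u $ v = - v then - 1 else 0)" for u
 define f where "f x = (\<Sum>g\<in>K. \<phi> (cj g x * inverse y))" for x
 have vv: "\<not> (\<forall>v\<in>Y. v = - v)" using KD(6) good_eq_minus[OF g] by blast
 have \<phi>m: "\<phi> (c * u) = s * \<phi> u"
  if "c \<in> K" "u \<in> K" "(s = 1 \<and> (\<forall>v\<in>Y. c $ v = v)) \<or> (s = - 1 \<and> (\<forall>v\<in>Y. c $ v = - v))" for c u s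
 proof -
  have uY: "u $ v \<in> Y" if "v \<in> Y" for v using KD(7) \<open>u \<in> K\<close> that by blast
  from that(3) show ?thesis
  proof (elim disjE conjE)
   assume c: "s = 1" "\<forall>v\<in>Y. c $ v = v"
   hence "(c * u) $ v = u $ v" if "v \<in> Y" for v using uY that by (simp add: act_mult)
   thus ?thesis using c by (simp add: \<phi>_def)
  next
   assume c: "s = - 1" "\<forall>v\<in>Y. c $ v = - v"
   hence cu: "(c * u) $ v = - (u $ v)" if "v \<in> Y" for v using uY that by (simp add: act_mult)
   have "(\<forall>v\<in>Y. (c * u) $ v = v) \<longleftrightarrow> (\<forall>v\<in>Y. u $ v = - v)" "(\<forall>v\<in>Y. (c * u) $ v = - v) \<longleftrightarrow> (\<forall>v\<in>Y. u $ v = v)"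
    using cu by (metis minus_minus)+
   moreover have "\<not> ((\<forall>v\<in>Y. u $ v = v) \<and> (\<forall>v\<in>Y. u $ v = - v))" using vv by metis
   ultimately show ?thesis using c by (auto simp: \<phi>_def)
  qed
 qed
 have cl: "f (cj h x) = f x" if h: "h \<in> K" for h x
  unfolding f_def by (rule sum.reindex_bij_witness[of _ "\<lambda>g. g * inverse h" "\<lambda>g. g * h"])
   (use SK(2,3) h in \<open>auto simp: cj_cj group_norm\<close>)
 have zf: "f (z * x) = sg Y z * f x" if z: "z \<in> zs K Y" and x: "x \<in> K" for z x
  unfolding f_def sum_distrib_left
 proof (rule sum.cong)
  fix h assume h: "h \<in> K"
  have zK: "z \<in> K" using z by (simp add: zs_def)
  have ih: "inverse h $ v \<in> Y" if "v \<in> Y" for v using KD(7) SK(3) h that by blast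
  have "(sg Y z = 1 \<and> (\<forall>v\<in>Y. cj h z $ v = v)) \<or> (sg Y z = - 1 \<and> (\<forall>v\<in>Y. cj h z $ v = - v))"
   using z sg_eqs[OF g] ih by (auto simp: zs_def cj_def act_mult act_minus)
  moreover have "cj h x * inverse y \<in> K" "cj h z \<in> K" using SK(2,3,4) h x y zK by auto
  ultimately have "\<phi> (cj h z * (cj h x * inverse y)) = sg Y z * \<phi> (cj h x * inverse y)" using \<phi>m by blast
  thus "\<phi> (cj h (z * x) * inverse y) = sg Y z * \<phi> (cj h x * inverse y)"
   by (simp add: cj_mult mult.assoc)
 qed simp
 have "f (y ^ k) = f y" using r cl zf y k unfolding ratl_def by blast
 moreover have "f y > 0" unfolding f_def
 proof (rule sum_pos2[of _ 1])
  show "0 < \<phi> (cj 1 y * inverse y)" by (simp add: \<phi>_def)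
  show "0 \<le> \<phi> (cj g y * inverse y)" if "g \<in> K" for g using ns[OF that] by (auto simp: \<phi>_def)
 qed (use KD(2) SK in auto)
 ultimately have "(\<Sum>g\<in>K. \<phi> (cj g (y ^ k) * inverse y)) > 0" by (simp add: f_def)
 then obtain h where h: "h \<in> K" "\<phi> (cj h (y ^ k) * inverse y) > 0"
  using sum_nonpos[of K "\<lambda>g. \<phi> (cj g (y ^ k) * inverse y)"] by force
 thus ?thesis by (auto simp: \<phi>_def split: if_splits)
qed

end

section \<open>Transpositions of the quaternion units\<close>

context prim_solv begin

text \<open>Multiplied by \<open>i\<close> if necessary, \<open>b\<close> becomes an element
  \<open>a\<close> that commutes with \<open>k\<close>. Its square is then \<open>k\<close> up to
  sign and its fourth power is -1. Rationality would make \<open>a\<close> conjugate to its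
  negative, which the structure of the quaternion group forbids.\<close>

lemma transposition_impossible:
 assumes r: "ratl K Y" and b: "b \<in> K" and k: "k \<in> E" "sqm k" and i: "i \<in> E" "sqm i" "anti k i"
  and bk: "onY (cj b k) k" and bi: "onY (cj b i) (k * i)"
 shows False
proof -
 have cent: "onY x 1" if "x \<in> K" "com x k" "com x i" for x
 proof -
  have "com x e" if e: "e \<in> E" for e
  proof -
   have c: "com x (k * i)" using com_mult that \<open>x \<in> K\<close> \<open>com x k\<close> \<open>com x i\<close> k i by auto
   have one: "com x 1" by (simp add: com_def)
   have "onY e 1 \<or> onY e k \<or> onY e i \<or> onY e (k * i)"
    using quaternion_action_cases[OF k i e] .
   thus ?thesis
    using onY_com[of e _ x] com_sym c one \<open>com x k\<close> \<open>com x i\<close> \<open>x \<in> K\<close> by blast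
  qed
  thus ?thesis using centralizer_central onY_one \<open>x \<in> K\<close> by blast
 qed
 have cj_act: "cj g e $ g $ v = g $ e $ v" for g e v by (simp add: cj_def act_mult)
 define a where "a = (if com b k then b else b * i)"
 have aK: "a \<in> K" using b i SK(2) by (auto simp: a_def)
 have ak: "com a k"
 proof (cases "com b k")
  case False
  hence "anti k b" using bk anti_sym unfolding onY_cj_iff[OF b] com_def anti_def by blast
  hence "com k (b * i)" using anti_mult2 i k b by auto
  thus ?thesis using False com_sym by (simp add: a_def)
 qed (simp add: a_def)
 have ai: "onY (cj a i) (k * i)"
 proof (cases "com b k")
  case False
  have "cj (b * i) i = cj b i" by (simp add: cj_cj[symmetric]) (simp add: cj_def group_norm)
  thus ?thesis using bi False by (simp add: a_def)
 qed (use bi in \<open>simp add: a_def\<close>)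
 have kiE: "k * i \<in> E" using SE(2) k i by blast
 have ai': "(\<forall>u\<in>Y. a $ i $ u = k $ i $ a $ u) \<or> (\<forall>u\<in>Y. a $ i $ u = - (k $ i $ a $ u))"
  using ai unfolding onY_cj_iff[OF aK] by (simp add: act_mult)
 have ka: "a $ k $ u = k $ a $ u" if "u \<in> Y" for u using ak that by (simp add: com_def)
 have kk: "k $ k $ u = - u" if "u \<in> Y" for u using k(2) that by (simp add: sqm_def)
 have aai: "anti (a * a) i"
 proof -
  have "a $ a $ i $ u = - (i $ a $ a $ u)" if u: "u \<in> Y" for u
   using ai' by (elim disjE) (use u aK i(1) ka kk in \<open>simp_all add: act_minus\<close>)
  thus ?thesis by (simp add: anti_def act_mult)
 qed
 have aaK: "a * a \<in> K" "a * a * k \<in> K" using SK(2) aK k(1) by auto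
 have "onY (a * a * k) 1"
 proof (rule cent[OF aaK(2)])
  have "com k (a * a)" using com_mult[of k a a] ak com_sym aK k(1) by blast
  thus "com (a * a * k) k" using com_mult[of k "a * a" k] aaK k(1) com_sym by (simp add: com_def[of k k])
  have "anti i (a * a)" "anti i k" using aai i(3) anti_sym by auto
  thus "com (a * a * k) i" using anti_mult2[of i "a * a" k] aaK i(1) k(1) com_sym by blast
 qed
 hence aak: "onY (a * a) k"
 proof -
  have "a $ a $ k $ k $ u = - (a $ a $ u)" if "u \<in> Y" for u using kk that by (simp add: act_minus)
  moreover assume "onY (a * a * k) 1"
  ultimately show ?thesis unfolding onY_def using k(1)
   by (auto simp: act_mult)
 qed
 have a4: "a ^ 4 $ u = - u" if u: "u \<in> Y" for u
 proof -
  have "a $ a $ a $ a $ u = k $ k $ u"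
   using aak u aK k(1) by (auto simp: onY_def act_mult act_minus)
  thus ?thesis using kk u by (simp add: act_mult eval_nat_numeral)
 qed
 obtain m where m: "card H = 2 ^ multiplicity 2 (card H) * m" "\<not> 2 dvd m"
  using multiplicity_decompose'[of "card H" "2::nat"] card_subgrp_pos[OF H] by auto
 \<comment> \<open>With \<open>m\<close> the odd part of the group order, \<open>n\<close> is odd
   and 1 modulo \<open>m\<close>, hence prime to the order. As \<open>m\<close> is odd,
   \<open>a ^ n\<close> acts as the negative of \<open>a\<close>.\<close>
 define n where "n = 4 * m + 1"
 have "coprime n (card H)"
 proof -
  have "coprime n m" unfolding n_def by (metis coprime_mult_self_right_iff coprime_Suc_left_nat Suc_eq_plus1 coprime_commute coprime_mult_left_iff)
  moreover have "coprime n 2" by (simp add: n_def)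
  ultimately show ?thesis using m(1) by (metis coprime_mult_right_iff coprime_power_right_iff)
 qed
 \<comment> \<open>If conjugation by \<open>g\<close> negates \<open>a\<close>, then
   \<open>g\<close> commutes with the square of \<open>a\<close>, hence with \<open>k\<close>, and
   it sends \<open>i\<close> to \<open>i\<close> or \<open>k * i\<close> up to sign. So
   \<open>g\<close> or \<open>inverse a * g\<close> commutes with \<open>k\<close> and fixes
   \<open>i\<close> up to sign; such an element is 1 or \<open>k\<close> up to sign and commutes
   with \<open>a\<close>, and then so does \<open>g\<close>.\<close>
 moreover have "\<not> (\<forall>v\<in>Y. (cj g a * inverse a) $ v = - v)" if g: "g \<in> K" for g
 proof
  assume h: "\<forall>v\<in>Y. (cj g a * inverse a) $ v = - v"
  have ga: "g $ a $ v = - (a $ g $ v)" if v: "v \<in> Y" for v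
  proof -
   have "a $ g $ v \<in> Y" using v g aK by blast
   hence "cj g a $ inverse a $ (a $ g $ v) = - (a $ g $ v)"
    using h by (simp only: act_mult)
   hence "cj g a $ g $ v = - (a $ g $ v)" by simp
   thus ?thesis by (simp add: cj_act)
  qed
  have gaa: "g $ a $ a $ v = a $ a $ g $ v" if v: "v \<in> Y" for v
   using ga[of v] ga[of "a $ v"] v aK by (simp add: act_minus)
  have gk: "com g k"
  proof -
   have "g $ k $ v = k $ g $ v" if v: "v \<in> Y" for v
    using aak gaa[OF v] v g by (auto simp: onY_def act_mult act_minus)
   thus ?thesis by (simp add: com_def)
  qed
  have comm_fin: False if "com g a"
  proof -
   obtain v where v: "v \<in> Y" "v \<noteq> 0" using Y_ex by blast
   hence "a $ g $ v = - (a $ g $ v)" using ga that by (simp add: com_def)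
   hence "a $ g $ v = 0" using not_minus v g aK by blast
   thus False using v by simp
  qed
  have fixi: "com x a" if x: "x \<in> K" "com x k" "onY (cj x i) i" for x
  proof (cases "com x i")
   case True
   hence "onY x 1" using cent x by blast
   thus ?thesis by (rule onY_com) (use aK in \<open>auto simp: com_def\<close>)
  next
   case False
   hence "anti i x" using x(3) anti_sym unfolding onY_cj_iff[OF x(1)] com_def anti_def by blast
   hence "com i (k * x)" using anti_mult2[of i k x] i k x(1) anti_sym by blast
   moreover have "com k (k * x)" using com_mult[of k k x] x(1,2) k(1) com_sym by (auto simp: com_def[of k k])
   ultimately have "onY (k * x) 1" using cent[of "k * x"] SK(2) k(1) x(1) com_sym by blast
   hence "com (k * x) a" by (rule onY_com) (use aK in \<open>auto simp: com_def\<close>)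
   hence "k $ x $ a $ u = k $ a $ x $ u" if "u \<in> Y" for u
    using that ka[of "x $ u"] x(1) by (simp add: com_def act_mult)
   hence "x $ a $ u = a $ x $ u" if "u \<in> Y" for u using that by (metis act_inverse(1))
   thus ?thesis by (simp add: com_def)
  qed
  have giE: "cj g i \<in> E" using E_cj g i(1) by blast
  have "anti (cj g k) (cj g i)" using anti_cj[OF g i(3)] .
  moreover have "cj g k $ v = k $ v" if v: "v \<in> Y" for v
  proof -
   have "inverse g $ v \<in> Y" using v SK(3)[OF g] by blast
   hence "g $ k $ inverse g $ v = k $ g $ inverse g $ v" using gk unfolding com_def by blast
   thus ?thesis by (simp add: cj_def act_mult)
  qed
  ultimately have "anti k (cj g i)" using giE by (simp add: anti_def)
  hence "onY (cj g i) i \<or> onY (cj g i) (k * i)"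
   using quaternion_action(3)[OF k i giE] anti_sym by blast
  thus False
  proof
   assume "onY (cj g i) i"
   thus False using fixi[OF g gk] comm_fin by blast
  next
   assume gi: "onY (cj g i) (k * i)"
   define x where "x = inverse a * g"
   have ia: "inverse a \<in> K" using SK(3) aK by blast
   have xK: "x \<in> K" using SK(2) ia g by (simp add: x_def)
   have "com (inverse a) k" using com_inverse[OF ak aK] .
   hence xk: "com x k" using com_mult[of k "inverse a" g] gk ia g k(1) com_sym unfolding x_def by blast
   have "onY (cj g i) (cj a i)" using gi ai onY_sym onY_trans by blast
   hence "onY (cj (inverse a) (cj g i)) (cj (inverse a) (cj a i))" using onY_cj ia by blast
   hence "onY (cj x i) i" by (simp add: x_def cj_cj)
   hence "com x a" using fixi xK xk by blast
   hence "com (a * x) a" using com_mult_left[of a a x] xK aK by (simp add: com_def[of a a])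
   hence "com g a" by (simp add: x_def group_norm)
   thus False by (rule comm_fin)
  qed
 qed
 ultimately obtain g where g: "g \<in> K" "\<forall>v\<in>Y. (cj g (a ^ n) * inverse a) $ v = v"
  using ratl_conjugate[OF KY(1) r aK] by blast
 have am: "(a ^ 4) ^ m $ u = - u" if u: "u \<in> Y" for u
 proof -
  have "(a ^ 4) ^ l $ u = (if even l then u else - u)" for l
   by (induction l) (auto simp: act_mult act_minus a4 u)
  thus ?thesis using m(2) by simp
 qed
 have "(cj g a * inverse a) $ v = - v" if v: "v \<in> Y" for v
 proof -
  have iv: "inverse a $ v \<in> Y" "inverse g $ inverse a $ v \<in> Y" "a $ inverse g $ inverse a $ v \<in> Y"
   using v SK(3) aK g(1) by blast+
  have "v = g $ a ^ n $ inverse g $ inverse a $ v" using g(2) v by (simp add: cj_def act_mult)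
  also have "\<dots> = g $ (a ^ 4) ^ m $ a $ inverse g $ inverse a $ v"
   by (simp only: n_def power_add power_mult act_mult power_one_right)
  also have "\<dots> = - (g $ a $ inverse g $ inverse a $ v)" using am[OF iv(3)] by (simp add: act_minus)
  finally have "g $ a $ inverse g $ inverse a $ v = - v" by (metis minus_minus)
  thus ?thesis by (simp add: cj_def act_mult)
 qed
 thus False using \<open>\<And>g. g \<in> K ==> \<not> (\<forall>v\<in>Y. (cj g a * inverse a) $ v = - v)\<close> g(1) by blast
qed

text \<open>A power \<open>t\<close> of \<open>h\<close> of 3-power order permutes \<open>i\<close>,
  \<open>j\<close>, \<open>k\<close> cyclically up to sign. Because of its odd order it is not
  conjugate to its negative, so rationality yields a \<open>g\<close> that inverts it on
  \<open>Y\<close>. Inverting a 3-cycle means fixing one unit and exchanging the other two.\<close>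

lemma not_rational: "\<not> ratl K Y"
proof
 assume r: "ratl K Y"
 obtain i where i: "i \<in> E" "sqm i" using quaternion_action(1) by blast
 obtain h where h: "h \<in> K" "anti i (cj h i)" "anti (cj h i) (cj h (cj h i))" "\<not> onY (cj h (cj h i)) i"
  using quaternion_action(4)[OF i] by blast
 define j k where "j = cj h i" and "k = cj h j"
 have E3: "j \<in> E" "k \<in> E" "sqm j" "sqm k" "anti i j" "anti j k" "\<not> onY k i"
  using E_cj sqm_cj h i by (auto simp: j_def k_def)
 have EK: "i \<in> K" "j \<in> K" "k \<in> K" using i E3 by auto
 note tr = onY_trans and sy = onY_sym
 have "onY k i \<or> onY k (j * i)"
  using quaternion_action(3)[OF E3(1,3) i anti_sym[OF E3(5)] E3(2)] anti_sym E3(6) by blast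
 hence kji: "onY k (j * i)" using E3(7) by blast
 have kij: "onY k (i * j)" using tr[OF kji] onY_anti[OF anti_sym[OF E3(5)]] by blast
 have sq1: "onY (e * e) 1" if "e \<in> {i, j, k}" for e using onY_sqm i E3 that by blast
 have can_l: "onY (e * (e * f)) f" if "e \<in> {i, j, k}" "f \<in> K" for e f
  using onY_mult[OF sq1[OF that(1)] onY_refl[of f] that(2,2)] by (simp add: mult.assoc)
 have can_r: "onY (f * e * e) f" if "e \<in> {i, j, k}" for e f
  using onY_mult[OF onY_refl[of f] sq1[OF that]] that EK SK(1,2) by (auto simp: mult.assoc)
 have jki: "onY (j * k) i" and kij2: "onY (k * i) j" and jk: "onY (k * j) i" and ik: "onY (i * k) j"
 proof -
  have "onY (j * k) (j * (j * i))" using onY_mult[OF onY_refl kji] EK SK(2) by blast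
  thus "onY (j * k) i" using can_l EK tr by blast
  have "onY (k * i) (j * i * i)" using onY_mult[OF kji onY_refl] EK by blast
  thus "onY (k * i) j" using can_r tr by blast
  have "onY (k * j) (i * j * j)" using onY_mult[OF kij onY_refl] EK by blast
  thus "onY (k * j) i" using can_r tr by blast
  have "onY (i * k) (i * (i * j))" using onY_mult[OF onY_refl kij] EK SK(2) by blast
  thus "onY (i * k) j" using can_l EK tr by blast
 qed
 have hk: "onY (cj h k) i"
 proof -
  have "onY (cj h k) (cj h (i * j))" using onY_cj[OF kij h(1)] .
  hence "onY (cj h k) (j * k)" by (simp add: cj_mult j_def k_def)
  thus ?thesis using jki tr by blast
 qed
 have cyc: "onY (cj (h ^ (3 * n + 1)) i) j \<and> onY (cj (h ^ (3 * n + 1)) j) k \<and> onY (cj (h ^ (3 * n + 1)) k) i" for n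
 proof (induction n)
  case 0 thus ?case using hk by (simp add: j_def k_def)
 next
  case (Suc n)
  have "h ^ (3 * Suc n + 1) = h ^ (3 * n + 1) * (h * (h * h))"
   by (simp only: mult_Suc_right power_add[symmetric] power3_eq_cube[symmetric] mult.assoc[symmetric] power_one_right)
     (simp add: power_add[symmetric] eval_nat_numeral power_Suc2 del: power_Suc)
  hence *: "cj (h ^ (3 * Suc n + 1)) e = cj (h ^ (3 * n + 1)) (cj h (cj h (cj h e)))" for e
   by (simp add: cj_cj mult.assoc)
  have c3: "onY (cj h (cj h (cj h i))) i" "onY (cj h (cj h (cj h j))) j" "onY (cj h (cj h (cj h k))) k"
  proof -
   show "onY (cj h (cj h (cj h i))) i" using hk by (simp add: j_def k_def)
   show "onY (cj h (cj h (cj h j))) j" using onY_cj[OF hk h(1)] by (simp add: j_def[symmetric] k_def[symmetric])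
   show "onY (cj h (cj h (cj h k))) k" using onY_cj[OF onY_cj[OF hk h(1)] h(1)]
    by (simp add: j_def[symmetric] k_def[symmetric])
  qed
  have hp: "h ^ (3 * n + 1) \<in> K" using SK(6) h(1) by blast
  show ?case unfolding * using Suc onY_cj[OF c3(1) hp] onY_cj[OF c3(2) hp] onY_cj[OF c3(3) hp] tr by blast
 qed
 obtain k' N where kN: "(h ^ (3 * k' + 1)) ^ (3 ^ N) = 1" using three_part[OF KD(1,2) h(1)] by blast
 define t where "t = h ^ (3 * k' + 1)"
 have tK: "t \<in> K" using SK(6) h(1) unfolding t_def by blast
 have t3: "t ^ (3 ^ N) = 1" unfolding t_def by (rule kN)
 have ti: "onY (cj t i) j" "onY (cj t j) k" "onY (cj t k) i" using cyc[of k'] unfolding t_def by blast+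
 have ns: "\<not> (\<forall>v\<in>Y. (cj g t * inverse t) $ v = - v)" if g: "g \<in> K" for g
 proof
  assume n: "\<forall>v\<in>Y. (cj g t * inverse t) $ v = - v"
  have gt: "cj g t $ v = - (t $ v)" if "v \<in> Y" for v
  proof -
   have "t $ v \<in> Y" using that tK by blast
   hence "cj g t $ inverse t $ (t $ v) = - (t $ v)" using n by (simp only: act_mult)
   thus ?thesis by simp
  qed
  have tm: "t ^ m $ v \<in> Y" if "v \<in> Y" for m v using that SK(6)[OF tK] by blast
  have "cj g t ^ m $ v = (if even m then t ^ m $ v else - (t ^ m $ v))" if v: "v \<in> Y" for m v
   by (induction m) (auto simp: act_mult act_minus gt tm[OF v])
  from this[of _ "3 ^ N"] have "v = - v" if "v \<in> Y" for v
   using that t3 by (simp add: cj_pow[symmetric])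
  thus False using Y_ex by blast
 qed
 \<comment> \<open>Inversion is the power with exponent \<open>card H - 1\<close>, which is prime to
   the order.\<close>
 note tinv = power_minus_one[OF pow_card[OF H] card_subgrp_pos[OF H], of t]
 obtain g where g: "g \<in> K" "\<forall>v\<in>Y. (cj g (inverse t) * inverse t) $ v = v"
  using ratl_conjugate[OF KY(1) r tK tinv(2) ns] tK unfolding tinv(1)[OF KD(3)[OF tK]] by blast
 have key: "onY (cj g f) (cj t (cj g e))" if "onY (cj t f) e" "e \<in> K" "f \<in> K" for e f
 proof -
  have u: "onY (cj g (inverse t)) t"
  proof -
   have "cj g (inverse t) $ v = t $ v" if "v \<in> Y" for v
   proof -
    have "t $ v \<in> Y" using that tK by blast
    hence "cj g (inverse t) $ inverse t $ (t $ v) = t $ v" using g(2) by (simp only: act_mult)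
    thus ?thesis by simp
   qed
   thus ?thesis by (simp add: onY_def)
  qed
  have it: "inverse t \<in> K" using SK(3) tK by blast
  have cK: "cj g x \<in> K" if "x \<in> K" for x using SK(4) g(1) that by blast
  have "onY f (cj (inverse t) e)" using onY_cj[OF that(1) it] by simp
  hence "onY (cj g f) (cj g (cj (inverse t) e))" using onY_cj g(1) by blast
  moreover have "cj g (cj (inverse t) e) = cj g (inverse t) * cj g e * inverse (cj g (inverse t))"
   by (simp add: cj_def group_norm)
  moreover have "onY (cj g (inverse t) * cj g e * inverse (cj g (inverse t))) (t * cj g e * inverse t)"
  proof -
   have "onY (inverse (cj g (inverse t))) (inverse t)"
   proof -
    let ?w = "cj g (inverse t)"
    have wK: "?w \<in> K" "inverse ?w \<in> K" using cK it SK(3) by blast+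
    have "onY (inverse ?w * ?w * inverse t) (inverse ?w * t * inverse t)"
     by (rule onY_mult[OF onY_mult[OF onY_refl u] onY_refl]) (use wK tK it in auto)
    thus ?thesis using onY_sym by (simp add: group_norm)
   qed
   moreover have "onY (cj g (inverse t) * cj g e) (t * cj g e)"
    by (rule onY_mult[OF u onY_refl]) (rule cK[OF \<open>e \<in> K\<close>])+
   moreover have "inverse (cj g (inverse t)) \<in> K" using cK it SK(3) by blast
   ultimately show ?thesis using onY_mult it by blast
  qed
  ultimately show ?thesis using tr unfolding cj_def[of t "cj g e"] by metis
 qed
 have tc: "onY (cj t e) f'" if "onY e f" "onY (cj t f) f'" for e f f'
  using onY_cj[OF that(1) tK] that(2) tr by blast
 have g_k: "onY (cj g k) (cj t (cj g i))" and g_j: "onY (cj g j) (cj t (cj g k))" and g_i: "onY (cj g i) (cj t (cj g j))"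
  using key ti EK by blast+
 have giE: "cj g i \<in> E" "\<not> onY (cj g i) 1"
 proof -
  show "cj g i \<in> E" using E_cj g i by blast
  have "sqm (cj g i)" using sqm_cj g i by blast
  hence "cj g i $ cj g i $ v = - v" if "v \<in> Y" for v using that by (simp add: sqm_def)
  moreover have "cj g i $ cj g i $ v = v" if "v \<in> Y" "onY (cj g i) 1" for v
   using that by (auto simp: onY_def act_minus)
  ultimately show "\<not> onY (cj g i) 1" using Y_ex by metis
 qed
 have aik: "anti i k"
  proof -
   have "anti i (i * j)" using anti_mult1(2)[of i j i] E3 EK by (auto simp: com_def[of i i])
   hence "anti (i * j) i" by (rule anti_sym)
   hence "anti k i" using kij EK(1) by (auto simp: onY_def anti_def act_minus)
   thus ?thesis by (rule anti_sym)
  qed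
 have "onY (cj g i) i \<or> onY (cj g i) j \<or> onY (cj g i) k"
  using quaternion_action_cases[OF i E3(1,3,5) giE(1)] giE(2) kij sy tr by blast
 thus False
 proof (elim disjE)
  assume a: "onY (cj g i) i"
  have "onY (cj g k) (i * k)" using tr[OF tr[OF g_k tc[OF a ti(1)]] sy[OF ik]] .
  moreover note aik
  ultimately show False using transposition_impossible[OF r g(1) i E3(2,4) _ a] by blast
 next
  assume a: "onY (cj g i) j"
  have k: "onY (cj g k) k" using tr[OF g_k tc[OF a ti(2)]] .
  have "onY (cj g i) (k * i)" using tr[OF a sy[OF kij2]] .
  moreover have "anti k i" using anti_sym[OF aik] .
  ultimately show False using transposition_impossible[OF r g(1) E3(2,4) i _ k] by blast
 next
  assume a: "onY (cj g i) k"
  have k: "onY (cj g k) i" using tr[OF g_k tc[OF a ti(3)]] .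
  have j: "onY (cj g j) j" using tr[OF g_j tc[OF k ti(1)]] .
  have "onY (cj g i) (j * i)" using a kji tr by blast
  thus False using transposition_impossible[OF r g(1) E3(1,3) i anti_sym[OF E3(5)] j] by blast
 qed
qed

end

context form_module begin

theorem no_rational_good_pair:
 assumes "good K Y" "ratl K Y" shows "\<not> solv H"
proof
 assume sH: "solv H"
 obtain K' Y' where P0: "good K' Y'" "ratl K' Y'" "primitive K' Y'"
  using primitive_pair_exists[OF assms] by blast
 note KD = goodD[OF P0(1)]
 have one: "1 \<in> zs K' Y'" using subgrpD(1)[OF KD(1)] by (simp add: zs_def)
 have nz: "\<not> K' \<subseteq> zs K' Y'"
 proof
  assume s: "K' \<subseteq> zs K' Y'"
  obtain v where v: "v \<in> Y'" "v \<noteq> 0" using KD(6) by blast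
  obtain h where h: "h \<in> K'" "h $ v = v + v" using KD(8) v by blast
  hence "v + v = v \<or> v + v = - v" using s v by (auto simp: zs_def)
  hence "v + v + v = 0" using v(2) by auto
  thus False using good_three[OF P0(1) v(1)] v(2) by blast
 qed
 have nK: "normal_in K' K'" using KD(1) subgrpD[OF KD(1)] by (auto simp: normal_in_def)
 have sK: "solv K'" by (rule solv_subset[OF sH]) (use KD(3) in blast)
 obtain E where E: "normal_in E K'" "\<not> E \<subseteq> zs K' Y'" "\<And>x y. x \<in> E ==> y \<in> E ==> cmt x y \<in> zs K' Y'"
  using solv_normal_section[OF KD(1) nK sK one nz] by metis
 interpret prim_solv act H V p B K' Y' E by unfold_locales (use P0 E sH in auto)
 show False using not_rational P0 by blast
qed

end

section \<open>Linearising an elementary abelian normal subgroup\<close>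

text \<open>An abelian group \<open>N\<close> of exponent \<open>p\<close> is embedded into the functions with values in \<open>\<real> / \<int>\<close> on the set of
  functionals \<open>\<alpha>\<close> modulo \<open>p\<close>, by \<open>n \<mapsto> (\<alpha> \<mapsto> \<alpha> n / p)\<close>. This makes \<open>N\<close> an additive subgroup of a type of class
  \<open>ab_group_add\<close>, on which a group normalising \<open>N\<close> acts by permuting the functionals.\<close>

definition circ_rel :: "real \<Rightarrow> real \<Rightarrow> bool" where "circ_rel x y \<longleftrightarrow> x - y \<in> \<int>"

quotient_type circ = real / circ_rel
proof (rule equivpI)
 show "reflp circ_rel" by (simp add: reflp_def circ_rel_def)
 show "symp circ_rel"
  unfolding symp_def circ_rel_def by (metis Ints_minus minus_diff_eq)
 show "transp circ_rel"
  unfolding transp_def circ_rel_def by (metis Ints_add diff_add_cancel add_diff_eq)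
qed

instantiation circ :: ab_group_add
begin
lift_definition zero_circ :: circ is 0 .
lift_definition plus_circ :: "circ \<Rightarrow> circ \<Rightarrow> circ" is "(+)"
 unfolding circ_rel_def by (metis Ints_add add_diff_add)
lift_definition uminus_circ :: "circ \<Rightarrow> circ" is uminus
 unfolding circ_rel_def by (metis Ints_minus minus_diff_minus)
lift_definition minus_circ :: "circ \<Rightarrow> circ \<Rightarrow> circ" is "(-)"
proof -
 fix a b c d :: real assume "circ_rel a b" "circ_rel c d"
 hence "(a - b) - (c - d) \<in> \<int>" unfolding circ_rel_def by (rule Ints_diff)
 thus "circ_rel (a - c) (b - d)" by (simp add: circ_rel_def algebra_simps)
qed
instance by standard (transfer, simp add: circ_rel_def algebra_simps)+
end

lift_definition circ_of :: "nat \<Rightarrow> int \<Rightarrow> circ" is "\<lambda>p a. of_int a / of_nat p" .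

lemma circ_of_add: "circ_of p (a + b) = circ_of p a + circ_of p b"
 by transfer (simp add: circ_rel_def add_divide_distrib)

lemma circ_of_eq_iff: assumes "p > 0" shows "circ_of p a = circ_of p b \<longleftrightarrow> [a = b] (mod int p)"
proof -
 have "real_of_int a / real p - real_of_int b / real p = real_of_int (a - b) / real_of_int (int p)"
  by (simp add: diff_divide_distrib)
 moreover have "real_of_int (a - b) / real_of_int (int p) \<in> \<int> \<longleftrightarrow> int p dvd a - b"
 proof
  assume "real_of_int (a - b) / real_of_int (int p) \<in> \<int>"
  then obtain k where "real_of_int (a - b) / real_of_int (int p) = of_int k" by (auto elim: Ints_cases)
  hence "real_of_int (a - b) = real_of_int (int p * k)" using assms by (simp add: field_simps)
  hence "a - b = int p * k" by (simp only: of_int_eq_iff)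
  thus "int p dvd a - b" by simp
 next
  assume "int p dvd a - b"
  then obtain k where "a - b = int p * k" by (auto simp: dvd_def)
  thus "real_of_int (a - b) / real_of_int (int p) \<in> \<int>" using assms by simp
 qed
 ultimately show ?thesis unfolding cong_iff_dvd_diff by transfer (simp add: circ_rel_def)
qed

text \<open>Functions are permuted through their arguments; the inverse makes this a left
  action.\<close>

definition pact :: "'a perm \<Rightarrow> ('a \<Rightarrow> 'b) \<Rightarrow> 'a \<Rightarrow> 'b" where
 "pact \<pi> f = (\<lambda>a. f (Perm.apply (inverse \<pi>) a))"

interpretation pact: rep "pact :: 'a perm \<Rightarrow> ('a \<Rightarrow> 'b::ab_group_add) \<Rightarrow> ('a \<Rightarrow> 'b)"
 by standard (auto simp: pact_def group_inverse_mult apply_times)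

lemma pow_mult_commuting: assumes "x * y = y * (x::'a::monoid_mult)" shows "(x * y) ^ n = x ^ n * y ^ n"
proof (induction n)
 case (Suc n)
 have "y * x ^ n = x ^ n * y" using assms by (induction n) (simp_all, metis mult.assoc)
 thus ?case using Suc by simp (metis mult.assoc)
qed simp

lemma subgrp_finite_closed:
 fixes A :: "'a::group_mult set"
 assumes "finite A" "1 \<in> A" "\<And>x y. x \<in> A ==> y \<in> A ==> x * y \<in> A" shows "subgrp A"
 unfolding subgrp_def
proof (intro conjI ballI)
 fix x assume x: "x \<in> A"
 have "inj_on ((*) x) A" by (auto simp: inj_on_def)
 hence "(*) x ` A = A" using endo_inj_surj[OF assms(1), of "(*) x"] assms(3) x by blast
 then obtain y where y: "y \<in> A" "x * y = 1" using assms(2) by (metis imageE)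
 hence "inverse x = y" by (metis group_left_cancel1 group_right_inverse mult_1_right)
 thus "inverse x \<in> A" using y by simp
qed (use assms in auto)

lemma cong_of_pow_mem:
 assumes U: "subgrp U" and p: "prime p" and n: "n ^ p = (1::'a::group_mult)" "n \<notin> U" and k: "n ^ k \<in> U"
 shows "p dvd k"
proof (rule ccontr)
 assume "\<not> p dvd k"
 hence "coprime p k" using p by (rule prime_imp_coprime[rotated])
 hence "n \<in> U" using pow_coprime_mem[OF U, of n p k] n(1) k subgrpD(1)[OF U] by simp
 thus False using n by blast
qed

text \<open>A maximal subgroup \<open>U\<close> avoiding \<open>n\<close> is a complement to the
  group generated by \<open>n\<close>. The functional reads off the exponent of
  \<open>n\<close>.\<close>

lemma functional_exists:
 fixes N :: "'a::group_mult set"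
 assumes N: "subgrp N" "finite N" "\<And>x y. x \<in> N ==> y \<in> N ==> x * y = y * x"
  and p: "prime p" "\<And>x. x \<in> N ==> x ^ p = 1" and n: "n \<in> N" "n \<noteq> 1"
 shows "\<exists>\<alpha>::'a \<Rightarrow> int. (\<forall>x\<in>N. \<forall>y\<in>N. [\<alpha> (x * y) = \<alpha> x + \<alpha> y] (mod int p)) \<and> \<not> int p dvd \<alpha> n"
proof -
 note SN = subgrpD[OF N(1)]
 define \<U> where "\<U> = {U. subgrp U \<and> U \<subseteq> N \<and> n \<notin> U}"
 have "finite \<U>" using N(2) by (auto simp: \<U>_def intro: finite_subset[of _ "Pow N"])
 moreover have "{1} \<in> \<U>" using subgrp_trivial SN(1) n by (auto simp: \<U>_def)
 ultimately obtain U where U: "U \<in> \<U>" "\<And>W. W \<in> \<U> ==> U \<subseteq> W ==> W = U"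
  using finite_has_maximal[of \<U>] by (metis empty_iff)
 hence SU: "subgrp U" "U \<subseteq> N" "n \<notin> U" by (auto simp: \<U>_def)
 note S = subgrpD[OF SU(1)]
 have cop: "\<exists>u\<in>U. \<exists>k. m = u * n ^ k" if m: "m \<in> N" for m
 proof (cases "m \<in> U")
  case True thus ?thesis by (intro bexI[of _ m] exI[of _ 0]) auto
 next
  case False
  \<comment> \<open>Adjoining an \<open>m\<close> outside \<open>U\<close> must capture
    \<open>n\<close>, by maximality. The exponent of \<open>m\<close> in the resulting expression
    for \<open>n\<close> is prime to \<open>p\<close>, so it can be solved for
    \<open>m\<close>.\<close>
  define W where "W = {u * m ^ k | u k. u \<in> U}"
  have "subgrp W"
  proof (rule subgrp_finite_closed)
   have "W \<subseteq> N" using SN(2,6) m SU(2) by (auto simp: W_def)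
   thus "finite W" using N(2) finite_subset by blast
   show "1 \<in> W" using S(1) unfolding W_def by (metis (mono_tags, lifting) mem_Collect_eq mult_1_right power_0)
   fix x y assume "x \<in> W" "y \<in> W"
   then obtain u k u' k' where x: "x = u * m ^ k" "y = u' * m ^ k'" "u \<in> U" "u' \<in> U" by (auto simp: W_def)
   have "m ^ k * u' = u' * m ^ k" using N(3) SN(6) m x SU(2) by blast
   hence "x * y = (u * u') * m ^ (k + k')" by (simp add: x power_add) (metis mult.assoc)
   thus "x * y \<in> W" using S(2) x unfolding W_def by blast
  qed
  moreover have "W \<subseteq> N" using SN(2,6) m SU(2) by (auto simp: W_def)
  moreover have UW: "U \<subseteq> W"
   unfolding W_def by (smt (verit) mem_Collect_eq mult_1_right power_0 subsetI)
  moreover have "m \<in> W"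
   using S(1) unfolding W_def by (metis (mono_tags, lifting) mem_Collect_eq mult_1_left power_one_right)
  ultimately have "n \<in> W" using U(2)[of W] False by (auto simp: \<U>_def)
  then obtain u k where uk: "u \<in> U" "n = u * m ^ k" by (auto simp: W_def)
  have "\<not> p dvd k"
  proof
   assume "p dvd k"
   then obtain l where "k = p * l" by (auto simp: dvd_def)
   hence "m ^ k = 1" using p(2)[OF m] by (simp add: power_mult)
   thus False using uk SU(3) by simp
  qed
  then obtain l where l: "[k * l = 1] (mod p)"
   using p(1) prime_imp_coprime[of p k] cong_solve_coprime_nat[of k p] coprime_commute by auto
  have mp: "m ^ (k * l) = m"
  proof -
   have "k * l = p * (k * l div p) + 1"
   proof -
    have "k * l mod p = 1" using l prime_gt_1_nat[OF p(1)] by (simp add: cong_def)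
    thus ?thesis using mult_div_mod_eq[of p "k * l"] by simp
   qed
   hence "m ^ (k * l) = (m ^ p) ^ (k * l div p) * m" by (metis power_add power_mult power_one_right)
   thus ?thesis using p(2)[OF m] by simp
  qed
  have "u * m ^ k = m ^ k * u" using N(3) uk(1) SU(2) SN(6)[OF m] by blast
  hence "n ^ l = u ^ l * (m ^ k) ^ l" using uk(2) pow_mult_commuting by metis
  hence "n ^ l = u ^ l * m" by (simp add: power_mult[symmetric] mp)
  hence "m = inverse (u ^ l) * n ^ l" by (simp add: group_left_cancel1)
  thus ?thesis using S(3,6) uk by blast
 qed
 define \<alpha> where "\<alpha> m = int (SOME k. \<exists>u\<in>U. m = u * n ^ k)" for m
 have \<alpha>: "[\<alpha> m = int k] (mod int p)" if m: "m = u * n ^ k" "u \<in> U" for m u k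
 proof -
  define l where "l = (SOME k. \<exists>u\<in>U. m = u * n ^ k)"
  have "\<exists>k. \<exists>u\<in>U. m = u * n ^ k" using m by blast
  hence "\<exists>u\<in>U. m = u * n ^ l" unfolding l_def by (rule someI_ex)
  then obtain w where w: "w \<in> U" "m = w * n ^ l" by blast
  have gen: "[i = j] (mod p)" if "i \<le> j" "x * n ^ j = y * n ^ i" "x \<in> U" "y \<in> U" for i j x y
  proof -
   have "n ^ j = n ^ (j - i) * n ^ i" using that(1) by (simp flip: power_add)
   hence "x * n ^ (j - i) * n ^ i = y * n ^ i" using that(2) by (simp add: mult.assoc)
   hence "x * n ^ (j - i) = y" by (metis mult.assoc group_right_inverse mult_1_right)
   hence "n ^ (j - i) = inverse x * y" by (metis group_left_cancel1)
   hence "n ^ (j - i) \<in> U" using S(2,3) that by simp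
   hence "p dvd j - i" using cong_of_pow_mem[OF SU(1) p(1) p(2)[OF n(1)] SU(3)] by blast
   thus ?thesis using that(1) by (metis cong_altdef_nat cong_sym)
  qed
  have "[l = k] (mod p)"
   using gen[of l k u w] gen[of k l w u] w m cong_sym by (metis nle_le)
  thus ?thesis by (simp add: \<alpha>_def l_def[symmetric] cong_int_iff)
 qed
 have "[\<alpha> (x * y) = \<alpha> x + \<alpha> y] (mod int p)" if xy: "x \<in> N" "y \<in> N" for x y
 proof -
  obtain u k where x: "u \<in> U" "x = u * n ^ k" using cop xy by blast
  obtain w l where y: "w \<in> U" "y = w * n ^ l" using cop xy by blast
  have "n ^ k * w = w * n ^ k" using N(3) SN(6) n y SU(2) by blast
  hence "x * y = (u * w) * n ^ (k + l)" by (simp add: x y power_add) (metis mult.assoc)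
  hence "[\<alpha> (x * y) = int (k + l)] (mod int p)" using \<alpha> S(2) x y by blast
  moreover have "[\<alpha> x + \<alpha> y = int k + int l] (mod int p)" using cong_add \<alpha> x y by blast
  ultimately show ?thesis by (metis of_nat_add cong_sym cong_trans)
 qed
 moreover have "\<not> int p dvd \<alpha> n"
 proof -
  have "[\<alpha> n = int 1] (mod int p)" using \<alpha>[of n 1 1] S(1) by simp
  moreover have "\<not> int p dvd 1" using p(1) prime_gt_1_nat by fastforce
  ultimately show ?thesis by (metis cong_dvd_iff of_nat_1)
 qed
 ultimately show ?thesis by blast
qed

definition homo :: "'a::group_mult set \<Rightarrow> ('a \<Rightarrow> 'b::group_mult) \<Rightarrow> bool" where
 "homo G f \<longleftrightarrow> (\<forall>x\<in>G. \<forall>y\<in>G. f (x * y) = f x * f y)"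

theorem linear_model:
 fixes G :: "'a::group_mult set"
 assumes G: "subgrp G" and N: "normal_in N G" "finite N" "\<And>x y. x \<in> N ==> y \<in> N ==> x * y = y * x"
  and p: "prime p" "\<And>x. x \<in> N ==> x ^ p = 1"
 shows "\<exists>(\<pi> :: 'a \<Rightarrow> ('a \<Rightarrow> int) perm) (\<iota> :: 'a \<Rightarrow> ('a \<Rightarrow> int) \<Rightarrow> circ). homo G \<pi> \<and> inj_on \<iota> N \<and>
  (\<forall>x\<in>N. \<forall>y\<in>N. \<iota> (x * y) = \<iota> x + \<iota> y) \<and> (\<forall>g\<in>G. \<forall>n\<in>N. pact (\<pi> g) (\<iota> n) = \<iota> (cj g n)) \<and>
  (\<forall>g\<in>G. (\<forall>n\<in>N. cj g n = n) \<longrightarrow> \<pi> g = 1)"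
proof -
 have SN: "subgrp N" "N \<subseteq> G" using N(1) by (auto simp: normal_in_def)
 note S = subgrpD[OF SN(1)] and SG = subgrpD[OF G]
 have p0: "p > 0" using p(1) prime_gt_0_nat by blast
 have cjN: "cj g n \<in> N \<longleftrightarrow> n \<in> N" if "g \<in> G" for g n using normal_cj_iff[OF N(1) G that] .
 \<comment> \<open>Functionals are normalised to values in \<open>0..<p\<close> on \<open>N\<close>
   and 0 elsewhere. This makes them finite in number, so a permutation of them, extended by the
   identity, has finite support.\<close>
 define \<Phi> :: "('a \<Rightarrow> int) set" where "\<Phi> = {\<alpha>. (\<forall>x. (x \<in> N \<longrightarrow> \<alpha> x \<in> {0..<int p}) \<and> (x \<notin> N \<longrightarrow> \<alpha> x = 0)) \<and>
  (\<forall>x\<in>N. \<forall>y\<in>N. [\<alpha> (x * y) = \<alpha> x + \<alpha> y] (mod int p))}"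
 have fin\<Phi>: "finite \<Phi>"
  by (rule finite_subset[OF _ finite_set_of_finite_funs[of N "{0..<int p}" 0]]) (use N(2) in \<open>auto simp: \<Phi>_def\<close>)
 define tr where "tr g \<alpha> = (if \<alpha> \<in> \<Phi> then \<alpha> \<circ> cj (inverse g) else \<alpha>)" for g and \<alpha> :: "'a \<Rightarrow> int"
 have tr\<Phi>: "tr g \<alpha> \<in> \<Phi> \<longleftrightarrow> \<alpha> \<in> \<Phi>" if g: "g \<in> G" for g \<alpha>
 proof -
  have "\<alpha> \<circ> cj (inverse g) \<in> \<Phi>" if "\<alpha> \<in> \<Phi>"
   using that cjN[OF SG(3)[OF g]] unfolding \<Phi>_def by (auto simp: cj_mult)
  thus ?thesis by (auto simp: tr_def)
 qed
 have tr_mult: "tr (g * h) \<alpha> = tr g (tr h \<alpha>)" if "g \<in> G" "h \<in> G" for g h \<alpha>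
  using tr\<Phi>[OF that(2), of \<alpha>] by (auto simp: tr_def fun_eq_iff cj_cj group_inverse_mult)
 have tr_one: "tr 1 \<alpha> = \<alpha>" for \<alpha> by (auto simp: tr_def fun_eq_iff)
 have perm: "bij (tr g) \<and> finite {\<alpha>. tr g \<alpha> \<noteq> \<alpha>}" if g: "g \<in> G" for g
 proof
  have "tr g (tr (inverse g) \<alpha>) = \<alpha>" "tr (inverse g) (tr g \<alpha>) = \<alpha>" for \<alpha>
   using tr_mult[of g "inverse g" \<alpha>] tr_mult[of "inverse g" g \<alpha>] g SG(3) tr_one by auto
  thus "bij (tr g)" by (intro bij_betw_byWitness[where f' = "tr (inverse g)"]) auto
  show "finite {\<alpha>. tr g \<alpha> \<noteq> \<alpha>}" by (rule finite_subset[OF _ fin\<Phi>]) (auto simp: tr_def)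
 qed
 define \<pi> where "\<pi> g = Perm (tr g)" for g
 have ap: "Perm.apply (\<pi> g) = tr g" if "g \<in> G" for g
  unfolding \<pi>_def by (rule Perm_inverse) (use perm[OF that] in simp)
 have \<pi>m: "\<pi> (g * h) = \<pi> g * \<pi> h" if "g \<in> G" "h \<in> G" for g h
  by (rule perm_eqI) (simp add: ap that SG(2) apply_times tr_mult)
 have \<pi>1: "\<pi> 1 = 1" by (rule perm_eqI) (simp add: ap SG(1) tr_one)
 have \<pi>i: "inverse (\<pi> g) = \<pi> (inverse g)" if g: "g \<in> G" for g
 proof -
  have "\<pi> g * \<pi> (inverse g) = 1" using \<pi>m[of g "inverse g"] g SG(3) \<pi>1 by simp
  thus ?thesis by (metis group_left_cancel1 group_right_inverse)
 qed
 define \<iota> where "\<iota> n \<alpha> = (if \<alpha> \<in> \<Phi> then circ_of p (\<alpha> n) else 0)" for n \<alpha>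
 have \<iota>a: "\<iota> (x * y) = \<iota> x + \<iota> y" if "x \<in> N" "y \<in> N" for x y
  using that by (auto simp: \<iota>_def fun_eq_iff \<Phi>_def circ_of_add[symmetric] circ_of_eq_iff[OF p0])
 show ?thesis
 proof (intro exI[of _ \<pi>] exI[of _ \<iota>] conjI ballI impI)
  show "\<iota> (x * y) = \<iota> x + \<iota> y" if "x \<in> N" "y \<in> N" for x y
   using \<iota>a that by blast
  show "inj_on \<iota> N"
  proof (rule inj_onI)
   fix x y assume xy: "x \<in> N" "y \<in> N" "\<iota> x = \<iota> y"
   show "x = y"
   proof (rule ccontr)
    assume "x \<noteq> y"
    hence n: "inverse y * x \<in> N" "inverse y * x \<noteq> 1"
     using S xy by (auto, metis group_left_cancel1 group_right_inverse mult_1_right mult.assoc mult_1_left)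
    obtain \<alpha> :: "'a \<Rightarrow> int" where \<alpha>: "\<forall>x\<in>N. \<forall>y\<in>N. [\<alpha> (x * y) = \<alpha> x + \<alpha> y] (mod int p)" "\<not> int p dvd \<alpha> (inverse y * x)"
     using functional_exists[OF SN(1) N(2,3) p n] by blast
    define \<beta> where "\<beta> m = (if m \<in> N then \<alpha> m mod int p else 0)" for m
    have \<beta>\<Phi>: "\<beta> \<in> \<Phi>"
    proof -
     have "[\<beta> (x * y) = \<beta> x + \<beta> y] (mod int p)" if "x \<in> N" "y \<in> N" for x y
      using \<alpha>(1) that S(2) by (simp add: \<beta>_def cong_def mod_add_eq)
     thus ?thesis using p0 by (auto simp: \<Phi>_def \<beta>_def)
    qed
    have "\<iota> (y * (inverse y * x)) \<beta> = \<iota> y \<beta> + \<iota> (inverse y * x) \<beta>"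
     using \<iota>a[OF xy(2) n(1)] by simp
    hence "\<iota> (inverse y * x) \<beta> = 0" using xy(3) by (simp add: group_norm)
    moreover have "circ_of p 0 = 0" using circ_of_add[of p 0 0] by simp
    ultimately have "[\<beta> (inverse y * x) = 0] (mod int p)"
     using \<beta>\<Phi> circ_of_eq_iff[OF p0, of _ 0] by (simp add: \<iota>_def)
    thus False using \<alpha>(2) n(1) by (simp add: \<beta>_def cong_0_iff dvd_mod_iff)
   qed
  qed
  show "pact (\<pi> g) (\<iota> n) = \<iota> (cj g n)" if g: "g \<in> G" and n: "n \<in> N" for g n
  proof
   fix \<alpha>
   have "Perm.apply (inverse (\<pi> g)) \<alpha> = tr (inverse g) \<alpha>" using \<pi>i[OF g] ap SG(3) g by simp
   thus "pact (\<pi> g) (\<iota> n) \<alpha> = \<iota> (cj g n) \<alpha>"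
    using tr\<Phi>[OF SG(3)[OF g], of \<alpha>] by (auto simp: pact_def \<iota>_def tr_def)
  qed
  show "\<pi> g = 1" if g: "g \<in> G" and fx: "\<forall>n\<in>N. cj g n = n" for g
  proof (rule perm_eqI)
   fix \<alpha>
   have "\<alpha> (cj (inverse g) x) = \<alpha> x" if "\<alpha> \<in> \<Phi>" for x
   proof (cases "x \<in> N")
    case True
    hence "cj (inverse g) x = x" using fx by (metis cj_left_inv(1))
    thus ?thesis by simp
   next
    case False
    thus ?thesis using that cjN[OF SG(3)[OF g]] by (simp add: \<Phi>_def)
   qed
   thus "Perm.apply (\<pi> g) \<alpha> = Perm.apply 1 \<alpha>" by (auto simp: ap[OF g] tr_def fun_eq_iff)
  qed
  show "homo G \<pi>" using \<pi>m by (simp add: homo_def)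
 qed
qed

section \<open>Rational groups\<close>

text \<open>The condition \<open>(x ^ k) ^ m = x\<close> says that \<open>x ^ k\<close> generates the same subgroup as \<open>x\<close>.\<close>

definition rational :: "'a::group_mult set \<Rightarrow> bool" where
 "rational G \<longleftrightarrow> (\<forall>x\<in>G. \<forall>k m. (x ^ k) ^ m = x \<longrightarrow> (\<exists>g\<in>G. cj g x = x ^ k))"

text \<open>To \<open>k\<close> is added \<open>m\<close> times the product of those primes of
  \<open>n\<close> that do not divide \<open>k\<close>; each prime of \<open>n\<close> then divides
  exactly one of the two summands. This turns an exponent prime to the order of a quotient into one
  prime to the order of the whole group.\<close>

lemma coprime_lift:
 fixes k m n :: nat
 assumes "coprime k m" "n > 0"
 shows "\<exists>k'. [k' = k] (mod m) \<and> coprime k' n"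
proof -
 define r where "r = \<Prod>{q \<in> prime_factors n. \<not> q dvd k}"
 have "coprime (k + m * r) n"
 proof (rule ccontr)
  assume "\<not> ?thesis"
  hence "gcd (k + m * r) n \<noteq> 1" by (simp add: coprime_iff_gcd_eq_1)
  then obtain q where q: "prime q" "q dvd k + m * r" "q dvd n"
   using prime_factor_nat[of "gcd (k + m * r) n"] by auto
  show False
  proof (cases "q dvd k")
   case True
   hence "q dvd m * r" using q(2) by (simp add: dvd_add_right_iff)
   moreover have "\<not> q dvd m" using True assms(1) q(1) by (metis coprime_common_divisor not_prime_unit)
   ultimately have "q dvd r" using q(1) prime_dvd_mult_iff by blast
   then obtain q' where "q' \<in> prime_factors n" "\<not> q' dvd k" "q dvd q'"
    using q(1) by (auto simp: r_def prime_dvd_prod_iff)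
   thus False using q(1) True by (metis in_prime_factors_imp_prime primes_dvd_imp_eq)
  next
   case False
   hence "q dvd r" unfolding r_def using q assms(2) by (intro dvd_prodI) (auto simp: prime_factors_dvd)
   hence "q dvd k" using q(2) by (metis dvd_add_left_iff dvd_mult)
   thus False using False by blast
  qed
 qed
 moreover have "[k + m * r = k] (mod m)" by (simp add: cong_def)
 ultimately show ?thesis by blast
qed

lemma power_cong_card:
 assumes "x ^ n = (1::'a::monoid_mult)" "[k = l] (mod n)" shows "x ^ k = x ^ l"
proof -
 have "x ^ k = x ^ (k mod n)" for k
  by (metis assms(1) mult_div_mod_eq power_add power_mult power_one mult_1_left)
 thus ?thesis using assms(2) by (metis cong_def)
qed

lemma rational_power:
 assumes "rational G" "subgrp G" "finite G" "x \<in> G" "x ^ n = 1" "coprime k n" "n > 0"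
 shows "\<exists>g\<in>G. cj g x = x ^ k"
proof -
 obtain m where "[k * m = 1] (mod n)"
  using cong_solve_coprime_nat[OF assms(6)] by auto
 hence "(x ^ k) ^ m = x" using power_cong_card[OF assms(5)] by (metis power_mult power_one_right)
 thus ?thesis using assms unfolding rational_def by blast
qed

lemma rational_inverse:
 assumes "rational G" "subgrp G" "finite G" "x \<in> G" obtains g where "g \<in> G" "cj g x = inverse x"
proof -
 note p = power_minus_one[OF pow_card[OF assms(2-4)] card_subgrp_pos[OF assms(2,3)]]
 show thesis
  using rational_power[OF assms pow_card[OF assms(2-4)] p(2) card_subgrp_pos[OF assms(2,3)]] that unfolding p(1) by blast
qed

lemma homo_one: assumes "homo G f" "1 \<in> G" shows "f 1 = 1"
proof -
 have "f 1 * f 1 = f 1 * 1" using assms unfolding homo_def by (metis mult_1_right)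
 thus ?thesis by (simp del: mult_1_right)
qed

lemma homo_props:
 assumes "homo G f" "subgrp G"
 shows "x \<in> G ==> f (inverse x) = inverse (f x)" "x \<in> G ==> f (x ^ n) = f x ^ n"
  "x \<in> G ==> y \<in> G ==> f (cj x y) = cj (f x) (f y)" "x \<in> G ==> y \<in> G ==> f (cmt x y) = cmt (f x) (f y)"
  "subgrp (f ` G)"
proof -
 note S = subgrpD[OF assms(2)]
 have m: "f (x * y) = f x * f y" if "x \<in> G" "y \<in> G" for x y using assms(1) that by (simp add: homo_def)
 note o = homo_one[OF assms(1) S(1)]
 have i: "f (inverse x) = inverse (f x)" if "x \<in> G" for x
 proof -
  have "f x * f (inverse x) = 1" using m[of x "inverse x"] that S(3) o by simp
  thus ?thesis using group_inverse_unique by metis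
 qed
 show "x \<in> G ==> f (inverse x) = inverse (f x)" by (rule i)
 show "x \<in> G ==> f (x ^ n) = f x ^ n" by (induction n) (auto simp: m o S(6))
 show "x \<in> G ==> y \<in> G ==> f (cj x y) = cj (f x) (f y)" using S(2,3) by (simp add: cj_def m i)
 show "x \<in> G ==> y \<in> G ==> f (cmt x y) = cmt (f x) (f y)" using S(2,3) by (simp add: cmt_def m i)
 show "subgrp (f ` G)" unfolding subgrp_def
 proof (intro conjI ballI)
  show "1 \<in> f ` G" using o S(1) by (metis imageI)
  show "a * b \<in> f ` G" if "a \<in> f ` G" "b \<in> f ` G" for a b
   using that m S(2) by (auto simp: image_iff) metis
  show "inverse a \<in> f ` G" if "a \<in> f ` G" for a
   using that i S(3) by (auto simp: image_iff) metis
 qed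
qed

lemma homo_subset: "homo G f ==> A \<subseteq> G ==> homo A f" by (auto simp: homo_def)

lemma homo_solv: assumes f: "homo G f" and G: "subgrp G" "solv G" shows "solv (f ` G)"
proof -
 have der: "der (f ` A) \<subseteq> f ` der A" "der A \<subseteq> A" if A: "subgrp A" "A \<subseteq> G" for A
 proof -
  show dA: "der A \<subseteq> A" by (rule der_least[OF A(1)]) (rule subgrpD(5)[OF A(1)])
  show "der (f ` A) \<subseteq> f ` der A"
  proof (rule der_least)
   show "subgrp (f ` der A)" by (rule homo_props(5)[OF homo_subset[OF f] der_subgrp]) (use dA A in blast)
   show "cmt x y \<in> f ` der A" if xy: "x \<in> f ` A" "y \<in> f ` A" for x y
   proof -
    obtain a b where "a \<in> A" "b \<in> A" "x = f a" "y = f b" using xy by blast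
    thus ?thesis using cmt_der[of a A b] homo_props(4)[OF homo_subset[OF f A(2)] A(1), of a b] by (metis imageI)
   qed
  qed
 qed
 have "(der ^^ n) (f ` G) \<subseteq> f ` (der ^^ n) G \<and> subgrp ((der ^^ n) G) \<and> (der ^^ n) G \<subseteq> G" for n
 proof (induction n)
  case (Suc n)
  hence h: "(der ^^ n) (f ` G) \<subseteq> f ` (der ^^ n) G" "subgrp ((der ^^ n) G)" "(der ^^ n) G \<subseteq> G" by auto
  hence "der ((der ^^ n) (f ` G)) \<subseteq> f ` der ((der ^^ n) G)"
   using der_mono[OF h(1)] der(1)[OF h(2,3)] by blast
  thus ?case using der_subgrp der(2)[OF h(2,3)] h(3) by auto
 qed (use G in auto)
 moreover obtain n where "(der ^^ n) G \<subseteq> {1}" using G(2) by (auto simp: solv_def)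
 ultimately have "(der ^^ n) (f ` G) \<subseteq> f ` {1}" by blast
 thus ?thesis using homo_one[OF f subgrpD(1)[OF G(1)]] by (auto simp: solv_def)
qed

lemma homo_card: assumes f: "homo G f" and G: "subgrp G" "finite G"
 shows "card G = card (f ` G) * card {g \<in> G. f g = 1}"
proof -
 note S = subgrpD[OF G(1)]
 have m: "f (x * y) = f x * f y" if "x \<in> G" "y \<in> G" for x y using f that by (simp add: homo_def)
 have fib: "card {g \<in> G. f g = y} = card {g \<in> G. f g = 1}" if yG: "y \<in> f ` G" for y
 proof -
  obtain x where x: "x \<in> G" "y = f x" using yG by blast
  have i: "f (inverse x * g) = inverse y * f g" "f (x * g) = y * f g" "inverse x * g \<in> G" "x * g \<in> G" if "g \<in> G" for g
   using homo_props(1)[OF f G(1) x(1)] m[of "inverse x" g] m[of x g] S(2,3) x that by auto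
  have "{g \<in> G. f g = y} = (\<lambda>g. x * g) ` {g \<in> G. f g = 1}"
  proof (intro equalityI subsetI)
   fix g assume "g \<in> {g \<in> G. f g = y}"
   hence "g = x * (inverse x * g)" "inverse x * g \<in> {g \<in> G. f g = 1}"
    using i(1,3)[of g] by (simp_all add: group_left_cancel2)
   thus "g \<in> (\<lambda>g. x * g) ` {g \<in> G. f g = 1}" by (rule image_eqI)
  next
   fix g assume "g \<in> (\<lambda>g. x * g) ` {g \<in> G. f g = 1}"
   thus "g \<in> {g \<in> G. f g = y}" using i(2,4) by auto
  qed
  thus ?thesis using card_image[of "(*) x" "{g \<in> G. f g = 1}"] by (simp add: inj_on_def)
 qed
 have "card G = (\<Sum>y\<in>f ` G. card {g \<in> G. f g = y})"
  unfolding card_eq_sum by (rule sum.image_gen[OF G(2)])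
 also have "\<dots> = card (f ` G) * card {g \<in> G. f g = 1}" using fib by simp
 finally show ?thesis .
qed

lemma homo_rational_power:
 assumes f: "homo G f" and G: "subgrp G" "finite G" "rational G"
  and x: "x \<in> f ` G" "coprime k (card (f ` G))"
 shows "\<exists>g\<in>f ` G. cj g x = x ^ k"
proof -
 obtain y where y: "y \<in> G" "x = f y" using x(1) by blast
 obtain k' where k': "[k' = k] (mod card (f ` G))" "coprime k' (card G)"
  using coprime_lift[OF x(2) card_subgrp_pos[OF G(1,2)]] by blast
 obtain g where g: "g \<in> G" "cj g y = y ^ k'"
  using rational_power[OF G(3,1,2) y(1) pow_card[OF G(1,2) y(1)] k'(2) card_subgrp_pos[OF G(1,2)]] by blast
 have "cj (f g) x = x ^ k'" using homo_props[OF f G(1)] g y by metis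
 also have "\<dots> = x ^ k"
  using power_cong_card[OF pow_card[OF homo_props(5)[OF f G(1)] _ x(1)] k'(1)] G(2) by simp
 finally show ?thesis using g(1) by blast
qed

lemma homo_rational:
 assumes f: "homo G f" and G: "subgrp G" "finite G" "rational G" shows "rational (f ` G)"
 unfolding rational_def
proof (intro ballI allI impI)
 fix x k m assume x: "x \<in> f ` G" "(x ^ k) ^ m = x"
 define n where "n = (LEAST n. n > 0 \<and> x ^ n = 1)"
 have fin: "finite (f ` G)" using G(2) by simp
 have "card (f ` G) > 0 \<and> x ^ card (f ` G) = 1"
  using pow_card[OF homo_props(5)[OF f G(1)] fin x(1)] card_subgrp_pos[OF homo_props(5)[OF f G(1)] fin] by blast
 hence n: "n > 0" "x ^ n = 1" "\<And>l. l > 0 ==> x ^ l = 1 ==> n \<le> l"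
  unfolding n_def by (metis (mono_tags, lifting) LeastI, metis (mono_tags, lifting) LeastI, metis (mono_tags, lifting) Least_le)
 have ndvd: "n dvd l" if "x ^ l = 1" for l
 proof -
  have "x ^ (l mod n) = 1" using power_cong_card[OF n(2), of "l mod n" l] that by simp
  hence "l mod n = 0" using n(3)[of "l mod n"] n(1) by (metis mod_less_divisor not_le gr0I)
  thus ?thesis by auto
 qed
 have ck: "coprime k n"
 proof (cases "k * m = 0")
  case True
  hence "x = 1" using x(2) by auto
  hence "n = 1" using ndvd[of 1] by simp
  thus ?thesis by simp
 next
  case False
  hence "x ^ (k * m - 1) * x = 1 * x" using x(2) by (simp flip: power_mult power_Suc2)
  hence "x ^ (k * m - 1) = 1" by (simp only: group_right_cancel)
  then obtain l where "k * m - 1 = n * l" using ndvd by (auto simp: dvd_def)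
  hence "k * m = n * l + 1" using False by linarith
  thus ?thesis
   by (metis coprime_add_one_right coprime_def dvd_add_right_iff dvd_mult dvd_mult2)
 qed
 obtain k' where k': "[k' = k] (mod n)" "coprime k' (card (f ` G))"
  using coprime_lift[OF ck card_subgrp_pos[OF homo_props(5)[OF f G(1)] fin]] by blast
 obtain g where "g \<in> f ` G" "cj g x = x ^ k'" using homo_rational_power[OF f G x(1) k'(2)] by blast
 thus "\<exists>g\<in>f ` G. cj g x = x ^ k" using power_cong_card[OF n(2) k'(1)] by metis
qed

section \<open>Exclusion of the primes from 7 on\<close>

definition min_normal :: "'a::group_mult set \<Rightarrow> 'a set \<Rightarrow> bool" where
 "min_normal N G \<longleftrightarrow> normal_in N G \<and> N \<noteq> {1} \<and> (\<forall>M. normal_in M G \<longrightarrow> M \<subseteq> N \<longrightarrow> M = {1} \<or> M = N)"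

lemma linear_module:
 fixes G :: "'a::group_mult set"
 assumes G: "subgrp G" "finite G" and N: "normal_in N G" "\<forall>x\<in>N. \<forall>y\<in>N. x * y = y * x"
  and p: "prime p" "\<forall>x\<in>N. x ^ p = 1"
 obtains \<pi> :: "'a \<Rightarrow> ('a \<Rightarrow> int) perm" and \<iota> :: "'a \<Rightarrow> ('a \<Rightarrow> int) \<Rightarrow> circ"
 where "homo G \<pi>" "inj_on \<iota> N" "adsub (\<iota> ` N)" "\<iota> 1 = 0" "\<forall>m\<in>N. \<forall>n\<in>N. \<iota> (m * n) = \<iota> m + \<iota> n"
  "\<forall>n\<in>N. \<forall>c. (\<Sum>i<c. \<iota> n) = \<iota> (n ^ c)" "\<forall>g\<in>G. \<forall>n\<in>N. pact (\<pi> g) (\<iota> n) = \<iota> (cj g n)"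
  "\<forall>g\<in>G. \<pi> g = 1 \<longleftrightarrow> (\<forall>n\<in>N. cj g n = n)" "card (\<pi> ` G) dvd card G div card N"
proof -
 have nN: "subgrp N" "N \<subseteq> G" using N(1) by (auto simp: normal_in_def)
 note S = subgrpD[OF nN(1)] and SG = subgrpD[OF G(1)]
 have finN: "finite N" using nN(2) G(2) finite_subset by blast
 obtain \<pi> :: "'a \<Rightarrow> ('a \<Rightarrow> int) perm" and \<iota> :: "'a \<Rightarrow> ('a \<Rightarrow> int) \<Rightarrow> circ"
  where h: "homo G \<pi>" and inj: "inj_on \<iota> N" and \<iota>0: "\<forall>x\<in>N. \<forall>y\<in>N. \<iota> (x * y) = \<iota> x + \<iota> y"
   and act: "\<forall>g\<in>G. \<forall>n\<in>N. pact (\<pi> g) (\<iota> n) = \<iota> (cj g n)"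
   and ker: "\<forall>g\<in>G. (\<forall>n\<in>N. cj g n = n) \<longrightarrow> \<pi> g = 1"
  using linear_model[OF G(1) N(1) finN N(2)[rule_format] p(1) p(2)[rule_format]] by blast
 have \<iota>: "\<iota> (x * y) = \<iota> x + \<iota> y" if "x \<in> N" "y \<in> N" for x y using \<iota>0 that by blast
 have \<iota>1: "\<iota> 1 = 0" using \<iota>[of 1 1] S(1) by simp
 have \<iota>i: "\<iota> (inverse n) = - \<iota> n" if "n \<in> N" for n
  using \<iota>[of n "inverse n"] S(3) that \<iota>1 by (simp add: eq_neg_iff_add_eq_0 add.commute)
 have VN: "v \<in> \<iota> ` N \<longleftrightarrow> (\<exists>n\<in>N. v = \<iota> n)" for v by auto
 have aV: "adsub (\<iota> ` N)" unfolding adsub_def using S \<iota> \<iota>1 \<iota>i by (auto simp: VN simp del: image_iff) metis+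
 have sum: "(\<Sum>i<c. \<iota> n) = \<iota> (n ^ c)" if n: "n \<in> N" for n c
  by (induction c) (use n \<iota>[OF n S(6)[OF n]] \<iota>1 in \<open>auto simp: add.commute\<close>)
 have ker1: "\<pi> g = 1 \<longleftrightarrow> (\<forall>n\<in>N. cj g n = n)" if g: "g \<in> G" for g
 proof
  assume "\<pi> g = 1"
  hence "\<iota> (cj g n) = \<iota> n" if "n \<in> N" for n using act g that by (metis pact.act_one)
  moreover have "cj g n \<in> N" if "n \<in> N" for n using N(1) g that by (simp add: normal_in_def)
  ultimately show "\<forall>n\<in>N. cj g n = n" using inj by (meson inj_onD)
 qed (use ker g in blast)
 have "card (\<pi> ` G) dvd card G div card N"
 proof -
  define C where "C = {g \<in> G. \<pi> g = 1}"
  have SC: "subgrp C" unfolding subgrp_def C_def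
   using SG h[unfolded homo_def] homo_one[OF h SG(1)] homo_props(1)[OF h G(1)] by auto
  have "N \<subseteq> C" "finite C" using nN(2) N(2) ker G(2) by (auto simp: C_def cj_fix_iff)
  then obtain c where "card C = card N * c" using card_subgrp_dvd[OF SC nN(1)] by (auto simp: dvd_def)
  hence "card G = card N * (card (\<pi> ` G) * c)" using homo_card[OF h G] by (simp add: C_def)
  thus ?thesis using card_subgrp_pos[OF nN(1) finN] by simp
 qed
 thus thesis using that h inj aV \<iota>1 \<iota>0 sum act ker1 by blast
qed

theorem no_large_prime:
 fixes G :: "'a::group_mult set"
 assumes G: "subgrp G" "finite G" "solv G" "rational G"
  and N: "min_normal N G" "\<And>x y. x \<in> N ==> y \<in> N ==> x * y = y * x"
  and p: "prime p" "p \<ge> 7" "\<And>x. x \<in> N ==> x ^ p = 1" "\<not> p dvd card G div card N"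
 shows False
proof -
 have nN: "normal_in N G" using N(1) by (simp add: min_normal_def)
 have SN: "subgrp N" "N \<subseteq> G" using nN by (auto simp: normal_in_def)
 note S = subgrpD[OF SN(1)] and SG = subgrpD[OF G(1)]
 have finN: "finite N" using SN(2) G(2) finite_subset by blast
 have cjN: "cj g n \<in> N" if "g \<in> G" "n \<in> N" for g n using nN that by (simp add: normal_in_def)
 obtain \<pi> :: "'a \<Rightarrow> ('a \<Rightarrow> int) perm" and \<iota> :: "'a \<Rightarrow> ('a \<Rightarrow> int) \<Rightarrow> circ"
  where h\<pi>: "homo G \<pi>" and inj: "inj_on \<iota> N" and aV0: "adsub (\<iota> ` N)" and \<iota>1: "\<iota> 1 = 0"
   and \<iota>0: "\<forall>x\<in>N. \<forall>y\<in>N. \<iota> (x * y) = \<iota> x + \<iota> y" and pw: "\<forall>n\<in>N. \<forall>c. (\<Sum>i<c. \<iota> n) = \<iota> (n ^ c)"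
   and act0: "\<forall>g\<in>G. \<forall>n\<in>N. pact (\<pi> g) (\<iota> n) = \<iota> (cj g n)"
   and ker: "\<forall>g\<in>G. \<pi> g = 1 \<longleftrightarrow> (\<forall>n\<in>N. cj g n = n)" and cH: "card (\<pi> ` G) dvd card G div card N"
  by (rule linear_module[OF G(1,2) nN _ p(1)]) (use N(2) p(3) in blast)+
 have \<iota>: "\<iota> (x * y) = \<iota> x + \<iota> y" if "x \<in> N" "y \<in> N" for x y using \<iota>0 that by blast
 have act: "pact (\<pi> g) (\<iota> n) = \<iota> (cj g n)" if "g \<in> G" "n \<in> N" for g n using act0 that by blast
 define H where "H = \<pi> ` G"
 define V where "V = \<iota> ` N"
 have aV: "adsub V" using aV0 by (simp add: V_def)
 have SH: "subgrp H" "finite H" using homo_props(5)[OF h\<pi> G(1)] G(2) by (auto simp: H_def)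
 have sH: "solv H" unfolding H_def by (rule homo_solv[OF h\<pi> G(1,3)])
 have pH: "\<not> p dvd card H" using cH p(4) dvd_trans by (auto simp: H_def)
 have VN: "v \<in> V \<longleftrightarrow> (\<exists>n\<in>N. v = \<iota> n)" for v by (auto simp: V_def)
 have HV: "pact h v \<in> V" if "h \<in> H" "v \<in> V" for h v
  using that act cjN by (auto simp: H_def VN)
 have rat: "\<exists>g\<in>H. cj g x = x ^ k" if "x \<in> H" "coprime k (card H)" for x k
  using homo_rational_power[OF h\<pi> G(1,2,4)] that by (simp add: H_def)
 have real: "\<exists>g\<in>H. cj g x = inverse x" if x: "x \<in> H" for x
  using rational_inverse[OF _ SH x] homo_rational[OF h\<pi> G(1,2,4)] unfolding H_def by blast
 have inv: "\<iota> (inverse n) = - \<iota> n" if "n \<in> N" for n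
  using \<iota>[of n "inverse n"] S(3) that \<iota>1 by (simp add: eq_neg_iff_add_eq_0 add.commute)
 \<comment> \<open>Invariant subgroups of \<open>V\<close> pull back to normal subgroups of
   \<open>G\<close> inside \<open>N\<close>.\<close>
 have irred: "W = {0} \<or> W = V" if W: "adsub W" "W \<subseteq> V" "\<And>h w. h \<in> H ==> w \<in> W ==> pact h w \<in> W" for W
 proof -
  define M where "M = {n \<in> N. \<iota> n \<in> W}"
  have "normal_in M G" unfolding normal_in_def subgrp_def
  proof (intro conjI ballI)
   show "cj g n \<in> M" if "g \<in> G" "n \<in> M" for g n
    using that W(3)[of "\<pi> g" "\<iota> n"] act cjN by (auto simp: M_def H_def)
  qed (use S \<iota> \<iota>1 inv adsubD[OF W(1)] SN in \<open>auto simp: M_def\<close>)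
  hence "M = {1} \<or> M = N" using N(1) by (auto simp: min_normal_def M_def)
  moreover have "W = \<iota> ` M" using W(2) by (auto simp: M_def V_def)
  ultimately show ?thesis using \<iota>1 by (auto simp: V_def)
 qed
 obtain n0 where n0: "n0 \<in> N" "n0 \<noteq> 1" using N(1) S(1) by (auto simp: min_normal_def)
 obtain \<alpha> :: "'a \<Rightarrow> int" where \<alpha>: "\<forall>x\<in>N. \<forall>y\<in>N. [\<alpha> (x * y) = \<alpha> x + \<alpha> y] (mod int p)" "\<not> int p dvd \<alpha> n0"
  using functional_exists[OF SN(1) finN N(2) p(1,3) n0] by blast
 define \<beta> where "\<beta> v = \<alpha> (inv_into N \<iota> v)" for v
 have \<beta>\<iota>: "\<beta> (\<iota> n) = \<alpha> n" if "n \<in> N" for n using inv_into_f_f[OF inj that] by (simp add: \<beta>_def)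
 have \<beta>: "addmod p V \<beta>" unfolding addmod_def
 proof (intro ballI)
  fix u v assume "u \<in> V" "v \<in> V"
  then obtain x y where xy: "x \<in> N" "y \<in> N" "u = \<iota> x" "v = \<iota> y" by (auto simp: VN)
  hence "u + v = \<iota> (x * y)" using \<iota> by simp
  thus "[\<beta> (u + v) = \<beta> u + \<beta> v] (mod int p)" using \<alpha>(1) xy \<beta>\<iota> S(2) by simp
 qed
 have on0: "\<iota> n0 \<in> V" "\<not> int p dvd \<beta> (\<iota> n0)" using n0 \<alpha>(2) \<beta>\<iota> by (auto simp: VN)
 have "\<exists>B. (\<forall>u\<in>V. addmod p V (B u) \<and> addmod p V (\<lambda>x. B x u)) \<and>
   (\<forall>h\<in>H. \<forall>u\<in>V. \<forall>v\<in>V. B (pact h u) (pact h v) = B u v) \<and>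
   (\<forall>u\<in>V. (\<forall>v\<in>V. int p dvd B u v) \<longrightarrow> u = 0)"
  by (rule pact.invariant_form_exists[where \<alpha> = \<beta> and v\<^sub>0 = "\<iota> n0"])
   (fact SH p(1) pH aV HV real irred \<beta> on0)+
 then obtain B where B: "\<forall>u\<in>V. addmod p V (B u) \<and> addmod p V (\<lambda>x. B x u)"
   "\<forall>h\<in>H. \<forall>u\<in>V. \<forall>v\<in>V. B (pact h u) (pact h v) = B u v"
   "\<forall>u\<in>V. (\<forall>v\<in>V. int p dvd B u v) \<longrightarrow> u = 0" by (elim exE conjE)
 have pow: "\<exists>h\<in>H. pact h (\<iota> n) = \<iota> (n ^ k)" if n: "n \<in> N" and k: "coprime k p" for n k
 proof -
  obtain g where "g \<in> G" "cj g n = n ^ k"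
   using rational_power[OF G(4,1,2) _ p(3)[OF n] k] n SN(2) prime_gt_0_nat[OF p(1)] by blast
  hence "\<pi> g \<in> H" "pact (\<pi> g) (\<iota> n) = \<iota> (n ^ k)" using act n by (auto simp: H_def)
  thus ?thesis by blast
 qed
 have cop: "coprime k p" if "0 < k" "k < p" for k
  using that p(1) by (metis coprime_commute nat_dvd_not_less prime_imp_coprime)
 have mul: "\<exists>h\<in>H. pact h v = (\<Sum>i<k. v)" if "v \<in> V" "0 < k" "k < p" for v k
  using that pow[OF _ cop[OF that(2,3)]] pw VN by metis
 have two: "\<exists>h\<in>H. pact h v = v + v" and three: "\<exists>h\<in>H. pact h v = v + v + v" if v: "v \<in> V" for v
  using mul[OF v, of 2] mul[OF v, of 3] p(2) by (simp_all add: numeral_2_eq_2 numeral_3_eq_3)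
 have alt: "int p dvd B v v" if v: "v \<in> V" for v
 proof -
  obtain h where h: "h \<in> H" "pact h v = v + v" using two v by blast
  have vv: "v + v \<in> V" using adsubD(2)[OF aV] v by blast
  have "B v v = B (v + v) (v + v)" using B(2) h v by metis
  also have "[\<dots> = B (v + v) v + B (v + v) v] (mod int p)" using B(1) vv v unfolding addmod_def by blast
  finally have "[B v v = B (v + v) v + B (v + v) v] (mod int p)" .
  moreover have "[B (v + v) v = B v v + B v v] (mod int p)" using B(1) v unfolding addmod_def by blast
  ultimately have "[B v v = (B v v + B v v) + (B v v + B v v)] (mod int p)"
   by (metis cong_add cong_trans)
  hence "int p dvd 3 * B v v" by (simp add: cong_iff_dvd_diff)
  moreover have "\<not> int p dvd 3" using p(2) zdvd_imp_le[of "int p" 3] by auto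
  ultimately show ?thesis using p(1) by (simp add: prime_dvd_mult_iff)
 qed
 interpret form_module pact H V p B
  by unfold_locales (use SH p pH aV HV B alt in \<open>auto simp: V_def finN\<close>)
 have "good H V" unfolding good_def
 proof (intro conjI)
  show "\<exists>v\<in>V. v \<noteq> 0" using n0 inj \<iota>1 S(1) by (metis VN inj_on_eq_iff)
  show "\<forall>v\<in>V. (\<forall>w\<in>V. B v w \<simeq> 0) \<longrightarrow> v = 0" using B(3) by (simp add: zeq_0_iff)
 qed (use SH aV HV two three in auto)
 moreover have "ratl H V" unfolding ratl_def
 proof (intro allI impI ballI)
  fix f :: "('a \<Rightarrow> int) perm \<Rightarrow> int" and x k
  assume f: "(\<forall>g\<in>H. \<forall>x\<in>H. f (cj g x) = f x) \<and> (\<forall>z\<in>zs H V. \<forall>x\<in>H. f (z * x) = sg V z * f x)"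
   and x: "x \<in> H" "coprime k (card H)"
  obtain g where "g \<in> H" "cj g x = x ^ k" using rat x by blast
  thus "f (x ^ k) = f x" using f x by metis
 qed
 ultimately show False using no_rational_good_pair sH by blast
qed

section \<open>Rational groups with a unique involution\<close>

lemma cj_pow_iter: assumes "cj g x = x ^ k" shows "cj (g ^ c) x = x ^ (k ^ c)"
proof (induction c)
 case (Suc c)
 have "cj (g ^ Suc c) x = cj g (cj (g ^ c) x)" by (simp add: cj_cj)
 also have "\<dots> = x ^ (k ^ Suc c)" using assms by (simp add: Suc cj_pow power_mult)
 finally show ?case .
qed simp

text \<open>As \<open>k * k\<close> is 1 modulo \<open>n\<close>, an odd power of a conjugating
  element still raises \<open>x\<close> to the power \<open>k\<close>, so the odd part of its order
  can be removed.\<close>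

lemma rational_two_element:
 assumes "rational G" "subgrp G" "finite G" "x \<in> G" "x ^ n = 1" "n > 0" "[k * k = 1] (mod n)"
 obtains u m where "u \<in> G" "u ^ (2 ^ m) = 1" "cj u x = x ^ k"
proof -
 have "coprime k n" using assms(7) coprime_iff_invertible_nat by auto
 then obtain g where g: "g \<in> G" "cj g x = x ^ k" using rational_power[OF assms(1-5) _ assms(6)] by blast
 obtain c m where c: "odd c" "(g ^ c) ^ (2 ^ m) = 1" using prime_part[OF assms(2,3) g(1), of 2] by auto
 obtain b where "c = 2 * b + 1" using c(1) by (auto elim: oddE)
 hence "k ^ c = k * (k * k) ^ b" by (simp add: power_mult power2_eq_square)
 moreover have "[(k * k) ^ b = 1 ^ b] (mod n)" by (rule cong_pow) (rule assms(7))
 ultimately have "[k ^ c = k] (mod n)" by (metis cong_mult cong_refl power_one mult_1_right)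
 hence "cj (g ^ c) x = x ^ k" using cj_pow_iter[OF g(2)] power_cong_card[OF assms(5)] by metis
 thus thesis using that[OF _ c(2)] subgrpD(6)[OF assms(2) g(1)] by blast
qed

lemma odd_power_generates:
 assumes "(x::'a::monoid_mult) ^ (2 ^ n) = 1" "odd s" shows "\<exists>u. x = (x ^ s) ^ u"
proof -
 have "coprime s (2 ^ n)" using assms(2) by simp
 then obtain u where "[s * u = 1] (mod 2 ^ n)" using cong_solve_coprime_nat[of s "2 ^ n"] by auto
 hence "x ^ (s * u) = x ^ 1" by (rule power_cong_card[OF assms(1)])
 thus ?thesis by (metis power_mult power_one_right)
qed

locale unique_involution =
 fixes H :: "'a::group_mult set" and z :: 'a
 assumes H: "subgrp H" "finite H" "rational H"
  and z: "z \<in> H" "z \<noteq> 1" "z * z = 1" "\<And>t. t \<in> H ==> t * t = 1 ==> t = 1 \<or> t = z"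
begin

lemmas SH = subgrpD[OF H(1)]

lemma z_inv [simp]: "inverse z = z" using z(3) by (rule group_inverse_unique)
lemma zz [simp]: "z * (z * x) = x" using z(3) by (metis mult.assoc mult_1_left)
lemma z_pow: "z ^ n = (if even n then 1 else z)" by (induction n) (auto simp: z(3))

lemma cj_z [simp]: "h \<in> H ==> cj h z = z"
 using z(4)[of "cj h z"] z SH(4) by (metis cj_eq_one cj_mult cj_one(1))
lemma zc: "h \<in> H ==> h * z = z * h" using cj_z cj_fix_iff by metis

lemma two_power_z: assumes "t \<in> H" "t ^ (2 ^ n) = 1" "t \<noteq> 1" shows "\<exists>k. t ^ k = z"
proof -
 obtain j where j: "t ^ (2 ^ j) \<noteq> 1" "(t ^ (2 ^ j)) ^ 2 = 1"
  using exists_prime_power_step[OF assms(3,2)] by blast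
 thus ?thesis using z(4)[of "t ^ (2 ^ j)"] SH(6)[OF assms(1)] by (auto simp: power2_eq_square)
qed

text \<open>A commutative 2-group with at most one involution is cyclic. Induction on the order of
  \<open>a\<close>: if \<open>a ^ 2\<close> is the square of a power of \<open>b\<close>, the
  quotient of \<open>a\<close> by that power has square 1, so it is 1 or \<open>z\<close>, and
  \<open>z\<close> is a power of \<open>b\<close> unless \<open>b = 1\<close>.\<close>

lemma commuting_two_elements:
 assumes "a \<in> H" "b \<in> H" "a * b = b * a" "a ^ (2 ^ m) = 1" "b ^ (2 ^ n) = 1"
 shows "(\<exists>s. b = a ^ s) \<or> (\<exists>s. a = b ^ s)"
 using assms
proof (induction m arbitrary: a)
 case 0
 hence "a = b ^ 0" by simp
 thus ?case by blast
next
 case (Suc m)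
 have "(a ^ 2) ^ (2 ^ m) = 1" using Suc.prems(4) by (simp add: power_mult[symmetric] mult.commute)
 moreover have "a ^ 2 * b = b * a ^ 2" using Suc.prems(3) by (simp add: power2_eq_square) (metis mult.assoc)
 ultimately consider s where "b = (a ^ 2) ^ s" | s where "a ^ 2 = b ^ s"
  using Suc.IH[of "a ^ 2"] SH(6)[OF Suc.prems(1)] Suc.prems(2,5) by blast
 thus ?case
 proof cases
  case 1 thus ?thesis by (metis power_mult)
 next
  case (2 s)
  show ?thesis
  proof (cases "odd s")
   case True
   then obtain u where "b = (b ^ s) ^ u" using odd_power_generates[OF Suc.prems(5)] by blast
   hence "b = a ^ (2 * u)" using 2 by (simp add: power_mult)
   thus ?thesis by blast
  next
   case False
   then obtain l where l: "s = 2 * l" by (auto elim: evenE)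
   define w where "w = a * inverse (b ^ l)"
   have ab: "a * b ^ l = b ^ l * a" using Suc.prems(3) by (metis power_commuting_commutes)
   have ai: "inverse (b ^ l) * a = a * inverse (b ^ l)"
    using ab by (metis group_left_cancel1 group_right_inverse mult.assoc mult_1_right)
   have "w * w = a * (inverse (b ^ l) * a) * inverse (b ^ l)" by (simp add: w_def mult.assoc)
   also have "\<dots> = a ^ 2 * inverse (b ^ l * b ^ l)" by (simp add: ai group_norm power2_eq_square)
   also have "\<dots> = 1" using 2 by (simp add: l power_add[symmetric] mult_2)
   finally have "w = 1 \<or> w = z" using z(4)[of w] SH Suc.prems by (simp add: w_def)
   thus ?thesis
   proof
    assume "w = 1"
    hence "a = b ^ l" by (simp add: w_def) (metis mult.assoc group_left_inverse mult_1_left mult_1_right)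
    thus ?thesis by blast
   next
    assume w: "w = z"
    hence a: "a = z * b ^ l" by (simp add: w_def) (metis mult.assoc group_left_inverse mult_1_right)
    show ?thesis
    proof (cases "b = 1")
     case True
     hence "b = a ^ 0" by simp
     thus ?thesis by blast
    next
     case False
     then obtain k where "b ^ k = z" using two_power_z Suc.prems by blast
     hence "a = b ^ (k + l)" using a by (simp add: power_add)
     thus ?thesis by blast
    qed
   qed
  qed
 qed
qed

text \<open>If \<open>t ^ 4\<close> is not 1, then \<open>t * z\<close> is a power of
  \<open>t\<close> generating the same group, so a 2-element \<open>h\<close> conjugates
  \<open>t\<close> to \<open>t * z\<close>. Its square commutes with \<open>t\<close> and must be an
  even power of \<open>t\<close>. Dividing \<open>h\<close> by half that power gives a
  \<open>k\<close> with the same effect on \<open>t\<close> and with square 1 or \<open>z\<close>.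
  Then \<open>k\<close> or \<open>k * t ^ (2 * l)\<close> is 1 or \<open>z\<close>, so
  \<open>k\<close> commutes with \<open>t\<close>.\<close>

lemma two_element_order: assumes t: "t \<in> H" "t ^ (2 ^ n) = 1" shows "t ^ 4 = 1"
proof (rule ccontr)
 assume t4: "t ^ 4 \<noteq> 1"
 have "(t ^ 4) ^ (2 ^ n) = 1" by (metis t(2) power_mult mult.commute power_one)
 then obtain j where j: "(t ^ 4) ^ (2 ^ j) \<noteq> 1" "((t ^ 4) ^ (2 ^ j)) ^ 2 = 1"
  using exists_prime_power_step[OF t4] by blast
 define l where "l = (2::nat) ^ j"
 have tz: "t ^ (4 * l) = z"
  using z(4)[of "(t ^ 4) ^ l"] j SH(6)[OF SH(6)[OF t(1)]] by (auto simp: power2_eq_square l_def power_mult)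
 have zt: "t * z = z * t" using zc t(1) .
 have tp: "(t * z) ^ k = t ^ k * z ^ k" for k by (rule pow_mult_commuting[OF zt])
 have "(t ^ (4 * l + 1)) ^ (4 * l + 1) = t"
 proof -
  have "t ^ (4 * l + 1) = t * z" using tz by (simp add: zt)
  hence "(t ^ (4 * l + 1)) ^ (4 * l + 1) = t ^ (4 * l + 1) * z ^ (4 * l + 1)" by (simp only: tp)
  also have "\<dots> = t * z * z" using tz zt by (simp add: z_pow)
  also have "\<dots> = t" by (simp add: mult.assoc z(3))
  finally show ?thesis .
 qed
 then obtain h0 where h0: "h0 \<in> H" "cj h0 t = t ^ (4 * l + 1)"
  using H(3) t(1) unfolding rational_def by blast
 obtain c m where c: "odd c" "(h0 ^ c) ^ (2 ^ m) = 1" using prime_part[OF H(1,2) h0(1), of 2] by auto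
 define h where "h = h0 ^ c"
 have hH: "h \<in> H" using SH(6) h0(1) by (simp add: h_def)
 have tz1: "t ^ (4 * l + 1) = t * z" using tz by (simp add: zt)
 have ht: "cj h t = t * z"
 proof -
  have "cj (h0 ^ k) t = (if even k then t else t * z)" for k
  proof (induction k)
   case (Suc k)
   have "cj (h0 ^ Suc k) t = cj h0 (cj (h0 ^ k) t)" by (simp add: cj_cj)
   thus ?case using Suc h0 tz1 by (auto simp: cj_mult mult.assoc z(3))
  qed simp
  thus ?thesis using c(1) by (simp add: h_def)
 qed
 have nc: "w * t \<noteq> t * w" if "w \<in> H" "cj w t = t * z" for w
 proof
  assume "w * t = t * w"
  hence "cj w t = t" by (simp add: cj_fix_iff)
  hence "t * z = t * 1" using that by simp
  thus False using z(2) by (simp del: mult_1_right)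
 qed
 have "cj (h * h) t = t" using ht by (simp add: cj_cj[symmetric] cj_mult hH mult.assoc z(3))
 hence "t * (h * h) = (h * h) * t" by (simp add: cj_fix_iff)
 moreover have "(h * h) ^ (2 ^ m) = 1" using c(2) by (simp add: h_def pow_mult_commuting)
 ultimately consider s where "h * h = t ^ s" | s where "t = (h * h) ^ s"
  using commuting_two_elements[of t "h * h" n m] t hH SH(2) by blast
 thus False
 proof cases
  case (2 s)
  have "h * (h * h) ^ s = (h * h) ^ s * h" by (rule power_commuting_commutes[symmetric]) (simp add: mult.assoc)
  hence "h * t = t * h" by (subst (1 2) 2)
  thus False using nc hH ht by blast
 next
  case (1 s)
  show False
  proof (cases "odd s")
   case True
   then obtain u where u: "t = (t ^ s) ^ u" using odd_power_generates[OF t(2)] by blast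
   have "h * (h * h) ^ u = (h * h) ^ u * h" by (rule power_commuting_commutes[symmetric]) (simp add: mult.assoc)
   hence "h * t = t * h" using 1 u by metis
   thus False using nc hH ht by blast
  next
   case False
   then obtain l' where l': "s = 2 * l'" by (auto elim: evenE)
   define k where "k = h * inverse (t ^ l')"
   have kH: "k \<in> H" using SH hH t(1) by (simp add: k_def)
   have kt: "cj k t = t * z"
   proof -
    have "cj (inverse (t ^ l')) t = t"
     by (simp add: cj_def) (metis group_left_cancel1 mult.assoc power_commutes)
    thus ?thesis by (simp add: k_def ht flip: cj_cj)
   qed
   have "k * k = cj h (inverse (t ^ l')) * (h * h) * inverse (t ^ l')"
    by (simp add: k_def cj_def group_norm)
   also have "\<dots> = inverse ((t * z) ^ l') * (t ^ l' * t ^ l') * inverse (t ^ l')"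
    using 1 ht by (simp add: cj_inverse cj_pow l' power_add mult_2)
   also have "\<dots> = inverse (t ^ l' * z ^ l') * t ^ l'" by (simp add: tp group_norm)
   also have "\<dots> = inverse (z ^ l')" by (simp add: group_norm)
   finally have kk: "k * k = inverse (z ^ l')" .
   have i: "t ^ (2 * l) * t ^ (2 * l) = z" using tz by (simp flip: power_add)
   have "cj k (t ^ (2 * l)) = t ^ (2 * l)" by (simp add: cj_pow kt tp z_pow)
   hence ki: "k * t ^ (2 * l) = t ^ (2 * l) * k" by (simp add: cj_fix_iff)
   show False
   proof (cases "even l'")
    case True
    hence "k = 1 \<or> k = z" using z(4)[OF kH] kk by (simp add: z_pow)
    hence "k * t = t * k" using zt by auto
    thus False using nc kH kt by blast
   next
    case False
    hence "k * k = z" using kk by (simp add: z_pow)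
    have "(k * t ^ (2 * l)) * (k * t ^ (2 * l)) = (k * k) * (t ^ (2 * l) * t ^ (2 * l))"
     using ki by (metis mult.assoc)
    hence "(k * t ^ (2 * l)) * (k * t ^ (2 * l)) = 1" using i \<open>k * k = z\<close> z(3) by simp
    hence "k * t ^ (2 * l) = 1 \<or> k * t ^ (2 * l) = z" using z(4) SH(2,6) kH t(1) by blast
    hence "(k * t ^ (2 * l)) * t = t * (k * t ^ (2 * l))" using zt by auto
    hence "k * t * t ^ (2 * l) = t * k * t ^ (2 * l)" by (metis mult.assoc power_commutes)
    hence "k * t = t * k" by simp
    thus False using nc kH kt by blast
   qed
  qed
 qed
qed

text \<open>A two-element centralising an element \<open>e\<close> of order 4 is a power of \<open>e\<close>.\<close>

lemma commutes_via_order_four: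
 assumes t: "t \<in> H" "t ^ (2 ^ n) = 1" and e: "e \<in> H" "e * e = z" "t * e = e * t"
  and w: "w \<in> H" "w * e = e * w"
 shows "w * t = t * w"
proof -
 have "(t * t) * (t * t) = 1" using two_element_order[OF t] by (simp add: eval_nat_numeral mult.assoc)
 then consider "t * t = 1" | "t * t = z" using z(4) SH(2) t(1) by blast
 thus ?thesis
 proof cases
  case 1
  hence "t = 1 \<or> t = z" using z(4) t(1) by blast
  thus ?thesis using zc[OF w(1)] by auto
 next
  case 2
  have "(t * e) * (t * e) = (t * t) * (e * e)" using e(3) by (metis mult.assoc)
  hence "(t * e) * (t * e) = 1" using 2 e(2) z(3) by simp
  hence "t * e = 1 \<or> t * e = z" using z(4) SH(2) t(1) e(1) by blast
  hence "w * (t * e) = (t * e) * w" using zc[OF w(1)] by auto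
  hence "(w * t) * e = (t * w) * e" using w(2) by (metis mult.assoc)
  thus ?thesis by simp
 qed
qed

text \<open>Let \<open>g\<close> square \<open>y\<close>. Its 2-part has square 1 or
  \<open>z\<close>, which is central, yet that square sends \<open>y\<close> to
  \<open>y ^ 4\<close>, since \<open>4 ^ c\<close> is 4 modulo 5 for odd \<open>c\<close>.\<close>

lemma no_five: assumes y: "y \<in> H" "y ^ 5 = 1" shows "y = 1"
proof -
 obtain g where g: "g \<in> H" "cj g y = y ^ 2" using rational_power[OF H(3,1,2) y, of 2] by auto
 obtain c m where c: "odd c" "(g ^ c) ^ (2 ^ m) = 1" using prime_part[OF H(1,2) g(1), of 2] by auto
 have gc: "g ^ c \<in> H" using SH(6) g(1) by blast
 have "(g ^ c * g ^ c) * (g ^ c * g ^ c) = 1"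
  using two_element_order[OF gc c(2)] by (simp add: eval_nat_numeral mult.assoc)
 hence "g ^ c * g ^ c = 1 \<or> g ^ c * g ^ c = z" using z(4) SH(2) gc by blast
 hence "cj (g ^ c * g ^ c) y = y" using zc[OF y(1)] by (auto simp: cj_fix_iff)
 moreover have "cj (g ^ c * g ^ c) y = y ^ (2 ^ (c + c))"
  unfolding power_add[symmetric] by (rule cj_pow_iter[OF g(2)])
 moreover have "y ^ (2 ^ (c + c)) = y ^ 4"
 proof (rule power_cong_card[OF y(2)])
  obtain b where "c = 2 * b + 1" using c(1) by (auto elim: oddE)
  hence "(2::nat) ^ (c + c) = 4 * 16 ^ b" by (simp add: power_add power_mult mult_2[symmetric])
  moreover have "[16 ^ b = 1 ^ b] (mod (5::nat))" by (rule cong_pow) (simp add: cong_def)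
  ultimately show "[2 ^ (c + c) = 4] (mod (5::nat))" by (metis cong_mult cong_refl power_one mult_1_right)
 qed
 ultimately have "y ^ 3 * y = 1 * y" by (simp add: eval_nat_numeral mult.assoc)
 hence "y ^ 3 = 1" by (simp only: group_right_cancel)
 moreover have "coprime (3::nat) 5" by (rule primes_coprime) simp_all
 ultimately show ?thesis using pow_coprime_eq_one[OF _ y(2)] by blast
qed

end

lemma power_of_two_only_prime:
 fixes n s :: nat
 assumes "n > 0" "\<And>p. prime p ==> p dvd n ==> p = s" "prime s" shows "\<exists>a. n = s ^ a"
proof -
 obtain c where c: "n = s ^ multiplicity s n * c" "\<not> s dvd c"
  using multiplicity_decompose'[of n s] assms(1,3) by (metis not_prime_unit not_gr_zero)
 have "c = 1"
 proof (rule ccontr)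
  assume "c \<noteq> 1"
  then obtain p where p: "prime p" "p dvd c" using prime_factor_nat by blast
  hence "p dvd n" using c(1) by (metis dvd_mult)
  thus False using assms(2) p c(2) by blast
 qed
 thus ?thesis using c(1) by auto
qed

context unique_involution begin

lemma two_element_cases: assumes "t \<in> H" "t ^ (2 ^ n) = 1" shows "t = 1 \<or> t = z \<or> t * t = z"
proof -
 have "(t * t) * (t * t) = 1" using two_element_order[OF assms] by (simp add: eval_nat_numeral mult.assoc)
 hence "t * t = 1 \<or> t * t = z" using z(4) SH(2) assms(1) by blast
 thus ?thesis using z(4) assms(1) by blast
qed

lemma fourth_power: assumes "g * g = z" shows "g ^ 4 = 1"
proof -
 have "g ^ 4 = (g * g) * (g * g)" by (simp add: eval_nat_numeral mult.assoc)
 thus ?thesis using assms z(3) by simp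
qed

text \<open>An element of order 12 would be conjugate to its fifth power by a 2-element. As 5 is 1
  modulo 4 and -1 modulo 3, this 2-element centralises \<open>g\<close> and inverts
  \<open>y\<close>; but \<open>y\<close> commutes with every 2-element that centralises
  \<open>g\<close>. The exponents 9 and 4 extract \<open>g\<close> and \<open>y\<close> from their
  product.\<close>

lemma four_three: assumes g: "g \<in> H" "g * g = z" and y: "y \<in> H" "y ^ 3 = 1" "g * y = y * g" shows "y = 1"
proof -
 have gy: "(g * y) ^ n = g ^ n * y ^ n" for n by (rule pow_mult_commuting[OF y(3)])
 have g4: "g ^ 4 = 1" by (rule fourth_power[OF g(2)])
 have gp: "g ^ n = g ^ (n mod 4)" and yp: "y ^ n = y ^ (n mod 3)" for n
  by (rule power_cong_card[OF g4], simp add: cong_def) (rule power_cong_card[OF y(2)], simp add: cong_def)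
 have gyH: "g * y \<in> H" using SH g y by blast
 have "g ^ 12 = 1" "y ^ 12 = 1" using gp[of 12] yp[of 12] by auto
 hence gy12: "(g * y) ^ 12 = 1" using gy[of 12] by simp
 obtain u m where uH: "u \<in> H" and c: "u ^ (2 ^ m) = 1" and u: "cj u (g * y) = (g * y) ^ 5"
  by (rule rational_two_element[OF H(3,1,2) gyH gy12, of 5]) (auto simp: cong_def)
 have "g = (g * y) ^ 9" "y = (g * y) ^ 4" using gy gp[of 9] yp[of 9] g4 yp[of 4] by auto
 moreover have "cj u ((g * y) ^ 9) = (g * y) ^ 45" "cj u ((g * y) ^ 4) = (g * y) ^ 20"
  by (simp_all add: cj_pow u flip: power_mult)
 moreover have "(g * y) ^ 45 = g" "(g * y) ^ 20 = y ^ 2"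
  using gy gp[of 45] gp[of 20] yp[of 45] yp[of 20] by simp_all
 ultimately have cu: "cj u g = g" "cj u y = y ^ 2" by metis+
 have "y * u = u * y"
  by (rule commutes_via_order_four[of u m g y]) (use uH c g y cu in \<open>auto simp: cj_fix_iff\<close>)
 hence "cj u y = y" by (simp add: cj_fix_iff)
 hence "y * y = y * 1" using cu(2) by (simp add: power2_eq_square)
 thus ?thesis by (simp del: mult_1_right)
qed

lemma inverting_two_element:
 assumes y: "y \<in> H" "y ^ 3 = 1" "y \<noteq> 1" shows "\<exists>g. g \<in> H \<and> cj g y = y ^ 2 \<and> g * g = z"
proof -
 obtain u m where u: "u \<in> H" "u ^ (2 ^ m) = 1" "cj u y = y ^ 2"
  by (rule rational_two_element[OF H(3,1,2) y(1,2), of 2]) (auto simp: cong_def)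
 have "cj u y \<noteq> y"
 proof
  assume "cj u y = y"
  hence "y * y = y * 1" using u(3) by (simp add: power2_eq_square)
  thus False using y(3) by (simp del: mult_1_right)
 qed
 hence "u \<noteq> 1" "u \<noteq> z" using zc[OF y(1)] cj_fix_iff by fastforce+
 thus ?thesis using two_element_cases[OF u(1,2)] u by blast
qed

text \<open>The argument mirrors the one for large primes, with \<open>z\<close> in place of the
  scalar -1. A normal subgroup abelian modulo \<open>z\<close> has a quaternion action of its units
  \<open>i\<close>, \<open>j\<close>, \<open>k\<close>, cycled by an element of order 3; an element
  inverting this one induces a transposition, which contradicts that squares of 2-elements are
  central.\<close>

lemma no_three:
 assumes solv: "solv H" and primes: "\<And>s. prime s ==> s dvd card H ==> s = 2 \<or> s = 3"
 shows "\<not> 3 dvd card H"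
proof
 assume "3 dvd card H"
 then obtain y where y: "y \<in> H" "y \<noteq> 1" "y ^ 3 = 1" using cauchy[OF H(1,2), of 3] by auto
 have nH: "normal_in H H" using H(1) SH by (auto simp: normal_in_def)
 have "y \<noteq> z" using y z(3) by (auto simp: eval_nat_numeral)
 hence "\<not> H \<subseteq> {1, z}" using y by blast
 then obtain E where E: "normal_in E H" "\<not> E \<subseteq> {1, z}" "\<And>a b. a \<in> E ==> b \<in> E ==> cmt a b \<in> {1, z}"
  using solv_normal_section[OF H(1) nH solv, of "{1, z}"] by auto
 have EH: "e \<in> H" if "e \<in> E" for e using E(1) that by (auto simp: normal_in_def)
 have SE: "subgrp E" using E(1) by (simp add: normal_in_def)
 note S = subgrpD[OF SE]
 have cjE: "cj h e \<in> E" if "h \<in> H" "e \<in> E" for h e using E(1) that by (auto simp: normal_in_def)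
 have finE: "finite E" by (rule finite_subset[OF _ H(2)]) (use EH in blast)
 have ca: "a * b = b * a \<or> a * b = z * (b * a)" if "a \<in> E" "b \<in> E" for a b
  using E(3)[OF that] cmt_swap[of a b] by auto
 have not_both: "b * a \<noteq> z * (b * a)" for a b
  by (metis group_right_cancel mult_1_left z(2))
 have anti_pow: "cj (a ^ n) b = z ^ n * b" if "a \<in> H" "cj a b = z * b" for a b n
 proof (induction n)
  case (Suc n)
  have "cj (a ^ Suc n) b = cj a (cj (a ^ n) b)" by (simp add: cj_cj)
  also have "\<dots> = cj a (z ^ n) * cj a b" using Suc.IH that by (simp only: cj_mult)
  also have "\<dots> = z ^ n * (z * b)" using that by (simp only: cj_pow cj_z)
  also have "\<dots> = z ^ Suc n * b" by (simp only: power_Suc2 mult.assoc)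
  finally show ?case .
 qed simp
 have anti_cj: "cj a b = z * b" if "a * b = z * (b * a)" for a b
  using that by (simp add: cj_def mult.assoc)
 have com3: "a * b = b * a" if "a \<in> E" "b \<in> E" "a ^ 3 = 1" for a b
 proof (rule ccontr)
  assume "a * b \<noteq> b * a"
  hence "cj a b = z * b" using ca that anti_cj by blast
  hence "b = z * b" using anti_pow[of a b 3] that(3) EH[OF that(1)] z_pow[of 3] by simp
  thus False using not_both[of b 1] by simp
 qed
 \<comment> \<open>Every element of order 4 inverts \<open>u\<close>. The elements \<open>g\<close>
   and \<open>s\<close> of order 4 have a product of order 4, which would both invert and centralise
   \<open>u\<close>.\<close>
 have no3: "u = 1" if u: "u \<in> E" "u ^ 3 = 1" for u
 proof (rule ccontr)
  assume u1: "u \<noteq> 1"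
  have inv: "cj w u = inverse u" if w: "w \<in> H" "w * w = z" for w
  proof -
   define x where "x = u * cj w u"
   have cw: "cj w u \<in> E" "cj w u ^ 3 = 1" using cjE w u by (auto simp flip: cj_pow)
   have uc: "u * cj w u = cj w u * u" by (rule com3[OF u(1) cw(1) u(2)])
   have "cj w (cj w u) = u" using w(2) zc[OF EH[OF u(1)]] by (simp add: cj_cj cj_fix_iff)
   hence "cj w x = x" using uc by (simp add: x_def cj_mult)
   moreover have "x ^ 3 = 1" using pow_mult_commuting[OF uc, of 3] cw u by (simp add: x_def)
   ultimately have "x = 1" using four_three[OF w, of x] EH S(2) u cw by (auto simp: x_def cj_fix_iff)
   thus ?thesis unfolding x_def using group_inverse_unique by metis
  qed
  obtain g where g: "g \<in> H" "g * g = z" using inverting_two_element[OF EH[OF u(1)] u(2) u1] by (elim exE conjE)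
  have g4: "g ^ 4 = 1" by (rule fourth_power[OF g(2)])
  obtain s m where sH: "s \<in> H" and c: "s ^ (2 ^ m) = 1" and sg: "cj s g = g ^ 3"
   by (rule rational_two_element[OF H(3,1,2) g(1) g4, of 3]) (auto simp: cong_def)
  have g3: "g ^ 3 = z * g" using g(2) zc[OF g(1)] by (simp add: eval_nat_numeral)
  have "cj s g \<noteq> g" using sg g3 not_both[of g 1] by auto
  hence "s \<noteq> 1" "s \<noteq> z" using zc[OF g(1)] cj_fix_iff by fastforce+
  hence ss: "s * s = z" using two_element_cases[OF sH c] by blast
  have "(g * s) * (g * s) = g * cj s g * (s * s)" by (simp add: cj_def group_norm)
  also have "\<dots> = z" using ss g3 sg g(2) zc[OF g(1)] by (metis mult.assoc zz z(3) mult_1_right)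
  finally have "cj (g * s) u = inverse u" using inv SH(2) g(1) sH by blast
  moreover have "cj (g * s) u = u" using inv[OF g] inv[OF sH ss] by (simp add: cj_cj[symmetric] cj_inverse)
  ultimately have "u ^ 2 = 1" by (metis group_right_inverse power2_eq_square)
  moreover have "coprime (2::nat) 3" by (rule primes_coprime) simp_all
  ultimately show False using pow_coprime_eq_one u(2) u1 by blast
 qed
 have cE: "card E > 0" by (rule card_subgrp_pos[OF SE finE])
 have "card E dvd card H" using card_subgrp_dvd[OF H(1) SE _ H(2)] EH by blast
 moreover have "\<not> 3 dvd card E" using cauchy[OF SE finE, of 3] no3 by auto
 ultimately have "p = 2" if "prime p" "p dvd card E" for p using primes that dvd_trans by blast
 then obtain n where "card E = 2 ^ n" using power_of_two_only_prime[OF cE, of 2] by auto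
 hence E2: "e ^ (2 ^ n) = 1" if "e \<in> E" for e using pow_card[OF SE finE that] by simp
 have Ec: "e = 1 \<or> e = z \<or> e * e = z" if "e \<in> E" for e using two_element_cases EH E2 that by blast
 define sim where "sim a b \<longleftrightarrow> a = b \<or> a = z * b" for a b
 have sim_sym: "sim b a" if "sim a b" for a b using that by (auto simp: sim_def)
 have sim_tr: "sim a d" if "sim a b" "sim b d" for a b d using that by (auto simp: sim_def)
 have sim_mult: "sim (a * b) (a' * b')" if "sim a a'" "sim b b'" "a' \<in> H" for a b a' b'
  using that zc[of a'] by (auto simp: sim_def mult.assoc) (metis mult.assoc zz)+
 have sim_cj: "sim (cj h a) (cj h b)" if "sim a b" "h \<in> H" for a b h
  using that by (auto simp: sim_def cj_mult)
 have q_inv: "sim (inverse e) e" if "e * e = z" for e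
 proof -
  have "e * (e * z) = 1" using that z(3) by (simp flip: mult.assoc)
  hence "inverse e = e * z" by (rule group_inverse_unique)
  moreover have "z * e = e * z" using mult.assoc[of e e e] that by simp
  ultimately show ?thesis by (simp add: sim_def)
 qed
 have comm_cases: "sim e 1 \<or> sim e i" if i: "i \<in> E" "i * i = z" and e: "e \<in> E" "e * i = i * e" for e i
 proof -
  consider "sim e 1" | "e * e = z" using Ec[OF e(1)] by (auto simp: sim_def)
  thus ?thesis
  proof cases
   case 2
   have "(e * i) * (e * i) = (e * e) * (i * i)" using e(2) by (metis mult.assoc)
   hence "(e * i) * (e * i) = 1" using 2 i(2) z(3) by simp
   hence "e * i = 1 \<or> e * i = z" using z(4) SH(2) EH i e by blast
   hence "e = inverse i \<or> e = z * inverse i"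
    by (metis group_right_inverse mult.assoc mult_1_left mult_1_right)
   hence "sim e (inverse i)" by (simp add: sim_def)
   thus ?thesis using q_inv[OF i(2)] sim_tr by blast
  qed blast
 qed
 have cases: "sim e 1 \<or> sim e i \<or> sim e j \<or> sim e (i * j)"
  if i: "i \<in> E" "i * i = z" and j: "j \<in> E" "j * j = z" "i * j = z * (j * i)" and e: "e \<in> E" for e i j
 proof (cases "e * i = i * e")
  case False
  hence ei: "e * i = z * (i * e)" using ca e i(1) by blast
  have iH: "e \<in> H" "i \<in> H" "j \<in> H" using EH e i(1) j(1) by auto
  have ji: "j * i = z * (i * j)" using j(3) by simp
  have "(e * j) * i = e * (z * (i * j))" using ji by (simp add: mult.assoc)
  also have "\<dots> = z * ((e * i) * j)" using zc[OF iH(1)] by (metis mult.assoc)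
  also have "\<dots> = i * (e * j)" unfolding ei by (simp add: mult.assoc)
  finally have "sim (e * j) 1 \<or> sim (e * j) i" using comm_cases[OF i, of "e * j"] S(2) e j(1) by blast
  moreover have "sim e (f * j)" if "sim (e * j) f" "f \<in> H" for f
  proof -
   have "sim (e * j * inverse j) (f * j)" using sim_mult[OF that(1) q_inv[OF j(2)] that(2)] .
   thus ?thesis by (simp add: mult.assoc)
  qed
  ultimately have "sim e (1 * j) \<or> sim e (i * j)" using SH(1) iH by blast
  thus ?thesis by auto
 qed (use comm_cases i e in blast)
 have n1: "\<not> sim e 1" if "e * e = z" for e using that z(2,3) by (auto simp: sim_def)
 obtain i where i: "i \<in> E" "i * i = z" using E(2) Ec by blast
 define j k where "j = cj y i" and "k = cj y j"
 have jE: "j \<in> E" "k \<in> E" using cjE y(1) i by (auto simp: j_def k_def)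
 have jj: "j * j = z" "k * k = z" using i(2) y(1) by (auto simp: j_def k_def cj_mult[symmetric])
 have cyk: "cj y k = i" using y(3) by (simp add: j_def k_def cj_cj eval_nat_numeral mult.assoc)
 have ji: "j \<noteq> i"
 proof
  assume "j = i"
  hence "i * y = y * i" by (simp add: j_def cj_fix_iff)
  thus False using four_three[OF EH[OF i(1)] i(2) y(1,3)] y(2) by blast
 qed
 have aij: "i * j = z * (j * i)"
 proof (rule ccontr)
  assume "i * j \<noteq> z * (j * i)"
  hence "j * i = i * j" using ca[OF i(1) jE(1)] by auto
  hence "sim j i" using comm_cases[OF i jE(1)] n1[OF jj(1)] by blast
  hence "cj y i = z * i" using ji by (auto simp: sim_def j_def)
  hence "i = z * i" using anti_pow[OF y(1), of i 3] y(3) z_pow[of 3] by simp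
  thus False using not_both[of i 1] by simp
 qed
 have anti_y: "cj y a * cj y b = z * (cj y b * cj y a)" if "a * b = z * (b * a)" for a b
  using arg_cong[OF that, of "cj y"] y(1) by (simp add: cj_mult)
 have ajk: "j * k = z * (k * j)" using anti_y[OF aij] by (simp add: j_def[symmetric] k_def[symmetric])
 have aki: "k * i = z * (i * k)" using anti_y[OF ajk] by (simp add: k_def[symmetric] cyk)
 have kij: "sim k (i * j)"
 proof -
  have sc: "a * b = b * a" if "sim a b" "b \<in> H" for a b
   using that zc[of b] by (auto simp: sim_def) (metis mult.assoc)
  have "\<not> sim k i" using sc[OF _ EH[OF i(1)]] aki not_both by metis
  moreover have "\<not> sim k j" using sc[OF _ EH[OF jE(1)]] ajk not_both by metis
  ultimately show ?thesis using cases[OF i jE(1) jj(1) aij jE(2)] n1[OF jj(2)] by blast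
 qed
 obtain g where g: "g \<in> H" "cj g y = y ^ 2" "g * g = z" using inverting_two_element[OF y(1,3,2)] by blast
 have key: "cj g (cj y e) = cj (y * y) (cj g e)" for e
 proof -
  have "g * y = (y * y) * g" using g(2) by (simp add: cj_def power2_eq_square) (metis group_left_inverse mult.assoc mult_1_right)
  thus ?thesis by (simp add: cj_cj)
 qed
 have yy: "cj (y * y) i = k" "cj (y * y) j = i" "cj (y * y) k = j"
  by (simp_all add: cj_cj[symmetric] j_def[symmetric] k_def[symmetric] cyk)
 have gij: "cj g j = cj (y * y) (cj g i)" "cj g k = cj (y * y) (cj g j)" using key[of i] key[of j] by (simp_all add: j_def k_def)
 have yyH: "y * y \<in> H" using SH(2) y(1) by blast
 \<comment> \<open>\<open>a\<close> centralises \<open>e\<close> and sends \<open>f\<close> to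
   \<open>e * f\<close> up to \<open>z\<close>, so its square sends \<open>f\<close> to
   \<open>z * f\<close>, and an odd power of \<open>a\<close> has the same property. But some odd
   power is a 2-element, whose square is 1 or \<open>z\<close>.\<close>
 have final: False if e: "e \<in> E" "e * e = z" and f: "f \<in> E" "f * f = z" "e * f = z * (f * e)"
  and ge: "sim (cj g e) e" and gf: "sim (cj g f) (e * f)" for e f
 proof -
  define a where "a = (if cj g e = e then g else g * f)"
  have eH: "e \<in> H" "f \<in> H" using EH e f by auto
  have aH: "a \<in> H" using g(1) SH(2) eH by (simp add: a_def)
  have ae: "cj a e = e"
  proof (cases "cj g e = e")
   case False
   hence "cj g e = z * e" using ge by (simp add: sim_def)
   moreover have "cj f e = z * e" by (rule anti_cj) (use f(3) in simp)
   ultimately show ?thesis using False g(1) by (simp add: a_def cj_cj[symmetric] cj_mult)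
  qed (simp add: a_def)
  have af: "sim (cj a f) (e * f)"
  proof (cases "cj g e = e")
   case False
   have "cj (g * f) f = cj g f" by (simp add: cj_cj[symmetric]) (simp add: cj_def mult.assoc)
   thus ?thesis using gf False by (simp add: a_def)
  qed (use gf in \<open>simp add: a_def\<close>)
  have aaf: "cj (a * a) f = z * f"
  proof -
   have ee: "e * (e * x) = z * x" for x using e(2) by (simp flip: mult.assoc)
   from af show ?thesis
    by (auto simp: sim_def cj_cj[symmetric] cj_mult ae aH ee) (metis ee mult.assoc zc[OF eH(1)] zz)
  qed
  obtain c m where c: "odd c" "(a ^ c) ^ (2 ^ m) = 1" using prime_part[OF H(1,2) aH, of 2] by auto
  have "cj ((a * a) ^ c) f = z ^ c * f" using anti_pow SH(2) aH aaf by blast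
  hence "cj (a ^ c * a ^ c) f = z * f" using c(1) by (simp add: pow_mult_commuting z_pow)
  moreover have "a ^ c * a ^ c = 1 \<or> a ^ c * a ^ c = z"
   using two_element_cases[OF _ c(2)] SH(6) aH z(3) by auto
  moreover have "cj z f = f" using zc[OF eH(2)] by (simp add: cj_fix_iff)
  ultimately have "f = z * f" by auto
  thus False using not_both[of f 1] by simp
 qed
 have gi: "cj g i \<in> E" "cj g i * cj g i = z" using cjE g(1) i by (auto simp: cj_mult[symmetric])
 have jiH: "i \<in> H" "j \<in> H" "k \<in> H" using EH i jE by auto
 have "sim (cj g i) i \<or> sim (cj g i) j \<or> sim (cj g i) k"
  using cases[OF i jE(1) jj(1) aij gi(1)] n1[OF gi(2)] kij sim_sym sim_tr by blast
 thus False
 proof (elim disjE)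
  assume a: "sim (cj g i) i"
  have "sim (cj g j) k" using sim_cj[OF a yyH] gij yy by simp
  hence "sim (cj g j) (i * j)" using kij sim_tr by blast
  thus False using final[OF i jE(1) jj(1) aij a] by blast
 next
  assume a: "sim (cj g i) j"
  have b: "sim (cj g j) i" using sim_cj[OF a yyH] gij yy by simp
  have c: "sim (cj g k) k" using sim_cj[OF b yyH] gij yy by simp
  have "sim (k * i) j"
  proof -
   have "sim (k * i) (i * j * i)" by (rule sim_mult[OF kij]) (use SH jiH in \<open>auto simp: sim_def\<close>)
   moreover have "sim (i * j * i) (j * i * i)" using sim_mult[of "i * j" "j * i" i i] aij SH jiH by (simp add: sim_def)
   moreover have "sim (j * i * i) j" using i(2) zc[OF jiH(2)] by (simp add: sim_def mult.assoc)
   ultimately show ?thesis using sim_tr by blast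
  qed
  hence "sim (cj g i) (k * i)" using a sim_sym sim_tr by blast
  thus False using final[OF jE(2) jj(2) i aki c] by blast
 next
  assume a: "sim (cj g i) k"
  have b: "sim (cj g j) j" using sim_cj[OF a yyH] gij yy by simp
  have "sim (cj g i) (i * j)" using a kij sim_tr by blast
  moreover have "sim (i * j) (j * i)" using aij by (simp add: sim_def)
  ultimately have "sim (cj g i) (j * i)" using sim_tr by blast
  thus False using final[OF jE(1) jj(1) i _ b] aij by simp
 qed
qed

end

section \<open>Rational groups of linear operators\<close>

lemma sum_const_card: "finite S ==> (\<Sum>s\<in>S. v) = (\<Sum>i<card S. (v::'v::comm_monoid_add))"
 by (induction S rule: finite_induct) (simp_all add: add.commute)

lemma power_swap:
 fixes x y :: "'a::group_mult"
 assumes "y \<noteq> 1" "y ^ q = 1" "prime q" "0 < m" "m < q" shows "y ^ m \<noteq> 1"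
proof
 assume "y ^ m = 1"
 moreover have "coprime m q" using assms(3-5) by (metis coprime_commute nat_dvd_not_less prime_imp_coprime)
 ultimately show False using pow_coprime_eq_one assms(1,2) by blast
qed

text \<open>\<open>H\<close> stands for \<open>G / N\<close> acting on an \<open>r\<close>-group
  \<open>N\<close>. The condition \<open>cent\<close> reflects the absence of elements of order
  \<open>2 q\<close>, and \<open>double\<close> the rationality of \<open>G\<close> on elements of
  order 5.\<close>

locale rational_module = rep act for act :: "'g::group_mult \<Rightarrow> 'v::ab_group_add \<Rightarrow> 'v" (infixr "$" 75) +
 fixes H :: "'g set" and V :: "'v set" and q r :: nat
 assumes H: "subgrp H" "finite H" "rational H" "solv H"
  and V: "adsub V" "V \<noteq> {0}" "\<And>h v. h \<in> H ==> v \<in> V ==> h $ v \<in> V"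
  and torsion: "\<And>v c. v \<in> V ==> \<not> r dvd c ==> (\<Sum>i<c. v) = 0 ==> v = 0"
  and faithful: "\<And>h. h \<in> H ==> (\<And>v. v \<in> V ==> h $ v = v) ==> h = 1"
  and q: "prime q" "q dvd card H" "(q = 3 \<and> r = 5) \<or> (q = 5 \<and> r = 3)"
  and primes: "\<And>s. prime s ==> s dvd card H ==> s = 2 \<or> s = q"
  and fpf: "\<And>y v. y \<in> H ==> y \<noteq> 1 ==> y ^ q = 1 ==> v \<in> V ==> y $ v = v ==> v = 0"
  and cent: "\<And>t y n. t \<in> H ==> t ^ (2 ^ n) = 1 ==> y \<in> H ==> y \<noteq> 1 ==> y ^ q = 1 ==> t * y = y * t ==> t = 1"
  and double: "\<And>v. r = 5 ==> v \<in> V ==> \<exists>h\<in>H. h $ v = v + v"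
begin

lemmas SH = subgrpD[OF H(1)]
lemmas VD = adsubD[OF V(1)]

lemma orbit_sum: assumes "y \<in> H" "y \<noteq> 1" "y ^ q = 1" "v \<in> V" shows "(\<Sum>m<q. y ^ m $ v) = 0"
proof (rule fpf[OF assms(1-3)])
 show "(\<Sum>m<q. y ^ m $ v) \<in> V" by (rule adsub_sum[OF V(1)]) (use V(3) SH(6) assms in blast)
 have "y $ (\<Sum>m<q. y ^ m $ v) = (\<Sum>m<q. y ^ Suc m $ v)" by (simp add: act_sum act_mult)
 also have "\<dots> = (\<Sum>m<q. y ^ m $ v)"
 proof -
  have "(\<Sum>m<q. y ^ Suc m $ v) + y ^ 0 $ v = (\<Sum>m<q. y ^ m $ v) + y ^ q $ v"
   using sum.lessThan_Suc[of "\<lambda>m. y ^ m $ v" q] sum.lessThan_Suc_shift[of "\<lambda>m. y ^ m $ v" q]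
   by (simp add: add.commute del: power_Suc)
  thus ?thesis using assms(3) by simp
 qed
 finally show "y $ (\<Sum>m<q. y ^ m $ v) = (\<Sum>m<q. y ^ m $ v)" .
qed

lemma q_not_r: "\<not> r dvd q" "\<not> r dvd 2 ^ n" "prime r" "odd r"
proof -
 show r: "prime r" using q(3) by auto
 show "\<not> r dvd q" using q(3) by auto
 show o: "odd r" using q(3) by auto
 show "\<not> r dvd 2 ^ n"
 proof
  assume "r dvd 2 ^ n"
  hence "r dvd 2" using r prime_dvd_power by blast
  thus False using r o by (metis dvd_refl prime_nat_iff primes_dvd_imp_eq two_is_prime_nat)
 qed
qed

text \<open>A noncyclic group of order \<open>q * q\<close> cannot act without fixed points. In the
  sum of the vanishing orbit sums of \<open>v\<close> under the elements \<open>a * b ^ i\<close>,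
  all terms cancel except \<open>q\<close> copies of \<open>v\<close>, and \<open>q\<close> is prime
  to \<open>r\<close>.\<close>

lemma rank_one:
 assumes ab: "a \<in> H" "b \<in> H" "a * b = b * a" "a ^ q = 1" "b ^ q = 1" "b \<noteq> 1"
 shows "\<exists>i. a = b ^ i"
proof (rule ccontr)
 assume n: "\<not> ?thesis"
 obtain v where v: "v \<in> V" "v \<noteq> 0" using V(2) VD(1) by blast
 define w where "w i = a * b ^ i" for i
 have abi: "a * b ^ i = b ^ i * a" for i using ab(3) by (metis power_commuting_commutes)
 have wH: "w i \<in> H" for i using SH ab by (simp add: w_def)
 have w1: "w i \<noteq> 1" for i
 proof
  assume "w i = 1"
  hence "a * b ^ (i * q) = b ^ (i * (q - 1))"
  proof -
   have "b ^ (i * q) = b ^ i * b ^ (i * (q - 1))"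
    using prime_gt_0_nat[OF q(1)] by (simp flip: power_add add: algebra_simps)
   hence "a * b ^ (i * q) = w i * b ^ (i * (q - 1))" by (simp add: w_def mult.assoc)
   thus ?thesis using \<open>w i = 1\<close> by simp
  qed
  moreover have "b ^ (i * q) = 1" using ab(5) by (metis mult.commute power_mult power_one)
  ultimately have "a = b ^ (i * (q - 1))" by simp
  thus False using n by blast
 qed
 have wp: "w i ^ m = a ^ m * b ^ (i * m)" for i m
  unfolding w_def by (simp add: pow_mult_commuting[OF abi] power_mult)
 have wq: "w i ^ q = 1" for i
  using ab(4,5) by (simp add: wp power_mult[symmetric] mult.commute) (simp add: power_mult mult.commute[of _ q])
 have bm: "(\<Sum>i<q. b ^ (i * m) $ v) = 0" if "0 < m" "m < q" for m
 proof -
  have "b ^ m \<noteq> 1" using power_swap[OF ab(6,5) q(1) that] .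
  moreover have "(b ^ m) ^ q = 1" using ab(5) by (metis mult.commute power_mult power_one)
  ultimately have "(\<Sum>i<q. (b ^ m) ^ i $ v) = 0" using orbit_sum SH(6)[OF ab(2)] v(1) by blast
  thus ?thesis by (simp add: power_mult[symmetric] mult.commute)
 qed
 have "0 = (\<Sum>i<q. \<Sum>m<q. w i ^ m $ v)" using orbit_sum[OF wH w1 wq v(1)] by simp
 also have "\<dots> = (\<Sum>m<q. \<Sum>i<q. w i ^ m $ v)" by (rule sum.swap)
 also have "\<dots> = (\<Sum>m<q. if m = 0 then (\<Sum>i<q. v) else 0)"
 proof (rule sum.cong)
  fix m assume m: "m \<in> {..<q}"
  show "(\<Sum>i<q. w i ^ m $ v) = (if m = 0 then (\<Sum>i<q. v) else 0)"
  proof (cases "m = 0")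
   case False
   have "(\<Sum>i<q. w i ^ m $ v) = a ^ m $ (\<Sum>i<q. b ^ (i * m) $ v)" by (simp add: wp act_mult act_sum)
   thus ?thesis using False bm m by simp
  qed simp
 qed simp
 also have "\<dots> = (\<Sum>i<q. v)" using prime_gt_0_nat[OF q(1)] by simp
 finally show False using torsion[OF v(1) q_not_r(1)] v(2) by simp
qed

lemma two_part: assumes "g \<in> H" obtains c m where "odd c" "(g ^ c) ^ (2 ^ m) = 1" "g ^ c \<in> H"
 using prime_part[OF H(1,2) assms, of 2] SH(6) assms by auto

lemma four_odd: assumes "odd c" shows "[2 ^ c * 2 ^ c = 4] (mod (5::nat))"
proof -
 obtain b where "c = 2 * b + 1" using assms by (auto elim: oddE)
 hence "(2::nat) ^ c * 2 ^ c = 4 * 16 ^ b" by (simp add: power_mult power2_eq_square flip: power_mult_distrib)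
 moreover have "[16 ^ b = 1 ^ b] (mod (5::nat))" by (rule cong_pow) (simp add: cong_def)
 ultimately show ?thesis by (metis cong_mult cong_refl power_one mult_1_right)
qed

text \<open>By \<open>rank_one\<close> the group generated by \<open>y\<close> is normal. For
  \<open>q = 3\<close> the 2-part of a doubling element has a square that centralises
  \<open>y\<close>, hence is trivial; yet it multiplies \<open>v\<close> by a number that is 4
  modulo 5. For \<open>q = 5\<close> the 2-element \<open>t\<close> acts on \<open>y\<close> with
  order 4 but is conjugate to its inverse, although automorphisms of a cyclic group commute.\<close>

lemma no_abelian_normal_q:
 assumes E: "normal_in E H" "\<And>a b. a \<in> E ==> b \<in> E ==> a * b = b * a"
 shows "\<not> q dvd card E"
proof
 assume "q dvd card E"
 moreover have "subgrp E" "finite E" using E(1) H(2) finite_subset by (auto simp: normal_in_def)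
 ultimately obtain y where y: "y \<in> E" "y \<noteq> 1" "y ^ q = 1" using cauchy q(1) by blast
 have yH: "y \<in> H" using E(1) y by (auto simp: normal_in_def)
 have char: "\<exists>i. cj h y = y ^ i" if h: "h \<in> H" for h
 proof (rule rank_one)
  have "cj h y \<in> E" using E(1) h y by (auto simp: normal_in_def)
  thus "cj h y * y = y * cj h y" using E(2) y by blast
  show "cj h y ^ q = 1" using y by (simp flip: cj_pow)
 qed (use y yH SH(4) h in auto)
 consider "q = 3" "r = 5" | "q = 5" "r = 3" using q(3) by blast
 thus False
 proof cases
  case 1
  obtain v where v: "v \<in> V" "v \<noteq> 0" using V(2) VD(1) by blast
  obtain h where h: "h \<in> H" "h $ v = v + v" using double[OF 1(2) v(1)] by blast
  obtain c m where c: "odd c" "(h ^ c) ^ (2 ^ m) = 1" "h ^ c \<in> H" by (rule two_part[OF h(1)])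
  obtain i where i: "cj (h ^ c) y = y ^ i" using char c(3) by blast
  have "cj (h ^ c) y \<noteq> 1" using y by simp
  hence "\<not> 3 dvd i" using i y(3) 1 by (auto simp: dvd_def power_mult)
  have "cj (h ^ c * h ^ c) y = y ^ (i * i)" using i by (simp add: cj_cj[symmetric] cj_pow power_mult)
  also have "\<dots> = y ^ 1"
  proof (rule power_cong_card[OF y(3)])
   have "i mod 3 = 1 \<or> i mod 3 = 2" using \<open>\<not> 3 dvd i\<close> by presburger
   thus "[i * i = 1] (mod q)" unfolding 1 cong_def by (auto simp: mod_mult_eq[of i 3 i, symmetric])
  qed
  finally have "(h ^ c * h ^ c) * y = y * (h ^ c * h ^ c)" by (simp add: cj_fix_iff)
  moreover have "(h ^ c * h ^ c) ^ (2 ^ m) = 1" using c(2) by (simp add: pow_mult_commuting)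
  ultimately have one: "h ^ c * h ^ c = 1" using cent SH(2)[OF c(3,3)] y yH by blast
  define sm where "sm n u = (\<Sum>i<n. u)" for n :: nat and u :: 'v
  have sm_add: "sm (k + l) u = sm k u + sm l u" for k l u
   by (induction l) (simp_all add: sm_def add.assoc)
  have hp: "h ^ k $ v = sm (2 ^ k) v" for k
  proof (induction k)
   case (Suc k)
   have "h ^ Suc k $ v = h ^ k $ h $ v" by (simp only: power_Suc2 act_mult)
   also have "\<dots> = sm (2 ^ k) v + sm (2 ^ k) v" using h(2) by (simp add: act_add Suc)
   finally show ?case by (simp add: sm_add[symmetric] mult_2)
  qed (simp add: sm_def)
  have "v = h ^ (c + c) $ v" using one by (simp add: power_add)
  also have "\<dots> = sm (2 ^ c * 2 ^ c) v" by (simp only: hp flip: power_add)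
  also have "\<dots> = sm (2 ^ c * 2 ^ c - 1) v + sm 1 v" by (simp flip: sm_add)
  finally have "sm (2 ^ c * 2 ^ c - 1) v = 0" by (simp add: sm_def)
  moreover have "\<not> r dvd 2 ^ c * 2 ^ c - 1"
  proof
   assume "r dvd 2 ^ c * 2 ^ c - 1"
   hence "[2 ^ c * 2 ^ c = 1] (mod (5::nat))" using 1 by (simp add: cong_altdef_nat)
   hence "[4 = 1] (mod (5::nat))" using four_odd[OF c(1)] cong_sym cong_trans by blast
   thus False by (simp add: cong_def)
  qed
  ultimately show False using torsion[OF v(1)] v(2) by (simp add: sm_def)
 next
  case 2
  have "coprime (2::nat) 5" by (rule primes_coprime) simp_all
  then obtain g where g: "g \<in> H" "cj g y = y ^ 2"
   using rational_power[OF H(3,1,2) yH y(3), of 2] 2 by auto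
  obtain c m where c: "odd c" "(g ^ c) ^ (2 ^ m) = 1" "g ^ c \<in> H" by (rule two_part[OF g(1)])
  define t where "t = g ^ c"
  have ty: "cj (t * t) y = y ^ 4"
  proof -
   have "cj (t * t) y = y ^ (2 ^ c * 2 ^ c)"
    using cj_pow_iter[OF g(2), of c] by (simp add: t_def cj_cj[symmetric] cj_pow power_mult)
   thus ?thesis using power_cong_card[OF y(3)[unfolded 2] four_odd[OF c(1)]] by simp
  qed
  obtain s where s: "s \<in> H" "cj s t = inverse t" using rational_inverse[OF H(3,1,2) c(3)] by (auto simp: t_def)
  obtain i where i: "cj s y = y ^ i" using char s(1) by blast
  obtain j where j: "cj t y = y ^ j" using char c(3) by (auto simp: t_def)
  have "s * t = inverse t * s" using s(2) by (simp add: cj_def) (metis group_left_inverse mult.assoc mult_1_right)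
  hence "cj (inverse t * s) y = cj (t * s) y"
   using i j by (simp add: cj_cj[symmetric, of s t] cj_cj[symmetric, of t s] cj_pow power_mult[symmetric] mult.commute flip: \<open>s * t = inverse t * s\<close>)
  hence "cj t (cj (inverse t) (cj s y)) = cj t (cj t (cj s y))" by (simp add: cj_cj mult.assoc)
  hence "cj s y = cj (t * t) (cj s y)" by (simp only: cj_left_inv cj_cj[of t t])
  hence "y ^ i = (y ^ 4) ^ i" using i ty by (simp add: cj_pow)
  moreover have "(y ^ i) ^ 3 * y ^ i = (y ^ 4) ^ i"
  proof -
   have "i * 3 + i = 4 * i" by simp
   thus ?thesis by (metis power_add power_mult)
  qed
  ultimately have "(y ^ i) ^ 3 * y ^ i = 1 * y ^ i" by simp
  hence "(y ^ i) ^ 3 = 1" by (simp only: group_right_cancel)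
  moreover have "(y ^ i) ^ 5 = 1" using y(3) 2 by (metis mult.commute power_mult power_one)
  moreover have "coprime (3::nat) 5" by (rule primes_coprime) simp_all
  ultimately have "cj s y = 1" using pow_coprime_eq_one i by metis
  thus False using y(2) by simp
 qed
qed

text \<open>If \<open>x\<close> of prime order acts without fixed points both on \<open>V\<close> and on an elementary abelian 2-group
  \<open>X\<close>, summing the vanishing orbit sums of all conjugates of \<open>x\<close> under \<open>X\<close> shows that \<open>X\<close> acts trivially.\<close>

lemma no_abelian_normal_two:
 assumes X: "normal_in X H" "\<And>a b. a \<in> X ==> b \<in> X ==> a * b = b * a" "\<And>a. a \<in> X ==> a * a = 1"
 shows "X = {1}"
proof -
 have SX: "subgrp X" "X \<subseteq> H" "finite X" using X(1) H(2) finite_subset by (auto simp: normal_in_def)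
 note S = subgrpD[OF SX(1)]
 obtain x where x: "x \<in> H" "x \<noteq> 1" "x ^ q = 1" using cauchy[OF H(1,2) q(1,2)] by blast
 have a1: "inverse a = a" if "a \<in> X" for a using X(3)[OF that] by (rule group_inverse_unique)
 have cardX: "\<not> r dvd card X"
 proof -
  have "p = 2" if pp: "prime p" "p dvd card X" for p
  proof -
   obtain a where a: "a \<in> X" "a \<noteq> 1" "a ^ p = 1" using cauchy[OF SX(1,3) pp] by blast
   have "a ^ 2 = 1" using X(3) a(1) by (simp add: power2_eq_square)
   hence "\<not> coprime p 2" using a pow_coprime_eq_one by blast
   thus ?thesis using pp(1) primes_coprime two_is_prime_nat by blast
  qed
  then obtain n where "card X = 2 ^ n" using power_of_two_only_prime[OF card_subgrp_pos[OF SX(1,3)], of 2] by auto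
  thus ?thesis using q_not_r(2) by simp
 qed
 define T where "T v = (\<Sum>a\<in>X. a $ v)" for v
 have TV: "T v \<in> V" if "v \<in> V" for v
  unfolding T_def by (rule adsub_sum[OF V(1)]) (use V(3) SX(2) that in blast)
 have conj: "(\<Sum>a\<in>X. cj a w $ v) = w $ T v" if w: "w \<in> H" "w \<noteq> 1" "w ^ q = 1" for w v
 proof -
  \<comment> \<open>Here \<open>cj a w = w * \<phi> a\<close>. As \<open>w\<close> centralises no
    involution of \<open>X\<close>, the map \<open>\<phi>\<close> is injective, so the conjugates of
    \<open>w\<close> under \<open>X\<close> are exactly the products \<open>w * b\<close> with
    \<open>b\<close> in \<open>X\<close>.\<close>
  define \<phi> where "\<phi> a = cj (inverse w) a * a" for a
  have cX: "cj (inverse w) a \<in> X" if "a \<in> X" for a using X(1) SH(3) w(1) that by (auto simp: normal_in_def)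
  have \<phi>X: "\<phi> ` X \<subseteq> X" using cX S(2) by (auto simp: \<phi>_def)
  have "inj_on \<phi> X"
  proof (rule inj_onI)
   fix a b assume ab: "a \<in> X" "b \<in> X" "\<phi> a = \<phi> b"
   have "cj (inverse w) (a * b) * (a * b) = \<phi> a * \<phi> b"
    using X(2) cX ab(1,2) by (simp add: \<phi>_def cj_mult) (metis mult.assoc)
   also have "\<dots> = 1" using ab X(3) \<phi>X by (metis imageI subsetD)
   finally have "cj (inverse w) (a * b) = a * b"
    using a1[OF S(2)[OF ab(1,2)]] by (metis group_inverse_inverse group_inverse_unique)
   hence "cj w (a * b) = a * b" by (metis cj_left_inv(2))
   hence "(a * b) * w = w * (a * b)" by (simp add: cj_fix_iff)
   moreover have "(a * b) ^ (2 ^ 1) = 1" using X(3) S(2) ab by (simp add: power2_eq_square)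
   ultimately have "a * b = 1" using cent[of "a * b" 1 w] w S(2) ab SX(2) by blast
   thus "a = b" using a1[OF ab(1)] group_inverse_unique by metis
  qed
  hence bij: "bij_betw \<phi> X X" using \<phi>X by (simp add: bij_betw_def endo_inj_surj[OF SX(3)])
  have "cj a w = w * \<phi> a" if "a \<in> X" for a using a1[OF that] by (simp add: \<phi>_def cj_def group_norm)
  hence "(\<Sum>a\<in>X. cj a w $ v) = w $ (\<Sum>a\<in>X. \<phi> a $ v)" by (simp add: act_sum act_mult)
  also have "(\<Sum>a\<in>X. \<phi> a $ v) = T v" unfolding T_def by (rule sum.reindex_bij_betw[OF bij])
  finally show ?thesis .
 qed
 have key: "T v = (\<Sum>a\<in>X. v)" if v: "v \<in> V" for v
 proof -
  have q0: "q > 0" using q(1) prime_gt_0_nat by blast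
  have "0 = (\<Sum>a\<in>X. \<Sum>m<q. cj a x ^ m $ v)"
  proof -
   have "(\<Sum>m<q. cj a x ^ m $ v) = 0" if "a \<in> X" for a
    by (rule orbit_sum) (use SH(4) SX(2) x that v in \<open>auto simp flip: cj_pow\<close>)
   thus ?thesis by simp
  qed
  also have "\<dots> = (\<Sum>m<q. \<Sum>a\<in>X. cj a (x ^ m) $ v)" by (simp add: cj_pow) (rule sum.swap)
  also have "\<dots> = (\<Sum>m<q. x ^ m $ T v + (if m = 0 then (\<Sum>a\<in>X. v) - T v else 0))"
  proof (rule sum.cong)
   fix m assume m: "m \<in> {..<q}"
   show "(\<Sum>a\<in>X. cj a (x ^ m) $ v) = x ^ m $ T v + (if m = 0 then (\<Sum>a\<in>X. v) - T v else 0)"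
   proof (cases "m = 0")
    case False
    have "x ^ m \<noteq> 1" using power_swap[OF x(2,3) q(1)] False m by auto
    moreover have "(x ^ m) ^ q = 1" using x(3) by (metis mult.commute power_mult power_one)
    ultimately show ?thesis using conj SH(6)[OF x(1)] False by simp
   qed simp
  qed simp
  also have "\<dots> = 0 + ((\<Sum>a\<in>X. v) - T v)"
   using orbit_sum[OF x TV[OF v]] q0 by (simp add: sum.distrib)
  finally show ?thesis by simp
 qed
 have "b = 1" if b: "b \<in> X" for b
 proof (rule faithful)
  show "b $ v = v" if v: "v \<in> V" for v
  proof -
   have "b $ T v = T v"
   proof -
    have "b $ T v = (\<Sum>a\<in>X. (b * a) $ v)" by (simp add: T_def act_sum act_mult)
    also have "\<dots> = T v" unfolding T_def
     by (rule sum.reindex_bij_witness[of _ "\<lambda>a. inverse b * a" "\<lambda>a. b * a"]) (use S b in \<open>auto simp: group_norm\<close>)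
    finally show ?thesis .
   qed
   hence "(\<Sum>a\<in>X. b $ v - v) = 0" using key[OF v] by (simp add: act_sum sum_subtractf)
   hence "(\<Sum>i<card X. b $ v - v) = 0" by (simp only: sum_const_card[OF SX(3)])
   hence "b $ v - v = 0" using torsion[OF _ cardX] VD(4) V(3) SX(2) b v by blast
   thus ?thesis by simp
  qed
 qed (use SX(2) b in blast)
 thus ?thesis using S(1) by blast
qed

text \<open>A nontrivial abelian normal subgroup exists by solvability. Its order is prime to
  \<open>q\<close>, hence even, and its involutions would span a nontrivial normal elementary
  abelian 2-group.\<close>

theorem impossible: False
proof -
 have nH: "normal_in H H" using H(1) SH by (auto simp: normal_in_def)
 obtain x where x: "x \<in> H" "x \<noteq> 1" "x ^ q = 1" using cauchy[OF H(1,2) q(1,2)] by blast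
 hence "\<not> H \<subseteq> {1}" by blast
 then obtain E where E: "normal_in E H" "\<not> E \<subseteq> {1}" "\<And>a b. a \<in> E ==> b \<in> E ==> cmt a b \<in> {1}"
  using solv_normal_section[OF H(1) nH H(4), of "{1}"] by auto
 have c: "a * b = b * a" if "a \<in> E" "b \<in> E" for a b using E(3)[OF that] cmt_swap[of a b] by simp
 have SE: "subgrp E" "E \<subseteq> H" "finite E" using E(1) H(2) finite_subset by (auto simp: normal_in_def)
 note S = subgrpD[OF SE(1)]
 have nq: "\<not> q dvd card E" using no_abelian_normal_q[OF E(1) c] .
 have "card E dvd card H" using card_subgrp_dvd[OF H(1) SE(1,2) H(2)] .
 hence p2: "p = 2" if "prime p" "p dvd card E" for p using primes nq that dvd_trans by blast
 define X where "X = {e \<in> E. e * e = 1}"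
 have "subgrp X" unfolding subgrp_def
 proof (intro conjI ballI)
  show "a * b \<in> X" if ab: "a \<in> X" "b \<in> X" for a b
  proof -
   have "(a * b) * (a * b) = (a * a) * (b * b)"
    using pow_mult_commuting[OF c, of a b 2] ab by (simp add: X_def power2_eq_square)
   thus ?thesis using ab S(2) by (simp add: X_def)
  qed
  show "inverse a \<in> X" if "a \<in> X" for a
   using that group_inverse_unique[of a a] by (auto simp: X_def)
 qed (use S in \<open>simp add: X_def\<close>)
 hence "normal_in X H" using E(1) SE(2) by (auto simp: normal_in_def X_def simp flip: cj_mult)
 hence X1: "X = {1}" by (rule no_abelian_normal_two) (use c in \<open>auto simp: X_def\<close>)
 obtain e where "e \<in> E" "e \<noteq> 1" using E(2) by blast
 hence "card E \<noteq> 1" using S(1) by (metis card_1_singletonE singletonD)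
 then obtain p where "prime p" "p dvd card E" using prime_factor_nat by blast
 then obtain a where "a \<in> E" "a \<noteq> 1" "a ^ 2 = 1" using cauchy[OF SE(1,3), of p] p2 by blast
 hence "a \<in> X" by (simp add: X_def power2_eq_square)
 thus False using X1 \<open>a \<noteq> 1\<close> by blast
qed

end

section \<open>Edges of the prime graph\<close>

lemma prime_dvd_card: assumes "subgrp G" "finite G" "x \<in> G" "x \<noteq> 1" "x ^ p = 1" "prime p" shows "p dvd card G"
proof (rule ccontr)
 assume "\<not> p dvd card G"
 hence "coprime p (card G)" using assms(6) prime_imp_coprime by blast
 thus False using pow_coprime_eq_one[OF assms(5) pow_card[OF assms(1-3)]] assms(4) by blast
qed

text \<open>A minimal normal subgroup coincides with its own abelian section \<open>E\<close>, and
  then with its elements killed by a prime divisor \<open>l\<close> of its order.\<close>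

lemma min_normal_exists:
 assumes G: "subgrp G" "finite G" "solv G" "G \<noteq> {1}"
 shows "\<exists>N l. min_normal N G \<and> (\<forall>x\<in>N. \<forall>y\<in>N. x * y = y * x) \<and> prime l \<and> (\<forall>x\<in>N. x ^ l = 1)"
proof -
 define \<N> where "\<N> = {M. normal_in M G \<and> M \<noteq> {1}}"
 have "normal_in G G" using G(1) subgrpD[OF G(1)] by (auto simp: normal_in_def)
 hence "\<N> \<noteq> {}" using G(4) by (auto simp: \<N>_def)
 moreover have "finite \<N>"
  by (rule finite_subset[of _ "Pow G"]) (use G(2) in \<open>auto simp: normal_in_def \<N>_def\<close>)
 ultimately obtain N where N0: "N \<in> \<N>" "\<forall>M\<in>\<N>. M \<subseteq> N \<longrightarrow> N = M"
  using finite_has_minimal[of \<N>] by blast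
 have N: "normal_in N G \<and> N \<noteq> {1}" "\<And>M. normal_in M G ==> M \<noteq> {1} ==> M \<subseteq> N ==> M = N"
  using N0 by (auto simp: \<N>_def)
 have mN: "min_normal N G" using N unfolding min_normal_def by blast
 have SN: "subgrp N" "N \<subseteq> G" "normal_in N G" "N \<noteq> {1}" using N(1) by (auto simp: normal_in_def)
 note S = subgrpD[OF SN(1)]
 have finN: "finite N" using SN(2) G(2) finite_subset by blast
 have "solv N" by (rule solv_subset[OF G(3) SN(2)])
 moreover have "\<not> N \<subseteq> {1}" using SN(4) S(1) by blast
 ultimately obtain E where E: "normal_in E G" "E \<subseteq> N" "\<not> E \<subseteq> {1}" "\<And>x y. x \<in> E ==> y \<in> E ==> cmt x y \<in> {1}"
  using solv_normal_section[OF G(1) SN(3), of "{1}"] by auto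
 have "E = N" using N(2)[of E] E by auto
 hence com: "x * y = y * x" if "x \<in> N" "y \<in> N" for x y using E(4)[of x y] that cmt_swap[of x y] by simp
 have "card N \<noteq> 1" using SN(4) S(1) by (metis card_1_singletonE singletonD)
 then obtain l where l: "prime l" "l dvd card N" using prime_factor_nat by blast
 define M where "M = {x \<in> N. x ^ l = 1}"
 have "subgrp M" unfolding subgrp_def M_def
  using S com pow_mult_commuting[OF com] by (auto simp flip: pow_inverse)
 hence "normal_in M G" using SN by (auto simp: normal_in_def M_def simp flip: cj_pow)
 moreover obtain x where "x \<in> N" "x \<noteq> 1" "x ^ l = 1" using cauchy[OF SN(1) finN l] by blast
 ultimately have "M = N" using N(2)[of M] by (auto simp: M_def)
 hence "\<forall>x\<in>N. x ^ l = 1" by (auto simp: M_def)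
 thus ?thesis using mN com l(1) by blast
qed

text \<open>Some \<open>g\<close> inverts \<open>x\<close>. In odd order the odd power
  \<open>g ^ card G = 1\<close> inverts it as well.\<close>

lemma rational_even:
 assumes G: "subgrp G" "finite G" "rational G" "G \<noteq> {1}" shows "2 dvd card G"
proof (rule ccontr)
 assume odd: "\<not> 2 dvd card G"
 obtain x where x: "x \<in> G" "x \<noteq> 1" using G(4) subgrpD(1)[OF G(1)] by blast
 obtain g where g: "g \<in> G" and gi: "cj g x = inverse x" using rational_inverse[OF G(3,1,2) x(1)] .
 have "cj (g ^ m) x = (if even m then x else inverse x)" for m
  by (induction m) (auto simp: cj_cj[symmetric] gi cj_inverse)
 from this[of "card G"] have "x = inverse x" using odd pow_card[OF G(1,2) g] by simp
 hence "x ^ 2 = 1" by (metis group_right_inverse power2_eq_square)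
 moreover have "coprime 2 (card G)" using odd by (simp add: prime_imp_coprime)
 ultimately show False using pow_coprime_eq_one pow_card[OF G(1,2) x(1)] x(2) by blast
qed

text \<open>The hypothesis \<open>min\<close> says that no proper quotient has order divisible by
  both 3 and 5. So the minimal normal \<open>l\<close>-subgroup \<open>N\<close> has
  \<open>l\<close> equal to 3 or 5 and index prime to \<open>l\<close>, and contains all elements of
  \<open>l\<close>-power order.\<close>

theorem edge_core:
 fixes G :: "'a::group_mult set"
 assumes G: "subgrp G" "finite G" "solv G" "rational G"
  and primes: "\<And>s. prime s ==> s dvd card G ==> s = 2 \<or> s = 3 \<or> s = 5"
  and dvd: "3 dvd card G" "5 dvd card G"
  and min: "\<And>M. normal_in M G ==> M \<noteq> {1} ==> \<not> (3 dvd card G div card M \<and> 5 dvd card G div card M)"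
  and q: "q = 3 \<or> q = 5"
 shows "\<exists>t\<in>G. \<exists>y\<in>G. t \<noteq> 1 \<and> t * t = 1 \<and> y \<noteq> 1 \<and> y ^ q = 1 \<and> t * y = y * t"
proof (rule ccontr)
 assume "\<not> ?thesis"
 hence no2q: "False" if "t \<in> G" "t \<noteq> 1" "t * t = 1" "y \<in> G" "y \<noteq> 1" "y ^ q = 1" "t * y = y * t" for t y
  using that by blast
 define r where "r = 8 - q"
 have qr: "(q = 3 \<and> r = 5) \<or> (q = 5 \<and> r = 3)" using q by (auto simp: r_def)
 have pq: "prime q" "prime r" "odd q" "odd r" "q \<noteq> r" using qr by auto
 have cqr: "coprime q r" using pq primes_coprime by blast
 note SG = subgrpD[OF G(1)]
 have LA: "g = 1" if g: "g \<in> G" "g ^ (2 ^ n) = 1" "y \<in> G" "y \<noteq> 1" "y ^ q = 1" "g * y = y * g" for g y n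
 proof (rule ccontr)
  assume "g \<noteq> 1"
  then obtain j where j: "g ^ (2 ^ j) \<noteq> 1" "(g ^ (2 ^ j)) ^ 2 = 1" using exists_prime_power_step g(2) by blast
  moreover have "g ^ (2 ^ j) * y = y * g ^ (2 ^ j)" using g(6) by (rule power_commuting_commutes)
  ultimately show False using no2q[of "g ^ (2 ^ j)" y] SG(6) g by (simp add: power2_eq_square)
 qed
 have step0: "y = 1" if x: "x \<in> G" "x \<noteq> 1" "x ^ q = 1" and y: "y \<in> G" "y ^ r = 1" and c: "x * y = y * x" for x y
 proof -
  have xyp: "(x * y) ^ n = x ^ n * y ^ n" for n by (rule pow_mult_commuting[OF c])
  have xp: "x ^ n = x ^ (n mod q)" and yp: "y ^ n = y ^ (n mod r)" for n
   by (rule power_cong_card[OF x(3)], simp add: cong_def) (rule power_cong_card[OF y(2)], simp add: cong_def)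
  \<comment> \<open>\<open>k\<close> is 1 modulo \<open>q\<close> and -1 modulo \<open>r\<close>, so
    its square is 1 modulo 15. The exponents \<open>e\<close> and \<open>f\<close> are the
    idempotents modulo 15 that extract the \<open>q\<close>-part and the
    \<open>r\<close>-part.\<close>
  define k e f where "k = (if q = 3 then 4 else 11 :: nat)" and "e = (if q = 3 then 10 else 6 :: nat)"
   and "f = (if q = 3 then 6 else 10 :: nat)"
  have xy15: "(x * y) ^ 15 = 1" using xyp[of 15] xp[of 15] yp[of 15] qr by auto
  obtain u m where uG: "u \<in> G" and cm: "u ^ (2 ^ m) = 1" and cu: "cj u (x * y) = (x * y) ^ k"
   by (rule rational_two_element[OF G(4,1,2) SG(2)[OF x(1) y(1)] xy15, of k]) (auto simp: k_def cong_def)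
  have xe: "(x * y) ^ e = x" and yf: "(x * y) ^ f = y"
   using xyp[of 10] xyp[of 6] xp[of 10] xp[of 6] yp[of 10] yp[of 6] qr by (auto simp: e_def f_def)
  have cue: "cj u ((x * y) ^ n) = (x * y) ^ (k * n)" for n by (simp add: cj_pow cu power_mult)
  have "cj u x = x"
   using cue[of e] xe xyp[of 40] xp[of 40] yp[of 40] xyp[of 66] xp[of 66] yp[of 66] qr by (auto simp: e_def k_def)
  hence "u * x = x * u" by (simp add: cj_fix_iff)
  hence "u = 1" using LA[OF uG cm] x by blast
  hence "y = (x * y) ^ (k * f)" using cue[of f] yf by simp
  also have "\<dots> = y ^ (if q = 3 then 4 else 2)"
   using xyp[of 24] xp[of 24] yp[of 24] xyp[of 110] xp[of 110] yp[of 110] qr by (auto simp: f_def k_def)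
  finally have y4: "y = y ^ (if q = 3 then 4 else 2)" .
  show ?thesis
  proof (cases "q = 3")
   case True
   have "y ^ 3 * y = 1 * y" using y4 True by (simp add: eval_nat_numeral mult.assoc)
   hence "y ^ 3 = 1" by (simp only: group_right_cancel)
   thus ?thesis using pow_coprime_eq_one y(2) cqr True by metis
  next
   case False
   hence "y * 1 = y * y" using y4 by (simp add: power2_eq_square)
   thus ?thesis by (simp del: mult_1_right)
  qed
 qed
 have "G \<noteq> {1}" using dvd(1) by auto
 then obtain N l where N: "min_normal N G" "\<forall>x\<in>N. \<forall>y\<in>N. x * y = y * x" "prime l" "\<forall>x\<in>N. x ^ l = 1"
  using min_normal_exists[OF G(1-3)] by blast
 have nN: "normal_in N G" "N \<noteq> {1}" using N(1) by (auto simp: min_normal_def)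
 have SN: "subgrp N" "N \<subseteq> G" using nN(1) by (auto simp: normal_in_def)
 note S = subgrpD[OF SN(1)]
 have finN: "finite N" using SN(2) G(2) finite_subset by blast
 have cN0: "card N > 0" by (rule card_subgrp_pos[OF SN(1) finN])
 obtain a where cN: "card N = l ^ a"
 proof -
  have "p = l" if p: "prime p" "p dvd card N" for p
  proof -
   obtain x where x: "x \<in> N" "x \<noteq> 1" "x ^ p = 1" using cauchy[OF SN(1) finN p] by blast
   hence "\<not> coprime p l" using pow_coprime_eq_one N(4) by blast
   thus ?thesis using p(1) N(3) primes_coprime by blast
  qed
  thus ?thesis using that power_of_two_only_prime[OF cN0 _ N(3)] by blast
 qed
 have cG: "card G = card N * (card G div card N)"
  using card_subgrp_dvd[OF G(1) SN G(2)] by simp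
 have other: "s dvd card G div card N" if "prime s" "s dvd card G" "s \<noteq> l" for s
 proof -
  have "\<not> s dvd card N" unfolding cN using that N(3) by (metis prime_dvd_power primes_dvd_imp_eq)
  thus ?thesis using that cG prime_dvd_mult_iff by metis
 qed
 have l: "\<not> l dvd card G div card N" "l = q \<or> l = r"
 proof -
  have "\<not> (3 dvd card G div card N \<and> 5 dvd card G div card N)" using min nN by blast
  moreover have "3 dvd card G div card N" if "l \<noteq> 3" using other[of 3] dvd that by auto
  moreover have "5 dvd card G div card N" if "l \<noteq> 5" using other[of 5] dvd that by auto
  ultimately have "\<not> l dvd card G div card N \<and> (l = 3 \<or> l = 5)" by metis
  thus "\<not> l dvd card G div card N" "l = q \<or> l = r" using qr by auto
 qed
 obtain n0 where n0: "n0 \<in> N" "n0 \<noteq> 1" using nN(2) S(1) by blast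
 have cjN: "cj g n \<in> N" if "g \<in> G" "n \<in> N" for g n using nN that by (simp add: normal_in_def)
 have l_elt: "g \<in> N" if "g \<in> G" "g ^ (l ^ b) = 1" for g b
 proof (rule pow_coprime_mem[OF SN(1)])
  show "g ^ (card G div card N) \<in> N" by (rule pow_index_mem[OF G(1,2) nN(1) that(1)])
  show "g ^ (l ^ b) \<in> N" using that(2) S(1) by simp
  show "coprime (card G div card N) (l ^ b)"
   using l(1) N(3) by (metis coprime_commute coprime_power_right_iff prime_imp_coprime)
 qed
 obtain \<pi> :: "'a \<Rightarrow> ('a \<Rightarrow> int) perm" and \<iota> :: "'a \<Rightarrow> ('a \<Rightarrow> int) \<Rightarrow> circ"
  where h: "homo G \<pi>" and inj: "inj_on \<iota> N" and aV: "adsub (\<iota> ` N)" and \<iota>1: "\<iota> 1 = 0"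
   and \<iota>: "\<forall>x\<in>N. \<forall>y\<in>N. \<iota> (x * y) = \<iota> x + \<iota> y" and \<iota>p: "\<forall>n\<in>N. \<forall>c. (\<Sum>i<c. \<iota> n) = \<iota> (n ^ c)"
   and act: "\<forall>g\<in>G. \<forall>n\<in>N. pact (\<pi> g) (\<iota> n) = \<iota> (cj g n)"
   and ker: "\<forall>g\<in>G. \<pi> g = 1 \<longleftrightarrow> (\<forall>n\<in>N. cj g n = n)" and cH: "card (\<pi> ` G) dvd card G div card N"
  by (rule linear_module[OF G(1,2) nN(1) N(2,3,4)])
 note hp = homo_props[OF h G(1)]
 define H where "H = \<pi> ` G"
 have sgH: "subgrp H" "finite H" "rational H" "solv H"
  using hp(5) G(2) homo_rational[OF h G(1,2,4)] homo_solv[OF h G(1,3)] by (auto simp: H_def)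
 have \<iota>0: "\<iota> n = 0 \<longleftrightarrow> n = 1" if "n \<in> N" for n using inj \<iota>1 S(1) that by (metis inj_on_eq_iff)
 have \<iota>eq: "\<iota> m = \<iota> n \<longleftrightarrow> m = n" if "m \<in> N" "n \<in> N" for m n using inj that by (simp add: inj_on_eq_iff)
 have \<pi>N: "\<pi> n = 1" if "n \<in> N" for n
  using ker SN(2) that N(2) by (auto simp: cj_fix_iff)
 have HV: "pact h v \<in> \<iota> ` N" if "h \<in> H" "v \<in> \<iota> ` N" for h v
  using that act cjN by (auto simp: H_def)
 have fixV: "g * n = n * g" if "g \<in> G" "n \<in> N" "pact (\<pi> g) (\<iota> n) = \<iota> n" for g n
  using act that \<iota>eq[OF cjN[OF that(1,2)] that(2)] by (simp add: cj_fix_iff)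
 have cardH: "card H dvd card G div card N" using cH by (simp add: H_def)
 have cardH': "card H dvd card G" using cardH cG by (metis dvd_mult)
 show False using l(2)
 proof
  assume lq: "l = q"
  \<comment> \<open>The centraliser of \<open>n\<close> contains no involution and no element of
    order \<open>r\<close>, so it is a \<open>q\<close>-group and lies in \<open>N\<close>: the
    quotient acts freely.\<close>
  have fpf: "g \<in> N" if g: "g \<in> G" and n: "n \<in> N" "n \<noteq> 1" and c: "g * n = n * g" for g n
  proof -
   define C where "C = {g \<in> G. g * n = n * g}"
   have nG: "n \<in> G" "n ^ q = 1" using n SN(2) N(4) lq by auto
   have SC: "subgrp C"
    unfolding subgrp_def C_def using SG(1,2,3)
    by (auto simp: cj_fix_iff[symmetric] cj_cj[symmetric]) (metis cj_left_inv(1))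
   have finC: "finite C" using G(2) by (simp add: C_def)
   have "p = q" if p: "prime p" "p dvd card C" for p
   proof -
    obtain x where x: "x \<in> C" "x \<noteq> 1" "x ^ p = 1" using cauchy[OF SC finC p] by blast
    hence xG: "x \<in> G" "x * n = n * x" by (auto simp: C_def)
    have "p dvd card G" using prime_dvd_card[OF G(1,2) xG(1) x(2,3) p(1)] .
    hence "p = 2 \<or> p = 3 \<or> p = 5" using primes p(1) by blast
    moreover have "p \<noteq> 2" using no2q[of x n] xG x nG n(2) by (auto simp: power2_eq_square)
    moreover have "p \<noteq> r" using step0[OF nG(1) n(2) nG(2) xG(1)] x xG(2) by auto
    ultimately show ?thesis using qr by auto
   qed
   then obtain b where "card C = q ^ b"
    using power_of_two_only_prime[OF card_subgrp_pos[OF SC finC] _ pq(1)] by blast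
   hence "g ^ (q ^ b) = 1" using pow_card[OF SC finC, of g] g c by (simp add: C_def)
   thus ?thesis using l_elt g lq by blast
  qed
  have "2 dvd card G" by (rule rational_even[OF G(1,2,4) \<open>G \<noteq> {1}\<close>])
  then obtain t where t: "t \<in> G" "t \<noteq> 1" "t ^ 2 = 1" using cauchy[OF G(1,2), of 2] by auto
  have \<pi>1: "\<pi> g = 1 ==> g \<in> N" if "g \<in> G" for g
   using fpf[OF that n0] ker that n0(1) by (auto simp: cj_fix_iff)
  have fpfH: "x = 1" if x: "x \<in> H" "v \<in> \<iota> ` N" "v \<noteq> 0" "pact x v = v" for x v
  proof -
   obtain g n where gn: "g \<in> G" "n \<in> N" "x = \<pi> g" "v = \<iota> n" using x(1,2) by (auto simp: H_def)
   hence "g \<in> N" using fpf[OF gn(1,2)] fixV x \<iota>0 by auto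
   thus ?thesis using \<pi>N gn by simp
  qed
  \<comment> \<open>\<open>v + pact s v\<close> is fixed by \<open>s\<close> and hence zero. All
    involutions act as -1, so there is only one.\<close>
  have minus: "pact s v = - v" if s: "s \<in> H" "s \<noteq> 1" "s * s = 1" and v: "v \<in> \<iota> ` N" for s v
  proof -
   have "pact s (v + pact s v) = v + pact s v"
    using s(3) by (simp add: pact.act_add add.commute flip: pact.act_mult)
   moreover have "v + pact s v \<in> \<iota> ` N" using adsubD(2)[OF aV] HV s v by blast
   ultimately have "v + pact s v = 0" using fpfH s by blast
   thus ?thesis by (simp add: eq_neg_iff_add_eq_0 add.commute)
  qed
  have z: "\<pi> t \<in> H" "\<pi> t \<noteq> 1" "\<pi> t * \<pi> t = 1"
  proof -
   show "\<pi> t \<noteq> 1"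
   proof
    assume "\<pi> t = 1"
    hence "t \<in> N" using \<pi>1 t by blast
    hence "t ^ q = 1" using N(4) lq by blast
    moreover have "coprime 2 q" using pq by simp
    ultimately show False using pow_coprime_eq_one t by blast
   qed
   show "\<pi> t * \<pi> t = 1" using hp(2)[OF t(1), of 2] t(3) homo_one[OF h SG(1)] by (simp add: power2_eq_square)
  qed (use t in \<open>simp add: H_def\<close>)
  have uniq: "s = 1 \<or> s = \<pi> t" if s: "s \<in> H" "s * s = 1" for s
  proof (rule ccontr)
   assume n: "\<not> ?thesis"
   have v: "\<iota> n0 \<in> \<iota> ` N" "\<iota> n0 \<noteq> 0" using n0 \<iota>0 by auto
   have "pact (s * \<pi> t) (\<iota> n0) = \<iota> n0"
    using minus[of "\<pi> t"] minus[of s] z s n v by (simp add: pact.act_mult pact.act_minus)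
   hence "s * \<pi> t = 1" using fpfH v subgrpD(2)[OF sgH(1) s(1) z(1)] by blast
   hence "s = \<pi> t" using z(3) by (metis group_right_cancel)
   thus False using n by blast
  qed
  interpret unique_involution H "\<pi> t" by unfold_locales (use sgH z uniq in auto)
  obtain y where y: "y \<in> G" "y \<noteq> 1" "y ^ r = 1" using cauchy[OF G(1,2) pq(2)] dvd qr by blast
  have y1: "\<pi> y \<noteq> 1"
  proof
   assume "\<pi> y = 1"
   hence "y ^ q = 1" using \<pi>1 y(1) N(4) lq by blast
   thus False using pow_coprime_eq_one y cqr by blast
  qed
  have yr: "\<pi> y ^ r = 1" "\<pi> y \<in> H" using hp(2)[OF y(1), of r] y homo_one[OF h SG(1)] by (auto simp: H_def)
  show False
  proof (cases "r = 5")
   case True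
   thus False using no_five yr y1 by blast
  next
   case False
   hence r3: "r = 3" "q = 5" using qr by auto
   have "3 dvd card H" using prime_dvd_card[OF sgH(1,2) yr(2) y1 yr(1) pq(2)] r3 by simp
   moreover have "s = 2 \<or> s = 3" if s: "prime s" "s dvd card H" for s
   proof -
    have "s \<noteq> 5" using s(2) cardH l(1) lq r3 dvd_trans by blast
    thus ?thesis using primes[OF s(1)] dvd_trans[OF s(2) cardH'] by blast
   qed
   ultimately show False using no_three[OF sgH(4)] by blast
  qed
 next
  assume lr: "l = r"
  define C where "C = {g \<in> G. \<forall>n\<in>N. cj g n = n}"
  have nC: "normal_in C G" unfolding normal_in_def subgrp_def
  proof (intro conjI ballI)
   show "cj g c \<in> C" if g: "g \<in> G" and c: "c \<in> C" for g c
   proof -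
    have "cj (cj g c) n = n" if n: "n \<in> N" for n
    proof -
     have "cj c (cj (inverse g) n) = cj (inverse g) n" using c cjN[OF SG(3)[OF g] n] by (auto simp: C_def)
     hence "cj g (cj c (cj (inverse g) n)) = n" by simp
     thus ?thesis by (simp add: cj_cj) (simp add: cj_def mult.assoc)
    qed
    thus ?thesis using SG(4) g c by (simp add: C_def)
   qed
   show "inverse c \<in> C" if "c \<in> C" for c using that SG(3) by (auto simp: C_def) (metis cj_left_inv(1))
  qed (use SG in \<open>auto simp: C_def simp flip: cj_cj\<close>)
  have noq: "\<not> q dvd card D" if D: "subgrp D" "D \<subseteq> C" for D
  proof
   assume "q dvd card D"
   moreover have finD: "finite D" using D(2) G(2) by (auto simp: C_def intro: finite_subset)
   ultimately obtain x where x: "x \<in> D" "x \<noteq> 1" "x ^ q = 1" using cauchy[OF D(1) _ pq(1)] by blast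
   hence "x \<in> G" "x * n0 = n0 * x" using D(2) n0(1) by (auto simp: C_def cj_fix_iff)
   thus False using step0[OF _ x(2,3), of n0] n0 SN(2) N(4) lr by blast
  qed
  have CN: "C \<subseteq> N"
  proof (rule ccontr)
   assume "\<not> C \<subseteq> N"
   moreover have "solv C" by (rule solv_subset[OF G(3)]) (auto simp: C_def)
   ultimately obtain E where E: "normal_in E G" "E \<subseteq> C" "\<not> E \<subseteq> N" "\<And>x y. x \<in> E ==> y \<in> E ==> cmt x y \<in> N"
    using solv_normal_section[OF G(1) nC _ S(1)] by metis
   have SE: "subgrp E" "E \<subseteq> G" "finite E" using E(1) G(2) finite_subset by (auto simp: normal_in_def)
   note SE' = subgrpD[OF SE(1)]
   have "2 dvd card E"
   proof (rule ccontr)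
    assume n2: "\<not> 2 dvd card E"
    have "p = l" if p: "prime p" "p dvd card E" for p
    proof -
     have "p dvd card G" using p(2) card_subgrp_dvd[OF G(1) SE(1,2) G(2)] dvd_trans by blast
     thus ?thesis using primes[OF p(1)] n2 noq[OF SE(1) E(2)] p(2) qr lr by auto
    qed
    then obtain b where "card E = l ^ b"
     using power_of_two_only_prime[OF card_subgrp_pos[OF SE(1,3)] _ N(3)] by blast
    hence "E \<subseteq> N" using pow_card[OF SE(1,3)] l_elt SE(2) by (metis subsetD subsetI)
    thus False using E(3) by blast
   qed
   define P where "P = {e \<in> E. e * e = 1}"
   \<comment> \<open>The commutator \<open>c\<close> lies in \<open>N\<close> and is centralised by
     \<open>a\<close>, so its square is 1, and it is trivial because \<open>N\<close> is an
     \<open>r\<close>-group. Thus the involutions of \<open>E\<close> generate a normal 2-subgroup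
     of \<open>G\<close>, and the quotient by it still has order divisible by 15, against
     minimality.\<close>
   have comP: "a * b = b * a" if ab: "a \<in> P" "b \<in> P" for a b
   proof -
    define c where "c = cmt a b"
    have cN: "c \<in> N" using E(4) ab by (simp add: c_def P_def)
    have cab: "cj a b = c * b" by (simp add: c_def cmt_cj mult.assoc)
    have ac: "cj a c = c" using ab E(2) cN by (auto simp: P_def C_def)
    have "b = cj a (cj a b)" using ab by (simp add: cj_cj P_def)
    also have "\<dots> = c * (c * b)" using ac by (simp add: cab cj_mult)
    finally have "1 * b = (c * c) * b" by (simp add: mult.assoc)
    hence "c ^ 2 = 1" by (simp only: group_right_cancel power2_eq_square)
    moreover have "c ^ r = 1" using cN N(4) lr by blast
    moreover have "coprime 2 r" using pq by simp
    ultimately have "c = 1" using pow_coprime_eq_one by blast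
    thus ?thesis using cmt_swap[of a b] by (simp add: c_def)
   qed
   have SP: "subgrp P" unfolding subgrp_def
   proof (intro conjI ballI)
    show "a * b \<in> P" if ab: "a \<in> P" "b \<in> P" for a b
     using pow_mult_commuting[OF comP[OF ab], of 2] ab SE'(2) by (simp add: P_def power2_eq_square)
    show "inverse a \<in> P" if "a \<in> P" for a
     using that group_inverse_unique[of a a] by (auto simp: P_def)
   qed (use SE' in \<open>simp add: P_def\<close>)
   have nP: "normal_in P G" using E(1) SP SE(2) by (auto simp: normal_in_def P_def simp flip: cj_mult)
   obtain e where "e \<in> E" "e \<noteq> 1" "e ^ 2 = 1" using cauchy[OF SE(1,3), of 2] \<open>2 dvd card E\<close> by auto
   hence "P \<noteq> {1}" by (auto simp: P_def power2_eq_square)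
   moreover have "s dvd card G div card P" if s: "prime s" "s dvd card G" "odd s" for s
   proof -
    have finP: "finite P" using SE(3) by (simp add: P_def)
    have "\<not> s dvd card P"
    proof
     assume "s dvd card P"
     then obtain x where x: "x \<in> P" "x \<noteq> 1" "x ^ s = 1" using cauchy[OF SP finP s(1)] by blast
     hence "x ^ 2 = 1" by (simp add: P_def power2_eq_square)
     moreover have "coprime 2 s" using s(3) by simp
     ultimately show False using pow_coprime_eq_one x by blast
    qed
    moreover have "card G = card P * (card G div card P)"
    proof -
     have "P \<subseteq> G" using SE(2) by (auto simp: P_def)
     thus ?thesis using card_subgrp_dvd[OF G(1) SP _ G(2)] by simp
    qed
    ultimately show ?thesis using s prime_dvd_mult_iff by metis
   qed
   ultimately show False using min[OF nP] dvd by auto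
  qed
  have \<pi>1: "\<pi> g = 1 \<longleftrightarrow> g \<in> N" if g: "g \<in> G" for g
   using ker g CN \<pi>N by (auto simp: C_def)
  have odd_cN: "odd (card N)" "coprime (card N) q"
   using cN lr pq(4) cqr by (auto simp: coprime_commute)
  have lift: "g ^ (card N * m) = 1" if "g \<in> G" "\<pi> g ^ m = 1" for g m
  proof -
   have "\<pi> (g ^ m) = 1" using hp(2) that by simp
   hence "g ^ m \<in> N" using \<pi>1 SG(6) that(1) by blast
   hence "(g ^ m) ^ card N = 1" using pow_card[OF SN(1) finN] by blast
   thus ?thesis by (metis mult.commute power_mult)
  qed
  have lq: "\<exists>g0. g0 = g ^ card N \<and> g0 \<in> G \<and> g0 ^ q = 1 \<and> g0 \<noteq> 1" if g: "g \<in> G" "\<pi> g \<noteq> 1" "\<pi> g ^ q = 1" for g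
  proof -
   have "(g ^ card N) ^ q = 1" using lift[OF g(1,3)] by (simp add: power_mult)
   moreover have "g ^ card N \<noteq> 1"
   proof
    assume "g ^ card N = 1"
    hence "\<pi> g ^ card N = 1" using hp(2)[OF g(1)] homo_one[OF h SG(1)] by metis
    thus False using pow_coprime_eq_one g odd_cN(2) by blast
   qed
   ultimately show ?thesis using SG(6) g(1) by blast
  qed
  interpret rational_module pact H "\<iota> ` N" q r
  proof (unfold_locales)
   show "\<iota> ` N \<noteq> {0}" using n0 \<iota>0 by auto
   show "v = 0" if v: "v \<in> \<iota> ` N" "\<not> r dvd c" "(\<Sum>i<c. v) = 0" for v c
   proof -
    obtain n where n: "n \<in> N" "v = \<iota> n" using v(1) by blast
    hence "n ^ c = 1" using \<iota>p v(3) \<iota>0 S(6) by auto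
    moreover have "n ^ r = 1" "coprime c r" using N(4) lr n v(2) pq(2) prime_imp_coprime coprime_commute by blast+
    ultimately have "n = 1" using pow_coprime_eq_one by blast
    thus ?thesis using n \<iota>1 by simp
   qed
   show "x = 1" if x: "x \<in> H" "\<And>v. v \<in> \<iota> ` N ==> pact x v = v" for x
   proof -
    obtain g where g: "g \<in> G" "x = \<pi> g" using x(1) by (auto simp: H_def)
    hence "g \<in> C" using fixV[OF g(1)] x(2) by (auto simp: C_def cj_fix_iff)
    thus ?thesis using CN \<pi>N g by blast
   qed
   show "q dvd card H"
   proof -
    obtain y where y: "y \<in> G" "y \<noteq> 1" "y ^ q = 1" using cauchy[OF G(1,2) pq(1)] dvd qr by blast
    have "\<pi> y \<noteq> 1"
    proof
     assume "\<pi> y = 1"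
     hence "y ^ r = 1" using \<pi>1 y(1) N(4) lr by blast
     thus False using pow_coprime_eq_one y cqr by blast
    qed
    moreover have "\<pi> y ^ q = 1" using hp(2)[OF y(1), of q] y homo_one[OF h SG(1)] by simp
    ultimately show ?thesis using prime_dvd_card[OF sgH(1,2)] y(1) pq(1) by (auto simp: H_def)
   qed
   show "s = 2 \<or> s = q" if s: "prime s" "s dvd card H" for s
   proof -
    have "s \<noteq> r" using s(2) cardH l(1) lr dvd_trans by blast
    thus ?thesis using primes[OF s(1)] dvd_trans[OF s(2) cardH'] qr by auto
   qed
   show "v = 0" if y: "y \<in> H" "y \<noteq> 1" "y ^ q = 1" "v \<in> \<iota> ` N" "pact y v = v" for y v
   proof -
    obtain g n where gn: "g \<in> G" "y = \<pi> g" "n \<in> N" "v = \<iota> n" using y(1,4) by (auto simp: H_def)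
    have "g * n = n * g" using fixV gn y(5) by blast
    hence "g ^ card N * n = n * g ^ card N" by (rule power_commuting_commutes)
    moreover obtain "g ^ card N \<in> G" "(g ^ card N) ^ q = 1" "g ^ card N \<noteq> 1" using lq gn y by blast
    ultimately have "n = 1" using step0 gn(3) SN(2) N(4) lr by blast
    thus ?thesis using gn \<iota>1 by simp
   qed
   show "t = 1" if t: "t \<in> H" "t ^ (2 ^ n) = 1" and y: "y \<in> H" "y \<noteq> 1" "y ^ q = 1" and c: "t * y = y * t" for t y n
   proof -
    obtain g k where gk: "g \<in> G" "y = \<pi> g" "k \<in> G" "t = \<pi> k" using t(1) y(1) by (auto simp: H_def)
    define t0 where "t0 = k ^ card N"
    have t0: "t0 \<in> G" "t0 ^ (2 ^ n) = 1" using lift[of k "2 ^ n"] SG(6) gk t(2) by (auto simp: t0_def power_mult)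
    have \<pi>t0: "\<pi> t0 = t ^ card N" using hp(2) gk by (simp add: t0_def)
    have "t ^ card N * y = y * t ^ card N" using c by (rule power_commuting_commutes)
    hence "\<pi> (cj t0 g) = y" using hp(3)[OF t0(1) gk(1)] \<pi>t0 gk(2) by (simp add: cj_fix_iff)
    hence "\<pi> (inverse g * cj t0 g) = 1"
     using h SG(3,4) gk t0(1) hp(1)[OF gk(1)] by (simp add: homo_def)
    hence mN: "inverse g * cj t0 g \<in> N"
     using \<pi>1[OF SG(2)[OF SG(3)[OF gk(1)] SG(4)[OF t0(1) gk(1)]]] by simp
    \<comment> \<open>Conjugation by the 2-element \<open>t0\<close> preserves the coset of
      \<open>g\<close> modulo \<open>N\<close>, which has odd size, so it fixes some
      \<open>x\<close> there. This \<open>x\<close> lifts \<open>y\<close> and commutes with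
      \<open>t0\<close>, and a power of it has order \<open>q\<close>.\<close>
    define X where "X = (\<lambda>m. g * m) ` N"
    have finX: "finite X" "card X = card N" using finN by (auto simp: X_def card_image inj_on_def)
    have tX: "cj t0 x \<in> X" if "x \<in> X" for x
    proof -
     obtain m where m: "m \<in> N" "x = g * m" using \<open>x \<in> X\<close> by (auto simp: X_def)
     have "cj t0 x = g * ((inverse g * cj t0 g) * cj t0 m)" by (simp add: m cj_mult group_norm)
     moreover have "(inverse g * cj t0 g) * cj t0 m \<in> N" by (rule S(2)[OF mN cjN[OF t0(1) m(1)]])
     ultimately show ?thesis unfolding X_def by blast
    qed
    have iter: "(cj t0 ^^ m) x = cj (t0 ^ m) x" for m x by (induction m) (simp_all add: cj_cj)
    have "int 2 dvd int (card X) - int (card {x \<in> X. cj t0 x = x})"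
     by (rule card_fixpoints_cong[OF finX(1), where n = n]) (use tX t0(2) iter in auto)
    hence "card {x \<in> X. cj t0 x = x} \<noteq> 0" using odd_cN(1) finX(2) by (intro notI) simp
    then obtain x where x: "x \<in> X" "cj t0 x = x" by (metis (mono_tags, lifting) card.empty empty_Collect_eq)
    then obtain m where m: "m \<in> N" "x = g * m" by (auto simp: X_def)
    have xG: "x \<in> G" "\<pi> x = y" using m gk SG(2) SN(2) h \<pi>N by (auto simp: homo_def)
    obtain x1: "x ^ card N \<in> G" "(x ^ card N) ^ q = 1" "x ^ card N \<noteq> 1" using lq xG y by blast
    have "x * t0 = t0 * x" using x(2) by (simp add: cj_fix_iff)
    hence "x ^ card N * t0 = t0 * x ^ card N" by (rule power_commuting_commutes)
    hence "t0 = 1" using LA[OF t0] x1 by metis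
    hence "t ^ card N = 1" using \<pi>t0 homo_one[OF h SG(1)] by simp
    moreover have "coprime (card N) (2 ^ n)" using odd_cN(1) by simp
    ultimately show ?thesis using pow_coprime_eq_one t(2) by blast
   qed
   show "\<exists>k\<in>H. pact k v = v + v" if "r = 5" "v \<in> \<iota> ` N" for v
   proof -
    obtain n where n: "n \<in> N" "v = \<iota> n" using \<open>v \<in> \<iota> ` N\<close> by blast
    have "coprime 2 r" using pq by simp
    then obtain g where g: "g \<in> G" "cj g n = n ^ 2"
     using rational_power[OF G(4,1,2), of n r 2] n SN(2) N(4) lr \<open>r = 5\<close> by auto
    have "pact (\<pi> g) v = (\<Sum>i<(2::nat). \<iota> n)" using act g n \<iota>p by simp
    thus ?thesis using g(1) n(2) by (auto simp: H_def numeral_2_eq_2)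
   qed
  qed (use sgH aV HV pq(1) qr in auto)
  show False by (rule impossible)
 qed
qed

section \<open>Transport between group records and groups in a type\<close>

definition vert :: "'a::group_mult set \<Rightarrow> nat set" where
 "vert \<Gamma> = {p. prime p \<and> (\<exists>x\<in>\<Gamma>. x \<noteq> 1 \<and> x ^ p = 1)}"

text \<open>For distinct primes this amounts to an element of order \<open>p * q\<close>. Commuting
  pairs are easier to find in direct products and as powers of a lifted element.\<close>

definition linked :: "'a::group_mult set \<Rightarrow> nat \<Rightarrow> nat \<Rightarrow> bool" where
 "linked \<Gamma> p q \<longleftrightarrow> (\<exists>x\<in>\<Gamma>. \<exists>y\<in>\<Gamma>. x \<noteq> 1 \<and> x ^ p = 1 \<and> y \<noteq> 1 \<and> y ^ q = 1 \<and> x * y = y * x)"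

lemma linked_sym: "linked \<Gamma> p q \<longleftrightarrow> linked \<Gamma> q p" unfolding linked_def by metis

text \<open>An injective homomorphism of a group record into a type of class
  \<open>group_mult\<close>, along which the notions of the theorem are translated to its
  image.\<close>

locale iso_model = group G for G (structure) +
 fixes \<phi> :: "'a \<Rightarrow> 'g::group_mult"
 assumes inj: "inj_on \<phi> (carrier G)" and mult: "\<And>x y. x \<in> carrier G ==> y \<in> carrier G ==> \<phi> (x \<otimes> y) = \<phi> x * \<phi> y"
  and fin: "finite (carrier G)"
begin

definition "\<Gamma> = \<phi> ` carrier G"

lemma one: "\<phi> \<one> = 1"
proof -
 have "\<phi> \<one> * \<phi> \<one> = \<phi> \<one> * 1" using mult[of \<one> \<one>] by simp
 thus ?thesis by (simp del: mult_1_right)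
qed

lemma eq_one: "x \<in> carrier G ==> \<phi> x = 1 \<longleftrightarrow> x = \<one>" using inj one by (metis inj_on_eq_iff one_closed)

lemma inverse: "x \<in> carrier G ==> \<phi> (inv x) = inverse (\<phi> x)"
 using mult[of x "inv x"] one by (metis group_inverse_unique inv_closed r_inv)

lemma pow: "x \<in> carrier G ==> \<phi> (x [^] (n::nat)) = \<phi> x ^ n"
 by (induction n) (simp_all add: one mult flip: power_Suc2)

lemma eq_iff: "x \<in> carrier G ==> y \<in> carrier G ==> \<phi> x = \<phi> y \<longleftrightarrow> x = y" using inj by (simp add: inj_on_eq_iff)

lemma pow_one: "x \<in> carrier G ==> \<phi> x ^ n = 1 \<longleftrightarrow> ord x dvd n"
 using pow_eq_id[of x n] eq_one[of "x [^] n"] pow by simp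

lemma sub: "subgroup A G ==> subgrp (\<phi> ` A)"
 unfolding subgrp_def
proof (intro conjI ballI)
 assume A: "subgroup A G"
 note SA = subgroup.subset[OF A]
 show "1 \<in> \<phi> ` A" using one subgroup.one_closed[OF A] by (metis imageI)
 show "a * b \<in> \<phi> ` A" if ab: "a \<in> \<phi> ` A" "b \<in> \<phi> ` A" for a b
 proof -
  obtain x y where "x \<in> A" "y \<in> A" "a = \<phi> x" "b = \<phi> y" using ab by blast
  thus ?thesis using mult[of x y] subgroup.m_closed[OF A] SA by (metis imageI subsetD)
 qed
 show "inverse a \<in> \<phi> ` A" if a: "a \<in> \<phi> ` A" for a
 proof -
  obtain x where "x \<in> A" "a = \<phi> x" using a by blast
  thus ?thesis using inverse[of x] subgroup.m_inv_closed[OF A] SA by (metis imageI subsetD)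
 qed
qed

lemma G_subgrp: "subgrp \<Gamma>" "finite \<Gamma>" using sub[OF subgroup_self] fin by (auto simp: \<Gamma>_def)

lemma conjugate: assumes "x \<in> carrier G" "y \<in> carrier G"
 shows "conjugate_in G x y \<longleftrightarrow> (\<exists>g\<in>\<Gamma>. cj g (\<phi> x) = \<phi> y)"
proof -
 have "y = g \<otimes> x \<otimes> inv g \<longleftrightarrow> cj (\<phi> g) (\<phi> x) = \<phi> y" if "g \<in> carrier G" for g
  using eq_iff[OF assms(2), of "g \<otimes> x \<otimes> inv g"] that assms by (auto simp: cj_def mult inverse)
 thus ?thesis by (auto simp: conjugate_in_def \<Gamma>_def)
qed

lemma rational_iff: "finite_rational_group G \<longleftrightarrow> rational \<Gamma>"
proof
 assume G: "finite_rational_group G"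
 show "rational \<Gamma>" unfolding rational_def
 proof (intro ballI allI impI)
  fix x k m assume x: "x \<in> \<Gamma>" "(x ^ k) ^ m = x"
  obtain g where g: "g \<in> carrier G" "x = \<phi> g" using x(1) by (auto simp: \<Gamma>_def)
  have "g = (g [^] k) [^] m" using x(2) eq_iff[OF g(1), of "(g [^] k) [^] m"] g by (simp add: pow)
  have "generate G {g [^] k} = generate G {g}"
  proof
   show "generate G {g [^] k} \<subseteq> generate G {g}"
    using generate_pow_on_finite_carrier[OF fin g(1)] g(1)
    by (intro generate_subgroup_incl generate_is_subgroup) auto
   have "g \<in> generate G {g [^] k}"
    using generate_pow_on_finite_carrier[OF fin, of "g [^] k"] g(1) \<open>g = (g [^] k) [^] m\<close> by auto
   thus "generate G {g} \<subseteq> generate G {g [^] k}"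
    using g(1) by (intro generate_subgroup_incl generate_is_subgroup) auto
  qed
  hence "conjugate_in G g (g [^] k)" using G g(1) by (simp add: finite_rational_group_def)
  thus "\<exists>h\<in>\<Gamma>. cj h x = x ^ k" using conjugate[of g "g [^] k"] g by (simp add: pow)
 qed
next
 assume r: "rational \<Gamma>"
 show "finite_rational_group G" unfolding finite_rational_group_def
 proof (intro conjI ballI impI)
  fix g h assume g: "g \<in> carrier G" and h: "h \<in> carrier G" and e: "generate G {h} = generate G {g}"
  have "h \<in> generate G {g}" "g \<in> generate G {h}" using e generate.incl[of h "{h}" G] generate.incl[of g "{g}" G] by auto
  then obtain k m :: nat where km: "h = g [^] k" "g = h [^] m"
   using generate_pow_on_finite_carrier[OF fin g] generate_pow_on_finite_carrier[OF fin h] by auto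
  hence "(\<phi> g ^ k) ^ m = \<phi> g" using pow g by (metis nat_pow_closed)
  hence "\<exists>x\<in>\<Gamma>. cj x (\<phi> g) = \<phi> g ^ k" using r g unfolding rational_def \<Gamma>_def by blast
  thus "conjugate_in G g h" using conjugate[OF g h] km(1) pow[OF g] by simp
 qed (use fin is_group in auto)
qed

lemma derived_image: assumes A: "subgroup A G" shows "\<phi> ` derived G A = der (\<phi> ` A)"
proof
 note SA = subgroup.subset[OF A]
 have dA: "subgroup (derived G A) G" by (rule derived_is_subgroup[OF SA])
 have c: "\<phi> (x \<otimes> y \<otimes> inv x \<otimes> inv y) = cmt (\<phi> x) (\<phi> y)" if "x \<in> A" "y \<in> A" for x y
  using that SA by (auto simp: cmt_def mult inverse subset_iff)
 show "der (\<phi> ` A) \<subseteq> \<phi> ` derived G A"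
 proof (rule der_least[OF sub[OF dA]])
  fix a b assume "a \<in> \<phi> ` A" "b \<in> \<phi> ` A"
  then obtain x y where xy: "x \<in> A" "y \<in> A" "a = \<phi> x" "b = \<phi> y" by blast
  have "x \<otimes> y \<otimes> inv x \<otimes> inv y \<in> derived G A" unfolding derived_def by (rule generate.incl) (use xy in blast)
  thus "cmt a b \<in> \<phi> ` derived G A" using c[OF xy(1,2)] xy by (metis imageI)
 qed
 define B where "B = {x \<in> carrier G. \<phi> x \<in> der (\<phi> ` A)}"
 note S = subgrpD[OF der_subgrp[of "\<phi> ` A"]]
 have sB: "subgroup B G" by (rule subgroupI) (use one S in \<open>auto simp: B_def inverse mult\<close>)
 have dB: "derived_set G A \<subseteq> B"
 proof clarify
  fix x y assume xy: "x \<in> A" "y \<in> A"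
  hence "\<phi> (x \<otimes> y \<otimes> inv x \<otimes> inv y) \<in> der (\<phi> ` A)" using c[OF xy] cmt_der[of "\<phi> x" "\<phi> ` A" "\<phi> y"] by simp
  moreover have "x \<in> carrier G" "y \<in> carrier G" using xy SA by blast+
  ultimately show "x \<otimes> y \<otimes> inv x \<otimes> inv y \<in> B"
   unfolding B_def by (intro CollectI conjI m_closed inv_closed)
 qed
 have "derived G A \<subseteq> B" unfolding derived_def by (rule generate_subgroup_incl[OF dB sB])
 thus "\<phi> ` derived G A \<subseteq> der (\<phi> ` A)" by (auto simp: B_def)
qed

lemma solvable_iff: "solvable G \<longleftrightarrow> solv \<Gamma>"
proof -
 have d: "\<phi> ` (derived G ^^ n) (carrier G) = (der ^^ n) \<Gamma>" for n
  by (induction n) (simp_all add: \<Gamma>_def derived_image exp_of_derived_is_subgroup subgroup_self)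
 have i: "(derived G ^^ n) (carrier G) = {\<one>} \<longleftrightarrow> (der ^^ n) \<Gamma> \<subseteq> {1}" for n
 proof
  assume "(der ^^ n) \<Gamma> \<subseteq> {1}"
  moreover have s: "subgroup ((derived G ^^ n) (carrier G)) G" by (rule exp_of_derived_is_subgroup[OF subgroup_self])
  ultimately have "x = \<one>" if "x \<in> (derived G ^^ n) (carrier G)" for x
   using d[of n] eq_one[of x] subgroup.subset[OF s] that by blast
  thus "(derived G ^^ n) (carrier G) = {\<one>}" using subgroup.one_closed[OF s] by blast
 qed (use d[of n] one in auto)
 thus ?thesis unfolding solvable_iff_trivial_derived_seq solv_def by simp
qed

lemma vertices: "gk_vertices G = vert \<Gamma>"
proof -
 have "(\<exists>x\<in>carrier G. ord x = p) \<longleftrightarrow> (\<exists>x\<in>carrier G. \<phi> x \<noteq> 1 \<and> \<phi> x ^ p = 1)" if p: "prime p" for p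
 proof (intro bex_cong refl)
  fix x assume x: "x \<in> carrier G"
  have "ord x = 1 \<longleftrightarrow> \<phi> x = 1" using ord_eq_1[OF x] eq_one[OF x] by simp
  thus "ord x = p \<longleftrightarrow> \<phi> x \<noteq> 1 \<and> \<phi> x ^ p = 1"
   using pow_one[OF x, of p] p by (metis dvd_refl not_prime_1 prime_nat_iff)
 qed
 thus ?thesis by (auto simp: gk_vertices_def vert_def \<Gamma>_def)
qed

lemma edge_iff:
 assumes "prime p" "prime q" "p \<noteq> q" shows "(\<exists>x\<in>carrier G. ord x = p * q) \<longleftrightarrow> linked \<Gamma> p q"
proof
 assume "\<exists>x\<in>carrier G. ord x = p * q"
 then obtain x where x: "x \<in> carrier G" "ord x = p * q" by blast
 have "\<phi> x ^ q \<noteq> 1" "\<phi> x ^ p \<noteq> 1"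
  using pow_one[OF x(1)] x(2) assms by (metis dvd_mult_left dvd_mult_right primes_dvd_imp_eq)+
 moreover have "(\<phi> x ^ q) ^ p = 1" "(\<phi> x ^ p) ^ q = 1"
  using pow_one[OF x(1)] x(2) by (simp_all add: mult.commute flip: power_mult)
 moreover have "\<phi> x ^ q * \<phi> x ^ p = \<phi> x ^ p * \<phi> x ^ q" by (simp add: add.commute flip: power_add)
 moreover have "\<phi> x ^ q \<in> \<Gamma>" "\<phi> x ^ p \<in> \<Gamma>" using x(1) subgrpD(6)[OF G_subgrp(1)] by (auto simp: \<Gamma>_def)
 ultimately show "linked \<Gamma> p q" unfolding linked_def by blast
next
 assume "linked \<Gamma> p q"
 then obtain a b where ab: "a \<in> carrier G" "b \<in> carrier G" "\<phi> a \<noteq> 1" "\<phi> a ^ p = 1" "\<phi> b \<noteq> 1" "\<phi> b ^ q = 1"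
   "\<phi> a * \<phi> b = \<phi> b * \<phi> a" by (auto simp: linked_def \<Gamma>_def)
 have ap: "\<phi> (a \<otimes> b) ^ n = \<phi> a ^ n * \<phi> b ^ n" for n
  unfolding mult[OF ab(1,2)] by (rule pow_mult_commuting[OF ab(7)])
 have cl: "a \<otimes> b \<in> carrier G" using ab by simp
 have cpq: "coprime p q" using assms primes_coprime by blast
 have "ord (a \<otimes> b) dvd p * q"
 proof -
  have "\<phi> a ^ (p * q) = 1" "\<phi> b ^ (p * q) = 1" using ab(4,6) by (metis power_mult power_one mult.commute)+
  thus ?thesis using pow_one[OF cl, of "p * q"] ap by simp
 qed
 moreover have "p * q dvd ord (a \<otimes> b)"
 proof -
  let ?n = "ord (a \<otimes> b)"
  have "\<phi> a ^ ?n * \<phi> b ^ ?n = 1" using pow_one[OF cl, of ?n] ap by simp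
  hence n: "\<phi> a ^ (?n * l) * \<phi> b ^ (?n * l) = 1" for l using ap[of "?n * l"] pow_one[OF cl, of "?n * l"] by simp
  have b1: "\<phi> b ^ (?n * q) = 1" "\<phi> a ^ (?n * p) = 1" using ab(4,6) by (metis power_mult power_one mult.commute)+
  have "\<phi> a ^ (?n * q) = 1" "\<phi> b ^ (?n * p) = 1" using n[of q] n[of p] b1 by auto
  hence "p dvd ?n * q" "q dvd ?n * p"
   using ab(3-6) assms(1,2) pow_coprime_eq_one prime_imp_coprime coprime_commute by metis+
  hence "p dvd ?n" "q dvd ?n" using cpq by (auto simp: coprime_dvd_mult_left_iff coprime_commute)
  thus ?thesis using cpq by (simp add: divides_mult)
 qed
 ultimately have "ord (a \<otimes> b) = p * q" by (rule dvd_antisym)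
 thus "\<exists>x\<in>carrier G. ord x = p * q" using cl by blast
qed

lemma graph: "gk_graph G = (vert \<Gamma>, {{p, q} | p q. p \<in> vert \<Gamma> \<and> q \<in> vert \<Gamma> \<and> p \<noteq> q \<and> linked \<Gamma> p q})"
proof -
 have "p \<in> vert \<Gamma> \<and> q \<in> vert \<Gamma> \<and> p \<noteq> q \<and> (\<exists>x\<in>carrier G. ord x = p * q) \<longleftrightarrow>
   p \<in> vert \<Gamma> \<and> q \<in> vert \<Gamma> \<and> p \<noteq> q \<and> linked \<Gamma> p q" for p q
  using edge_iff[of p q] by (auto simp: vert_def)
 thus ?thesis unfolding gk_graph_def gk_edges_def vertices by simp
qed

end

lemma vert_iff: assumes "subgrp \<Gamma>" "finite \<Gamma>" shows "vert \<Gamma> = {p. prime p \<and> p dvd card \<Gamma>}"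
 using cauchy[OF assms] prime_dvd_card[OF assms] by (auto simp: vert_def)

lemma cayley:
 assumes "group G" "finite (carrier G)"
 shows "\<exists>\<phi> :: 'a \<Rightarrow> 'a perm. iso_model (G :: ('a, 'b) monoid_scheme) \<phi>"
proof -
 interpret group G by fact
 define tr where "tr x a = (if a \<in> carrier G then x \<otimes>\<^bsub>G\<^esub> a else a)" for x a
 have trm: "tr (x \<otimes>\<^bsub>G\<^esub> y) a = tr x (tr y a)" if "x \<in> carrier G" "y \<in> carrier G" for x y a
  using that by (simp add: tr_def m_assoc)
 have p: "bij (tr x) \<and> finite {a. tr x a \<noteq> a}" if x: "x \<in> carrier G" for x
 proof
  have "tr (inv\<^bsub>G\<^esub> x) (tr x a) = a" "tr x (tr (inv\<^bsub>G\<^esub> x) a) = a" for a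
   using x by (simp_all add: tr_def flip: m_assoc)
  thus "bij (tr x)" by (intro bij_betw_byWitness[where f' = "tr (inv\<^bsub>G\<^esub> x)"]) auto
  show "finite {a. tr x a \<noteq> a}" by (rule finite_subset[OF _ assms(2)]) (auto simp: tr_def)
 qed
 have ap: "Perm.apply (Perm (tr x)) = tr x" if "x \<in> carrier G" for x
  by (rule Perm_inverse) (use p[OF that] in simp)
 have "iso_model G (\<lambda>x. Perm (tr x))"
 proof
  show "inj_on (\<lambda>x. Perm (tr x)) (carrier G)"
  proof (rule inj_onI)
   fix x y assume xy: "x \<in> carrier G" "y \<in> carrier G" "Perm (tr x) = Perm (tr y)"
   hence "tr x \<one>\<^bsub>G\<^esub> = tr y \<one>\<^bsub>G\<^esub>" using ap by metis
   thus "x = y" using xy by (simp add: tr_def)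
  qed
  show "Perm (tr (x \<otimes>\<^bsub>G\<^esub> y)) = Perm (tr x) * Perm (tr y)" if "x \<in> carrier G" "y \<in> carrier G" for x y
   by (rule perm_eqI) (simp add: ap that apply_times trm)
 qed (rule assms(2))
 thus ?thesis by blast
qed

section \<open>The possible graphs\<close>

text \<open>The quotient is realised by left multiplication on the cosets of \<open>M\<close>, whose
  kernel is \<open>M\<close> by normality.\<close>

lemma quotient_hom:
 fixes G :: "'a::group_mult set"
 assumes G: "subgrp G" "finite G" and M: "normal_in M G"
 shows "\<exists>\<rho> :: 'a \<Rightarrow> 'a set perm. homo G \<rho> \<and> (\<forall>g\<in>G. \<rho> g = 1 \<longleftrightarrow> g \<in> M)"
proof -
 note S = subgrpD[OF G(1)]
 have SM: "subgrp M" using M by (simp add: normal_in_def)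
 note SMD = subgrpD[OF SM]
 define \<C> where "\<C> = (\<lambda>x. (*) x ` M) ` G"
 define tr where "tr g A = (if A \<in> \<C> then (*) g ` A else A)" for g A
 have tC: "(*) g ` A \<in> \<C>" if "g \<in> G" "A \<in> \<C>" for g A
  using that S(2) by (auto simp: \<C>_def image_image mult.assoc[symmetric])
 have trm: "tr (g * h) A = tr g (tr h A)" if "g \<in> G" "h \<in> G" for g h A
  using tC[OF that(2), of A] by (auto simp: tr_def image_image mult.assoc)
 have tr1: "tr 1 A = A" for A by (simp add: tr_def)
 have p: "bij (tr g) \<and> finite {A. tr g A \<noteq> A}" if g: "g \<in> G" for g
 proof
  have "tr (inverse g) (tr g A) = A" "tr g (tr (inverse g) A) = A" for A
   using trm[of "inverse g" g A] trm[of g "inverse g" A] g S(3) tr1 by auto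
  thus "bij (tr g)" by (intro bij_betw_byWitness[where f' = "tr (inverse g)"]) auto
  show "finite {A. tr g A \<noteq> A}"
   by (rule finite_subset[of _ \<C>]) (use G(2) in \<open>auto simp: tr_def \<C>_def\<close>)
 qed
 have ap: "Perm.apply (Perm (tr g)) = tr g" if "g \<in> G" for g
  by (rule Perm_inverse) (use p[OF that] in simp)
 have "homo G (\<lambda>g. Perm (tr g))"
  unfolding homo_def by (intro ballI perm_eqI) (simp add: ap S(2) apply_times trm)
 moreover have "Perm (tr g) = 1 \<longleftrightarrow> g \<in> M" if g: "g \<in> G" for g
 proof
  assume "Perm (tr g) = 1"
  hence "tr g M = Perm.apply 1 M" using ap[OF g] by simp
  hence "tr g M = M" by simp
  moreover have "M \<in> \<C>" using S(1) by (force simp: \<C>_def)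
  ultimately have "g * 1 \<in> M" using SMD(1) by (metis imageI tr_def)
  thus "g \<in> M" by simp
 next
  assume gM: "g \<in> M"
  have "(*) g ` A = A" if A: "A \<in> \<C>" for A
  proof -
   obtain x where x: "x \<in> G" "A = (*) x ` M" using A by (auto simp: \<C>_def)
   have c: "cj (inverse x) h \<in> M" if "h \<in> M" for h using M S(3)[OF x(1)] that by (simp add: normal_in_def)
   have "h * (x * m) \<in> A" if "h \<in> M" "m \<in> M" for h m
   proof -
    have "h * (x * m) = x * (cj (inverse x) h * m)" by (simp add: cj_def group_norm)
    thus ?thesis using x(2) c that SMD(2) by blast
   qed
   hence h: "h * a \<in> A" if "h \<in> M" "a \<in> A" for h a using x(2) that by blast
   show ?thesis
   proof
    show "(*) g ` A \<subseteq> A" using h gM by blast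
    show "A \<subseteq> (*) g ` A"
    proof
     fix a assume "a \<in> A"
     hence "a = g * (inverse g * a)" "inverse g * a \<in> A" using h SMD(3)[OF gM] by (simp_all add: group_norm)
     thus "a \<in> (*) g ` A" by (rule image_eqI)
    qed
   qed
  qed
  thus "Perm (tr g) = 1" by (intro perm_eqI) (simp add: ap[OF g] tr_def)
 qed
 ultimately show ?thesis by blast
qed

text \<open>The kernel is a maximal normal \<open>M\<close> whose index satisfies \<open>P\<close>;
  a nontrivial normal subgroup of the quotient pulls back to a larger one.\<close>

lemma minimal_quotient:
 fixes G :: "'a::group_mult set" and P :: "nat \<Rightarrow> bool"
 assumes G: "subgrp G" "finite G" and P: "P (card G)"
 shows "\<exists>\<rho> :: 'a \<Rightarrow> 'a set perm. homo G \<rho> \<and> P (card (\<rho> ` G)) \<and>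
  (\<forall>N. normal_in N (\<rho> ` G) \<longrightarrow> N \<noteq> {1} \<longrightarrow> \<not> P (card (\<rho> ` G) div card N))"
proof -
 note S = subgrpD[OF G(1)]
 define \<M> where "\<M> = {M. normal_in M G \<and> P (card G div card M)}"
 have "finite \<M>" by (rule finite_subset[of _ "Pow G"]) (use G(2) in \<open>auto simp: normal_in_def \<M>_def\<close>)
 moreover have "{1} \<in> \<M>" using P subgrp_trivial S(1) by (auto simp: \<M>_def normal_in_def)
 ultimately obtain M where M0: "M \<in> \<M>" "\<forall>M'\<in>\<M>. M \<subseteq> M' \<longrightarrow> M = M'"
  using finite_has_maximal[of \<M>] by blast
 have M: "normal_in M G" "P (card G div card M)" using M0(1) by (auto simp: \<M>_def)
 have MG: "M \<subseteq> G" "subgrp M" using M by (auto simp: normal_in_def)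
 have finM: "finite M" using MG G(2) finite_subset by blast
 obtain \<rho> :: "'a \<Rightarrow> 'a set perm" where \<rho>: "homo G \<rho>" "\<forall>g\<in>G. \<rho> g = 1 \<longleftrightarrow> g \<in> M"
  using quotient_hom[OF G M(1)] by blast
 note hp = homo_props[OF \<rho>(1) G(1)]
 have M0': "card M > 0" by (rule card_subgrp_pos[OF MG(2) finM])
 have kM: "{g \<in> G. \<rho> g = 1} = M" using \<rho>(2) MG by blast
 have cG: "card G = card (\<rho> ` G) * card M" using homo_card[OF \<rho>(1) G] kM by simp
 hence c: "card G div card M = card (\<rho> ` G)" using M0' by simp
 have "\<not> P (card (\<rho> ` G) div card N)" if N: "normal_in N (\<rho> ` G)" "N \<noteq> {1}" for N
 proof
  assume PN: "P (card (\<rho> ` G) div card N)"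
  have SN: "subgrp N" "N \<subseteq> \<rho> ` G" using N by (auto simp: normal_in_def)
  note SND = subgrpD[OF SN(1)]
  define M' where "M' = {g \<in> G. \<rho> g \<in> N}"
  have SM': "subgrp M'" unfolding subgrp_def M'_def
   using S SND \<rho>(1)[unfolded homo_def] hp(1) homo_one[OF \<rho>(1) S(1)] by auto
  have "normal_in M' G" using SM' N(1) hp(3) S(4) by (auto simp: normal_in_def M'_def)
  moreover have "card G div card M' = card (\<rho> ` G) div card N"
  proof -
   have "\<rho> ` M' = N" using SN(2) by (auto simp: M'_def)
   moreover have "{g \<in> M'. \<rho> g = 1} = M" using kM SND(1) MG \<rho>(2) by (auto simp: M'_def)
   moreover have "card M' = card (\<rho> ` M') * card {g \<in> M'. \<rho> g = 1}"
    by (rule homo_card[OF homo_subset[OF \<rho>(1)] SM']) (use G(2) in \<open>auto simp: M'_def\<close>)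
   ultimately have "card M' = card N * card M" by simp
   thus ?thesis using cG M0' by simp
  qed
  ultimately have "M' \<in> \<M>" using PN by (simp add: \<M>_def)
  moreover have "M \<subseteq> M'"
  proof
   fix x assume x: "x \<in> M"
   hence "\<rho> x = 1" using MG(1) \<rho>(2) by blast
   thus "x \<in> M'" using x MG(1) SND(1) by (auto simp: M'_def)
  qed
  ultimately have "M' = M" using M0(2) by blast
  hence "x = 1" if "x \<in> N" for x
  proof -
   obtain g where "g \<in> G" "x = \<rho> g" using SN(2) \<open>x \<in> N\<close> by blast
   thus ?thesis using \<open>M' = M\<close> \<rho>(2) \<open>x \<in> N\<close> by (auto simp: M'_def)
  qed
  thus False using N(2) SND(1) by blast
 qed
 thus ?thesis using \<rho>(1) c M(2) by metis
qed

theorem prime_restriction: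
 fixes G :: "'a::group_mult set"
 assumes G: "subgrp G" "finite G" "solv G" "rational G" and p: "prime p" "p dvd card G"
 shows "p = 2 \<or> p = 3 \<or> p = 5"
proof (rule ccontr)
 assume n: "\<not> ?thesis"
 have "\<not> prime (2 * 2 :: nat)" "\<not> prime (2 * 3 :: nat)" using prime_product[of 2 2] prime_product[of 2 3] by auto
 hence "p \<noteq> 4" "p \<noteq> 6" using p(1) by auto
 hence p7: "p \<ge> 7" using n prime_ge_2_nat[OF p(1)] by linarith
 obtain \<rho> :: "'a \<Rightarrow> 'a set perm" where \<rho>: "homo G \<rho>" "p dvd card (\<rho> ` G)"
   "\<forall>N. normal_in N (\<rho> ` G) \<longrightarrow> N \<noteq> {1} \<longrightarrow> \<not> p dvd card (\<rho> ` G) div card N"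
  using minimal_quotient[OF G(1,2), of "\<lambda>n. p dvd n"] p(2) by blast
 define H where "H = \<rho> ` G"
 have H: "subgrp H" "finite H" "solv H" "rational H"
  using homo_props(5)[OF \<rho>(1) G(1)] G(2) homo_solv[OF \<rho>(1) G(1,3)] homo_rational[OF \<rho>(1) G(1,2,4)]
  by (auto simp: H_def)
 have "H \<noteq> {1}" using \<rho>(2) p7 by (auto simp: H_def)
 then obtain N l where N: "min_normal N H" "\<forall>x\<in>N. \<forall>y\<in>N. x * y = y * x" "prime l" "\<forall>x\<in>N. x ^ l = 1"
  using min_normal_exists[OF H(1-3)] by blast
 have SN: "subgrp N" "N \<subseteq> H" "normal_in N H" "N \<noteq> {1}" using N(1) by (auto simp: min_normal_def normal_in_def)
 have np: "\<not> p dvd card H div card N" using \<rho>(3) SN by (simp add: H_def)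
 have finN: "finite N" using SN(2) H(2) finite_subset by blast
 have "card H = card N * (card H div card N)" using card_subgrp_dvd[OF H(1) SN(1,2) H(2)] by simp
 hence "p dvd card N" using np \<rho>(2) p(1) unfolding H_def by (metis prime_dvd_mult_iff)
 then obtain x where x: "x \<in> N" "x \<noteq> 1" "x ^ p = 1" using cauchy[OF SN(1) finN p(1)] by blast
 have "p = l" using x N(4) pow_coprime_eq_one primes_coprime[OF p(1) N(3)] by blast
 thus False using no_large_prime[OF H N(1) _ p(1) p7 _ np] N(2,4) by blast
qed

text \<open>An element of order \<open>2 q\<close> in a minimal quotient lifts to some
  \<open>g\<close> whose order is divisible by \<open>2 q\<close>, and suitable powers of
  \<open>g\<close> give the commuting pair.\<close>

theorem edges_exist:
 fixes G :: "'a::group_mult set"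
 assumes G: "subgrp G" "finite G" "solv G" "rational G" and d: "3 dvd card G" "5 dvd card G"
  and q: "q = 3 \<or> q = 5"
 shows "linked G 2 q"
proof -
 obtain \<rho> :: "'a \<Rightarrow> 'a set perm" where \<rho>: "homo G \<rho>" "3 dvd card (\<rho> ` G) \<and> 5 dvd card (\<rho> ` G)"
   "\<forall>N. normal_in N (\<rho> ` G) \<longrightarrow> N \<noteq> {1} \<longrightarrow> \<not> (3 dvd card (\<rho> ` G) div card N \<and> 5 dvd card (\<rho> ` G) div card N)"
  using minimal_quotient[OF G(1,2), of "\<lambda>n. 3 dvd n \<and> 5 dvd n"] d by blast
 note hp = homo_props[OF \<rho>(1) G(1)]
 define H where "H = \<rho> ` G"
 have H: "subgrp H" "finite H" "solv H" "rational H"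
  using hp(5) G(2) homo_solv[OF \<rho>(1) G(1,3)] homo_rational[OF \<rho>(1) G(1,2,4)] by (auto simp: H_def)
 have "\<exists>t\<in>H. \<exists>y\<in>H. t \<noteq> 1 \<and> t * t = 1 \<and> y \<noteq> 1 \<and> y ^ q = 1 \<and> t * y = y * t"
  by (rule edge_core[OF H]) (use prime_restriction[OF H] \<rho> q in \<open>auto simp: H_def\<close>)
 then obtain t y where ty: "t \<in> H" "y \<in> H" "t \<noteq> 1" "t * t = 1" "y \<noteq> 1" "y ^ q = 1" "t * y = y * t" by blast
 have pq: "prime q" "odd q" using q by auto
 obtain g where g: "g \<in> G" "\<rho> g = t * y" using ty(1,2) subgrpD(2)[OF H(1)] by (metis H_def imageE)
 have gp: "\<rho> (g ^ n) = t ^ n * y ^ n" for n using hp(2)[OF g(1)] g(2) pow_mult_commuting[OF ty(7)] by simp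
 have o: "\<rho> 1 = 1" using homo_one[OF \<rho>(1) subgrpD(1)[OF G(1)]] .
 have t2: "t ^ 2 = 1" using ty(4) by (simp add: power2_eq_square)
 have part: "\<exists>m. g ^ m \<noteq> 1 \<and> (g ^ m) ^ s = 1" if s: "prime s" "\<And>c. \<not> s dvd c ==> g ^ c \<noteq> 1" for s
 proof -
  obtain c m where c: "\<not> s dvd c" "(g ^ c) ^ (s ^ m) = 1" using prime_part[OF G(1,2) g(1) s(1)] by blast
  obtain j where "(g ^ c) ^ (s ^ j) \<noteq> 1" "((g ^ c) ^ (s ^ j)) ^ s = 1"
   using exists_prime_power_step[OF s(2)[OF c(1)] c(2)] by blast
  thus ?thesis by (metis power_mult)
 qed
 obtain a where a: "g ^ a \<noteq> 1" "(g ^ a) ^ 2 = 1"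
 proof -
  have "g ^ c \<noteq> 1" if "\<not> 2 dvd c" for c
  proof
   assume "g ^ c = 1"
   hence "t ^ (c * q) * y ^ (c * q) = 1" using gp[of "c * q"] o by (simp add: power_mult)
   moreover have "y ^ (c * q) = 1" using ty(6) by (metis mult.commute power_mult power_one)
   ultimately have "t ^ (c * q) = 1" by simp
   moreover have "coprime (c * q) 2" using that pq(2) by simp
   ultimately show False using pow_coprime_eq_one t2 ty(3) by blast
  qed
  thus ?thesis using part[of 2] that by auto
 qed
 obtain b where b: "g ^ b \<noteq> 1" "(g ^ b) ^ q = 1"
 proof -
  have "g ^ c \<noteq> 1" if "\<not> q dvd c" for c
  proof
   assume "g ^ c = 1"
   hence "t ^ (c * 2) * y ^ (c * 2) = 1" using gp[of "c * 2"] o by (simp add: power_mult)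
   moreover have "t ^ (c * 2) = 1" using t2 by (metis mult.commute power_mult power_one)
   ultimately have "y ^ (c * 2) = 1" by simp
   moreover have "coprime (c * 2) q" using that pq by (metis coprime_commute coprime_mult_left_iff coprime_right_2_iff_odd prime_imp_coprime)
   ultimately show False using pow_coprime_eq_one ty(5,6) by blast
  qed
  thus ?thesis using part[OF pq(1)] that by blast
 qed
 have "g ^ a * g ^ b = g ^ b * g ^ a" by (simp add: add.commute flip: power_add)
 thus ?thesis unfolding linked_def using a b g(1) subgrpD(6)[OF G(1)] by blast
qed

theorem graph_classification:
 fixes G :: "('a, 'b) monoid_scheme"
 assumes G: "finite_rational_group G" "solvable G" "\<not> trivial_group G"
 shows "gk_graph G \<in> {graph_a, graph_c, graph_d, graph_e, graph_f, graph_i, graph_k}"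
proof -
 have gf: "group G" "finite (carrier G)" using G(1) by (auto simp: finite_rational_group_def)
 obtain \<phi> :: "'a \<Rightarrow> 'a perm" where "iso_model G \<phi>" using cayley[OF gf] by blast
 then interpret iso_model G \<phi> .
 have H: "subgrp \<Gamma>" "finite \<Gamma>" "solv \<Gamma>" "rational \<Gamma>" using G_subgrp solvable_iff rational_iff G by auto
 have "\<Gamma> \<noteq> {1}"
 proof
  assume "\<Gamma> = {1}"
  hence "carrier G \<subseteq> {\<one>\<^bsub>G\<^esub>}" using eq_one by (auto simp: \<Gamma>_def)
  thus False using G(3) trivial_group_subset by blast
 qed
 hence v2: "2 \<in> vert \<Gamma>" using rational_even[OF H(1,2,4)] vert_iff[OF H(1,2)] by simp
 have vs: "p = 2 \<or> p = 3 \<or> p = 5" if "p \<in> vert \<Gamma>" for p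
  using that prime_restriction[OF H] vert_iff[OF H(1,2)] by auto
 have lk: "linked \<Gamma> 2 3 \<and> linked \<Gamma> 2 5" if "3 \<in> vert \<Gamma>" "5 \<in> vert \<Gamma>"
  using that edges_exist[OF H] vert_iff[OF H(1,2)] by auto
 let ?E = "{{p, q} | p q. p \<in> vert \<Gamma> \<and> q \<in> vert \<Gamma> \<and> p \<noteq> q \<and> linked \<Gamma> p q}"
 have E: "?E = (if 3 \<in> vert \<Gamma> \<and> linked \<Gamma> 2 3 then {{2, 3}} else {}) \<union>
   (if 5 \<in> vert \<Gamma> \<and> linked \<Gamma> 2 5 then {{2, 5}} else {}) \<union>
   (if 3 \<in> vert \<Gamma> \<and> 5 \<in> vert \<Gamma> \<and> linked \<Gamma> 3 5 then {{3, 5}} else {})" (is "_ = ?F")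
 proof
  show "?E \<subseteq> ?F"
  proof
   fix A assume "A \<in> ?E"
   then obtain a b where ab: "A = {a, b}" "a \<in> vert \<Gamma>" "b \<in> vert \<Gamma>" "a \<noteq> b" "linked \<Gamma> a b" by blast
   define p q where "p = min a b" and "q = max a b"
   have pq: "A = {p, q}" "p \<in> vert \<Gamma>" "q \<in> vert \<Gamma>" "p < q" "linked \<Gamma> p q"
   proof -
    have "(p = a \<and> q = b \<and> a < b) \<or> (p = b \<and> q = a \<and> b < a)" using ab(4) by (auto simp: p_def q_def min_def max_def)
    thus "A = {p, q}" "p \<in> vert \<Gamma>" "q \<in> vert \<Gamma>" "p < q" "linked \<Gamma> p q"
     using ab linked_sym[of \<Gamma> a b] by (elim disjE conjE; simp add: insert_commute)+
   qed
   have "p = 2 \<and> q = 3 \<or> p = 2 \<and> q = 5 \<or> p = 3 \<and> q = 5" using vs[OF pq(2)] vs[OF pq(3)] pq(4) by auto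
   thus "A \<in> ?F" using pq by (elim disjE conjE) simp_all
  qed
  have m: "{p, q} \<in> ?E" if "p \<in> vert \<Gamma>" "q \<in> vert \<Gamma>" "p \<noteq> q" "linked \<Gamma> p q" for p q using that by blast
  show "?F \<subseteq> ?E" using m[of 2 3] m[of 2 5] m[of 3 5] v2 by (simp split: if_split)
 qed
 consider "vert \<Gamma> = {2}" | "vert \<Gamma> = {2, 3}" | "vert \<Gamma> = {2, 5}" | "vert \<Gamma> = {2, 3, 5}"
  using v2 vs by (cases "3 \<in> vert \<Gamma>"; cases "5 \<in> vert \<Gamma>") blast+
 thus ?thesis
 proof cases
  case 1 thus ?thesis unfolding graph E by (simp add: graph_a_def)
 next
  case 2 thus ?thesis unfolding graph E by (simp add: graph_c_def graph_d_def)
 next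
  case 3 thus ?thesis unfolding graph E by (simp add: graph_e_def graph_f_def)
 next
  case 4
  hence "linked \<Gamma> 2 3" "linked \<Gamma> 2 5" using lk by auto
  thus ?thesis using 4 unfolding graph E by (auto simp: graph_i_def graph_k_def insert_commute)
 qed
qed

section \<open>Examples\<close>

lemma nat_realisation:
 fixes \<Gamma> :: "'a::group_mult set"
 assumes \<Gamma>: "subgrp \<Gamma>" "finite \<Gamma>" "solv \<Gamma>" "rational \<Gamma>"
 shows "\<exists>H :: nat monoid. finite_rational_group H \<and> solvable H \<and>
  gk_graph H = (vert \<Gamma>, {{p, q} | p q. p \<in> vert \<Gamma> \<and> q \<in> vert \<Gamma> \<and> p \<noteq> q \<and> linked \<Gamma> p q})"
proof -
 note S = subgrpD[OF \<Gamma>(1)]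
 obtain f :: "'a \<Rightarrow> nat" where f: "inj_on f \<Gamma>" using finite_imp_inj_to_nat_seg[OF \<Gamma>(2)] by metis
 define g where "g = inv_into \<Gamma> f"
 have gf: "g (f x) = x" if "x \<in> \<Gamma>" for x using f that by (simp add: g_def)
 define H where "H = \<lparr>carrier = f ` \<Gamma>, monoid.mult = (\<lambda>a b. f (g a * g b)), one = f 1\<rparr>"
 have G: "group H"
 proof (rule groupI)
  show "\<exists>y\<in>carrier H. y \<otimes>\<^bsub>H\<^esub> x = \<one>\<^bsub>H\<^esub>" if x: "x \<in> carrier H" for x
  proof -
   obtain a where "a \<in> \<Gamma>" "x = f a" using x by (auto simp: H_def)
   thus ?thesis using S by (intro bexI[of _ "f (inverse a)"]) (auto simp: H_def gf)
  qed
 qed (use S in \<open>auto simp: H_def gf mult.assoc\<close>)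
 have ig: "inj_on g (f ` \<Gamma>)" unfolding g_def by (rule inj_on_inv_into) simp
 interpret I: iso_model H g
  by (intro iso_model.intro G iso_model_axioms.intro) (use S(2) \<Gamma>(2) ig in \<open>auto simp: H_def gf\<close>)
 have "I.\<Gamma> = \<Gamma>" unfolding I.\<Gamma>_def by (auto simp: H_def gf image_image)
 thus ?thesis using I.rational_iff I.solvable_iff I.graph \<Gamma> by auto
qed

instantiation prod :: (group_mult, group_mult) group_mult
begin
definition "1 = (1, 1)"
definition "x * y = (fst x * fst y, snd x * snd y)"
definition "inverse x = (inverse (fst x), inverse (snd x))"
instance by standard (auto simp: one_prod_def times_prod_def inverse_prod_def mult.assoc)
end

lemma prod_pow: "(a, b) ^ n = (a ^ n, b ^ n)"
 for a :: "'a::group_mult" and b :: "'b::group_mult"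
 by (induction n) (simp_all add: one_prod_def times_prod_def)

lemma prod_cj: "cj (a, b) (c, d) = (cj a c, cj b d)"
 by (simp add: cj_def times_prod_def inverse_prod_def)

lemma product_group:
 assumes A: "subgrp A" "finite A" "rational A" "solv A" and B: "subgrp B" "finite B" "rational B" "solv B"
 shows "subgrp (A \<times> B)" "finite (A \<times> B)" "rational (A \<times> B)" "solv (A \<times> B)" "vert (A \<times> B) = vert A \<union> vert B"
  "p \<in> vert A ==> q \<in> vert B ==> linked (A \<times> B) p q"
proof -
 note SA = subgrpD[OF A(1)] and SB = subgrpD[OF B(1)]
 have sub: "subgrp (X \<times> Y)" if "subgrp X" "subgrp Y" for X :: "'a set" and Y :: "'b set"
  using subgrpD(1-3)[OF that(1)] subgrpD(1-3)[OF that(2)]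
  by (auto simp: subgrp_def one_prod_def times_prod_def inverse_prod_def)
 show "subgrp (A \<times> B)" "finite (A \<times> B)" using sub A B by auto
 show "rational (A \<times> B)" unfolding rational_def
 proof (intro ballI allI impI)
  fix x k m assume x: "x \<in> A \<times> B" "(x ^ k) ^ m = x"
  obtain a b where ab: "x = (a, b)" "a \<in> A" "b \<in> B" using x(1) by blast
  have "(a ^ k) ^ m = a" "(b ^ k) ^ m = b" using x(2) by (simp_all add: ab prod_pow)
  then obtain g h where "g \<in> A" "cj g a = a ^ k" "h \<in> B" "cj h b = b ^ k"
   using A(3) B(3) ab unfolding rational_def by metis
  thus "\<exists>g\<in>A \<times> B. cj g x = x ^ k" by (intro bexI[of _ "(g, h)"]) (auto simp: ab prod_cj prod_pow)
 qed
 have dp: "der (X \<times> Y) \<subseteq> der X \<times> der Y" for X :: "'a set" and Y :: "'b set"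
  by (rule der_least[OF sub[OF der_subgrp der_subgrp]])
   (auto simp: cmt_def times_prod_def inverse_prod_def intro: cmt_der[unfolded cmt_def])
 have dn: "(der ^^ n) (A \<times> B) \<subseteq> (der ^^ n) A \<times> (der ^^ n) B" for n
 proof (induction n)
  case (Suc n)
  hence "der ((der ^^ n) (A \<times> B)) \<subseteq> der ((der ^^ n) A \<times> (der ^^ n) B)" by (rule der_mono)
  thus ?case using dp by fastforce
 qed simp
 have d1: "(der ^^ n) X \<subseteq> {1} ==> (der ^^ (m + n)) X \<subseteq> {1}" for n m and X :: "'c::group_mult set"
 proof (induction m)
  case (Suc m)
  hence "der ((der ^^ (m + n)) X) \<subseteq> der {1}" by (intro der_mono) simp
  also have "\<dots> \<subseteq> {1}" by (rule der_least[OF subgrp_trivial]) (simp add: cmt_def)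
  finally show ?case by simp
 qed simp
 obtain m n where "(der ^^ m) A \<subseteq> {1}" "(der ^^ n) B \<subseteq> {1}" using A(4) B(4) by (auto simp: solv_def)
 hence "(der ^^ (n + m)) A \<subseteq> {1}" "(der ^^ (m + n)) B \<subseteq> {1}" using d1 by blast+
 hence "(der ^^ (m + n)) (A \<times> B) \<subseteq> {1}" using dn[of "m + n"] by (auto simp: one_prod_def add.commute)
 thus "solv (A \<times> B)" by (auto simp: solv_def)
 show "vert (A \<times> B) = vert A \<union> vert B"
 proof -
  have "(\<exists>x\<in>A \<times> B. x \<noteq> 1 \<and> x ^ p = 1) \<longleftrightarrow> (\<exists>x\<in>A. x \<noteq> 1 \<and> x ^ p = 1) \<or> (\<exists>x\<in>B. x \<noteq> 1 \<and> x ^ p = 1)" for p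
   using SA(1) SB(1) by (auto simp: one_prod_def prod_pow intro: power_one)
  thus ?thesis by (auto simp: vert_def)
 qed
 show "linked (A \<times> B) p q" if pq: "p \<in> vert A" "q \<in> vert B"
 proof -
  obtain a b where "a \<in> A" "a \<noteq> 1" "a ^ p = 1" "b \<in> B" "b \<noteq> 1" "b ^ q = 1" using pq by (auto simp: vert_def)
  thus ?thesis unfolding linked_def using SA(1) SB(1)
   by (intro bexI[of _ "(a, 1)"] bexI[of _ "(1, b)"]) (auto simp: one_prod_def prod_pow times_prod_def)
 qed
qed

text \<open>In exponent 4 the generators of a cyclic subgroup are just an element and its
  inverse.\<close>

lemma rational_exponent_four:
 assumes "\<And>x. x \<in> Q ==> x ^ 4 = 1" "\<And>x. x \<in> Q ==> x * x = 1 \<or> (\<exists>g\<in>Q. cj g x = inverse x)" "1 \<in> Q"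
 shows "rational (Q :: 'a::group_mult set)"
 unfolding rational_def
proof (intro ballI allI impI)
 fix x k m assume x: "x \<in> Q" "(x ^ k) ^ m = x"
 have x4: "x ^ 4 = 1" using assms(1) x(1) .
 have xk: "x ^ k = x ^ (k mod 4)" by (rule power_cong_card[OF x4]) (simp add: cong_def)
 have x3: "x ^ 3 = inverse x"
 proof -
  have "x * x ^ 3 = 1" using x4 by (simp add: eval_nat_numeral)
  thus ?thesis by (metis group_inverse_unique)
 qed
 have "even k \<or> k mod 4 = 1 \<or> k mod 4 = 3" by presburger
 then consider "even k" | "k mod 4 = 1" | "k mod 4 = 3" by blast
 thus "\<exists>g\<in>Q. cj g x = x ^ k"
 proof cases
  case 1
  then obtain l where l: "k = 2 * l" by (auto elim: evenE)
  have "x ^ 2 = x ^ (4 * (l * m))" using arg_cong[OF x(2), of "\<lambda>u. u ^ 2"] by (simp add: l mult_ac flip: power_mult)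
  also have "\<dots> = 1" by (simp add: power_mult x4)
  finally have "x ^ k = 1" by (simp add: l power_mult)
  thus ?thesis using x assms(3) by (intro bexI[of _ 1]) auto
 next
  case 2
  thus ?thesis using xk assms(3) by (intro bexI[of _ 1]) auto
 next
  case 3
  hence "x ^ k = inverse x" using xk x3 by simp
  moreover have "inverse x = x" if "x * x = 1" using that by (rule group_inverse_unique)
  ultimately show ?thesis using assms(2)[OF x(1)] assms(3) by (metis cj_one(2))
 qed
qed

lemma solv_chain:
 assumes "solv B" "der A \<subseteq> B" shows "solv A"
proof -
 obtain n where "(der ^^ n) B \<subseteq> {1}" using assms(1) by (auto simp: solv_def)
 hence "(der ^^ n) (der A) \<subseteq> {1}" using der_pow_mono[OF assms(2)] by blast
 thus ?thesis unfolding solv_def by (intro exI[of _ "Suc n"]) (simp add: funpow_swap1)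
qed

lemma solv_abelian: assumes "\<And>x y. x \<in> A ==> y \<in> A ==> x * y = y * x" shows "solv A"
proof -
 have "cmt x y = 1" if "x \<in> A" "y \<in> A" for x y using assms[OF that] cmt_swap[of x y] by (metis group_right_cancel mult_1_left)
 hence "der A \<subseteq> {1}" by (intro der_least[OF subgrp_trivial]) simp
 thus ?thesis unfolding solv_def by (intro exI[of _ 1]) simp
qed

locale quaternion =
 fixes i j :: "'a::group_mult"
 assumes ij: "i * i = j * j" "i * i * (i * i) = 1" "i * j = i * i * (j * i)" "i * i \<noteq> 1"
begin

definition "z = i * i"
definition "Q = {1, z, i, z * i, j, z * j, i * j, z * (i * j)}"

lemma zz: "z * z = 1" "z \<noteq> 1" "j * j = z" "i * i = z" using ij by (simp_all add: z_def)

lemma base: "z * z = 1" "j * j = z" "i * i = z" "i * z = z * i" "j * z = z * j" "j * i = z * (i * j)"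
proof -
 show "i * z = z * i" by (simp add: z_def mult.assoc)
 show "j * z = z * j" by (simp add: z_def ij(1) mult.assoc)
 have "z * (i * j) = (z * z) * (j * i)" using ij(3) by (simp only: z_def mult.assoc)
 thus "j * i = z * (i * j)" by (simp add: zz)
qed (rule zz)+

lemma norm: "z * (z * x) = x" "j * (j * x) = z * x" "i * (i * x) = z * x"
 "i * (z * x) = z * (i * x)" "j * (z * x) = z * (j * x)" "j * (i * x) = z * (i * (j * x))"
 using base by (metis mult.assoc mult_1_left)+

lemmas norm_simps = base norm mult.assoc

lemma Q_mult: "x \<in> Q ==> y \<in> Q ==> x * y \<in> Q"
 unfolding Q_def by (elim insertE emptyE) (simp_all add: norm_simps)

lemma Q_gens: "1 \<in> Q" "i \<in> Q" "j \<in> Q" "z \<in> Q" by (simp_all add: Q_def)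

lemma Q_finite: "finite Q" by (simp add: Q_def)

lemma Q_subgrp: "subgrp Q" by (rule subgrp_finite_closed[OF Q_finite Q_gens(1) Q_mult])

lemma Q_cases: assumes "x \<in> Q" shows "x = 1 \<or> x = z \<or> (x * x = z \<and> (\<exists>g\<in>Q. cj g x = inverse x))"
proof -
 have inv: "cj g x = inverse x" if "x * x = z" "g * x = z * (x * g)" for g
 proof -
  have "inverse x = z * x" using that(1) norm_simps(1) by (intro group_inverse_unique) (metis mult.assoc)
  thus ?thesis using that(2) by (simp add: cj_def mult.assoc)
 qed
 have "x = 1 \<or> x = z \<or> (x * x = z \<and> (i * x = z * (x * i) \<or> j * x = z * (x * j)))"
  using assms unfolding Q_def by (elim insertE emptyE) (simp_all add: norm_simps)
 thus ?thesis using inv Q_gens by blast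
qed

lemma Q_fourth: "x \<in> Q ==> x ^ 4 = 1"
proof -
 assume "x \<in> Q"
 have f: "x ^ 4 = x * x * (x * x)" by (simp add: eval_nat_numeral mult.assoc)
 show ?thesis unfolding f using Q_cases[OF \<open>x \<in> Q\<close>] zz by auto
qed

lemma Q_rational: "rational Q"
proof (rule rational_exponent_four[OF Q_fourth _ Q_gens(1)])
 show "x * x = 1 \<or> (\<exists>g\<in>Q. cj g x = inverse x)" if "x \<in> Q" for x using Q_cases[OF that] zz(1) by auto
qed

lemma Q_solv: "solv Q"
proof (rule solv_chain)
 show "solv {1, z}" by (rule solv_abelian) auto
 have "cmt x y \<in> {1, z}" if xy: "x \<in> Q" "y \<in> Q" for x y
 proof -
  have "x * y = y * x \<or> x * y = z * (y * x)"
   using xy unfolding Q_def by (elim insertE emptyE) (simp_all add: norm_simps)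
  thus ?thesis using cmt_swap[of x y] by (metis group_right_cancel insert_iff mult_1_left)
 qed
 moreover have "subgrp {1, z}" using zz group_inverse_unique[of z z] by (auto simp: subgrp_def)
 ultimately show "der Q \<subseteq> {1, z}" by (intro der_least) auto
qed

lemma Q_vert: "vert Q = {2}"
proof -
 have "p = 2" if p: "prime p" "x \<in> Q" "x \<noteq> 1" "x ^ p = 1" for p x
 proof -
  have n4: "\<not> coprime p 4" using pow_coprime_eq_one[OF p(4) Q_fourth[OF p(2)]] p(3) by blast
  show ?thesis
  proof (rule ccontr)
   assume "p \<noteq> 2"
   hence "coprime p 2" using p(1) primes_coprime two_is_prime_nat by blast
   hence "coprime p (2 ^ 2)" by (rule coprime_power_right_iff[THEN iffD2, OF disjI1])
   thus False using n4 by simp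
  qed
 qed
 thus ?thesis using Q_gens zz by (auto simp: vert_def power2_eq_square)
qed

end

lemma apply_Perm: "bij f ==> Perm.apply (Perm f) = f" for f :: "'a::finite \<Rightarrow> 'a"
 by (rule Perm_inverse) simp

text \<open>\<open>ext Q\<close> is a Frobenius group of affine maps, with the translations as
  kernel and \<open>Q\<close> as complement. The condition \<open>scalar\<close> says that the
  translations are rational; the remaining elements are conjugate into \<open>Q\<close>.\<close>

locale affine =
 fixes Q :: "'v::{ab_group_add, finite} perm set" and p :: nat
 assumes Q: "subgrp Q" "finite Q" "rational Q" "solv Q"
  and add: "\<And>b x y. b \<in> Q ==> Perm.apply b (x + y) = Perm.apply b x + Perm.apply b y"
  and fpf: "\<And>b x. b \<in> Q ==> b \<noteq> 1 ==> Perm.apply b x = x ==> x = 0"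
  and p: "prime p" "\<And>x :: 'v. (\<Sum>i<p. x) = 0" "p \<notin> vert Q" "\<exists>x :: 'v. x \<noteq> 0"
  and scalar: "\<And>k x. \<not> p dvd k ==> \<exists>b\<in>Q. Perm.apply b x = (\<Sum>i<k. x)"
begin

definition tr :: "'v \<Rightarrow> 'v perm" where "tr v = Perm ((+) v)"
definition ext :: "'v perm set \<Rightarrow> 'v perm set" where "ext B = {tr v * b | v b. b \<in> B}"

lemmas SQ = subgrpD[OF Q(1)]

lemma ap_tr [simp]: "Perm.apply (tr v) x = v + x"
proof -
 have "bij ((+) v)" by (rule bij_betw_byWitness[where f' = "\<lambda>x. - v + x"]) (auto simp: add.assoc[symmetric])
 thus ?thesis by (simp add: tr_def apply_Perm)
qed
lemma tr_add: "tr v * tr w = tr (v + w)" by (rule perm_eqI) (simp add: apply_times add.assoc)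
lemma tr_0 [simp]: "tr 0 = 1" by (rule perm_eqI) simp
lemma tr_eq_one: "tr v = 1 \<longleftrightarrow> v = 0"
proof
 assume "tr v = 1"
 hence "Perm.apply (tr v) 0 = Perm.apply 1 0" by simp
 thus "v = 0" by simp
qed simp
lemma tr_inverse: "inverse (tr v) = tr (- v)" by (rule group_inverse_unique) (simp add: tr_add)
lemma tr_pow: "tr v ^ k = tr (\<Sum>i<k. v)" by (induction k) (simp_all add: tr_add add.commute)
lemma ap_0 [simp]: "b \<in> Q ==> Perm.apply b 0 = 0" using add[of b 0 0] by simp
lemma ap_minus: "b \<in> Q ==> Perm.apply b (- x) = - Perm.apply b x"
 using add[of b x "- x"] by (simp add: eq_neg_iff_add_eq_0 add.commute)
lemma swap: "b \<in> Q ==> b * tr v = tr (Perm.apply b v) * b" by (rule perm_eqI) (simp add: apply_times add)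

lemma ext_mult: "b \<in> Q ==> (tr v * b) * (tr w * c) = tr (v + Perm.apply b w) * (b * c)"
proof -
 assume b: "b \<in> Q"
 have "(tr v * b) * (tr w * c) = tr v * (b * tr w) * c" by (simp only: mult.assoc)
 also have "\<dots> = (tr v * tr (Perm.apply b w)) * (b * c)" unfolding swap[OF b] by (simp only: mult.assoc)
 finally show ?thesis by (simp only: tr_add)
qed

lemma ext_eq: assumes "tr v * b = tr w * c" "b \<in> Q" "c \<in> Q" shows "v = w" "b = c"
proof -
 have "Perm.apply (tr u * a) 0 = u" if "a \<in> Q" for u a using that by (simp add: apply_times)
 thus "v = w" using assms by metis
 thus "b = c" using assms(1) by simp
qed

lemma extI: "b \<in> B ==> tr v * b \<in> ext B" unfolding ext_def by blast

lemma ext_subgrp: assumes "subgrp B" "B \<subseteq> Q" shows "subgrp (ext B)" "finite (ext B)"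
proof -
 have "ext B \<subseteq> (\<lambda>(v, b). tr v * b) ` (UNIV \<times> Q)" using assms(2) by (auto simp: ext_def)
 thus "finite (ext B)" using Q(2) by (meson finite_SigmaI finite_code finite_imageI finite_subset)
 thus "subgrp (ext B)"
 proof (rule subgrp_finite_closed)
  show "1 \<in> ext B" using extI[of 1 B 0] subgrpD(1)[OF assms(1)] by simp
  show "x * y \<in> ext B" if xy: "x \<in> ext B" "y \<in> ext B" for x y
  proof -
   obtain v b w c where "x = tr v * b" "y = tr w * c" "b \<in> B" "c \<in> B" using xy by (auto simp: ext_def)
   thus ?thesis using ext_mult[of b v w c] assms subgrpD(2)[OF assms(1)] extI by auto
  qed
 qed
qed

lemma ext_inverse: "b \<in> Q ==> inverse (tr v * b) = tr (- Perm.apply (inverse b) v) * inverse b"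
 using swap[of "inverse b" "- v"] SQ(3) by (simp add: group_inverse_mult tr_inverse ap_minus)

lemma ext_pow: "b \<in> Q ==> \<exists>u. (tr v * b) ^ n = tr u * b ^ n"
proof (induction n)
 case 0
 thus ?case by (intro exI[of _ 0]) simp
next
 case (Suc n)
 then obtain u where "(tr v * b) ^ n = tr u * b ^ n" by blast
 thus ?case using ext_mult[OF Suc.prems, of v u "b ^ n"] by auto
qed

lemma der_ext: assumes "subgrp B" "B \<subseteq> Q" shows "der (ext B) \<subseteq> ext (der B)"
proof (rule der_least)
 have "der B \<subseteq> B" by (rule der_least[OF assms(1)]) (rule subgrpD(5)[OF assms(1)])
 thus "subgrp (ext (der B))" using ext_subgrp der_subgrp assms(2) by blast
 show "cmt x y \<in> ext (der B)" if xy: "x \<in> ext B" "y \<in> ext B" for x y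
 proof -
  obtain v b w c where bc: "x = tr v * b" "y = tr w * c" "b \<in> B" "c \<in> B" using xy by (auto simp: ext_def)
  have q: "b \<in> Q" "c \<in> Q" "inverse b \<in> Q" "inverse c \<in> Q" "b * c \<in> Q" "b * c * inverse b \<in> Q"
   using bc assms(2) SQ(2,3) by (auto simp: subset_iff)
  have "\<exists>u. cmt x y = tr u * cmt b c"
   unfolding cmt_def bc ext_mult[OF q(1)] ext_inverse[OF q(1)] ext_mult[OF q(5)] ext_inverse[OF q(2)] ext_mult[OF q(6)]
   by (rule exI, rule refl)
  thus ?thesis using cmt_der[OF bc(3,4)] extI by auto
 qed
qed

lemma ext_solv_pow: "(der ^^ n) B \<subseteq> {1} ==> subgrp B ==> B \<subseteq> Q ==> solv (ext B)"
proof (induction n arbitrary: B)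
 case 0
 have "x * y = y * x" if "x \<in> ext B" "y \<in> ext B" for x y
 proof -
  have "B \<subseteq> {1}" using 0 by simp
  then obtain v w where "x = tr v" "y = tr w" using \<open>x \<in> ext B\<close> \<open>y \<in> ext B\<close> unfolding ext_def by fastforce
  thus ?thesis by (simp add: tr_add add.commute)
 qed
 thus ?case by (rule solv_abelian)
next
 case (Suc n)
 have "der B \<subseteq> Q" using der_least[OF Suc.prems(2) subgrpD(5)[OF Suc.prems(2)]] Suc.prems(3) by blast
 moreover have "(der ^^ n) (der B) \<subseteq> {1}" using Suc.prems(1) by (simp add: funpow_swap1)
 ultimately have "solv (ext (der B))" using Suc.IH der_subgrp by blast
 thus ?case by (rule solv_chain) (rule der_ext[OF Suc.prems(2,3)])
qed

lemma ext_solv: "solv (ext Q)"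
 using ext_solv_pow Q(1,4) unfolding solv_def[of Q] by blast

lemma Q_ext: "b \<in> Q ==> b \<in> ext Q" "tr v \<in> ext Q"
 using extI[of b Q 0] extI[of 1 Q v] SQ(1) by auto

text \<open>As \<open>b\<close> fixes only 0, the differences \<open>w - b w\<close> run through all
  vectors, so the whole coset of translations times \<open>b\<close> is conjugate to
  \<open>b\<close>.\<close>

lemma ext_conj: assumes "b \<in> Q" "b \<noteq> 1" shows "\<exists>w. cj (tr w) b = tr v * b"
proof -
 have "inj (\<lambda>w. w - Perm.apply b w)"
 proof (rule injI)
  fix x y assume "x - Perm.apply b x = y - Perm.apply b y"
  hence a: "Perm.apply b x - Perm.apply b y = x - y" by (simp add: algebra_simps)
  have "Perm.apply b (x - y) = Perm.apply b x - Perm.apply b y"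
   using add[OF assms(1), of x "- y"] ap_minus[OF assms(1), of y] by simp
  hence "Perm.apply b (x - y) = x - y" using a by (rule trans)
  hence "x - y = 0" using fpf assms by blast
  thus "x = y" by simp
 qed
 hence "surj (\<lambda>w. w - Perm.apply b w)" by (rule finite_UNIV_inj_surj[OF finite])
 then obtain w where w: "v = w - Perm.apply b w" by (metis surjD)
 have "cj (tr w) b = (tr w * b) * (tr (- w) * 1)" by (simp add: cj_def tr_inverse)
 also have "\<dots> = tr v * b" unfolding ext_mult[OF assms(1)] using assms(1) by (simp add: w ap_minus)
 finally show ?thesis by blast
qed

lemma ext_rational: "rational (ext Q)"
 unfolding rational_def
proof (intro ballI allI impI)
 note SE = subgrpD[OF ext_subgrp(1)[OF Q(1) subset_refl]]
 fix x k m assume x: "x \<in> ext Q" "(x ^ k) ^ m = x"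
 obtain v b where b: "x = tr v * b" "b \<in> Q" using x(1) by (auto simp: ext_def)
 show "\<exists>g\<in>ext Q. cj g x = x ^ k"
 proof (cases "b = 1")
  case True
  hence xk: "x ^ k = tr (\<Sum>i<k. v)" by (simp add: b tr_pow)
  show ?thesis
  proof (cases "p dvd k")
   case True
   then obtain l where "k = p * l" by (auto simp: dvd_def)
   moreover have "x ^ p = 1" using \<open>b = 1\<close> p(2) by (simp add: b tr_pow)
   ultimately have "x ^ k = 1" by (simp add: power_mult)
   thus ?thesis using x SE(1) by (intro bexI[of _ 1]) auto
  next
   case False
   then obtain c where c: "c \<in> Q" "Perm.apply c v = (\<Sum>i<k. v)" using scalar by blast
   have "cj c x = tr (Perm.apply c v)" using swap[OF c(1), of v] \<open>b = 1\<close> by (simp add: b cj_def mult.assoc)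
   thus ?thesis using xk c Q_ext(1) by (intro bexI[of _ c]) auto
  qed
 next
  case False
  then obtain w where w: "cj (tr w) b = x" using ext_conj b by blast
  hence "(b ^ k) ^ m = b" using x(2) by (metis cj_eq_iff cj_pow)
  then obtain c where c: "c \<in> Q" "cj c b = b ^ k" using Q(3) b(2) unfolding rational_def by blast
  have "cj (cj (tr w) c) x = cj (tr w) (cj c b)"
   unfolding w[symmetric] by (simp add: cj_cj) (simp add: cj_def mult.assoc)
  hence "cj (cj (tr w) c) x = x ^ k" by (simp add: c w flip: cj_pow) (simp add: cj_pow w)
  thus ?thesis using SE(4) Q_ext c(1) by blast
 qed
qed

lemma ext_vert: "vert (ext Q) = insert p (vert Q)"
proof -
 obtain v :: 'v where v: "v \<noteq> 0" using p(4) by blast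
 have pv: "p \<in> vert (ext Q)" unfolding vert_def
  using p(1,2) Q_ext(2)[of v] v by (auto simp: tr_eq_one tr_pow intro!: bexI[of _ "tr v"])
 have Qv: "vert Q \<subseteq> vert (ext Q)" using Q_ext(1) by (auto simp: vert_def)
 have "r = p \<or> r \<in> vert Q" if r: "prime r" "x \<in> ext Q" "x \<noteq> 1" "x ^ r = 1" for r x
 proof -
  obtain v b where b: "x = tr v * b" "b \<in> Q" using r(2) by (auto simp: ext_def)
  obtain u where "x ^ r = tr u * b ^ r" using ext_pow b by blast
  hence br: "b ^ r = 1" using ext_eq(2)[of u "b ^ r" 0 1] r(4) SQ(1,6) b(2) by simp
  show ?thesis
  proof (cases "b = 1")
   case True
   hence "x ^ p = 1" using p(2) by (simp add: b tr_pow)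
   hence "\<not> coprime r p" using pow_coprime_eq_one r(3,4) by blast
   thus ?thesis using primes_coprime r(1) p(1) by blast
  qed (use br b(2) r(1) in \<open>auto simp: vert_def\<close>)
 qed
 hence "vert (ext Q) \<subseteq> insert p (vert Q)" unfolding vert_def[of "ext Q"] by blast
 thus ?thesis using pv Qv by blast
qed

text \<open>An element of order \<open>p\<close> is a translation, and one of order \<open>r\<close>
  has a nontrivial linear part; commuting would give this linear part a nonzero fixed
  vector.\<close>

lemma ext_unlinked: assumes "prime r" "r \<noteq> p" shows "\<not> linked (ext Q) p r"
proof
 assume "linked (ext Q) p r"
 then obtain x y where xy: "x \<in> ext Q" "y \<in> ext Q" "x \<noteq> 1" "x ^ p = 1" "y \<noteq> 1" "y ^ r = 1" "x * y = y * x"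
  unfolding linked_def by blast
 obtain v b where b: "x = tr v * b" "b \<in> Q" using xy(1) by (auto simp: ext_def)
 obtain w c where c: "y = tr w * c" "c \<in> Q" using xy(2) by (auto simp: ext_def)
 obtain u where "x ^ p = tr u * b ^ p" using ext_pow b by blast
 hence "b ^ p = 1" using ext_eq(2)[of u "b ^ p" 0 1] xy(4) SQ(1,6) b(2) by simp
 hence b1: "b = 1" using p(1,3) b(2) by (auto simp: vert_def)
 have "c \<noteq> 1"
 proof
  assume "c = 1"
  hence "y ^ p = 1" using p(2) by (simp add: c tr_pow)
  thus False using pow_coprime_eq_one xy(5,6) primes_coprime[OF p(1) assms(1)] assms(2) by blast
 qed
 have "tr (v + w) * c = tr (w + Perm.apply c v) * c"
  using xy(7) ext_mult[OF c(2), of w v 1] by (simp add: b b1 c tr_add mult.assoc[symmetric])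
 hence "v + w = w + Perm.apply c v" using ext_eq(1) c(2) by blast
 hence "Perm.apply c v = v" by (simp add: add.commute)
 hence "v = 0" using fpf c(2) \<open>c \<noteq> 1\<close> by blast
 thus False using xy(3) by (simp add: b b1)
qed

end

lemma type3_cases: "x = 0 \<or> x = 1 \<or> x = 2" for x :: 3
proof (cases x rule: bit1_cases)
 case (of_int z)
 hence "z = 0 \<or> z = 1 \<or> z = 2" by auto
 thus ?thesis using of_int by auto
qed

lemma type5_cases: "x = 0 \<or> x = 1 \<or> x = 2 \<or> x = 3 \<or> x = 4" for x :: 5
proof (cases x rule: bit1_cases)
 case (of_int z)
 hence "z = 0 \<or> z = 1 \<or> z = 2 \<or> z = 3 \<or> z = 4" by auto
 thus ?thesis using of_int by auto
qed

definition neg3 :: "3 perm" where "neg3 = Perm uminus"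
definition C2 :: "3 perm set" where "C2 = {1, neg3}"

lemma neg3_apply [simp]: "Perm.apply neg3 x = - x"
 unfolding neg3_def by (subst apply_Perm) (auto intro: bij_betw_byWitness[where f' = uminus])

lemma neg3: "neg3 * neg3 = 1" "neg3 \<noteq> 1"
proof -
 show "neg3 * neg3 = 1" by (rule perm_eqI) (simp add: apply_times)
 show "neg3 \<noteq> 1" unfolding perm_eq_iff by (auto intro: exI[of _ 1])
qed

lemma C2: "subgrp C2" "finite C2" "rational C2" "solv C2" "vert C2 = {2}"
proof -
 have i: "inverse neg3 = neg3" using neg3(1) by (rule group_inverse_unique)
 show "subgrp C2" using neg3 i by (auto simp: subgrp_def C2_def)
 show "finite C2" by (simp add: C2_def)
 show "rational C2" by (rule rational_exponent_four) (use neg3 in \<open>auto simp: C2_def eval_nat_numeral\<close>)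
 show "solv C2" by (rule solv_abelian) (auto simp: C2_def)
 have "p = 2" if "prime p" "neg3 ^ p = 1" for p
 proof -
  have "neg3 ^ 2 = 1" using neg3 by (simp add: power2_eq_square)
  hence "\<not> coprime p 2" using pow_coprime_eq_one[OF that(2)] neg3(2) by blast
  thus ?thesis using primes_coprime that(1) two_is_prime_nat by blast
 qed
 thus "vert C2 = {2}" using neg3 by (auto simp: vert_def C2_def power2_eq_square)
qed

interpretation S3: affine C2 3
proof
 have char3: "(3 :: 3) = 0" by simp
 have c: "(\<Sum>i<k. x) = of_nat (k mod 3) * x" for k :: nat and x :: 3
 proof -
  have "(of_nat k :: 3) = of_nat (3 * (k div 3) + k mod 3)" by simp
  also have "\<dots> = of_nat (k mod 3)" unfolding of_nat_add of_nat_mult by (simp add: char3)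
  finally show ?thesis by simp
 qed
 show "\<exists>b\<in>C2. Perm.apply b x = (\<Sum>i<k. x)" if "\<not> 3 dvd k" for k :: nat and x
 proof -
  have "k mod 3 = 1 \<or> k mod 3 = 2" using that by presburger
  thus ?thesis unfolding c using type3_cases[of x] by (auto simp: C2_def)
 qed
 show "(\<Sum>i<(3::nat). x) = 0" for x :: 3 unfolding c by simp
 show "x = 0" if "b \<in> C2" "b \<noteq> 1" "Perm.apply b x = x" for b x
  using that type3_cases[of x] by (auto simp: C2_def)
 show "\<exists>x :: 3. x \<noteq> 0" by (intro exI[of _ 1]) simp
qed (use C2 in \<open>auto simp: C2_def\<close>)

text \<open>Over the field with 5 elements, \<open>i5\<close> is the diagonal matrix with entries 2
  and 3. Together with \<open>j5\<close> it generates a quaternion group inside the matrices of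
  determinant 1.\<close>

definition i5 :: "(5 \<times> 5) perm" where "i5 = Perm (\<lambda>(x, y). (2 * x, 3 * y))"
definition j5 :: "(5 \<times> 5) perm" where "j5 = Perm (\<lambda>(x, y). (y, - x))"

lemma char5: "(5 :: 5) = 0" "(10 :: 5) = 0" by simp_all

lemma five_mult: "2 * (3 * x) = x" "3 * (2 * x) = x" "2 * (2 * x) = - x" "3 * (3 * x) = - x" "2 * x = - (3 * x)"
 for x :: 5 using type5_cases[of x] by auto

lemma ij_apply [simp]: "Perm.apply i5 (x, y) = (2 * x, 3 * y)" "Perm.apply j5 (x, y) = (y, - x)"
proof -
 have "bij (\<lambda>(x :: 5, y :: 5). (2 * x, 3 * y))"
  by (rule bij_betw_byWitness[where f' = "\<lambda>(x, y). (3 * x, 2 * y)"]) (auto simp: five_mult(1,2) char5)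
 thus "Perm.apply i5 (x, y) = (2 * x, 3 * y)" by (simp add: i5_def apply_Perm)
 have "bij (\<lambda>(x :: 5, y :: 5). (y, - x))"
  by (rule bij_betw_byWitness[where f' = "\<lambda>(x, y). (- y, x)"]) auto
 thus "Perm.apply j5 (x, y) = (y, - x)" by (simp add: j5_def apply_Perm)
qed

interpretation Q8: quaternion i5 j5
proof
 have ii: "Perm.apply (i5 * i5) v = - v" "Perm.apply (j5 * j5) v = - v" for v
  by (cases v; simp add: apply_times five_mult(3,4) char5)+
 show "i5 * i5 = j5 * j5" by (rule perm_eqI) (simp add: ii)
 show "i5 * i5 * (i5 * i5) = 1" by (rule perm_eqI) (simp only: apply_times[of "i5 * i5" "i5 * i5"] o_def ii, simp)
 show "i5 * j5 = i5 * i5 * (j5 * i5)"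
 proof (rule perm_eqI)
  fix v :: "5 \<times> 5"
  obtain x y where v: "v = (x, y)" by fastforce
  have "Perm.apply (i5 * i5 * (j5 * i5)) v = - Perm.apply (j5 * i5) v"
   unfolding apply_times[of "i5 * i5"] o_def ii ..
  also have "\<dots> = Perm.apply (i5 * j5) v" using five_mult(5)[of x] five_mult(5)[of y] by (simp add: v apply_times)
  finally show "Perm.apply (i5 * j5) v = Perm.apply (i5 * i5 * (j5 * i5)) v" ..
 qed
 have "Perm.apply (i5 * i5) (1, 0) \<noteq> Perm.apply 1 (1, 0)" unfolding ii by simp
 thus "i5 * i5 \<noteq> 1" by metis
qed

lemma z5_apply: "Perm.apply Q8.z v = - v"
 unfolding Q8.z_def by (cases v) (simp add: apply_times five_mult(3,4) char5)

lemma minus5: "- v = v ==> v = 0" for v :: "5 \<times> 5"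
 using type5_cases[of "fst v"] type5_cases[of "snd v"] by (cases v) (auto simp: zero_prod_def)

text \<open>The three cyclic subgroups of order 4 have two eigenlines each, and these are the six
  lines of the plane. So on each vector the scalars 2 and 3 are realised by elements of order
  4.\<close>

lemma eigenvector:
 fixes x y c :: 5
 assumes "c = 2 \<or> c = 3"
 shows "(2 * x = c * x \<and> 3 * y = c * y) \<or> (- (2 * x) = c * x \<and> - (3 * y) = c * y) \<or>
  (y = c * x \<and> - x = c * y) \<or> (- y = c * x \<and> x = c * y) \<or>
  (2 * y = c * x \<and> 3 * - x = c * y) \<or> (- (2 * y) = c * x \<and> - (3 * - x) = c * y)"
 using assms type5_cases[of x] type5_cases[of y] by (elim disjE) simp_all

interpretation F200: affine Q8.Q 5
proof
 show "Perm.apply b (u + v) = Perm.apply b u + Perm.apply b v" if "b \<in> Q8.Q" for b u v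
 proof -
  define A where "A b \<longleftrightarrow> (\<forall>u v. Perm.apply b (u + v) = Perm.apply b u + Perm.apply b v)" for b :: "(5 \<times> 5) perm"
  have "A i5" "A j5" "A 1" by (auto simp: A_def algebra_simps)
  note A1 = this
  have m: "A (b * c)" if "A b" "A c" for b c
   using that by (simp add: A_def apply_times del: split_paired_All)
  have "A b" using that m A1 unfolding Q8.Q_def Q8.z_def by auto
  thus ?thesis unfolding A_def by blast
 qed
 show "v = 0" if b: "b \<in> Q8.Q" "b \<noteq> 1" "Perm.apply b v = v" for b v
 proof -
  have "Perm.apply (b * b) v = v" using b(3) by (simp add: apply_times)
  hence "Perm.apply Q8.z v = v" using Q8.Q_cases[OF b(1)] b(2,3) by auto
  thus ?thesis by (simp add: z5_apply minus5)
 qed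
 have c: "(\<Sum>i<k. (x, y)) = (of_nat (k mod 5) * x, of_nat (k mod 5) * y)" for k :: nat and x y :: 5
 proof -
  have "(of_nat k :: 5) = of_nat (5 * (k div 5) + k mod 5)" by simp
  also have "\<dots> = of_nat (k mod 5)" unfolding of_nat_add of_nat_mult by (simp add: char5)
  finally have "(of_nat k :: 5) = of_nat (k mod 5)" .
  moreover have "(\<Sum>i<k. (x, y)) = (of_nat k * x, of_nat k * y)"
   by (induction k) (simp_all add: zero_prod_def algebra_simps)
  ultimately show ?thesis by simp
 qed
 show "(\<Sum>i<(5::nat). v) = 0" for v :: "5 \<times> 5" by (cases v) (simp only: c, simp add: zero_prod_def)
 show "\<exists>b\<in>Q8.Q. Perm.apply b v = (\<Sum>i<k. v)" if k: "\<not> 5 dvd k" for k :: nat and v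
 proof -
  obtain x y where v: "v = (x, y)" by fastforce
  define e :: 5 where "e = of_nat (k mod 5)"
  have "k mod 5 = 1 \<or> k mod 5 = 2 \<or> k mod 5 = 3 \<or> k mod 5 = 4" using k by presburger
  hence e: "e = 1 \<or> e = 4 \<or> e = 2 \<or> e = 3" by (auto simp: e_def)
  have s: "(\<Sum>i<k. v) = (e * x, e * y)" by (simp only: v c e_def)
  note G = Q8.Q_gens Q8.Q_mult
  from e consider "e = 1" | "e = 4" | "e = 2 \<or> e = 3" by blast
  thus ?thesis unfolding s
  proof cases
   case 1 thus "\<exists>b\<in>Q8.Q. Perm.apply b v = (e * x, e * y)" using G(1) by (intro bexI[of _ 1]) (auto simp: v)
  next
   case 2
   have "4 * w = - w" for w :: 5 using type5_cases[of w] by auto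
   thus "\<exists>b\<in>Q8.Q. Perm.apply b v = (e * x, e * y)"
    using 2 G(4) by (intro bexI[of _ Q8.z]) (auto simp: v z5_apply)
  next
   case 3
   have m: "i5 \<in> Q8.Q" "Q8.z * i5 \<in> Q8.Q" "j5 \<in> Q8.Q" "Q8.z * j5 \<in> Q8.Q" "i5 * j5 \<in> Q8.Q" "Q8.z * (i5 * j5) \<in> Q8.Q"
    using G by blast+
   have a: "Perm.apply i5 v = (2 * x, 3 * y)" "Perm.apply (Q8.z * i5) v = (- (2 * x), - (3 * y))"
    "Perm.apply j5 v = (y, - x)" "Perm.apply (Q8.z * j5) v = (- y, x)"
    "Perm.apply (i5 * j5) v = (2 * y, 3 * - x)" "Perm.apply (Q8.z * (i5 * j5)) v = (- (2 * y), - (3 * - x))"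
    by (simp_all add: v apply_times z5_apply del: mult_minus_right)
   show "\<exists>b\<in>Q8.Q. Perm.apply b v = (e * x, e * y)"
    using eigenvector[OF 3, of x y] m a by (metis (no_types, lifting))
  qed
 qed
 show "\<exists>v :: 5 \<times> 5. v \<noteq> 0" by (intro exI[of _ "(1, 0)"]) (simp add: zero_prod_def)
qed (use Q8.Q_subgrp Q8.Q_finite Q8.Q_rational Q8.Q_solv Q8.Q_vert in auto)

lemma edges_of_two:
 assumes "vert \<Gamma> = {p, q}" "p \<noteq> q"
 shows "{{a, b} | a b. a \<in> vert \<Gamma> \<and> b \<in> vert \<Gamma> \<and> a \<noteq> b \<and> linked \<Gamma> a b} = (if linked \<Gamma> p q then {{p, q}} else {})"
 using assms linked_sym[of \<Gamma> p q] by auto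

lemma nat_realisation_two:
 assumes "subgrp \<Gamma>" "finite \<Gamma>" "solv \<Gamma>" "rational \<Gamma>" "vert \<Gamma> = {p, q}" "p \<noteq> q"
 shows "\<exists>H :: nat monoid. finite_rational_group H \<and> solvable H \<and>
  gk_graph H = ({p, q}, if linked \<Gamma> p q then {{p, q}} else {})"
 using nat_realisation[OF assms(1-4)] unfolding edges_of_two[OF assms(5,6)] unfolding assms(5) .

theorem theorem1p4:
  shows "(\<forall>G :: ('a, 'b) monoid_scheme.
            finite_rational_group G \<and> solvable G \<and> \<not> trivial_group G \<longrightarrow>
            gk_graph G \<in> {graph_a, graph_c, graph_d, graph_e, graph_f, graph_i, graph_k})
       \<and> (\<forall>\<Gamma> \<in> {graph_a, graph_c, graph_d, graph_e, graph_f, graph_k}.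
            \<exists>H :: nat monoid. finite_rational_group H \<and> solvable H \<and> gk_graph H = \<Gamma>)"
proof (intro conjI allI impI)
 fix G :: "('a, 'b) monoid_scheme"
 assume "finite_rational_group G \<and> solvable G \<and> \<not> trivial_group G"
 thus "gk_graph G \<in> {graph_a, graph_c, graph_d, graph_e, graph_f, graph_i, graph_k}"
  using graph_classification by blast
next
 let ?R = "\<lambda>\<Gamma>. \<exists>H :: nat monoid. finite_rational_group H \<and> solvable H \<and> gk_graph H = \<Gamma>"
 note sub = S3.ext_subgrp[OF C2(1) subset_refl] and sub' = F200.ext_subgrp[OF Q8.Q_subgrp subset_refl]
 note S3 = sub S3.ext_rational S3.ext_solv and F = sub' F200.ext_rational F200.ext_solv
 have vS: "vert (S3.ext C2) = {2, 3}" and vF: "vert (F200.ext Q8.Q) = {2, 5}"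
  using S3.ext_vert F200.ext_vert C2(5) Q8.Q_vert by auto
 \<comment> \<open>A direct factor of order 2 joins 2 to every other vertex, which turns the
   unlinked examples into linked ones.\<close>
 note SC = product_group[OF S3 C2(1-4)] and FC = product_group[OF F C2(1-4)] and SF = product_group[OF S3 F]
 have "?R graph_a"
  using nat_realisation[OF C2(1,2,4,3)] by (simp add: C2(5) graph_a_def)
 moreover have "?R graph_c"
 proof -
  have "\<not> linked (S3.ext C2) 2 3" using S3.ext_unlinked[of 2] linked_sym by auto
  thus ?thesis using nat_realisation_two[OF S3(1,2,4,3) vS] by (simp add: graph_c_def)
 qed
 moreover have "?R graph_d"
 proof -
  have "vert (S3.ext C2 \<times> C2) = {2, 3}" using SC(5) vS C2(5) by auto
  moreover have "linked (S3.ext C2 \<times> C2) 2 3"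
   by (rule linked_sym[THEN iffD1], rule SC(6)) (simp_all add: vS C2(5))
  ultimately show ?thesis
   using nat_realisation_two[OF SC(1,2,4,3), of 2 3] by (simp add: graph_d_def)
 qed
 moreover have "?R graph_e"
 proof -
  have "\<not> linked (F200.ext Q8.Q) 2 5" using F200.ext_unlinked[of 2] linked_sym by auto
  thus ?thesis using nat_realisation_two[OF F(1,2,4,3) vF] by (simp add: graph_e_def)
 qed
 moreover have "?R graph_f"
 proof -
  have "vert (F200.ext Q8.Q \<times> C2) = {2, 5}" using FC(5) vF C2(5) by auto
  moreover have "linked (F200.ext Q8.Q \<times> C2) 2 5"
   by (rule linked_sym[THEN iffD1], rule FC(6)) (simp_all add: vF C2(5))
  ultimately show ?thesis
   using nat_realisation_two[OF FC(1,2,4,3), of 2 5] by (simp add: graph_f_def)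
 qed
 moreover have "?R graph_k"
 proof -
  let ?G = "S3.ext C2 \<times> F200.ext Q8.Q"
  have v: "vert ?G = {2, 3, 5}" using SF(5) vS vF by auto
  \<comment> \<open>Both factors have even order, so an involution of one commutes with the elements
    of order 3 or 5 of the other.\<close>
  have l: "linked ?G 2 3" "linked ?G 2 5" "linked ?G 3 5"
   by (rule linked_sym[THEN iffD1]; rule SF(6); simp add: vS vF) (rule SF(6); simp add: vS vF)+
  hence l': "linked ?G 3 2" "linked ?G 5 2" "linked ?G 5 3" using linked_sym by blast+
  have "{{a, b} | a b. a \<in> vert ?G \<and> b \<in> vert ?G \<and> a \<noteq> b \<and> linked ?G a b} = {{2, 3}, {2, 5}, {3, 5}}"
  proof
   show "{{a, b} | a b. a \<in> vert ?G \<and> b \<in> vert ?G \<and> a \<noteq> b \<and> linked ?G a b} \<subseteq> {{2, 3}, {2, 5}, {3, 5}}"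
    unfolding v by auto
   show "{{2, 3}, {2, 5}, {3, 5}} \<subseteq> {{a, b} | a b. a \<in> vert ?G \<and> b \<in> vert ?G \<and> a \<noteq> b \<and> linked ?G a b}"
   proof -
    have m: "{p, q} \<in> {{a, b} | a b. a \<in> vert ?G \<and> b \<in> vert ?G \<and> a \<noteq> b \<and> linked ?G a b}"
     if "p \<in> vert ?G" "q \<in> vert ?G" "p \<noteq> q" "linked ?G p q" for p q using that by blast
    show ?thesis using m[of 2 3] m[of 2 5] m[of 3 5] l v by simp
   qed
  qed
  thus ?thesis using nat_realisation[OF SF(1,2,4,3)] v by (simp add: graph_k_def)
 qed
 ultimately show "\<forall>\<Gamma> \<in> {graph_a, graph_c, graph_d, graph_e, graph_f, graph_k}. ?R \<Gamma>" by blast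
qed

end
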